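(* Let $1<p<\infty$ and $1\le q\le\infty$. Assume that $w_*\in\mathcal{W}_1(\mathbb{R})$ is regularly varying of index $\alpha\in(0,1)$ and write $w_*(x)=x^\alpha\,\widetilde{w}_*(x)$, $x>0$, with $\widetilde w_*$ slowly varying. (a) If $\widetilde w_*$ is bounded, let $\mu$ be a complex measure on $\mathbb{R}$ with $\mu(\mathbb{R})=0$ and such that for every $\lambda>0$ \[ L_1(\lambda):=\int_{\mathbb{R}}e^{\lambda|\xi|^\alpha\log|\xi|}\,d|\mu|(\xi)<\infty . \] (b) If $\lim_{t\to\infty}\widetilde w_*(t)=\infty$, let $\mu$ be a complex measure on $\mathbb{R}$ with $\mu(\mathbb{R})=0$ and such that for every $\lambda>0$ \[ L_2(\lambda):=\int_{|\xi|>1}e^{\lambda|\xi|^\alpha\log(|\xi|)\,\widetilde w_*\left(|\xi|(\log|\xi|)^{1/\alpha}\right)}\,d|\mu|(\xi)<\infty . \] In either case (a) or (b), let $f$ be the inverse Fourier transform of $\mu$, $f(t)=\frac1{\sqrt{2\pi}}\int_{\mathbb{R}}e^{\mathrm{i}t\xi}\,d\mu(\xi)$. Then $f\in C^\infty(\mathbb{R})$ and the composition operator $T_f:u\mapsto f\circ u$ maps $\mathcal{M}^{w_*}_{p,q}(\mathbb{R}^n)$ into $\mathcal{M}^{w_*}_{p,q}(\mathbb{R}^n)$, i.e. $f\circ u\in\mathcal{M}^{w_*}_{p,q}(\mathbb{R}^n)$ for every real-valued $u\in\mathcal{M}^{w_*}_{p,q}(\mathbb{R}^n)$.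
   Context: Fourier transform on $\mathbb{R}^n$: $\mathcal{F}f(\xi)=(2\pi)^{-n/2}\int_{\mathbb{R}^n}f(x)e^{-\mathrm{i}x\cdot\xi}\,dx$. The expression $|\xi|^\alpha\log|\xi|$ is read as $0$ at $\xi=0$. Frequency-uniform decomposition: fix $\rho\in C_0^\infty(\mathbb{R}^n)$ with values in $[0,1]$, supported in $[-1,1]^n$, with $\rho(\xi)=1$ if $|\xi_i|\le\frac12$ for all $i$. Put $\rho_k(\xi)=\rho(\xi-k)$, $\sigma_k=\rho_k\big(\sum_{m\in\mathbb{Z}^n}\rho_m\big)^{-1}$ and $\Box_kf=\mathcal{F}^{-1}(\sigma_k\mathcal{F}f)$ for $k\in\mathbb{Z}^n$. Modulation space: for $1\le p,q\le\infty$ and a monotonically increasing weight function $w_*$ on $[0,\infty)$ with $w_*(0)\ge0$, $\mathcal{M}^{w_*}_{p,q}(\mathbb{R}^n)$ is the set of all $f\in L^p(\mathbb{R}^n)$ with $\|f\|_{\mathcal{M}^{w_*}_{p,q}}:=\big(\sum_{k\in\mathbb{Z}^n}e^{q\,w_*(|k|)}\|\Box_kf\|_{L^p}^q\big)^{1/q}<\infty$ (supremum over $k$ if $q=\infty$). Weights: a measurable function $h:(0,\infty)\to(0,\infty)$ is regularly varying of index $\alpha\in\mathbb{R}$ if $\lim_{t\to\infty}h(tx)/h(t)=x^\alpha$ for all $x>0$; it is slowly varying if this holds with $\alpha=0$. The set $\mathcal{W}(\mathbb{R})$ consists of all functions $w_*=w_*(x)$, $x\in[0,\infty)$, such that: (A1)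 $w_*\in C^\infty(0,\infty)$ is regularly varying with index $\alpha$, $0\le\alpha<1$; (A2) $w_*\ge1$; (A3) $w_*$ is strictly increasing; (A4) $\lim_{t\to\infty}(w_*(t)-M\log t)=\infty$ for all $M$; (A5) $w_*'(0)=0$; (A6) $w_*''$ has finitely many changes of sign, with a number $\tau$ such that $w_*''(x)<0$ for all $x>\tau$. $\mathcal{W}_1(\mathbb{R})$ is the set of $w_*\in\mathcal{W}(\mathbb{R})$ that are regularly varying of index $\alpha\in(0,1)$. *)

theory Defs
  imports "HOL-Probability.Essential_Supremum"
begin

section \<open>Smooth functions\<close>

fun iterated_partial ::
  "'a list \<Rightarrow> ('a::euclidean_space \<Rightarrow> 'b::real_normed_vector) \<Rightarrow> 'a \<Rightarrow> 'b" where
  "iterated_partial [] f = f"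
| "iterated_partial (b # bs) f = (\<lambda>x. frechet_derivative (iterated_partial bs f) (at x) b)"

text \<open>
  \<open>C\<^sup>\<infinity>\<close> on an open set \<open>S\<close>: all iterated partial derivatives exist and are (Frechet)
  differentiable, hence continuous, at every point of \<open>S\<close>.
\<close>

definition smooth_on :: "'a set \<Rightarrow> ('a::euclidean_space \<Rightarrow> 'b::real_normed_vector) \<Rightarrow> bool" where
  "smooth_on S f \<longleftrightarrow>
     (\<forall>bs. set bs \<subseteq> Basis \<longrightarrow> (\<forall>x\<in>S. iterated_partial bs f differentiable (at x)))"

definition schwartz :: "('a::euclidean_space \<Rightarrow> complex) set" where
  "schwartz = {\<phi>. smooth_on UNIV \<phi> \<and>
     (\<forall>bs N. set bs \<subseteq> Basis \<longrightarrow>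
        (\<exists>C. \<forall>x. (1 + norm x) ^ N * norm (iterated_partial bs \<phi> x) \<le> C))}"


section \<open>Fourier transform and tempered distributions\<close>

definition fourier :: "(real^'n \<Rightarrow> complex) \<Rightarrow> real^'n \<Rightarrow> complex" where
  "fourier f \<xi> = of_real ((2 * pi) powr (- real CARD('n) / 2)) *
     (LINT x|lebesgue. f x * exp (- \<i> * of_real (x \<bullet> \<xi>)))"

definition inv_fourier :: "(real^'n \<Rightarrow> complex) \<Rightarrow> real^'n \<Rightarrow> complex" where
  "inv_fourier f x = of_real ((2 * pi) powr (- real CARD('n) / 2)) *
     (LINT \<xi>|lebesgue. f \<xi> * exp (\<i> * of_real (x \<bullet> \<xi>)))"

text \<open>
  For \<open>f \<in> L\<^sup>p\<close> with \<open>p > 2\<close> the Fourier transform of \<open>f\<close> is in general only a tempered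
  distribution. A distribution is represented by its action on test functions; only its values
  on \<^const>\<open>schwartz\<close> are ever used.
\<close>

type_synonym 'n distribution = "(real^'n \<Rightarrow> complex) \<Rightarrow> complex"

definition dist_of_fun :: "(real^'n \<Rightarrow> complex) \<Rightarrow> 'n distribution" where
  "dist_of_fun f = (\<lambda>\<phi>. LINT x|lebesgue. f x * \<phi> x)"

definition dist_fourier :: "('n::finite) distribution \<Rightarrow> 'n distribution" where
  "dist_fourier T = (\<lambda>\<phi>. T (fourier \<phi>))"

definition dist_inv_fourier :: "('n::finite) distribution \<Rightarrow> 'n distribution" where
  "dist_inv_fourier T = (\<lambda>\<phi>. T (inv_fourier \<phi>))"

definition dist_mult :: "(real^'n \<Rightarrow> real) \<Rightarrow> ('n::finite) distribution \<Rightarrow> 'n distribution" where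
  "dist_mult \<sigma> T = (\<lambda>\<phi>. T (\<lambda>x. of_real (\<sigma> x) * \<phi> x))"


section \<open>Lebesgue spaces\<close>

text \<open>Power with a real exponent \<open>r > 0\<close>, extended to the base \<open>\<infinity>\<close>.\<close>

definition ennpowr :: "ennreal \<Rightarrow> real \<Rightarrow> ennreal" where
  "ennpowr x r = (if x = \<infinity> then \<infinity> else ennreal (enn2real x powr r))"

definition Lp_norm :: "ennreal \<Rightarrow> (real^'n \<Rightarrow> complex) \<Rightarrow> ennreal" where
  "Lp_norm p f =
     (if p = \<infinity> then esssup lebesgue (\<lambda>x. ennreal (norm (f x)))
      else ennpowr (\<integral>\<^sup>+ x. ennreal (norm (f x) powr enn2real p) \<partial>lebesgue) (1 / enn2real p))"

definition Lp_space :: "ennreal \<Rightarrow> (real^'n \<Rightarrow> complex) set" where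
  "Lp_space p = {f \<in> borel_measurable lebesgue. Lp_norm p f < \<infinity>}"

text \<open>
  The \<open>L\<^sup>p\<close> norm of a distribution is that of the (almost everywhere unique) function in \<open>L\<^sup>p\<close>
  inducing it, and \<open>\<infinity>\<close>, the infimum of the empty set, if there is none.
\<close>

definition dist_Lp_norm :: "ennreal \<Rightarrow> ('n::finite) distribution \<Rightarrow> ennreal" where
  "dist_Lp_norm p T =
     (INF g \<in> {g \<in> Lp_space p. \<forall>\<phi>\<in>schwartz. T \<phi> = dist_of_fun g \<phi>}. Lp_norm p g)"


section \<open>Frequency-uniform decomposition and modulation spaces\<close>

definition real_vec :: "int^'n \<Rightarrow> real^'n" where
  "real_vec k = (\<chi> i. real_of_int (k $ i))"

definition decomposition_function :: "(real^'n \<Rightarrow> real) \<Rightarrow> bool" where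
  "decomposition_function \<rho> \<longleftrightarrow>
     smooth_on UNIV \<rho> \<and> (\<forall>\<xi>. 0 \<le> \<rho> \<xi> \<and> \<rho> \<xi> \<le> 1) \<and>
     closure {\<xi>. \<rho> \<xi> \<noteq> 0} \<subseteq> {\<xi>. \<forall>i. \<bar>\<xi> $ i\<bar> \<le> 1} \<and>
     (\<forall>\<xi>. (\<forall>i. \<bar>\<xi> $ i\<bar> \<le> 1 / 2) \<longrightarrow> \<rho> \<xi> = 1)"

text \<open>At every point only finitely many terms of the sum are nonzero.\<close>

definition decomposition_symbol :: "(real^'n \<Rightarrow> real) \<Rightarrow> int^'n \<Rightarrow> real^'n \<Rightarrow> real" where
  "decomposition_symbol \<rho> k \<xi> =
     \<rho> (\<xi> - real_vec k) / (\<Sum>\<^sub>\<infinity>m\<in>UNIV. \<rho> (\<xi> - real_vec m))"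

definition box_op ::
  "(real^'n \<Rightarrow> real) \<Rightarrow> int^'n \<Rightarrow> (real^'n \<Rightarrow> complex) \<Rightarrow> 'n distribution" where
  "box_op \<rho> k f =
     dist_inv_fourier (dist_mult (decomposition_symbol \<rho> k) (dist_fourier (dist_of_fun f)))"

definition modulation_norm ::
  "(real^'n \<Rightarrow> real) \<Rightarrow> (real \<Rightarrow> real) \<Rightarrow> ennreal \<Rightarrow> ennreal \<Rightarrow> (real^'n \<Rightarrow> complex) \<Rightarrow> ennreal" where
  "modulation_norm \<rho> w p q f =
     (if q = \<infinity>
      then (SUP k. ennreal (exp (w (norm (real_vec k)))) * dist_Lp_norm p (box_op \<rho> k f))
      else ennpowr
        (\<Sum>\<^sub>\<infinity>k\<in>UNIV. ennreal (exp (enn2real q * w (norm (real_vec k)))) *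
            ennpowr (dist_Lp_norm p (box_op \<rho> k f)) (enn2real q))
        (1 / enn2real q))"

definition modulation_space ::
  "(real^'n \<Rightarrow> real) \<Rightarrow> (real \<Rightarrow> real) \<Rightarrow> ennreal \<Rightarrow> ennreal \<Rightarrow> (real^'n \<Rightarrow> complex) set" where
  "modulation_space \<rho> w p q = {f \<in> Lp_space p. modulation_norm \<rho> w p q f < \<infinity>}"


section \<open>Weights\<close>

definition regularly_varying :: "real \<Rightarrow> (real \<Rightarrow> real) \<Rightarrow> bool" where
  "regularly_varying \<alpha> h \<longleftrightarrow>
     h \<in> borel_measurable (lebesgue_on {0<..}) \<and> (\<forall>x>0. h x > 0) \<and>
     (\<forall>x>0. ((\<lambda>t. h (t * x) / h t) \<longlongrightarrow> x powr \<alpha>) at_top)"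

abbreviation slowly_varying :: "(real \<Rightarrow> real) \<Rightarrow> bool" where
  "slowly_varying \<equiv> regularly_varying 0"

text \<open>
  The number of sign changes of \<open>g\<close> on \<open>S\<close> is finite if and only if there is a bound on the
  length of the increasing sequences in \<open>S\<close> along which the sign of \<open>g\<close> alternates strictly.
\<close>

definition finitely_many_sign_changes :: "real set \<Rightarrow> (real \<Rightarrow> real) \<Rightarrow> bool" where
  "finitely_many_sign_changes S g \<longleftrightarrow>
     (\<exists>N. \<forall>xs. sorted_wrt (<) xs \<and> set xs \<subseteq> S \<and>
        (\<forall>i. Suc i < length xs \<longrightarrow> g (xs ! i) * g (xs ! Suc i) < 0) \<longrightarrow> length xs \<le> N)"

text \<open>
  Weights are functions on \<open>[0,\<infinity>)\<close>: values at negative arguments are irrelevant, and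
  the derivative at \<open>0\<close> is one-sided.
\<close>

definition weight_class :: "(real \<Rightarrow> real) set" where
  "weight_class = {w.
     smooth_on {0<..} w \<and> (\<exists>\<alpha>. 0 \<le> \<alpha> \<and> \<alpha> < 1 \<and> regularly_varying \<alpha> w) \<and>
     (\<forall>x\<ge>0. w x \<ge> 1) \<and>
     strict_mono_on {0..} w \<and>
     (\<forall>M. filterlim (\<lambda>t. w t - M * ln t) at_top at_top) \<and>
     (w has_real_derivative 0) (at 0 within {0..}) \<and>
     finitely_many_sign_changes {0<..} (deriv (deriv w)) \<and>
     (\<exists>\<tau>\<ge>0. \<forall>x>\<tau>. deriv (deriv w) x < 0)}"

definition weight_class_1 :: "(real \<Rightarrow> real) set" where
  "weight_class_1 = {w \<in> weight_class. \<exists>\<alpha>. 0 < \<alpha> \<and> \<alpha> < 1 \<and> regularly_varying \<alpha> w}"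


section \<open>Complex measures on the real line\<close>

text \<open>Only the values on Borel sets matter.\<close>

definition complex_measure :: "(real set \<Rightarrow> complex) \<Rightarrow> bool" where
  "complex_measure \<mu> \<longleftrightarrow> \<mu> {} = 0 \<and>
     (\<forall>A :: nat \<Rightarrow> real set. range A \<subseteq> sets borel \<longrightarrow> disjoint_family A \<longrightarrow>
        (\<lambda>i. \<mu> (A i)) sums \<mu> (\<Union>i. A i))"

definition total_variation :: "(real set \<Rightarrow> complex) \<Rightarrow> real measure" where
  "total_variation \<mu> = measure_of UNIV (sets borel)
     (\<lambda>E. SUP A \<in> {A :: nat \<Rightarrow> real set. range A \<subseteq> sets borel \<and> disjoint_family A \<and> (\<Union>i. A i) = E}.
        \<Sum>i. ennreal (norm (\<mu> (A i))))"

text \<open>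
  The positive variation of a finite signed measure \<open>\<nu>\<close>, i.e. the positive part of its Jordan
  decomposition; the negative part is the positive variation of \<open>-\<nu>\<close>. Note that
  \<^const>\<open>ennreal\<close> sends negative numbers to \<open>0\<close>.
\<close>

definition positive_variation :: "(real set \<Rightarrow> real) \<Rightarrow> real measure" where
  "positive_variation \<nu> = measure_of UNIV (sets borel)
     (\<lambda>E. SUP A \<in> {A \<in> sets borel. A \<subseteq> E}. ennreal (\<nu> A))"

definition signed_integral :: "(real set \<Rightarrow> real) \<Rightarrow> (real \<Rightarrow> complex) \<Rightarrow> complex" where
  "signed_integral \<nu> g =
     (LINT x|positive_variation \<nu>. g x) - (LINT x|positive_variation (\<lambda>A. - \<nu> A). g x)"

definition complex_measure_integral :: "(real set \<Rightarrow> complex) \<Rightarrow> (real \<Rightarrow> complex) \<Rightarrow> complex" where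
  "complex_measure_integral \<mu> g =
     signed_integral (\<lambda>A. Re (\<mu> A)) g + \<i> * signed_integral (\<lambda>A. Im (\<mu> A)) g"

definition inv_fourier_measure :: "(real set \<Rightarrow> complex) \<Rightarrow> real \<Rightarrow> complex" where
  "inv_fourier_measure \<mu> t =
     of_real (1 / sqrt (2 * pi)) *
       complex_measure_integral \<mu> (\<lambda>\<xi>. exp (\<i> * of_real (t * \<xi>)))"

text \<open>
  At \<open>\<xi> = 0\<close> the exponent in \<open>L_1\<close> is \<open>0\<close>, since \<open>0 powr \<alpha> = 0\<close> and \<open>ln 0 = 0\<close>.
\<close>

definition L_1 :: "real \<Rightarrow> (real set \<Rightarrow> complex) \<Rightarrow> real \<Rightarrow> ennreal" where
  "L_1 \<alpha> \<mu> l =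
     (\<integral>\<^sup>+ \<xi>. ennreal (exp (l * \<bar>\<xi>\<bar> powr \<alpha> * ln \<bar>\<xi>\<bar>)) \<partial>total_variation \<mu>)"

definition L_2 :: "real \<Rightarrow> (real \<Rightarrow> real) \<Rightarrow> (real set \<Rightarrow> complex) \<Rightarrow> real \<Rightarrow> ennreal" where
  "L_2 \<alpha> wt \<mu> l =
     (\<integral>\<^sup>+ \<xi>\<in>{\<xi>. \<bar>\<xi>\<bar> > 1}.
        ennreal (exp (l * \<bar>\<xi>\<bar> powr \<alpha> * ln \<bar>\<xi>\<bar> * wt (\<bar>\<xi>\<bar> * (ln \<bar>\<xi>\<bar>) powr (1 / \<alpha>))))
        \<partial>total_variation \<mu>)"

end

theory Submission
  imports Defs "HOL-Probability.Characteristic_Functions" "HOL-Real_Asymp.Real_Asymp"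
begin

text \<open>
  The operators \<open>\<box>\<^sub>k\<close> are convolutions with integrable kernels, so \<open>u\<close> is the sum of its
  pieces \<open>V\<^sub>k\<close> with frequencies near \<open>k\<close>, and a product of pieces has frequencies near the sum of
  their indices. For \<open>\<bar>s\<bar> \<le> r\<close> split \<open>u = v + h\<close> at the frequency \<open>R\<close> with \<open>w R \<approx> ln r\<close>. The low part
  \<open>exp (i s v)\<close> is controlled in the exponential weight \<open>exp (y \<bar>k\<bar>)\<close> with \<open>y \<approx> w R / R\<close>, while the power
  series of \<open>exp (i s h)\<close> converges since \<open>r \<parallel>h\<parallel> \<le> 1\<close>. The subadditivity
  \<open>w (x + y) \<le> max (w x + \<beta> w y) (w y + \<beta> w x) + C\<close> with \<open>\<beta> < 1\<close> lets only one factor of each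
  product carry the full weight, so the weighted pieces of \<open>u exp (i s u)\<close> are dominated by a
  convolution of those of \<open>u\<close> with a sequence of sum at most \<open>C r exp (2 w (C r (ln r)\<^bsup>1/\<alpha>\<^esup>))\<close>.
  Writing \<open>exp (i \<xi> u) - 1\<close> as an integral over \<open>s \<in> [0, \<xi>]\<close> and integrating against \<open>\<mu>\<close> gives the
  theorem, because in both cases \<open>exp (l w (\<bar>\<xi>\<bar> (ln \<bar>\<xi>\<bar>)\<^bsup>1/\<alpha>\<^esup>))\<close> is \<open>\<bar>\<mu>\<bar>\<close>-integrable at infinity
  for every \<open>l\<close>.
\<close>

text \<open>The scale r (ln r)^(1/\<alpha>) is forced by two competing demands. The tail beyond R
  must be at most 1/r even in the damped weight exp (\<beta> w); it is of size exp (- \<delta> w R),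
  so w R must be a multiple of ln r. The low part costs exp (C r), while its strip has width y of
  order w R / R, so the decay exp (- y t) beats that cost only from t of order r R / w R on. A lower
  power bound of w turns R / w R into at most a multiple of (ln r)^(1/\<alpha>). Up to that point
  the weight itself has to be paid. With w x = x^\<alpha> wt x its value at r (ln r)^(1/\<alpha>) is
  r^\<alpha> ln r times wt at the same point, the exponent in \<open>L_2\<close>. A frequency cut
  need not preserve real values, so exp (i s v) need not be unimodular; as v + h is real, Im v = -
  Im h, and the smallness of s h bounds it by \<open>exp 1\<close>. By \<mu>(R) = 0, exp (i \<xi> u)
  may be replaced by exp (i \<xi> u) - 1, which is dominated by |\<xi> u| and so lies in
  L^p.\<close>

lemma ennpowr_ennreal [simp]: "0 \<le> x \<Longrightarrow> ennpowr (ennreal x) r = ennreal (x powr r)"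
  by (simp add: ennpowr_def)

lemma ennpowr_top [simp]: "ennpowr top r = top" "ennpowr \<infinity> r = \<infinity>"
  by (simp_all add: ennpowr_def)

lemma ennpowr_0 [simp]: "ennpowr 0 r = 0"
  by (simp add: ennpowr_def)

lemma ennpowr_1 [simp]: "ennpowr 1 r = 1"
  using ennpowr_ennreal[of 1 r] by simp

lemma ennpowr_mono: "0 < r \<Longrightarrow> x \<le> y \<Longrightarrow> ennpowr x r \<le> ennpowr y r"
  by (cases x; cases y) (auto simp: powr_mono2 top_unique)

lemma ennpowr_mult: "0 < r \<Longrightarrow> ennpowr (x * y) r = ennpowr x r * ennpowr y r"
proof (cases "x = \<infinity> \<or> y = \<infinity>")
  case True
  then show "0 < r \<Longrightarrow> ?thesis"
    by (cases x; cases y) (auto simp: ennreal_mult_top ennreal_top_mult)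
next
  case False
  then show "0 < r \<Longrightarrow> ?thesis"
    by (cases x; cases y) (auto simp: powr_mult simp flip: ennreal_mult)
qed

lemma ennpowr_ennpowr: "ennpowr (ennpowr x r) s = ennpowr x (r * s)"
  by (cases x) (auto simp: powr_powr)

lemma ennpowr_by_1 [simp]: "ennpowr x 1 = x"
  by (cases x) auto

lemma ennpowr_eq_0_iff [simp]: "ennpowr x r = 0 \<longleftrightarrow> x = 0"
  by (cases x) auto

lemma ennpowr_eq_top_iff [simp]: "ennpowr x r = top \<longleftrightarrow> x = top"
  by (cases x) auto

lemma measurable_ennpowr [measurable]:
  "f \<in> borel_measurable M \<Longrightarrow> (\<lambda>x. ennpowr (f x) r) \<in> borel_measurable M"
  unfolding ennpowr_def infinity_ennreal_def
proof (intro measurable_If)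
  assume [measurable]: "f \<in> borel_measurable M"
  show "(\<lambda>x. ennreal (enn2real (f x) powr r)) \<in> borel_measurable M"
    unfolding powr_def by measurable
  show "{x \<in> space M. f x = top} \<in> sets M" by measurable
qed auto

section \<open>Norms of nonnegative functions: Jensen, Minkowski and Hoelder inequalities\<close>

text \<open>One norm for arbitrary measures and infinite values: over \<open>lborel\<close> it gives
  the L^p norm \<open>cN\<close>, over counting measures the sequence norms, so that Minkowski's
  inequality is proved once for both.\<close>

definition lpn :: "'a measure \<Rightarrow> real \<Rightarrow> ('a \<Rightarrow> ennreal) \<Rightarrow> ennreal" where
  "lpn M p f = ennpowr (\<integral>\<^sup>+x. ennpowr (f x) p \<partial>M) (1 / p)"

lemma lpn_mono_AE:
  assumes "0 < p" "AE x in M. f x \<le> g x"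
  shows "lpn M p f \<le> lpn M p g"
  unfolding lpn_def
  by (intro ennpowr_mono nn_integral_mono_AE) (use assms in \<open>auto intro: ennpowr_mono\<close>)

lemma lpn_mono: "0 < p \<Longrightarrow> (\<And>x. f x \<le> g x) \<Longrightarrow> lpn M p f \<le> lpn M p g"
  by (rule lpn_mono_AE) auto

lemma lpn_cong_AE:
  assumes "0 < p" "AE x in M. f x = g x"
  shows "lpn M p f = lpn M p g"
  by (intro antisym lpn_mono_AE) (use assms in auto)

lemma lpn_cmult:
  assumes "0 < p" "f \<in> borel_measurable M"
  shows "lpn M p (\<lambda>x. c * f x) = c * lpn M p f"
  using assms by (simp add: lpn_def ennpowr_mult nn_integral_cmult ennpowr_ennpowr)

lemma lpn_powr: "0 < p \<Longrightarrow> ennpowr (lpn M p f) p = (\<integral>\<^sup>+x. ennpowr (f x) p \<partial>M)"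
  by (simp add: lpn_def ennpowr_ennpowr)

lemma lpn_le_iff: "0 < p \<Longrightarrow> lpn M p f \<le> c \<longleftrightarrow> (\<integral>\<^sup>+x. ennpowr (f x) p \<partial>M) \<le> ennpowr c p"
  unfolding lpn_powr[symmetric]
  using ennpowr_mono[of p "lpn M p f" c] ennpowr_mono[of "1/p" "ennpowr (lpn M p f) p" "ennpowr c p"]
  by (auto simp: ennpowr_ennpowr)

lemma lpn_zero_AE: "AE x in M. f x = 0" if "0 < p" "f \<in> borel_measurable M" "lpn M p f = 0"
  using that nn_integral_0_iff_AE[of "\<lambda>x. ennpowr (f x) p" M] by (simp add: lpn_def)

text \<open>The graph of h powr p lies above its tangent at h = a. This is Young's inequality for
  (h/a) powr p and 1 with exponents 1/p and 1 - 1/p, multiplied by p a powr p.\<close>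

lemma young_tangent:
  fixes h a :: real
  assumes "0 \<le> h" "0 < a" "1 \<le> p"
  shows "p * a powr (p - 1) * h \<le> h powr p + (p - 1) * a powr p"
proof -
  have "p * (h / a) \<le> (h/a) powr p + (p - 1)"
  proof (cases "h = 0")
    case False
    have "((h/a) powr p) powr (1/p) * 1 powr (1 - 1/p) \<le> (1/p) * (h/a) powr p + (1 - 1/p) * 1"
      by (rule Youngs_inequality_0) (use assms False in auto)
    then have "h/a \<le> (1/p) * (h/a) powr p + (1 - 1/p)"
      using assms by (simp add: powr_powr)
    then have "p * (h/a) \<le> p * ((1/p) * (h/a) powr p + (1 - 1/p))"
      using assms by (intro mult_left_mono) auto
    also have "\<dots> = (h/a) powr p + (p - 1)" using assms by (simp add: right_diff_distrib distrib_left)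
    finally show ?thesis .
  qed (use assms in auto)
  then have "p * (h / a) * a powr p \<le> ((h/a) powr p + (p - 1)) * a powr p"
    by (intro mult_right_mono) auto
  moreover have "p * (h / a) * a powr p = p * a powr (p - 1) * h"
    using assms by (simp add: powr_diff)
  moreover have "(h/a) powr p * a powr p = h powr p" using assms by (simp add: powr_divide)
  ultimately show ?thesis by (simp add: distrib_right)
qed

lemma young_tangent_ennreal:
  assumes "0 < a" "1 \<le> p"
  shows "ennreal (p * a powr (p - 1)) * h \<le> ennpowr h p + ennreal ((p - 1) * a powr p)"
proof (cases h)
  case (real r)
  then show ?thesis using young_tangent[of r a p] assms
    by (simp flip: ennreal_mult ennreal_plus)
qed auto

text \<open>The tangent inequality, integrated against the weight c, is sharpest when the point of
  contact is the weighted mean A / C of h; there the terms with a combine to the claim.\<close>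

lemma weighted_jensen_ennreal:
  assumes p: "1 \<le> p" and [measurable]: "c \<in> borel_measurable M" "h \<in> borel_measurable M"
    and C: "(\<integral>\<^sup>+s. c s \<partial>M) = ennreal C" "0 < C"
  shows "ennpowr (\<integral>\<^sup>+s. c s * h s \<partial>M) p \<le> ennreal (C powr (p - 1)) * (\<integral>\<^sup>+s. c s * ennpowr (h s) p \<partial>M)"
proof (cases "\<integral>\<^sup>+s. c s * ennpowr (h s) p \<partial>M = \<infinity>")
  case True
  then show ?thesis using C by (simp add: ennreal_mult_top)
next
  case False
  then obtain J where J: "(\<integral>\<^sup>+s. c s * ennpowr (h s) p \<partial>M) = ennreal J" "0 \<le> J"
    by (cases "\<integral>\<^sup>+s. c s * ennpowr (h s) p \<partial>M") auto
  have main: "ennreal (p * a powr (p - 1)) * (\<integral>\<^sup>+s. c s * h s \<partial>M) \<le> ennreal (J + (p - 1) * a powr p * C)"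
    if "0 < a" for a
  proof -
    have "ennreal (p * a powr (p - 1)) * (\<integral>\<^sup>+s. c s * h s \<partial>M) =
       (\<integral>\<^sup>+s. c s * (ennreal (p * a powr (p - 1)) * h s) \<partial>M)"
      by (simp add: nn_integral_cmult[symmetric] mult_ac)
    also have "\<dots> \<le> (\<integral>\<^sup>+s. c s * (ennpowr (h s) p + ennreal ((p - 1) * a powr p)) \<partial>M)"
      by (intro nn_integral_mono mult_left_mono young_tangent_ennreal that p) auto
    also have "\<dots> = ennreal J + ennreal C * ennreal ((p - 1) * a powr p)"
      by (simp add: distrib_left nn_integral_add nn_integral_multc J C)
    also have "\<dots> = ennreal (J + (p - 1) * a powr p * C)"
      using p C J by (simp add: mult_ac flip: ennreal_mult ennreal_plus)
    finally show ?thesis .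
  qed
  have "(\<integral>\<^sup>+s. c s * h s \<partial>M) \<noteq> \<infinity>"
    using main[of 1] p by (auto simp: ennreal_mult_top top_unique split: if_splits)
  \<comment> \<open>The tangent at 1 has shown the integral to be finite, so the mean A / C may
    serve as point of contact.\<close>
  then obtain A where A: "(\<integral>\<^sup>+s. c s * h s \<partial>M) = ennreal A" "0 \<le> A"
    by (cases "\<integral>\<^sup>+s. c s * h s \<partial>M") auto
  show ?thesis
  proof (cases "A = 0")
    case False
    then have pos: "0 < A / C" using A C by auto
    have "p * (A/C) powr (p - 1) * A \<le> J + (p - 1) * (A/C) powr p * C"
    proof -
      have "ennreal (p * (A/C) powr (p - 1) * A) \<le> ennreal (J + (p - 1) * (A/C) powr p * C)"
        using main[OF pos] A p by (simp add: ennreal_mult)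
      moreover have "0 \<le> J + (p - 1) * (A/C) powr p * C" using p J C by simp
      ultimately show ?thesis by (simp only: ennreal_le_iff)
    qed
    moreover have "(A/C) powr (p - 1) * A = (A/C) powr p * C"
      using pos C A False by (simp add: powr_diff)
    ultimately have "p * ((A/C) powr p * C) \<le> J + (p - 1) * ((A/C) powr p * C)"
      by (simp only: mult.assoc)
    then have "(A/C) powr p * C \<le> J"
      by (simp only: left_diff_distrib)
    then have "A powr p \<le> C powr (p - 1) * J"
      using A C by (simp add: powr_divide powr_diff field_simps)
    then show ?thesis using A J C by (simp flip: ennreal_mult)
  qed (use A in auto)
qed

text \<open>Jensen's inequality takes the place of duality: g s x is written as c' s times g s x /
  c' s, where c' s is essentially the norm of the slice \<open>g s\<close>. Every normalised slice
  then has norm at most 1, and Fubini finishes. Division requires c' to be positive, hence the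
  perturbation by a small multiple of a positive integrable function, removed at the end.\<close>

lemma lpn_minkowski:
  assumes p: "1 \<le> p" and sf: "sigma_finite_measure M" "sigma_finite_measure N"
    and g: "(\<lambda>(s, x). g s x) \<in> borel_measurable (N \<Otimes>\<^sub>M M)"
  shows "lpn M p (\<lambda>x. \<integral>\<^sup>+s. g s x \<partial>N) \<le> (\<integral>\<^sup>+s. lpn M p (g s) \<partial>N)"
proof -
  interpret M: sigma_finite_measure M by fact
  interpret N: sigma_finite_measure N by fact
  interpret NM: pair_sigma_finite N M by standard
  note [measurable] = g
  have gx [measurable]: "\<And>x. x \<in> space M \<Longrightarrow> (\<lambda>s. g s x) \<in> borel_measurable N"
    using measurable_Pair1[OF g] by simp
  define c where "c s = lpn M p (g s)" for s
  have cm [measurable]: "c \<in> borel_measurable N"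
    unfolding c_def lpn_def by measurable
  show ?thesis
  proof (cases "(\<integral>\<^sup>+s. c s \<partial>N) = \<infinity>")
    case True then show ?thesis unfolding c_def by simp
  next
    case False
    then obtain C where C: "(\<integral>\<^sup>+s. c s \<partial>N) = ennreal C" "0 \<le> C"
      by (cases "\<integral>\<^sup>+s. c s \<partial>N") auto
    obtain \<delta> :: "_ \<Rightarrow> ennreal" where d [measurable]: "\<delta> \<in> borel_measurable N" "(\<integral>\<^sup>+s. \<delta> s \<partial>N) \<noteq> \<infinity>"
       "\<And>s. s \<in> space N \<Longrightarrow> 0 < \<delta> s \<and> \<delta> s < \<infinity>"
      using N.Ex_finite_integrable_function by metis
    define D where "D = enn2real (\<integral>\<^sup>+s. \<delta> s \<partial>N)"
    have D: "(\<integral>\<^sup>+s. \<delta> s \<partial>N) = ennreal D" "0 \<le> D"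
      using d(2) by (auto simp: D_def less_top)
    have "lpn M p (\<lambda>x. \<integral>\<^sup>+s. g s x \<partial>N) \<le> ennreal (C + e)" if "0 < e" for e :: real
    proof -
      define e' where "e' = e / (D + 1)"
      have e': "0 < e'" "e' * D \<le> e"
        using that D by (auto simp: e'_def field_simps)
      define c' where "c' s = c s + ennreal e' * \<delta> s" for s
      have [measurable]: "c' \<in> borel_measurable N" unfolding c'_def by measurable
      have ic': "(\<integral>\<^sup>+s. c' s \<partial>N) = ennreal (C + e' * D)"
        unfolding c'_def using C D e'
        by (simp add: nn_integral_add nn_integral_cmult flip: ennreal_mult ennreal_plus)
      have pos: "0 < c' s" if "s \<in> space N" for s
        using d(3)[OF that] e' by (simp add: c'_def ennreal_zero_less_mult_iff add_nonneg_pos)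
      have fin: "AE s in N. c' s \<noteq> \<infinity>"
        by (rule nn_integral_PInf_AE) (simp_all add: ic')
      show ?thesis
      \<comment> \<open>Since c' is positive everywhere, a vanishing integral of c' forces N to be a
        null measure, so all inner integrals vanish.\<close>
      proof (cases "C + e' * D = 0")
        case True
        then have "(\<integral>\<^sup>+s. c' s \<partial>N) = 0" using ic' by simp
        then have "AE s in N. c' s = 0" by (subst (asm) nn_integral_0_iff_AE) auto
        moreover have "AE s in N. c' s \<noteq> 0" using pos by (intro AE_I2) (auto simp: less_le)
        ultimately have "AE s in N. False" by eventually_elim auto
        then have "(\<integral>\<^sup>+s. g s x \<partial>N) = (\<integral>\<^sup>+s. 0 \<partial>N)" for x
            by (intro nn_integral_cong_AE) auto
        then show ?thesis by (simp add: lpn_def)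
      next
        case False
        then have Cp: "0 < C + e' * D" using C D e' by (simp add: less_le)
        define h where "h s x = g s x / c' s" for s x
        have hm [measurable]: "(\<lambda>(s, x). h s x) \<in> borel_measurable (N \<Otimes>\<^sub>M M)"
          unfolding h_def by measurable
        have 1: "ennpowr (\<integral>\<^sup>+s. g s x \<partial>N) p \<le> ennreal ((C + e' * D) powr (p - 1)) * (\<integral>\<^sup>+s. c' s * ennpowr (h s x) p \<partial>N)"
          if x: "x \<in> space M" for x
        proof -
          have [measurable]: "(\<lambda>s. h s x) \<in> borel_measurable N"
            unfolding h_def using x by measurable
          have "AE s in N. g s x = c' s * h s x"
            using fin AE_space
          proof eventually_elim
            case (elim s)
            have "c' s * (g s x / c' s) = (g s x * c' s) / c' s"
              by (simp add: ennreal_times_divide mult.commute)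
            also have "\<dots> = g s x"
              using elim pos[of s] by (intro mult_divide_eq_ennreal) auto
            finally show ?case by (simp add: h_def)
          qed
          then have "(\<integral>\<^sup>+s. g s x \<partial>N) = (\<integral>\<^sup>+s. c' s * h s x \<partial>N)"
            by (rule nn_integral_cong_AE)
          also have "ennpowr \<dots> p \<le> ennreal ((C + e' * D) powr (p - 1)) * (\<integral>\<^sup>+s. c' s * ennpowr (h s x) p \<partial>N)"
            by (rule weighted_jensen_ennreal[OF p]) (use ic' Cp in auto)
          finally show ?thesis .
        qed
        have 2: "AE s in N. (\<integral>\<^sup>+x. ennpowr (h s x) p \<partial>M) \<le> 1"
          using fin AE_space
        proof eventually_elim
          case (elim s)
          have [measurable]: "g s \<in> borel_measurable M" using elim by measurable
          have "lpn M p (h s) = lpn M p (\<lambda>x. inverse (c' s) * g s x)"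
            by (simp add: h_def[abs_def] divide_ennreal_def mult.commute)
          also have "\<dots> = inverse (c' s) * c s"
            using p by (subst lpn_cmult) (auto simp: c_def)
          also have "\<dots> \<le> inverse (c' s) * c' s"
            by (intro mult_left_mono) (auto simp: c'_def)
          also have "\<dots> = c' s / c' s"
            by (simp add: divide_ennreal_def mult.commute)
          also have "\<dots> = 1" using elim pos[of s]
            by (intro ennreal_divide_self) (auto simp: top.not_eq_extremum[symmetric])
          finally have "lpn M p (h s) \<le> 1" .
          then have "(\<integral>\<^sup>+x. ennpowr (h s x) p \<partial>M) \<le> ennpowr 1 p"
            by (rule lpn_le_iff[THEN iffD1, rotated]) (use p in simp)
          then show ?case by simp
        qed
        have "(\<integral>\<^sup>+x. ennpowr (\<integral>\<^sup>+s. g s x \<partial>N) p \<partial>M) \<le>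
           (\<integral>\<^sup>+x. ennreal ((C + e' * D) powr (p - 1)) * (\<integral>\<^sup>+s. c' s * ennpowr (h s x) p \<partial>N) \<partial>M)"
          by (intro nn_integral_mono 1)
        also have "\<dots> = ennreal ((C + e' * D) powr (p - 1)) * (\<integral>\<^sup>+s. (\<integral>\<^sup>+x. c' s * ennpowr (h s x) p \<partial>M) \<partial>N)"
        proof -
          have "(\<integral>\<^sup>+x. (\<integral>\<^sup>+s. c' s * ennpowr (h s x) p \<partial>N) \<partial>M) = (\<integral>\<^sup>+s. (\<integral>\<^sup>+x. c' s * ennpowr (h s x) p \<partial>M) \<partial>N)"
            by (rule NM.Fubini') measurable
          moreover have "(\<lambda>x. \<integral>\<^sup>+s. c' s * ennpowr (h s x) p \<partial>N) \<in> borel_measurable M"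
          proof (rule N.borel_measurable_nn_integral)
            have "(\<lambda>(s, x). c' s * ennpowr (h s x) p) \<in> borel_measurable (N \<Otimes>\<^sub>M M)" by measurable
            from measurable_pair_swap[OF this]
            show "(\<lambda>(x, s). c' s * ennpowr (h s x) p) \<in> borel_measurable (M \<Otimes>\<^sub>M N)" by simp
          qed
          ultimately show ?thesis by (simp add: nn_integral_cmult)
        qed
        also have "\<dots> \<le> ennreal ((C + e' * D) powr (p - 1)) * (\<integral>\<^sup>+s. c' s * 1 \<partial>N)"
        proof (intro mult_left_mono nn_integral_mono_AE)
          show "AE s in N. (\<integral>\<^sup>+x. c' s * ennpowr (h s x) p \<partial>M) \<le> c' s * 1"
            using 2 AE_space
          proof eventually_elim
            case (elim s)
            then have [measurable]: "h s \<in> borel_measurable M" unfolding h_def by measurable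
            have "(\<integral>\<^sup>+x. c' s * ennpowr (h s x) p \<partial>M) = c' s * (\<integral>\<^sup>+x. ennpowr (h s x) p \<partial>M)"
              by (rule nn_integral_cmult) measurable
            also have "\<dots> \<le> c' s * 1" using elim by (intro mult_left_mono) auto
            finally show ?case .
          qed
        qed simp
        also have "ennreal ((C + e' * D) powr (p - 1)) * (\<integral>\<^sup>+s. c' s * 1 \<partial>N) = ennpowr (ennreal (C + e' * D)) p"
        proof -
          have "(C + e' * D) powr (p - 1) * (C + e' * D) = (C + e' * D) powr p"
            using Cp by (simp add: powr_diff)
          moreover have "ennreal ((C + e' * D) powr (p - 1)) * ennreal (C + e' * D) =
            ennreal ((C + e' * D) powr (p - 1) * (C + e' * D))"
            using Cp by (intro ennreal_mult[symmetric]) auto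
          ultimately show ?thesis using Cp by (simp only: ic' mult_1_right ennpowr_ennreal less_imp_le)
        qed
        finally have "(\<integral>\<^sup>+x. ennpowr (\<integral>\<^sup>+s. g s x \<partial>N) p \<partial>M) \<le> ennpowr (ennreal (C + e' * D)) p" .
        then have "lpn M p (\<lambda>x. \<integral>\<^sup>+s. g s x \<partial>N) \<le> ennreal (C + e' * D)"
          by (rule lpn_le_iff[THEN iffD2, rotated]) (use p in simp)
        also have "\<dots> \<le> ennreal (C + e)" using e' by (intro ennreal_leI) auto
        finally show ?thesis .
      qed
    qed
    note eps = this
    have "lpn M p (\<lambda>x. \<integral>\<^sup>+s. g s x \<partial>N) \<le> ennreal C"
    proof (rule ennreal_le_epsilon)
      fix e :: real assume e: "0 < e"
      have "ennreal (C + e) = ennreal C + ennreal e" using C e by (intro ennreal_plus) auto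
      then show "lpn M p (\<lambda>x. \<integral>\<^sup>+s. g s x \<partial>N) \<le> ennreal C + ennreal e" using eps[OF e] by metis
    qed
    then show ?thesis using C by (simp add: c_def[abs_def])
  qed
qed

text \<open>Replacing \<open>k\<close> by \<open>k powr p'\<close> and bounding \<open>k powr (p' - 1)\<close> by its supremum avoids the dual norm.\<close>

lemma lpn_hoelder:
  assumes p: "1 < p" and [measurable]: "f \<in> borel_measurable M" "k \<in> borel_measurable M"
    and k: "\<And>x. k x \<le> ennreal B" "1 \<le> B"
  shows "(\<integral>\<^sup>+x. f x * k x \<partial>M) \<le> lpn M p f * (1 + ennreal (B powr (1 / (p - 1))) * (\<integral>\<^sup>+x. k x \<partial>M))"
proof -
  define K where "K = 1 + ennreal (B powr (1 / (p - 1))) * (\<integral>\<^sup>+x. k x \<partial>M)"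
  have one: "(\<integral>\<^sup>+x. f x * k x \<partial>M) \<le> K" if f: "f \<in> borel_measurable M" "lpn M p f \<le> 1" for f
  proof -
    note [measurable] = f(1)
    have "f x * k x \<le> ennpowr (f x) p + ennreal (B powr (1 / (p - 1))) * k x" for x
    proof (cases "f x")
      case (real a)
      obtain b where b: "k x = ennreal b" "0 \<le> b" "b \<le> B"
        using k by (cases "k x") (metis ennreal_le_iff2 ennreal_less_top le_less_trans not_le order_trans top.extremum_unique zero_le_one | force)+
      have "a * b \<le> a powr p + B powr (1 / (p - 1)) * b"
      \<comment> \<open>Below the threshold the factor a is bounded by the threshold itself; above
        it B \<le> a powr (p - 1), so a b is at most a powr p.\<close>
      proof (cases "a \<le> B powr (1 / (p - 1))")
        case True
        then have "a * b \<le> B powr (1 / (p - 1)) * b" using b by (intro mult_right_mono) auto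
        then show ?thesis by (smt (verit) powr_ge_zero)
      next
        case False
        then have "B \<le> a powr (p - 1)"
          using powr_mono2[of "p - 1" "B powr (1 / (p - 1))" a] p k(2) by (simp add: powr_powr)
        then have "a * b \<le> a * a powr (p - 1)" using b real by (intro mult_left_mono) auto
        also have "\<dots> = a powr p" using False
          by (smt (verit) powr_gt_zero powr_mult_base powr_ge_zero)
        finally show ?thesis using b by (smt (verit) mult_nonneg_nonneg powr_ge_zero)
      qed
      then show ?thesis using real b by (simp flip: ennreal_mult ennreal_plus)
    qed auto
    then have "(\<integral>\<^sup>+x. f x * k x \<partial>M) \<le> (\<integral>\<^sup>+x. ennpowr (f x) p + ennreal (B powr (1 / (p - 1))) * k x \<partial>M)"
      by (intro nn_integral_mono) auto
    also have "\<dots> = (\<integral>\<^sup>+x. ennpowr (f x) p \<partial>M) + ennreal (B powr (1 / (p - 1))) * (\<integral>\<^sup>+x. k x \<partial>M)"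
      by (simp add: nn_integral_add nn_integral_cmult)
    also have "\<dots> \<le> K" unfolding K_def using f p by (subst (asm) lpn_le_iff) (auto intro: add_mono)
    finally show ?thesis .
  qed
  \<comment> \<open>The estimate is homogeneous in f, so it remains to rescale to norm 1; the norms
    0 and \<infinity> are treated apart.\<close>
  show ?thesis unfolding K_def[symmetric]
  proof (cases "lpn M p f = 0 \<or> lpn M p f = \<infinity>")
    case True
    then show "(\<integral>\<^sup>+x. f x * k x \<partial>M) \<le> lpn M p f * K"
    proof
      assume "lpn M p f = 0"
      then have "AE x in M. f x * k x = 0" using lpn_zero_AE[of p f M] p by auto
      then show ?thesis by (subst nn_integral_cong_AE[where v="\<lambda>_. 0"]) auto
    next
      assume "lpn M p f = \<infinity>"
      then show ?thesis by (simp add: K_def ennreal_top_mult)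
    qed
  next
    case False
    then obtain c where c: "lpn M p f = ennreal c" "0 < c"
      by (cases "lpn M p f") (auto simp: less_le)
    have "(\<integral>\<^sup>+x. (ennreal (1/c) * f x) * k x \<partial>M) \<le> K"
      by (rule one) (use p c in \<open>auto simp: lpn_cmult simp flip: ennreal_mult\<close>)
    then have "ennreal c * (\<integral>\<^sup>+x. (ennreal (1/c) * f x) * k x \<partial>M) \<le> ennreal c * K"
      by (intro mult_left_mono) auto
    moreover have "ennreal c * (\<integral>\<^sup>+x. (ennreal (1/c) * f x) * k x \<partial>M) = (\<integral>\<^sup>+x. f x * k x \<partial>M)"
    proof -
      have "(\<integral>\<^sup>+x. (ennreal (1/c) * f x) * k x \<partial>M) = ennreal (1/c) * (\<integral>\<^sup>+x. f x * k x \<partial>M)"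
        by (simp add: nn_integral_cmult mult.assoc)
      moreover have "ennreal c * ennreal (1/c) = 1"
        using c by (simp flip: ennreal_mult)
      ultimately show ?thesis by (simp add: mult.assoc[symmetric])
    qed
    ultimately show "(\<integral>\<^sup>+x. f x * k x \<partial>M) \<le> lpn M p f * K" using c by simp
  qed
qed

section \<open>Translation, dilation and Fubini for Lebesgue integrals\<close>

lemma borel_measurable_cis [measurable]: "cis \<in> borel_measurable borel"
  by (intro borel_measurable_continuous_onI continuous_intros)

lemma nn_integral_lborel_affine:
  fixes f :: "'a::euclidean_space \<Rightarrow> ennreal"
  assumes [measurable]: "f \<in> borel_measurable borel" and c: "c \<noteq> 0"
  shows "(\<integral>\<^sup>+x. f x \<partial>lborel) = ennreal (\<bar>c\<bar> ^ DIM('a)) * (\<integral>\<^sup>+x. f (t + c *\<^sub>R x) \<partial>lborel)"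
  by (subst lborel_affine[OF c, of t])
     (simp add: nn_integral_density nn_integral_distr nn_integral_cmult)

lemma lint_lborel_affine:
  fixes f :: "'a::euclidean_space \<Rightarrow> complex"
  assumes [measurable]: "f \<in> borel_measurable borel" and c: "c \<noteq> 0"
  shows "(LINT x|lborel. f x) = of_real (\<bar>c\<bar> ^ DIM('a)) * (LINT x|lborel. f (t + c *\<^sub>R x))"
  by (subst lborel_affine[OF c, of t])
     (simp add: integral_density integral_distr scaleR_conv_of_real)

lemma nn_integral_lborel_shift:
  fixes f :: "'a::euclidean_space \<Rightarrow> ennreal"
  assumes [measurable]: "f \<in> borel_measurable borel"
  shows "(\<integral>\<^sup>+x. f (t + x) \<partial>lborel) = (\<integral>\<^sup>+x. f x \<partial>lborel)" "(\<integral>\<^sup>+x. f (x + t) \<partial>lborel) = (\<integral>\<^sup>+x. f x \<partial>lborel)"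
    "(\<integral>\<^sup>+x. f (x - t) \<partial>lborel) = (\<integral>\<^sup>+x. f x \<partial>lborel)" "(\<integral>\<^sup>+x. f (t - x) \<partial>lborel) = (\<integral>\<^sup>+x. f x \<partial>lborel)"
  using nn_integral_lborel_affine[of f 1 t] nn_integral_lborel_affine[of f 1 "-t"] nn_integral_lborel_affine[of f "-1" t]
  by (simp_all add: add.commute)

lemma lint_lborel_shift:
  fixes f :: "'a::euclidean_space \<Rightarrow> complex"
  assumes [measurable]: "f \<in> borel_measurable borel"
  shows "(LINT x|lborel. f (t + x)) = (LINT x|lborel. f x)" "(LINT x|lborel. f (x + t)) = (LINT x|lborel. f x)"
    "(LINT x|lborel. f (x - t)) = (LINT x|lborel. f x)" "(LINT x|lborel. f (t - x)) = (LINT x|lborel. f x)"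
  using lint_lborel_affine[of f 1 t] lint_lborel_affine[of f 1 "-t"] lint_lborel_affine[of f "-1" t]
  by (simp_all add: add.commute)

lemma integrable_iff_nn:
  fixes f :: "'a \<Rightarrow> complex"
  assumes "f \<in> borel_measurable M"
  shows "integrable M f \<longleftrightarrow> (\<integral>\<^sup>+x. ennreal (norm (f x)) \<partial>M) < \<infinity>"
  using assms by (simp add: integrable_iff_bounded)

lemma norm_lint_le_nn:
  fixes f :: "'a \<Rightarrow> complex"
  shows "ennreal (norm (LINT x|M. f x)) \<le> (\<integral>\<^sup>+x. ennreal (norm (f x)) \<partial>M)"
  using integral_norm_bound_ennreal[of M f] by (cases "integrable M f") (auto simp: not_integrable_integral_eq)

lemma
  fixes f :: "'a \<Rightarrow> 'b \<Rightarrow> complex"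
  assumes "sigma_finite_measure M1" "sigma_finite_measure M2"
    and f: "(\<lambda>(x, y). f x y) \<in> borel_measurable (M1 \<Otimes>\<^sub>M M2)"
    and fin: "(\<integral>\<^sup>+x. (\<integral>\<^sup>+y. ennreal (norm (f x y)) \<partial>M2) \<partial>M1) < \<infinity>"
  shows integrable_pair_nn: "integrable (M1 \<Otimes>\<^sub>M M2) (\<lambda>(x, y). f x y)"
    and lint_swap: "(LINT x|M1. LINT y|M2. f x y) = (LINT y|M2. LINT x|M1. f x y)"
    and integrable_lint_snd: "integrable M2 (\<lambda>y. LINT x|M1. f x y)"
    and integrable_lint_fst: "integrable M1 (\<lambda>x. LINT y|M2. f x y)"
proof -
  interpret pair_sigma_finite M1 M2 using assms by (simp add: pair_sigma_finite_def)
  note [measurable] = f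
  have "(\<integral>\<^sup>+z. ennreal (norm (case z of (x, y) \<Rightarrow> f x y)) \<partial>(M1 \<Otimes>\<^sub>M M2)) =
     (\<integral>\<^sup>+x. (\<integral>\<^sup>+y. ennreal (norm (f x y)) \<partial>M2) \<partial>M1)"
    using M2.nn_integral_fst[of "\<lambda>z. ennreal (norm (case z of (x, y) \<Rightarrow> f x y))" M1] f by simp
  then show *: "integrable (M1 \<Otimes>\<^sub>M M2) (\<lambda>(x, y). f x y)"
    using fin f by (simp add: integrable_iff_nn)
  show "(LINT x|M1. LINT y|M2. f x y) = (LINT y|M2. LINT x|M1. f x y)"
    using Fubini_integral[OF *] by simp
  show "integrable M2 (\<lambda>y. LINT x|M1. f x y)" using integrable_snd[OF *] by simp
  show "integrable M1 (\<lambda>x. LINT y|M2. f x y)" using integrable_fst[OF *] by simp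
qed

lemmas lint_swap_lborel =
  lint_swap[OF lborel.sigma_finite_measure_axioms lborel.sigma_finite_measure_axioms]

lemma continuous_LINT:
  fixes f :: "'a::metric_space \<Rightarrow> 'b \<Rightarrow> complex"
  assumes "\<And>t. f t \<in> borel_measurable M" "integrable M w"
    and "\<And>t x. norm (f t x) \<le> w x" "\<And>x. continuous_on UNIV (\<lambda>t. f t x)"
  shows "continuous_on UNIV (\<lambda>t. LINT x|M. f t x)"
  unfolding continuous_on_eq_continuous_at[OF open_UNIV]
proof (intro ballI)
  fix t
  show "isCont (\<lambda>t. LINT x|M. f t x) t"
    unfolding continuous_at_sequentially
  proof (intro allI impI)
    fix s :: "nat \<Rightarrow> 'a" assume s: "s \<longlonglongrightarrow> t"
    have "(\<lambda>n. LINT x|M. f (s n) x) \<longlonglongrightarrow> (LINT x|M. f t x)"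
    proof (rule integral_dominated_convergence[where w=w])
      show "AE x in M. (\<lambda>n. f (s n) x) \<longlonglongrightarrow> f t x"
        using assms(4) s by (intro AE_I2) (auto simp: continuous_on_eq_continuous_at continuous_at_sequentially o_def)
    qed (use assms in auto)
    then show "((\<lambda>t. LINT x|M. f t x) \<circ> s) \<longlonglongrightarrow> (LINT x|M. f t x)" by (simp add: o_def)
  qed
qed

text \<open>The set where f is nonzero is open and null, and a nonempty open set has positive
  measure.\<close>

lemma AE_zero_continuous:
  fixes f :: "'a::euclidean_space \<Rightarrow> complex"
  assumes "continuous_on UNIV f" "AE x in lborel. f x = 0"
  shows "f x = 0"
proof -
  have o: "open {x. f x \<noteq> 0}" using assms(1) by (intro open_Collect_neq continuous_intros) auto
  have "{x. f x \<noteq> 0} \<in> null_sets lborel"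
    using assms(2) o by (subst (asm) AE_iff_null) auto
  then have "negligible {x. f x \<noteq> 0}"
    by (simp add: negligible_iff_null_sets null_sets_completionI)
  then have "{x. f x \<noteq> 0} = {}" using open_not_negligible o by blast
  then show ?thesis by auto
qed

section \<open>Fourier multipliers with integrable kernels\<close>

definition ker :: "('a::euclidean_space \<Rightarrow> complex) \<Rightarrow> 'a \<Rightarrow> complex" where
  "ker a z = (LINT \<xi>|lborel. a \<xi> * cis (- (z \<bullet> \<xi>)))"

definition bsupp :: "('a::euclidean_space \<Rightarrow> complex) \<Rightarrow> bool" where
  "bsupp a \<longleftrightarrow> continuous_on UNIV a \<and> (\<exists>r. \<forall>\<xi>. r < norm \<xi> \<longrightarrow> a \<xi> = 0)"

text \<open>Integrability of the kernel makes the multiplier bounded on L^p; continuity and compact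
  support of the symbol make the kernel bounded and continuous.\<close>

definition wsym :: "('a::euclidean_space \<Rightarrow> complex) \<Rightarrow> bool" where
  "wsym a \<longleftrightarrow> bsupp a \<and> integrable lborel (ker a)"

text \<open>Up to the factor (2 pi)^n this is the Fourier multiplier F^-1 (a F f): the integral over
  x produces the transform of f, and the sign in \<open>x - y\<close> the factor exp (i y \<bullet>
  \<xi>). As an integral against f it makes sense for every f in L^p, also when the transform of f
  is only a distribution.\<close>

definition conv_op :: "('a::euclidean_space \<Rightarrow> complex) \<Rightarrow> ('a \<Rightarrow> complex) \<Rightarrow> 'a \<Rightarrow> complex" where
  "conv_op a f y = (LINT x|lborel. f x * ker a (x - y))"

definition cN :: "real \<Rightarrow> ('a::euclidean_space \<Rightarrow> complex) \<Rightarrow> ennreal" where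
  "cN p f = lpn lborel p (\<lambda>x. ennreal (norm (f x)))"

lemma bsupp_measurable [measurable_dest]: "bsupp a \<Longrightarrow> a \<in> borel_measurable borel"
  by (auto simp: bsupp_def intro: borel_measurable_continuous_onI)

lemma bsupp_integrable:
  assumes "bsupp a" shows "integrable lborel a"
proof -
  obtain r where r: "\<And>\<xi>. r < norm \<xi> \<Longrightarrow> a \<xi> = 0" using assms by (auto simp: bsupp_def)
  have "integrable lborel (\<lambda>x. indicator (cball 0 r) x *\<^sub>R a x)"
    by (rule borel_integrable_compact) (use assms in \<open>auto simp: bsupp_def intro: continuous_on_subset\<close>)
  moreover have "(\<lambda>x. indicator (cball 0 r) x *\<^sub>R a x) = a"
    using r by (auto simp: indicator_def fun_eq_iff not_le)
  ultimately show ?thesis by simp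
qed

lemma bsupp_bounded:
  assumes "bsupp a" obtains B where "0 \<le> B" "\<And>x. norm (a x) \<le> B"
proof -
  obtain r where r: "\<And>\<xi>. r < norm \<xi> \<Longrightarrow> a \<xi> = 0" using assms by (auto simp: bsupp_def)
  have "compact (a ` cball 0 r)"
    by (rule compact_continuous_image) (use assms in \<open>auto simp: bsupp_def intro: continuous_on_subset\<close>)
  then obtain B where B: "\<And>x. x \<in> cball 0 r \<Longrightarrow> norm (a x) \<le> B"
    by (metis bounded_iff compact_imp_bounded imageI)
  show ?thesis
  proof (rule that[of "max B 0"])
    fix x show "norm (a x) \<le> max B 0" using B[of x] r[of x] by (cases "norm x \<le> r") auto
  qed simp
qed

lemma ker_measurable:
  assumes "bsupp a" shows "ker a \<in> borel_measurable borel"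
proof -
  note [measurable] = bsupp_measurable[OF assms]
  show ?thesis unfolding ker_def
    by (intro lborel.borel_measurable_lebesgue_integral) measurable
qed

lemma norm_ker_le: "norm (ker a z) \<le> (LINT \<xi>|lborel. norm (a \<xi>))"
proof -
  have "norm (ker a z) \<le> (LINT \<xi>|lborel. norm (a \<xi> * cis (- (z \<bullet> \<xi>))))"
    unfolding ker_def by (rule integral_norm_bound)
  then show ?thesis by (simp add: norm_mult)
qed

lemma ker_continuous: "bsupp a \<Longrightarrow> continuous_on UNIV (ker a)"
  unfolding ker_def
proof (rule continuous_LINT[where w="\<lambda>\<xi>. norm (a \<xi>)"])
  assume "bsupp a"
  note [measurable] = bsupp_measurable[OF this]
  show "(\<lambda>\<xi>. a \<xi> * cis (- (t \<bullet> \<xi>))) \<in> borel_measurable lborel" for t by measurable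
qed (auto intro!: continuous_intros integrable_norm bsupp_integrable simp: norm_mult)

lemma wsym_bsupp [dest]: "wsym a \<Longrightarrow> bsupp a" by (simp add: wsym_def)
lemma wsym_integrable [dest]: "wsym a \<Longrightarrow> integrable lborel (ker a)" by (simp add: wsym_def)

lemma ker_nn_finite: "wsym a \<Longrightarrow> (\<integral>\<^sup>+x. ennreal (norm (ker a x)) \<partial>lborel) < \<infinity>"
  by (subst integrable_iff_nn[symmetric]) auto

text \<open>Testing the inversion integral against the cut-off \<open>th (z / R)\<close> reduces it to an average
  of \<open>a\<close> near \<open>\<eta>\<close> with weight \<open>ker th\<close>; the normalising constant is not needed.\<close>

lemma ker_inversion:
  fixes a :: "'a::euclidean_space \<Rightarrow> complex"
  and th :: "'a \<Rightarrow> complex"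
  assumes a: "wsym a" and th: "wsym th"
  shows "th 0 * (LINT z|lborel. ker a z * cis (z \<bullet> \<eta>)) = a \<eta> * (LINT z|lborel. ker th z)"
proof -
  note [measurable] = bsupp_measurable[OF wsym_bsupp[OF a]] bsupp_measurable[OF wsym_bsupp[OF th]]
    ker_measurable[OF wsym_bsupp[OF a]] ker_measurable[OF wsym_bsupp[OF th]]
  have ca: "continuous_on UNIV a" and ct: "continuous_on UNIV th"
    using a th by (auto simp: wsym_def bsupp_def)
  obtain A where A: "0 \<le> A" "\<And>x. norm (a x) \<le> A" using bsupp_bounded[OF wsym_bsupp[OF a]] by blast
  obtain B where B: "0 \<le> B" "\<And>x. norm (th x) \<le> B" using bsupp_bounded[OF wsym_bsupp[OF th]] by blast
  \<comment> \<open>Fubini and the dilation rule for \<open>ker th\<close> move the scale e from the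
    cut-off into the argument of a; letting e tend to 0 then yields the two sides of the
    claim.\<close>
  have eq: "(LINT z|lborel. ker a z * th (e *\<^sub>R z) * cis (z \<bullet> \<eta>)) = (LINT \<zeta>|lborel. a (\<eta> + e *\<^sub>R \<zeta>) * ker th \<zeta>)"
    if e: "0 < e" for e
  proof -
    have fth: "(\<integral>\<^sup>+z. ennreal (norm (th (e *\<^sub>R z))) \<partial>lborel) < \<infinity>"
    proof -
      have "(\<integral>\<^sup>+z. ennreal (norm (th z)) \<partial>lborel) < \<infinity>"
        using bsupp_integrable[OF wsym_bsupp[OF th]] by (simp add: integrable_iff_nn)
      then have "ennreal (e ^ DIM('a)) * (\<integral>\<^sup>+z. ennreal (norm (th (e *\<^sub>R z))) \<partial>lborel) < \<infinity>"
        using nn_integral_lborel_affine[of "\<lambda>z. ennreal (norm (th z))" e 0] e by simp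
      then show ?thesis using e by (auto simp: ennreal_mult_less_top)
    qed
    have fa: "(\<integral>\<^sup>+z. ennreal (norm (a z)) \<partial>lborel) < \<infinity>"
      using bsupp_integrable[OF wsym_bsupp[OF a]] by (simp add: integrable_iff_nn)
    have "(LINT z|lborel. ker a z * th (e *\<^sub>R z) * cis (z \<bullet> \<eta>)) =
      (LINT z|lborel. LINT \<xi>|lborel. a \<xi> * cis (- (z \<bullet> \<xi>)) * (th (e *\<^sub>R z) * cis (z \<bullet> \<eta>)))"
    proof (rule Bochner_Integration.integral_cong[OF refl])
      fix z
      show "ker a z * th (e *\<^sub>R z) * cis (z \<bullet> \<eta>) =
        (LINT \<xi>|lborel. a \<xi> * cis (- (z \<bullet> \<xi>)) * (th (e *\<^sub>R z) * cis (z \<bullet> \<eta>)))"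
        by (subst integral_mult_left_zero) (simp add: ker_def mult.assoc)
    qed
    also have "\<dots> = (LINT \<xi>|lborel. LINT z|lborel. a \<xi> * cis (- (z \<bullet> \<xi>)) * (th (e *\<^sub>R z) * cis (z \<bullet> \<eta>)))"
    proof (rule lint_swap_lborel)
      have "(\<integral>\<^sup>+z. (\<integral>\<^sup>+\<xi>. ennreal (norm (a \<xi> * cis (- (z \<bullet> \<xi>)) * (th (e *\<^sub>R z) * cis (z \<bullet> \<eta>)))) \<partial>lborel) \<partial>lborel) =
        (\<integral>\<^sup>+z. (\<integral>\<^sup>+\<xi>. ennreal (norm (a \<xi>)) * ennreal (norm (th (e *\<^sub>R z))) \<partial>lborel) \<partial>lborel)"
        by (simp add: norm_mult ennreal_mult)
      also have "\<dots> = (\<integral>\<^sup>+\<xi>. ennreal (norm (a \<xi>)) \<partial>lborel) * (\<integral>\<^sup>+z. ennreal (norm (th (e *\<^sub>R z))) \<partial>lborel)"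
        by (simp add: nn_integral_multc nn_integral_cmult)
      also have "\<dots> < \<infinity>" using fa fth by (simp add: ennreal_mult_less_top)
      finally show "(\<integral>\<^sup>+z. (\<integral>\<^sup>+\<xi>. ennreal (norm (a \<xi> * cis (- (z \<bullet> \<xi>)) * (th (e *\<^sub>R z) * cis (z \<bullet> \<eta>)))) \<partial>lborel) \<partial>lborel) < \<infinity>" .
    qed measurable
    also have "\<dots> = (LINT \<xi>|lborel. a \<xi> * (of_real (inverse e ^ DIM('a)) * ker th (inverse e *\<^sub>R (\<xi> - \<eta>))))"
    proof (rule Bochner_Integration.integral_cong[OF refl])
      fix \<xi>
      have "(LINT z|lborel. a \<xi> * cis (- (z \<bullet> \<xi>)) * (th (e *\<^sub>R z) * cis (z \<bullet> \<eta>))) =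
        (LINT z|lborel. a \<xi> * (th (e *\<^sub>R z) * cis (- (z \<bullet> (\<xi> - \<eta>)))))"
      proof (rule Bochner_Integration.integral_cong[OF refl])
        fix z
        have "cis (- (z \<bullet> \<xi>)) * cis (z \<bullet> \<eta>) = cis (- (z \<bullet> (\<xi> - \<eta>)))"
          by (simp add: cis_mult inner_diff_right)
        then show "a \<xi> * cis (- (z \<bullet> \<xi>)) * (th (e *\<^sub>R z) * cis (z \<bullet> \<eta>)) = a \<xi> * (th (e *\<^sub>R z) * cis (- (z \<bullet> (\<xi> - \<eta>))))"
          by (simp add: mult.assoc mult.left_commute[of "cis _"])
      qed
      also have "\<dots> = a \<xi> * (LINT z|lborel. th (e *\<^sub>R z) * cis (- (z \<bullet> (\<xi> - \<eta>))))"
        by simp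
      also have "(LINT z|lborel. th (e *\<^sub>R z) * cis (- (z \<bullet> (\<xi> - \<eta>)))) = of_real (inverse e ^ DIM('a)) * ker th (inverse e *\<^sub>R (\<xi> - \<eta>))"
        unfolding ker_def using e
        by (subst lint_lborel_affine[where c="inverse e" and t=0]) (auto simp: inner_commute)
      finally show "(LINT z|lborel. a \<xi> * cis (- (z \<bullet> \<xi>)) * (th (e *\<^sub>R z) * cis (z \<bullet> \<eta>))) =
         a \<xi> * (of_real (inverse e ^ DIM('a)) * ker th (inverse e *\<^sub>R (\<xi> - \<eta>)))" .
    qed
    also have "\<dots> = (LINT \<zeta>|lborel. a (\<eta> + e *\<^sub>R \<zeta>) * ker th \<zeta>)"
    proof -
      have *: "complex_of_real (\<bar>e\<bar> ^ DIM('a)) * (a (\<eta> + e *\<^sub>R x) * (of_real (inverse e ^ DIM('a)) * y)) = a (\<eta> + e *\<^sub>R x) * y" for x y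
        using e by (simp add: power_inverse field_simps)
      have m: "(\<lambda>\<xi>. a \<xi> * (of_real (inverse e ^ DIM('a)) * ker th (inverse e *\<^sub>R (\<xi> - \<eta>)))) \<in> borel_measurable borel"
        by measurable
      have e0: "e \<noteq> 0" using e by simp
      show ?thesis unfolding lint_lborel_affine[OF m e0, of \<eta>] integral_mult_right_zero[symmetric] *
        using e by simp
    qed
    finally show ?thesis .
  qed
  let ?e = "\<lambda>n. inverse (real (Suc n))"
  have e0: "?e \<longlonglongrightarrow> 0" by (rule LIMSEQ_inverse_real_of_nat)
  have "(\<lambda>n. LINT z|lborel. ker a z * th (?e n *\<^sub>R z) * cis (z \<bullet> \<eta>)) \<longlonglongrightarrow> (LINT z|lborel. ker a z * th 0 * cis (z \<bullet> \<eta>))"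
  proof (rule integral_dominated_convergence[where w="\<lambda>z. norm (ker a z) * B"])
    show "integrable lborel (\<lambda>z. norm (ker a z) * B)" using a by auto
    show "AE z in lborel. (\<lambda>n. ker a z * th (?e n *\<^sub>R z) * cis (z \<bullet> \<eta>)) \<longlonglongrightarrow> ker a z * th 0 * cis (z \<bullet> \<eta>)"
    proof (intro AE_I2 tendsto_intros)
      fix z :: 'a have "(\<lambda>n. ?e n *\<^sub>R z) \<longlonglongrightarrow> 0 *\<^sub>R z" by (rule tendsto_scaleR[OF e0 tendsto_const])
      then show "(\<lambda>n. th (?e n *\<^sub>R z)) \<longlonglongrightarrow> th 0"
        using ct by (auto simp: continuous_on_eq_continuous_at intro!: isCont_tendsto_compose[of 0 th])
    qed
    show "AE z in lborel. norm (ker a z * th (?e n *\<^sub>R z) * cis (z \<bullet> \<eta>)) \<le> norm (ker a z) * B" for n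
      using B by (intro AE_I2) (auto simp: norm_mult intro!: mult_left_mono)
  qed measurable
  moreover have "(\<lambda>n. LINT \<zeta>|lborel. a (\<eta> + ?e n *\<^sub>R \<zeta>) * ker th \<zeta>) \<longlonglongrightarrow> (LINT \<zeta>|lborel. a \<eta> * ker th \<zeta>)"
  proof (rule integral_dominated_convergence[where w="\<lambda>z. A * norm (ker th z)"])
    show "integrable lborel (\<lambda>z. A * norm (ker th z))" using th by auto
    show "AE \<zeta> in lborel. (\<lambda>n. a (\<eta> + ?e n *\<^sub>R \<zeta>) * ker th \<zeta>) \<longlonglongrightarrow> a \<eta> * ker th \<zeta>"
    proof (intro AE_I2 tendsto_intros)
      fix \<zeta> :: 'a have "(\<lambda>n. \<eta> + ?e n *\<^sub>R \<zeta>) \<longlonglongrightarrow> \<eta> + 0 *\<^sub>R \<zeta>" by (rule tendsto_add[OF tendsto_const tendsto_scaleR[OF e0 tendsto_const]])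
      then show "(\<lambda>n. a (\<eta> + ?e n *\<^sub>R \<zeta>)) \<longlonglongrightarrow> a \<eta>"
        using ca by (auto simp: continuous_on_eq_continuous_at intro!: isCont_tendsto_compose[of \<eta> a])
    qed
    show "AE \<zeta> in lborel. norm (a (\<eta> + ?e n *\<^sub>R \<zeta>) * ker th \<zeta>) \<le> A * norm (ker th \<zeta>)" for n
      using A by (intro AE_I2) (auto simp: norm_mult intro!: mult_right_mono)
  qed measurable
  ultimately have "(LINT z|lborel. ker a z * th 0 * cis (z \<bullet> \<eta>)) = (LINT \<zeta>|lborel. a \<eta> * ker th \<zeta>)"
    using eq[of "?e _"] by (auto intro: LIMSEQ_unique)
  then show ?thesis by (simp add: mult_ac mult.left_commute[of _ "th 0"])
qed

lemma wsymI:
  assumes "bsupp a" "(\<integral>\<^sup>+x. ennreal (norm (ker a x)) \<partial>lborel) < \<infinity>"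
  shows "wsym a"
  using assms ker_measurable[OF assms(1)] by (simp add: wsym_def integrable_iff_nn)

lemma bsupp_add: "bsupp a \<Longrightarrow> bsupp b \<Longrightarrow> bsupp (\<lambda>x. a x + b x)"
proof -
  assume a: "bsupp a" "bsupp b"
  then obtain r r' where "\<forall>\<xi>. r < norm \<xi> \<longrightarrow> a \<xi> = 0" "\<forall>\<xi>. r' < norm \<xi> \<longrightarrow> b \<xi> = 0"
    by (auto simp: bsupp_def)
  then have "\<forall>\<xi>. max r r' < norm \<xi> \<longrightarrow> a \<xi> + b \<xi> = 0" by auto
  moreover have "continuous_on UNIV (\<lambda>x. a x + b x)"
    using a by (auto simp: bsupp_def intro!: continuous_intros)
  ultimately show ?thesis unfolding bsupp_def by blast
qed

lemma bsupp_mult: "bsupp a \<Longrightarrow> continuous_on UNIV b \<Longrightarrow> bsupp (\<lambda>x. a x * b x)"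
  by (fastforce simp: bsupp_def intro!: continuous_intros)

lemma ker_add: "bsupp a \<Longrightarrow> bsupp b \<Longrightarrow> ker (\<lambda>x. a x + b x) z = ker a z + ker b z"
proof -
  assume a: "bsupp a" "bsupp b"
  have i: "integrable lborel (\<lambda>\<xi>. a \<xi> * cis (- (z \<bullet> \<xi>)))" if "bsupp a" for a
    by (rule bsupp_integrable[OF bsupp_mult[OF that]]) (intro continuous_intros)
  show ?thesis unfolding ker_def
    by (simp add: distrib_right Bochner_Integration.integral_add[OF i[OF a(1)] i[OF a(2)]])
qed

lemma wsym_add: "wsym a \<Longrightarrow> wsym b \<Longrightarrow> wsym (\<lambda>x. a x + b x)"
proof -
  assume ab: "wsym a" "wsym b"
  then have "ker (\<lambda>x. a x + b x) = (\<lambda>z. ker a z + ker b z)"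
    by (intro ext ker_add) auto
  then show ?thesis using ab by (simp add: wsym_def bsupp_add)
qed

lemma wsym_zero: "wsym (\<lambda>x. 0)"
  by (simp add: wsym_def bsupp_def ker_def[abs_def])

lemma wsym_sum: "finite I \<Longrightarrow> (\<And>i. i \<in> I \<Longrightarrow> wsym (a i)) \<Longrightarrow> wsym (\<lambda>x. \<Sum>i\<in>I. a i x)"
  by (induction I rule: finite_induct) (auto simp: wsym_zero intro!: wsym_add)

lemma ker_translate:
  assumes "bsupp a"
  shows "ker (\<lambda>\<xi>. a (\<xi> - k)) z = cis (- (z \<bullet> k)) * ker a z"
proof -
  note [measurable] = bsupp_measurable[OF assms]
  have "ker (\<lambda>\<xi>. a (\<xi> - k)) z = (LINT \<xi>|lborel. cis (- (z \<bullet> k)) * (a (\<xi> - k) * cis (- (z \<bullet> (\<xi> - k)))))"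
    unfolding ker_def
  proof (rule Bochner_Integration.integral_cong[OF refl])
    fix \<xi>
    have "cis (- (z \<bullet> k)) * cis (- (z \<bullet> (\<xi> - k))) = cis (- (z \<bullet> \<xi>))"
      by (simp add: cis_mult inner_diff_right)
    then show "a (\<xi> - k) * cis (- (z \<bullet> \<xi>)) = cis (- (z \<bullet> k)) * (a (\<xi> - k) * cis (- (z \<bullet> (\<xi> - k))))"
      by (simp add: mult.left_commute)
  qed
  also have "\<dots> = cis (- (z \<bullet> k)) * ker a z"
    unfolding ker_def using lint_lborel_shift(3)[of "\<lambda>\<xi>. a \<xi> * cis (- (z \<bullet> \<xi>))" k] by simp
  finally show ?thesis .
qed

lemma bsupp_translate: "bsupp a \<Longrightarrow> bsupp (\<lambda>\<xi>. a (\<xi> - k))"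
proof -
  assume a: "bsupp a"
  then obtain r where r: "\<And>\<xi>. r < norm \<xi> \<Longrightarrow> a \<xi> = 0" by (auto simp: bsupp_def)
  have "a (\<xi> - k) = 0" if "r + norm k < norm \<xi>" for \<xi>
    using r[of "\<xi> - k"] that norm_triangle_ineq2[of \<xi> k] by auto
  moreover have "continuous_on UNIV (\<lambda>\<xi>. a (\<xi> - k))"
    using a unfolding bsupp_def by (auto intro!: continuous_intros continuous_on_compose2[of UNIV a])
  ultimately show ?thesis unfolding bsupp_def by blast
qed

lemma norm_ker_translate: "bsupp a \<Longrightarrow> norm (ker (\<lambda>\<xi>. a (\<xi> - k)) z) = norm (ker a z)"
  by (simp add: ker_translate norm_mult)

lemma wsym_translate: "wsym a \<Longrightarrow> wsym (\<lambda>\<xi>. a (\<xi> - k))"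
  by (intro wsymI bsupp_translate) (auto simp: norm_ker_translate wsym_bsupp ker_nn_finite[unfolded infinity_ennreal_def])

lemma ker_dilate:
  fixes a :: "'a::euclidean_space \<Rightarrow> complex"
  assumes "bsupp a" "0 < R"
  shows "ker (\<lambda>\<xi>. a (inverse R *\<^sub>R \<xi>)) z = of_real (R ^ DIM('a)) * ker a (R *\<^sub>R z)"
proof -
  note [measurable] = bsupp_measurable[OF assms(1)]
  show ?thesis unfolding ker_def using assms(2)
    by (subst lint_lborel_affine[where c=R and t=0]) auto
qed

text \<open>Dilating the symbol by R turns the kernel into R^n \<open>ker a\<close> (R z), which has
  the same L^1 norm.\<close>

lemma wsym_dilate:
  fixes a :: "'a::euclidean_space \<Rightarrow> complex"
  assumes a: "wsym a" and R: "0 < R" shows "wsym (\<lambda>\<xi>. a (inverse R *\<^sub>R \<xi>))"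
proof (rule wsymI)
  obtain r where r: "\<And>\<xi>. r < norm \<xi> \<Longrightarrow> a \<xi> = 0" using a by (auto simp: wsym_def bsupp_def)
  note [measurable] = ker_measurable[OF wsym_bsupp[OF a]]
  have "a (inverse R *\<^sub>R \<xi>) = 0" if "r * R < norm \<xi>" for \<xi>
    using that R by (intro r) (simp add: field_simps)
  moreover have "continuous_on UNIV (\<lambda>\<xi>. a (inverse R *\<^sub>R \<xi>))"
    using a unfolding wsym_def bsupp_def by (auto intro!: continuous_intros continuous_on_compose2[of UNIV a])
  ultimately show "bsupp (\<lambda>\<xi>. a (inverse R *\<^sub>R \<xi>))" unfolding bsupp_def by blast
  have "(\<integral>\<^sup>+x. ennreal (norm (ker (\<lambda>\<xi>. a (inverse R *\<^sub>R \<xi>)) x)) \<partial>lborel) =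
     ennreal (\<bar>R\<bar> ^ DIM('a)) * (\<integral>\<^sup>+x. ennreal (norm (ker a (0 + R *\<^sub>R x))) \<partial>lborel)"
    using R by (simp add: ker_dilate[OF wsym_bsupp[OF a] R] norm_mult ennreal_mult nn_integral_cmult norm_power)
  also have "\<dots> = (\<integral>\<^sup>+x. ennreal (norm (ker a x)) \<partial>lborel)"
    using R by (subst nn_integral_lborel_affine[of _ R 0]) auto
  also have "\<dots> < \<infinity>" by (rule ker_nn_finite[OF a])
  finally show "(\<integral>\<^sup>+x. ennreal (norm (ker (\<lambda>\<xi>. a (inverse R *\<^sub>R \<xi>)) x)) \<partial>lborel) < \<infinity>" .
qed

text \<open>The inner integral on the right is the inversion integral of \<open>ker a\<close>;
  evaluating it turns this identity into the convolution theorem \<open>ker_mult\<close>.\<close>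

lemma ker_convolution_aux:
  fixes a b :: "'a::euclidean_space \<Rightarrow> complex"
  assumes a: "wsym a" and b: "bsupp b"
  shows "(LINT z|lborel. ker a z * ker b (x - z)) =
     (LINT \<xi>|lborel. b \<xi> * cis (- (x \<bullet> \<xi>)) * (LINT z|lborel. ker a z * cis (z \<bullet> \<xi>)))"
proof -
  note [measurable] = bsupp_measurable[OF b] ker_measurable[OF b]
    bsupp_measurable[OF wsym_bsupp[OF a]] ker_measurable[OF wsym_bsupp[OF a]]
  have fb: "(\<integral>\<^sup>+z. ennreal (norm (b z)) \<partial>lborel) < \<infinity>"
    using bsupp_integrable[OF b] by (simp add: integrable_iff_nn)
  have "(LINT z|lborel. ker a z * ker b (x - z)) =
     (LINT z|lborel. LINT \<xi>|lborel. ker a z * (b \<xi> * cis (- ((x - z) \<bullet> \<xi>))))"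
    by (simp add: ker_def[of b])
  also have "\<dots> = (LINT \<xi>|lborel. LINT z|lborel. ker a z * (b \<xi> * cis (- ((x - z) \<bullet> \<xi>))))"
  proof (rule lint_swap_lborel)
    have "(\<integral>\<^sup>+z. (\<integral>\<^sup>+\<xi>. ennreal (norm (ker a z * (b \<xi> * cis (- ((x - z) \<bullet> \<xi>))))) \<partial>lborel) \<partial>lborel) =
      (\<integral>\<^sup>+z. ennreal (norm (ker a z)) \<partial>lborel) * (\<integral>\<^sup>+\<xi>. ennreal (norm (b \<xi>)) \<partial>lborel)"
      by (simp add: norm_mult ennreal_mult nn_integral_multc nn_integral_cmult)
    also have "\<dots> < \<infinity>" using fb ker_nn_finite[OF a] by (simp add: ennreal_mult_less_top)
    finally show "(\<integral>\<^sup>+z. (\<integral>\<^sup>+\<xi>. ennreal (norm (ker a z * (b \<xi> * cis (- ((x - z) \<bullet> \<xi>))))) \<partial>lborel) \<partial>lborel) < \<infinity>" .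
  qed measurable
  also have "\<dots> = (LINT \<xi>|lborel. b \<xi> * cis (- (x \<bullet> \<xi>)) * (LINT z|lborel. ker a z * cis (z \<bullet> \<xi>)))"
  proof (rule Bochner_Integration.integral_cong[OF refl])
    fix \<xi>
    have eq: "ker a z * (b \<xi> * cis (- ((x - z) \<bullet> \<xi>))) = (b \<xi> * cis (- (x \<bullet> \<xi>))) * (ker a z * cis (z \<bullet> \<xi>))" for z
    proof -
      have "cis (- ((x - z) \<bullet> \<xi>)) = cis (- (x \<bullet> \<xi>)) * cis (z \<bullet> \<xi>)"
        by (simp add: cis_mult inner_diff_left)
      then show ?thesis by (simp only: mult_ac)
    qed
    show "(LINT z|lborel. ker a z * (b \<xi> * cis (- ((x - z) \<bullet> \<xi>)))) =
       b \<xi> * cis (- (x \<bullet> \<xi>)) * (LINT z|lborel. ker a z * cis (z \<bullet> \<xi>))"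
      by (simp only: eq integral_mult_right_zero)
  qed
  finally show ?thesis .
qed

lemma integrable_convolution:
  fixes f g :: "'a::euclidean_space \<Rightarrow> complex"
  assumes "integrable lborel f" "integrable lborel g"
  shows "integrable lborel (\<lambda>x. LINT z|lborel. f z * g (x - z))"
proof (rule integrable_lint_snd[where f="\<lambda>z x. f z * g (x - z)"])
  have [measurable]: "f \<in> borel_measurable borel" "g \<in> borel_measurable borel" using assms by auto
  show "(\<lambda>(z, x). f z * g (x - z)) \<in> borel_measurable (lborel \<Otimes>\<^sub>M lborel)" by measurable
  have "(\<integral>\<^sup>+z. (\<integral>\<^sup>+x. ennreal (norm (f z * g (x - z))) \<partial>lborel) \<partial>lborel) =
     (\<integral>\<^sup>+z. ennreal (norm (f z)) \<partial>lborel) * (\<integral>\<^sup>+x. ennreal (norm (g x)) \<partial>lborel)"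
    using nn_integral_lborel_shift(3)[of "\<lambda>x. ennreal (norm (g x))"]
    by (simp add: norm_mult ennreal_mult nn_integral_cmult nn_integral_multc)
  also have "\<dots> < \<infinity>" using assms by (simp add: integrable_iff_nn ennreal_mult_less_top)
  finally show "(\<integral>\<^sup>+z. (\<integral>\<^sup>+x. ennreal (norm (f z * g (x - z))) \<partial>lborel) \<partial>lborel) < \<infinity>" .
qed (rule lborel.sigma_finite_measure_axioms)+

text \<open>\<open>th\<close> is a reference bump by which the inversion formula is calibrated. Its
  sign and its value at 0 serve to show that the constant of inversion does not vanish.\<close>

locale wiener_base =
  fixes th :: "'a::euclidean_space \<Rightarrow> complex" and th' :: "'a \<Rightarrow> real"
  assumes th: "wsym th" and th_real: "\<And>\<xi>. th \<xi> = of_real (th' \<xi>)"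
    and th_nonneg: "\<And>\<xi>. 0 \<le> th' \<xi>" and th_pos: "0 < th' 0"
begin

text \<open>The classical value is (2 pi)^n for any such bump. What enters below is that it does not
  depend on the symbol being inverted and that it is not zero.\<close>

definition kap :: complex where "kap = (LINT z|lborel. ker th z) / th 0"

lemma th0 [simp]: "th 0 \<noteq> 0" using th_real th_pos by auto

lemma inversion: "wsym (a :: 'a \<Rightarrow> complex) \<Longrightarrow> (LINT z|lborel. ker a z * cis (z \<bullet> \<eta>)) = kap * a \<eta>"
  using ker_inversion[of a th \<eta>] th by (simp add: kap_def field_simps)

lemma ker_mult:
  fixes a b :: "'a \<Rightarrow> complex"
  assumes a: "wsym a" and b: "bsupp b"
  shows "(LINT z|lborel. ker a z * ker b (x - z)) = kap * ker (\<lambda>\<xi>. a \<xi> * b \<xi>) x"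
proof -
  have eq: "b \<xi> * cis (- (x \<bullet> \<xi>)) * (kap * a \<xi>) = kap * (a \<xi> * b \<xi> * cis (- (x \<bullet> \<xi>)))" for \<xi>
    by (simp only: mult_ac)
  show ?thesis
    unfolding ker_convolution_aux[OF a b] inversion[OF a] eq integral_mult_right_zero by (simp only: ker_def)
qed

text \<open>If the constant vanished, the convolution theorem at the point 0 would make the integral
  of |\<open>ker th\<close>|^2 zero, because \<open>th\<close> is real and its kernel hermitian.
  Then \<open>ker th\<close> vanishes identically, in particular at 0, where its value is the
  integral of the nonnegative function \<open>th'\<close>.\<close>

lemma kap_nonzero: "kap \<noteq> 0"
proof
  assume k: "kap = 0"
  note [measurable] = ker_measurable[OF wsym_bsupp[OF th]]
  have cnj: "ker th (- z) = cnj (ker th z)" for z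
  proof -
    have eq: "cnj (th \<xi> * cis (- (z \<bullet> \<xi>))) = th \<xi> * cis (- (- z \<bullet> \<xi>))" for \<xi>
      by (simp add: th_real cis_cnj)
    show ?thesis by (simp only: ker_def Bochner_Integration.integral_cnj[symmetric] eq)
  qed
  have "(LINT z|lborel. ker th z * ker th (0 - z)) = 0"
    using ker_mult[OF th wsym_bsupp[OF th], of 0] k by simp
  then have "(LINT z|lborel. complex_of_real ((norm (ker th z))\<^sup>2)) = 0"
    by (simp add: cnj complex_norm_square[symmetric] del: of_real_power)
  then have 0: "(LINT z|lborel. (norm (ker th z))\<^sup>2) = 0"
    by (simp only: integral_complex_of_real of_real_eq_0_iff)
  \<comment> \<open>The kernel is bounded by the L^1 norm of \<open>th\<close>, so its square is
    dominated by a multiple of its modulus.\<close>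
  have "integrable lborel (\<lambda>z. (norm (ker th z))\<^sup>2)"
  proof (rule Bochner_Integration.integrable_bound)
    show "integrable lborel (\<lambda>z. (LINT \<xi>|lborel. norm (th \<xi>)) * norm (ker th z))" using th by auto
    show "AE z in lborel. norm ((norm (ker th z))\<^sup>2) \<le> norm ((LINT \<xi>|lborel. norm (th \<xi>)) * norm (ker th z))"
      using norm_ker_le[of th] by (intro AE_I2) (auto simp: power2_eq_square intro!: mult_right_mono)
  qed measurable
  then have "AE z in lborel. (norm (ker th z))\<^sup>2 = 0"
    using 0 by (subst (asm) integral_nonneg_eq_0_iff_AE) auto
  then have "AE z in lborel. ker th z = 0" by simp
  then have k0: "ker th 0 = 0"
    using AE_zero_continuous ker_continuous[OF wsym_bsupp[OF th]] by blast
  have th': "integrable lborel th'"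
    using integrable_norm[OF bsupp_integrable[OF wsym_bsupp[OF th]]] th_nonneg by (simp add: th_real)
  have "(LINT \<xi>|lborel. th' \<xi>) = 0"
    using k0 by (simp add: ker_def th_real integral_complex_of_real)
  then have "AE \<xi> in lborel. th' \<xi> = 0"
    using th' th_nonneg by (subst (asm) integral_nonneg_eq_0_iff_AE) auto
  then have "AE \<xi> in lborel. th \<xi> = 0" by (simp add: th_real)
  then have "th 0 = 0" using AE_zero_continuous[of th 0] th by (auto simp: wsym_def bsupp_def)
  then show False by simp
qed

text \<open>By the convolution theorem the kernel of the product is a multiple of the convolution of
  two integrable kernels.\<close>

lemma wsym_mult:
  fixes a b :: "'a \<Rightarrow> complex"
  assumes a: "wsym a" and b: "wsym b"
  shows "wsym (\<lambda>\<xi>. a \<xi> * b \<xi>)"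
proof -
  have "integrable lborel (\<lambda>x. kap * ker (\<lambda>\<xi>. a \<xi> * b \<xi>) x)"
    using integrable_convolution[of "ker a" "ker b"] a b ker_mult[OF a wsym_bsupp[OF b]] by (auto simp: wsym_def)
  then have "integrable lborel (\<lambda>x. inverse kap * (kap * ker (\<lambda>\<xi>. a \<xi> * b \<xi>) x))"
    by (rule integrable_mult_right)
  then have "integrable lborel (ker (\<lambda>\<xi>. a \<xi> * b \<xi>))"
    using kap_nonzero by (simp add: mult.assoc[symmetric] del: integrable_mult_right_iff)
  moreover have "bsupp (\<lambda>\<xi>. a \<xi> * b \<xi>)" using a b by (intro bsupp_mult) (auto simp: wsym_def bsupp_def)
  ultimately show ?thesis by (simp add: wsym_def)
qed

end

section \<open>Norm estimates for multipliers\<close>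

definition kI :: "('a::euclidean_space \<Rightarrow> complex) \<Rightarrow> ennreal" where
  "kI a = (\<integral>\<^sup>+x. ennreal (norm (ker a x)) \<partial>lborel)"

text \<open>\<open>kI\<close> bounds the multiplier on L^p, \<open>kC\<close> bounds it from L^p to
  bounded functions: it is the factor in \<open>lpn_hoelder\<close> for a kernel bounded by the L^1
  norm of its symbol, raised to at least 1 as that lemma demands. Both are invariant under
  translation of the symbol, which makes all estimates uniform in k.\<close>

definition kC :: "real \<Rightarrow> ('a::euclidean_space \<Rightarrow> complex) \<Rightarrow> ennreal" where
  "kC p a = 1 + ennreal (max 1 (LINT \<xi>|lborel. norm (a \<xi>)) powr (1 / (p - 1))) * kI a"

lemma kI_finite: "wsym a \<Longrightarrow> kI a < \<infinity>"
  unfolding kI_def by (rule ker_nn_finite)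

lemma kC_finite: "wsym a \<Longrightarrow> kC p a < \<infinity>"
  using kI_finite[of a] by (simp add: kC_def ennreal_mult_less_top)

lemma kI_translate: "bsupp a \<Longrightarrow> kI (\<lambda>\<xi>. a (\<xi> - k)) = kI a"
  unfolding kI_def by (simp add: norm_ker_translate)

lemma kC_translate:
  assumes "bsupp a" shows "kC p (\<lambda>\<xi>. a (\<xi> - k)) = kC p a"
proof -
  note [measurable] = bsupp_measurable[OF assms]
  have "(LINT \<xi>|lborel. complex_of_real (norm (a (\<xi> - k)))) = (LINT \<xi>|lborel. complex_of_real (norm (a \<xi>)))"
    using lint_lborel_shift(3)[of "\<lambda>\<xi>. complex_of_real (norm (a \<xi>))" k] by simp
  then have "(LINT \<xi>|lborel. norm (a (\<xi> - k))) = (LINT \<xi>|lborel. norm (a \<xi>))"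
    by (simp only: integral_complex_of_real of_real_eq_iff)
  then show ?thesis by (simp add: kC_def kI_translate[OF assms])
qed

lemma cN_zero_function [simp]: "cN p (\<lambda>x. 0) = 0"
  by (simp add: cN_def lpn_def)

lemma cN_cong_AE: "0 < p \<Longrightarrow> AE x in lborel. f x = g x \<Longrightarrow> cN p f = cN p g"
  unfolding cN_def by (intro lpn_cong_AE) auto

lemma cN_cmult: "0 < p \<Longrightarrow> f \<in> borel_measurable borel \<Longrightarrow> cN p (\<lambda>x. c * f x) = ennreal (norm c) * cN p f"
  unfolding cN_def by (simp add: norm_mult ennreal_mult lpn_cmult)

lemma cN_mult_bounded:
  assumes "0 < p" "f \<in> borel_measurable borel" "AE x in lborel. norm (g x) \<le> C" "0 \<le> C"
  shows "cN p (\<lambda>x. f x * g x) \<le> cN p f * ennreal C"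
proof -
  have "cN p (\<lambda>x. f x * g x) \<le> lpn lborel p (\<lambda>x. ennreal C * ennreal (norm (f x)))"
    unfolding cN_def
  proof (rule lpn_mono_AE[OF assms(1)])
    show "AE x in lborel. ennreal (norm (f x * g x)) \<le> ennreal C * ennreal (norm (f x))"
      using assms(3)
    proof eventually_elim
      case (elim x)
      then have "norm (f x * g x) \<le> C * norm (f x)"
        by (subst mult.commute[of C]) (auto simp: norm_mult intro: mult_left_mono)
      then show ?case using assms(4) by (simp add: ennreal_leI flip: ennreal_mult)
    qed
  qed
  also have "\<dots> = cN p f * ennreal C"
    using assms by (subst lpn_cmult) (auto simp: cN_def mult.commute)
  finally show ?thesis .
qed

lemma conv_bound:
  assumes p: "1 < p" and a: "wsym a" and f [measurable]: "f \<in> borel_measurable borel"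
  shows "(\<integral>\<^sup>+x. ennreal (norm (f x * ker a (x - y))) \<partial>lborel) \<le> cN p f * kC p a"
proof -
  note [measurable] = ker_measurable[OF wsym_bsupp[OF a]]
  have "(\<integral>\<^sup>+x. ennreal (norm (f x)) * ennreal (norm (ker a (x - y))) \<partial>lborel) \<le>
      lpn lborel p (\<lambda>x. ennreal (norm (f x))) *
        (1 + ennreal (max 1 (LINT \<xi>|lborel. norm (a \<xi>)) powr (1 / (p - 1))) * (\<integral>\<^sup>+x. ennreal (norm (ker a (x - y))) \<partial>lborel))"
    by (rule lpn_hoelder[OF p]) (auto intro!: ennreal_leI simp: le_max_iff_disj norm_ker_le)
  also have "(\<integral>\<^sup>+x. ennreal (norm (ker a (x - y))) \<partial>lborel) = kI a"
    using nn_integral_lborel_shift(3)[of "\<lambda>x. ennreal (norm (ker a x))" y] by (simp add: kI_def)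
  finally show ?thesis by (simp add: cN_def kC_def norm_mult ennreal_mult)
qed

lemma conv_integrable:
  assumes p: "1 < p" and a: "wsym a" and f [measurable]: "f \<in> borel_measurable borel" and "cN p f < \<infinity>"
  shows "integrable lborel (\<lambda>x. f x * ker a (x - y))"
proof -
  note [measurable] = ker_measurable[OF wsym_bsupp[OF a]]
  have "cN p f * kC p a < \<infinity>" using assms kC_finite[OF a] by (simp add: ennreal_mult_less_top)
  then show ?thesis using conv_bound[OF p a f, of y] by (subst integrable_iff_nn) (auto simp: less_le_trans le_less_trans)
qed

text \<open>A Bernstein inequality: for a function that the multiplier reproduces up to a constant,
  it bounds the values by the L^p norm.\<close>

lemma norm_conv_op_le:
  assumes p: "1 < p" and a: "wsym a" and f [measurable]: "f \<in> borel_measurable borel"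
  shows "ennreal (norm (conv_op a f y)) \<le> cN p f * kC p a"
  unfolding conv_op_def using norm_lint_le_nn conv_bound[OF p a f] by (rule order_trans)

lemma conv_op_measurable:
  assumes a: "wsym a" and f [measurable]: "f \<in> borel_measurable borel"
  shows "conv_op a f \<in> borel_measurable borel"
proof -
  note [measurable] = ker_measurable[OF wsym_bsupp[OF a]]
  show ?thesis unfolding conv_op_def[abs_def]
    by (intro lborel.borel_measurable_lebesgue_integral) measurable
qed

lemma conv_op_cmult: "conv_op a (\<lambda>x. c * f x) y = c * conv_op a f y"
  by (simp add: conv_op_def mult.assoc)

text \<open>Young's inequality from Minkowski's: the result is dominated by an average of translates
  of |f| with weight |\<open>ker a\<close>|, and translation preserves the L^p norm.\<close>

lemma cN_conv_op_le:
  fixes f :: "'a::euclidean_space \<Rightarrow> complex"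
  assumes p: "1 < p" and a: "wsym a" and f [measurable]: "f \<in> borel_measurable borel"
  shows "cN p (conv_op a f) \<le> kI a * cN p f"
proof -
  note [measurable] = ker_measurable[OF wsym_bsupp[OF a]]
  have "cN p (conv_op a f) \<le> lpn lborel p (\<lambda>y. \<integral>\<^sup>+z. ennreal (norm (ker a z)) * ennreal (norm (f (y + z))) \<partial>lborel)"
    unfolding cN_def
  proof (rule lpn_mono)
    fix y
    have "ennreal (norm (conv_op a f y)) \<le> (\<integral>\<^sup>+x. ennreal (norm (f x * ker a (x - y))) \<partial>lborel)"
      unfolding conv_op_def by (rule norm_lint_le_nn)
    also have "\<dots> = (\<integral>\<^sup>+x. ennreal (norm (f (y + x) * ker a ((y + x) - y))) \<partial>lborel)"
      using nn_integral_lborel_shift(1)[of "\<lambda>x. ennreal (norm (f x * ker a (x - y)))" y] by simp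
    finally show "ennreal (norm (conv_op a f y)) \<le> (\<integral>\<^sup>+z. ennreal (norm (ker a z)) * ennreal (norm (f (y + z))) \<partial>lborel)"
      by (simp add: norm_mult ennreal_mult mult.commute)
  qed (use p in simp)
  also have "\<dots> \<le> (\<integral>\<^sup>+z. lpn lborel p (\<lambda>y. ennreal (norm (ker a z)) * ennreal (norm (f (y + z)))) \<partial>lborel)"
    by (rule lpn_minkowski) (use p in \<open>auto simp: lborel.sigma_finite_measure_axioms\<close>)
  also have "\<dots> = (\<integral>\<^sup>+z. ennreal (norm (ker a z)) * cN p f \<partial>lborel)"
  proof (rule nn_integral_cong)
    fix z
    have "lpn lborel p (\<lambda>y. ennreal (norm (f (y + z)))) = cN p f"
      unfolding lpn_def cN_def
      using nn_integral_lborel_shift(2)[of "\<lambda>y. ennpowr (ennreal (norm (f y))) p" z] by simp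
    then show "lpn lborel p (\<lambda>y. ennreal (norm (ker a z)) * ennreal (norm (f (y + z)))) = ennreal (norm (ker a z)) * cN p f"
      using p by (subst lpn_cmult) auto
  qed
  also have "\<dots> = kI a * cN p f" by (simp add: nn_integral_multc kI_def)
  finally show ?thesis .
qed

text \<open>A multiplier may be pulled inside a superposition of L^p functions with summable norms.
  This is applied with counting measures (series of pieces, power series), with Lebesgue measure in
  the parameter of exp (i s u), and with the positive parts of \<mu>.\<close>

lemma conv_op_param:
  fixes g :: "'s \<Rightarrow> 'a::euclidean_space \<Rightarrow> complex"
  assumes p: "1 < p" and a: "wsym a" and M: "sigma_finite_measure M"
    and g: "(\<lambda>(s, x). g s x) \<in> borel_measurable (M \<Otimes>\<^sub>M lborel)"
    and fin: "(\<integral>\<^sup>+s. cN p (g s) \<partial>M) < \<infinity>"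
    and X [measurable]: "X \<in> borel_measurable borel" and eq: "AE x in lborel. X x = (LINT s|M. g s x)"
  shows conv_op_param_eq: "conv_op a X y = (LINT s|M. conv_op a (g s) y)"
    and cN_conv_op_param: "cN p (conv_op a X) \<le> (\<integral>\<^sup>+s. cN p (conv_op a (g s)) \<partial>M)"
proof -
  interpret M: sigma_finite_measure M by fact
  note [measurable] = g
  note [measurable] = ker_measurable[OF wsym_bsupp[OF a]]
  have g' [measurable]: "(\<lambda>(x, s). g s x) \<in> borel_measurable (lborel \<Otimes>\<^sub>M M)"
    using measurable_pair_swap[OF g] by simp
  have 1: "conv_op a X y = (LINT s|M. conv_op a (g s) y)" for y
  proof -
    have m: "(\<lambda>(s, x). g s x * ker a (x - y)) \<in> borel_measurable (M \<Otimes>\<^sub>M lborel)" by measurable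
    have "(\<integral>\<^sup>+s. (\<integral>\<^sup>+x. ennreal (norm (g s x * ker a (x - y))) \<partial>lborel) \<partial>M) \<le> (\<integral>\<^sup>+s. cN p (g s) * kC p a \<partial>M)"
      by (intro nn_integral_mono conv_bound[OF p a]) measurable
    also have "\<dots> = (\<integral>\<^sup>+s. cN p (g s) \<partial>M) * kC p a"
      unfolding cN_def lpn_def by (intro nn_integral_multc) measurable
    also have "\<dots> < \<infinity>" using fin kC_finite[OF a] by (simp add: ennreal_mult_less_top)
    finally have *: "(LINT s|M. LINT x|lborel. g s x * ker a (x - y)) = (LINT x|lborel. LINT s|M. g s x * ker a (x - y))"
      by (intro lint_swap m M lborel.sigma_finite_measure_axioms)
    have "conv_op a X y = (LINT x|lborel. (LINT s|M. g s x) * ker a (x - y))"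
      unfolding conv_op_def using eq by (intro integral_cong_AE) auto
    also have "\<dots> = (LINT s|M. conv_op a (g s) y)"
      unfolding conv_op_def using * by simp
    finally show ?thesis .
  qed
  then show "conv_op a X y = (LINT s|M. conv_op a (g s) y)" .
  have m2: "(\<lambda>(s, y). ennreal (norm (conv_op a (g s) y))) \<in> borel_measurable (M \<Otimes>\<^sub>M lborel)"
    unfolding conv_op_def by measurable
  have "cN p (conv_op a X) \<le> lpn lborel p (\<lambda>y. \<integral>\<^sup>+s. ennreal (norm (conv_op a (g s) y)) \<partial>M)"
    unfolding cN_def using p by (intro lpn_mono) (auto simp: 1 norm_lint_le_nn)
  also have "\<dots> \<le> (\<integral>\<^sup>+s. cN p (conv_op a (g s)) \<partial>M)"
    unfolding cN_def by (rule lpn_minkowski[OF _ lborel.sigma_finite_measure_axioms M m2]) (use p in simp)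
  finally show "cN p (conv_op a X) \<le> (\<integral>\<^sup>+s. cN p (conv_op a (g s)) \<partial>M)" .
qed

section \<open>Spectral localisation\<close>

text \<open>A product of kernels corresponds to a correlation of symbols, modulated by v. The value
  c \<zeta> can be nonzero only if \<zeta> is a point of the support of a minus one of the support
  of b; this is what moves spectra in \<open>spec_mult\<close>.\<close>

lemma product_symbol:
  fixes a b :: "'a::euclidean_space \<Rightarrow> complex" and v :: 'a
  assumes a: "wsym a" and b: "wsym b"
  defines "c \<equiv> \<lambda>\<zeta>. LINT \<eta>|lborel. b \<eta> * a (\<zeta> + \<eta>) * cis (- (v \<bullet> \<eta>))"
  shows product_symbol_ker: "ker c x = ker b (v - x) * ker a x" and product_symbol_wsym: "wsym c"
proof -
  note [measurable] = bsupp_measurable[OF wsym_bsupp[OF a]] bsupp_measurable[OF wsym_bsupp[OF b]]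
    ker_measurable[OF wsym_bsupp[OF a]] ker_measurable[OF wsym_bsupp[OF b]]
  obtain A where A: "0 \<le> A" "\<And>x. norm (a x) \<le> A" using bsupp_bounded[OF wsym_bsupp[OF a]] by blast
  obtain ra rb where r: "\<And>\<xi>. ra < norm \<xi> \<Longrightarrow> a \<xi> = 0" "\<And>\<xi>. rb < norm \<xi> \<Longrightarrow> b \<xi> = 0"
    using a b by (auto simp: wsym_def bsupp_def)
  have ca: "continuous_on UNIV a" using a by (auto simp: wsym_def bsupp_def)
  have fa: "(\<integral>\<^sup>+z. ennreal (norm (a z)) \<partial>lborel) < \<infinity>" and fb: "(\<integral>\<^sup>+z. ennreal (norm (b z)) \<partial>lborel) < \<infinity>"
    using bsupp_integrable[OF wsym_bsupp[OF a]] bsupp_integrable[OF wsym_bsupp[OF b]] by (simp_all add: integrable_iff_nn)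
  have k: "ker c x = ker b (v - x) * ker a x" for x
  proof -
    have "ker c x = (LINT \<zeta>|lborel. LINT \<eta>|lborel. b \<eta> * a (\<zeta> + \<eta>) * cis (- (v \<bullet> \<eta>)) * cis (- (x \<bullet> \<zeta>)))"
      unfolding c_def ker_def by simp
    also have "\<dots> = (LINT \<eta>|lborel. LINT \<zeta>|lborel. b \<eta> * a (\<zeta> + \<eta>) * cis (- (v \<bullet> \<eta>)) * cis (- (x \<bullet> \<zeta>)))"
    proof (rule lint_swap_lborel[symmetric])
      have "(\<integral>\<^sup>+\<eta>. (\<integral>\<^sup>+\<zeta>. ennreal (norm (b \<eta> * a (\<zeta> + \<eta>) * cis (- (v \<bullet> \<eta>)) * cis (- (x \<bullet> \<zeta>)))) \<partial>lborel) \<partial>lborel) =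
        (\<integral>\<^sup>+\<eta>. ennreal (norm (b \<eta>)) * (\<integral>\<^sup>+\<zeta>. ennreal (norm (a (\<zeta> + \<eta>))) \<partial>lborel) \<partial>lborel)"
        by (simp add: norm_mult ennreal_mult nn_integral_cmult)
      also have "\<dots> = (\<integral>\<^sup>+\<eta>. ennreal (norm (b \<eta>)) \<partial>lborel) * (\<integral>\<^sup>+\<zeta>. ennreal (norm (a \<zeta>)) \<partial>lborel)"
        using nn_integral_lborel_shift(2)[of "\<lambda>\<zeta>. ennreal (norm (a \<zeta>))"] by (simp add: nn_integral_multc)
      also have "\<dots> < \<infinity>" using fa fb by (simp add: ennreal_mult_less_top)
      finally show "(\<integral>\<^sup>+\<eta>. (\<integral>\<^sup>+\<zeta>. ennreal (norm (b \<eta> * a (\<zeta> + \<eta>) * cis (- (v \<bullet> \<eta>)) * cis (- (x \<bullet> \<zeta>)))) \<partial>lborel) \<partial>lborel) < \<infinity>" .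
    qed measurable
    also have "\<dots> = (LINT \<eta>|lborel. b \<eta> * cis (- ((v - x) \<bullet> \<eta>)) * ker a x)"
    proof (rule Bochner_Integration.integral_cong[OF refl])
      fix \<eta>
      have "b \<eta> * a (\<zeta> + \<eta>) * cis (- (v \<bullet> \<eta>)) * cis (- (x \<bullet> \<zeta>)) =
         (b \<eta> * cis (- ((v - x) \<bullet> \<eta>))) * (a (\<zeta> + \<eta>) * cis (- (x \<bullet> (\<zeta> + \<eta>))))" for \<zeta>
      proof -
        have "cis (- (v \<bullet> \<eta>)) * cis (- (x \<bullet> \<zeta>)) = cis (- ((v - x) \<bullet> \<eta>)) * cis (- (x \<bullet> (\<zeta> + \<eta>)))"
          by (simp add: cis_mult inner_diff_left inner_add_right)
        then show ?thesis by (metis mult.assoc mult.left_commute)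
      qed
      then have "(LINT \<zeta>|lborel. b \<eta> * a (\<zeta> + \<eta>) * cis (- (v \<bullet> \<eta>)) * cis (- (x \<bullet> \<zeta>))) =
         (b \<eta> * cis (- ((v - x) \<bullet> \<eta>))) * (LINT \<zeta>|lborel. a (\<zeta> + \<eta>) * cis (- (x \<bullet> (\<zeta> + \<eta>))))"
        by (simp only: integral_mult_right_zero)
      also have "(LINT \<zeta>|lborel. a (\<zeta> + \<eta>) * cis (- (x \<bullet> (\<zeta> + \<eta>)))) = ker a x"
        using lint_lborel_shift(2)[of "\<lambda>\<zeta>. a \<zeta> * cis (- (x \<bullet> \<zeta>))" \<eta>] by (simp add: ker_def)
      finally show "(LINT \<zeta>|lborel. b \<eta> * a (\<zeta> + \<eta>) * cis (- (v \<bullet> \<eta>)) * cis (- (x \<bullet> \<zeta>))) =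
         b \<eta> * cis (- ((v - x) \<bullet> \<eta>)) * ker a x" .
    qed
    also have "\<dots> = ker b (v - x) * ker a x" by (simp add: ker_def[of b])
    finally show ?thesis .
  qed
  then show "ker c x = ker b (v - x) * ker a x" .
  have "c \<zeta> = 0" if "ra + rb < norm \<zeta>" for \<zeta>
  proof -
    have eq: "b \<eta> * a (\<zeta> + \<eta>) * cis (- (v \<bullet> \<eta>)) = 0" for \<eta>
    proof (cases "rb < norm \<eta>")
      case False
      then have "ra < norm (\<zeta> + \<eta>)" using that norm_triangle_ineq4[of "\<zeta> + \<eta>" \<eta>] by simp
      then show ?thesis using r by simp
    qed (use r in simp)
    show ?thesis by (simp add: c_def eq)
  qed
  moreover have "continuous_on UNIV c"
    unfolding c_def
  proof (rule continuous_LINT[where w="\<lambda>\<eta>. norm (b \<eta>) * A"])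
    show "integrable lborel (\<lambda>\<eta>. norm (b \<eta>) * A)" using bsupp_integrable[OF wsym_bsupp[OF b]] by auto
    show "norm (b \<eta> * a (\<zeta> + \<eta>) * cis (- (v \<bullet> \<eta>))) \<le> norm (b \<eta>) * A" for \<eta> \<zeta>
      using A by (auto simp: norm_mult intro!: mult_left_mono)
    show "continuous_on UNIV (\<lambda>\<zeta>. b \<eta> * a (\<zeta> + \<eta>) * cis (- (v \<bullet> \<eta>)))" for \<eta>
      by (intro continuous_intros continuous_on_compose2[OF ca]) auto
  qed measurable
  ultimately have c: "bsupp c" unfolding bsupp_def by blast
  show "wsym c"
  proof (rule wsymI[OF c])
    have "(\<integral>\<^sup>+x. ennreal (norm (ker c x)) \<partial>lborel) \<le> (\<integral>\<^sup>+x. ennreal (LINT \<xi>|lborel. norm (b \<xi>)) * ennreal (norm (ker a x)) \<partial>lborel)"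
      unfolding k norm_mult
      by (intro nn_integral_mono) (auto simp: ennreal_mult intro!: mult_right_mono ennreal_leI norm_ker_le)
    also have "\<dots> = ennreal (LINT \<xi>|lborel. norm (b \<xi>)) * (\<integral>\<^sup>+x. ennreal (norm (ker a x)) \<partial>lborel)"
      by (simp add: nn_integral_cmult)
    also have "\<dots> < \<infinity>" using ker_nn_finite[OF a] by (simp add: ennreal_mult_less_top)
    finally show "(\<integral>\<^sup>+x. ennreal (norm (ker c x)) \<partial>lborel) < \<infinity>" .
  qed
qed

text \<open>The Fourier transform of f is concentrated in the ball around k of radius L, expressed
  by duality: multipliers whose symbols vanish on the ball annihilate f. This avoids supports of
  distributions; the finite norm makes the integrals defining these multipliers converge.\<close>

definition spec :: "real \<Rightarrow> 'a::euclidean_space \<Rightarrow> real \<Rightarrow> ('a \<Rightarrow> complex) \<Rightarrow> bool" where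
  "spec p k L f \<longleftrightarrow> f \<in> borel_measurable borel \<and> cN p f < \<infinity> \<and>
     (\<forall>a. wsym a \<longrightarrow> (\<forall>\<xi>\<in>cball k L. a \<xi> = 0) \<longrightarrow> (\<forall>y. conv_op a f y = 0))"

context wiener_base
begin

lemma conv_op_comp:
  fixes a b f :: "'a \<Rightarrow> complex"
  assumes p: "1 < p" and a: "wsym a" and b: "wsym b"
    and f [measurable]: "f \<in> borel_measurable borel" and fin: "cN p f < \<infinity>"
  shows "conv_op a (conv_op b f) y = kap * conv_op (\<lambda>\<xi>. a \<xi> * b \<xi>) f y"
proof -
  note [measurable] = ker_measurable[OF wsym_bsupp[OF a]] ker_measurable[OF wsym_bsupp[OF b]]
  have "conv_op a (conv_op b f) y = (LINT x|lborel. LINT x'|lborel. f x' * ker b (x' - x) * ker a (x - y))"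
    by (simp add: conv_op_def)
  also have "\<dots> = (LINT x'|lborel. LINT x|lborel. f x' * ker b (x' - x) * ker a (x - y))"
  proof (rule lint_swap_lborel)
    have "(\<integral>\<^sup>+x. (\<integral>\<^sup>+x'. ennreal (norm (f x' * ker b (x' - x) * ker a (x - y))) \<partial>lborel) \<partial>lborel) =
       (\<integral>\<^sup>+x. (\<integral>\<^sup>+x'. ennreal (norm (f x' * ker b (x' - x))) \<partial>lborel) * ennreal (norm (ker a (x - y))) \<partial>lborel)"
      by (simp add: norm_mult ennreal_mult nn_integral_multc)
    also have "\<dots> \<le> (\<integral>\<^sup>+x. (cN p f * kC p b) * ennreal (norm (ker a (x - y))) \<partial>lborel)"
      by (intro nn_integral_mono mult_right_mono conv_bound[OF p b]) auto
    also have "\<dots> = (cN p f * kC p b) * (\<integral>\<^sup>+x. ennreal (norm (ker a x)) \<partial>lborel)"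
      using nn_integral_lborel_shift(3)[of "\<lambda>x. ennreal (norm (ker a x))" y] by (simp add: nn_integral_cmult)
    also have "\<dots> < \<infinity>" using fin kC_finite[OF b] ker_nn_finite[OF a] by (simp add: ennreal_mult_less_top)
    finally show "(\<integral>\<^sup>+x. (\<integral>\<^sup>+x'. ennreal (norm (f x' * ker b (x' - x) * ker a (x - y))) \<partial>lborel) \<partial>lborel) < \<infinity>" .
  qed measurable
  also have "\<dots> = (LINT x'|lborel. f x' * (kap * ker (\<lambda>\<xi>. a \<xi> * b \<xi>) (x' - y)))"
  proof (rule Bochner_Integration.integral_cong[OF refl])
    fix x'
    have "(LINT x|lborel. f x' * ker b (x' - x) * ker a (x - y)) = f x' * (LINT x|lborel. ker b (x' - x) * ker a (x - y))"
      by (simp only: mult.assoc integral_mult_right_zero)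
    also have "(LINT x|lborel. ker b (x' - x) * ker a (x - y)) = (LINT x|lborel. ker a x * ker b ((x' - y) - x))"
      using lint_lborel_shift(1)[of "\<lambda>x. ker b (x' - x) * ker a (x - y)" y] by (simp add: diff_diff_eq mult.commute)
    also have "\<dots> = kap * ker (\<lambda>\<xi>. a \<xi> * b \<xi>) (x' - y)"
      by (rule ker_mult[OF a wsym_bsupp[OF b]])
    finally show "(LINT x|lborel. f x' * ker b (x' - x) * ker a (x - y)) = f x' * (kap * ker (\<lambda>\<xi>. a \<xi> * b \<xi>) (x' - y))" .
  qed
  also have "\<dots> = kap * conv_op (\<lambda>\<xi>. a \<xi> * b \<xi>) f y"
    unfolding conv_op_def by (subst integral_mult_right_zero[symmetric]) (simp only: mult.left_commute)
  finally show ?thesis .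
qed

text \<open>Both claims rest on b reproducing h. Bernstein's inequality bounds h, which gives the
  norm estimate. Inserting the convolution for h into a multiplier applied to the product turns it
  into an average over z of multipliers applied to f alone, with the symbols of
  \<open>product_symbol\<close>; these vanish on the spectrum of f.\<close>

lemma spec_mult:
  fixes f h b :: "'a \<Rightarrow> complex"
  assumes p: "1 < p" and f: "spec p k L f" and b: "wsym b" and bs: "\<And>\<xi>. \<xi> \<notin> cball k' L' \<Longrightarrow> b \<xi> = 0"
    and h [measurable]: "h \<in> borel_measurable borel" and fin: "cN p h < \<infinity>"
    and rep: "\<And>y. conv_op b h y = kap * h y"
  shows "spec p (k + k') (L + L') (\<lambda>x. f x * h x)"
    "cN p (\<lambda>x. f x * h x) \<le> cN p f * (cN p h * kC p b * ennreal (inverse (norm kap)))"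
proof -
  have fm [measurable]: "f \<in> borel_measurable borel" and ff: "cN p f < \<infinity>" using f by (auto simp: spec_def)
  note [measurable] = ker_measurable[OF wsym_bsupp[OF b]]
  define C where "C = enn2real (cN p h * kC p b * ennreal (inverse (norm kap)))"
  have Cf: "cN p h * kC p b * ennreal (inverse (norm kap)) < \<infinity>"
    using fin kC_finite[OF b] by (simp add: ennreal_mult_less_top)
  then have C: "cN p h * kC p b * ennreal (inverse (norm kap)) = ennreal C" "0 \<le> C"
    by (auto simp: C_def less_top)
  have hb: "norm (h y) \<le> C" for y
  proof -
    have "ennreal (norm (h y)) = ennreal (norm (conv_op b h y)) * ennreal (inverse (norm kap))"
      using kap_nonzero by (simp add: rep norm_mult flip: ennreal_mult)
    also have "\<dots> \<le> ennreal C"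
      unfolding C(1)[symmetric] by (intro mult_right_mono norm_conv_op_le[OF p b]) auto
    finally show ?thesis using C by simp
  qed
  show bnd: "cN p (\<lambda>x. f x * h x) \<le> cN p f * (cN p h * kC p b * ennreal (inverse (norm kap)))"
    unfolding C(1) by (rule cN_mult_bounded) (use p hb C in auto)
  have "conv_op a (\<lambda>x. f x * h x) y = 0" if a: "wsym a" "\<And>\<xi>. \<xi> \<in> cball (k + k') (L + L') \<Longrightarrow> a \<xi> = 0" for a y
  proof -
    note [measurable] = ker_measurable[OF wsym_bsupp[OF a(1)]]
    have "conv_op a (\<lambda>x. f x * h x) y = (LINT x|lborel. inverse kap * (f x * (LINT z|lborel. h z * ker b (z - x)) * ker a (x - y)))"
      unfolding conv_op_def
      using rep kap_nonzero by (intro Bochner_Integration.integral_cong[OF refl]) (simp add: conv_op_def)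
    also have "\<dots> = inverse kap * (LINT x|lborel. LINT z|lborel. f x * ker a (x - y) * (h z * ker b (z - x)))"
    proof -
      have "inverse kap * (f x * (LINT z|lborel. h z * ker b (z - x)) * ker a (x - y)) =
        inverse kap * (LINT z|lborel. f x * ker a (x - y) * (h z * ker b (z - x)))" for x
        by (subst integral_mult_right_zero) (simp only: mult_ac)
      then show ?thesis by (simp only: integral_mult_right_zero)
    qed
    also have "(LINT x|lborel. LINT z|lborel. f x * ker a (x - y) * (h z * ker b (z - x))) =
       (LINT z|lborel. LINT x|lborel. f x * ker a (x - y) * (h z * ker b (z - x)))"
    proof (rule lint_swap_lborel)
      have "(\<integral>\<^sup>+x. (\<integral>\<^sup>+z. ennreal (norm (f x * ker a (x - y) * (h z * ker b (z - x)))) \<partial>lborel) \<partial>lborel) =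
         (\<integral>\<^sup>+x. ennreal (norm (f x * ker a (x - y))) * (\<integral>\<^sup>+z. ennreal (norm (h z * ker b (z - x))) \<partial>lborel) \<partial>lborel)"
        by (simp add: norm_mult ennreal_mult nn_integral_cmult)
      also have "\<dots> \<le> (\<integral>\<^sup>+x. ennreal (norm (f x * ker a (x - y))) * (cN p h * kC p b) \<partial>lborel)"
        by (intro nn_integral_mono mult_left_mono conv_bound[OF p b]) auto
      also have "\<dots> = (\<integral>\<^sup>+x. ennreal (norm (f x * ker a (x - y))) \<partial>lborel) * (cN p h * kC p b)"
        by (simp add: nn_integral_multc)
      also have "\<dots> \<le> (cN p f * kC p a) * (cN p h * kC p b)"
        by (intro mult_right_mono conv_bound[OF p a(1)]) auto
      also have "\<dots> < \<infinity>" using fin ff kC_finite[OF b] kC_finite[OF a(1)] by (simp add: ennreal_mult_less_top)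
      finally show "(\<integral>\<^sup>+x. (\<integral>\<^sup>+z. ennreal (norm (f x * ker a (x - y) * (h z * ker b (z - x)))) \<partial>lborel) \<partial>lborel) < \<infinity>" .
    qed measurable
    also have "\<dots> = (LINT (z::'a)|lborel. 0)"
    proof (rule Bochner_Integration.integral_cong[OF refl])
      fix z
      \<comment> \<open>If \<zeta> is within L of k and \<eta> within L' of k', then \<zeta> +
        \<eta> is within L + L' of k + k', where a vanishes.\<close>
      define c where "c = (\<lambda>\<zeta>. LINT \<eta>|lborel. b \<eta> * a (\<zeta> + \<eta>) * cis (- ((z - y) \<bullet> \<eta>)))"
      have "c \<zeta> = 0" if "\<zeta> \<in> cball k L" for \<zeta>
      proof -
        have eq: "b \<eta> * a (\<zeta> + \<eta>) * cis (- ((z - y) \<bullet> \<eta>)) = 0" for \<eta>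
        proof (cases "\<eta> \<in> cball k' L'")
          case True
          then have "dist (k + k') (\<zeta> + \<eta>) \<le> L + L'"
            using that dist_triangle_add[of k k' \<zeta> \<eta>] by simp
          then show ?thesis using a(2)[of "\<zeta> + \<eta>"] by simp
        qed (use bs in simp)
        show ?thesis by (simp add: c_def eq)
      qed
      then have "conv_op c f y = 0"
        using f product_symbol_wsym[OF a(1) b, of "z - y"] unfolding spec_def c_def by blast
      moreover have "conv_op c f y = (LINT x|lborel. f x * (ker b (z - x) * ker a (x - y)))"
        unfolding conv_op_def c_def product_symbol_ker[OF a(1) b] by (simp add: algebra_simps)
      ultimately have "(LINT x|lborel. f x * (ker b (z - x) * ker a (x - y))) = 0" by simp
      moreover have "(LINT x|lborel. f x * ker a (x - y) * (h z * ker b (z - x))) =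
         h z * (LINT x|lborel. f x * (ker b (z - x) * ker a (x - y)))"
        by (subst integral_mult_right_zero[symmetric]) (simp only: mult_ac)
      ultimately show "(LINT x|lborel. f x * ker a (x - y) * (h z * ker b (z - x))) = 0" by simp
    qed
    finally show ?thesis by simp
  qed
  moreover have "cN p (\<lambda>x. f x * h x) < \<infinity>"
  proof (rule le_less_trans[OF bnd[unfolded C(1)]])
    show "cN p f * ennreal C < \<infinity>" using ff by (simp add: ennreal_mult_less_top)
  qed
  ultimately show "spec p (k + k') (L + L') (\<lambda>x. f x * h x)"
    unfolding spec_def by auto
qed

end

section \<open>Approximate identities\<close>

definition bump :: "nat \<Rightarrow> 'a::euclidean_space \<Rightarrow> real" where
  "bump m x = max 0 (min 1 (real m + 1 - norm x))"

lemma bump_bounds: "0 \<le> bump m x" "bump m x \<le> 1" "norm x \<le> real m \<Longrightarrow> bump m x = 1"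
  "real m + 1 < norm x \<Longrightarrow> bump m x = 0"
  by (auto simp: bump_def)

lemma bsupp_mult_bump:
  assumes "continuous_on UNIV g" shows "bsupp (\<lambda>x. g x * of_real (bump m x))"
  unfolding bsupp_def bump_def using assms
  by (auto intro!: continuous_intros exI[of _ "real m + 1"])

text \<open>The bound is uniform in the translation s, because translating \<open>phi\<close>
  changes neither its supremum nor its L^1 norm.\<close>

lemma lpn_test_bound:
  assumes p: "1 < p" and v [measurable]: "v \<in> borel_measurable borel" and phi: "bsupp phi"
  obtains C where "C < \<infinity>" "\<And>s. (\<integral>\<^sup>+x. ennreal (norm (v x * phi (x - s))) \<partial>lborel) \<le> cN p v * C"
proof -
  note [measurable] = bsupp_measurable[OF phi]
  obtain B where B: "0 \<le> B" "\<And>x. norm (phi x) \<le> B" using bsupp_bounded[OF phi] by blast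
  define C where "C = 1 + ennreal (max 1 B powr (1 / (p - 1))) * (\<integral>\<^sup>+x. ennreal (norm (phi x)) \<partial>lborel)"
  have "(\<integral>\<^sup>+x. ennreal (norm (phi x)) \<partial>lborel) < \<infinity>"
    using bsupp_integrable[OF phi] by (simp add: integrable_iff_nn)
  then have "C < \<infinity>" by (simp add: C_def ennreal_mult_less_top)
  moreover have "(\<integral>\<^sup>+x. ennreal (norm (v x * phi (x - s))) \<partial>lborel) \<le> cN p v * C" for s
  proof -
    have "(\<integral>\<^sup>+x. ennreal (norm (v x)) * ennreal (norm (phi (x - s))) \<partial>lborel) \<le>
       lpn lborel p (\<lambda>x. ennreal (norm (v x))) * (1 + ennreal (max 1 B powr (1 / (p - 1))) * (\<integral>\<^sup>+x. ennreal (norm (phi (x - s))) \<partial>lborel))"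
      by (rule lpn_hoelder[OF p]) (use B in \<open>auto intro!: ennreal_leI simp: le_max_iff_disj\<close>)
    also have "(\<integral>\<^sup>+x. ennreal (norm (phi (x - s))) \<partial>lborel) = (\<integral>\<^sup>+x. ennreal (norm (phi x)) \<partial>lborel)"
      by (rule nn_integral_lborel_shift(3)) measurable
    finally show ?thesis by (simp add: C_def cN_def norm_mult ennreal_mult)
  qed
  ultimately show ?thesis by (rule that)
qed

lemma test_integrable:
  assumes p: "1 < p" and v [measurable]: "v \<in> borel_measurable borel" and fin: "cN p v < \<infinity>" and phi: "bsupp phi"
  shows "integrable lborel (\<lambda>x. v x * phi x)"
proof -
  note [measurable] = bsupp_measurable[OF phi]
  obtain C where C: "C < \<infinity>" "\<And>s. (\<integral>\<^sup>+x. ennreal (norm (v x * phi (x - s))) \<partial>lborel) \<le> cN p v * C"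
    using lpn_test_bound[OF p v phi] by blast
  have "cN p v * C < \<infinity>" using C fin by (simp add: ennreal_mult_less_top)
  then have "(\<integral>\<^sup>+x. ennreal (norm (v x * phi x)) \<partial>lborel) < \<infinity>"
    using le_less_trans[OF C(2)[of 0]] by simp
  then show ?thesis by (subst integrable_iff_nn) auto
qed

text \<open>The ideal test function is the conjugate sign of v, which would produce the integral of
  |v|. It is an almost everywhere limit of continuous functions; localised by \<open>bump\<close>,
  these are admissible, and dominated convergence applies on each ball.\<close>

lemma zero_if_test_zero:
  fixes v :: "'a::euclidean_space \<Rightarrow> complex"
  assumes p: "1 < p" and v [measurable]: "v \<in> borel_measurable borel" and fin: "cN p v < \<infinity>"
    and test: "\<And>phi. bsupp phi \<Longrightarrow> (LINT x|lborel. v x * phi x) = 0"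
  shows "AE x in lborel. v x = 0"
proof -
  define s where "s x = cnj (v x) / norm (v x)" for x
  have [measurable]: "s \<in> borel_measurable borel"
    unfolding s_def using borel_measurable_continuous_onI[OF continuous_on_cnj[OF continuous_on_id]]
    by (intro borel_measurable_divide measurable_compose[OF v]) auto
  have s1: "norm (s x) \<le> 1" for x by (simp add: s_def norm_divide)
  have "s \<in> borel_measurable lebesgue" by (simp add: measurable_completion)
  then have "s measurable_on UNIV" by (rule lebesgue_measurable_imp_measurable_on) simp
  then obtain Ng g where Ng: "negligible Ng" and g: "\<And>n. continuous_on UNIV (g n)"
    and gs: "\<And>x. x \<notin> Ng \<Longrightarrow> (\<lambda>n. g n x) \<longlonglongrightarrow> s x"
    unfolding measurable_on_def by auto
  have AEs: "AE x in lborel. (\<lambda>n. g n x) \<longlonglongrightarrow> s x"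
  proof -
    have "AE x in lebesgue. x \<notin> Ng" using Ng by (simp add: negligible_iff_null_sets AE_not_in)
    then have "AE x in lborel. x \<notin> Ng" by (simp add: AE_completion_iff)
    then show ?thesis using gs by (auto elim: eventually_mono)
  qed
  have "AE x in lborel. norm (v x) * bump m x = 0" for m
  proof -
    have bm: "bsupp (\<lambda>x::'a. complex_of_real (bump m x))"
      using bsupp_mult_bump[of "\<lambda>_. 1" m] by simp
    note [measurable] = bsupp_measurable[OF bm]
    have int: "integrable lborel (\<lambda>x. v x * of_real (bump m x))"
      by (rule test_integrable[OF p v fin bm])
    \<comment> \<open>Division by the maximum keeps the approximants bounded by 1 and does not
      change the limit, since |s| \<le> 1.\<close>
    define phi where "phi n x = g n x / of_real (max 1 (norm (g n x))) * of_real (bump m x)" for n x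
    have phi: "bsupp (phi n)" for n
      unfolding phi_def by (intro bsupp_mult_bump continuous_intros g) auto
    note [measurable] = bsupp_measurable[OF phi]
    have "(\<lambda>n. LINT x|lborel. v x * phi n x) \<longlonglongrightarrow> (LINT x|lborel. complex_of_real (norm (v x) * bump m x))"
    proof (rule integral_dominated_convergence[where w="\<lambda>x. norm (v x * of_real (bump m x))"])
      show "integrable lborel (\<lambda>x. norm (v x * of_real (bump m x)))" using int by auto
      show "AE x in lborel. (\<lambda>n. v x * phi n x) \<longlonglongrightarrow> complex_of_real (norm (v x) * bump m x)"
        using AEs
      proof eventually_elim
        case (elim x)
        have "(\<lambda>n. v x * phi n x) \<longlonglongrightarrow> v x * (s x / of_real (max 1 (norm (s x))) * of_real (bump m x))"
          unfolding phi_def by (intro tendsto_intros elim) auto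
        moreover have "v x * s x = norm (v x)"
          by (cases "v x = 0") (auto simp: s_def complex_norm_square[symmetric] power2_eq_square)
        ultimately show ?case using s1[of x] by (simp add: max_def mult.assoc[symmetric] split: if_splits)
      qed
      show "AE x in lborel. norm (v x * phi n x) \<le> norm (v x * of_real (bump m x))" for n
      proof (intro AE_I2)
        fix x
        have "norm (g n x / of_real (max 1 (norm (g n x)))) \<le> 1"
          by (auto simp: norm_divide divide_le_eq)
        then have "norm (phi n x) \<le> 1 * norm (complex_of_real (bump m x))"
          unfolding phi_def norm_mult[of "_ / _"] by (intro mult_right_mono) auto
        then show "norm (v x * phi n x) \<le> norm (v x * of_real (bump m x))"
          by (simp add: norm_mult mult_left_mono)
      qed
      show "(\<lambda>x. complex_of_real (norm (v x) * bump m x)) \<in> borel_measurable lborel" by simp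
    qed measurable
    then have "(LINT x|lborel. complex_of_real (norm (v x) * bump m x)) = 0"
      using test[OF phi] by (simp add: LIMSEQ_const_iff)
    then have "(LINT x|lborel. norm (v x) * bump m x) = 0"
      by (simp only: integral_complex_of_real of_real_eq_0_iff)
    moreover have "integrable lborel (\<lambda>x. norm (v x) * bump m x)"
      using integrable_norm[OF int] by (simp add: norm_mult bump_bounds)
    ultimately show ?thesis
      by (subst (asm) integral_nonneg_eq_0_iff_AE) (auto simp: bump_bounds)
  qed
  then have "AE x in lborel. \<forall>m. norm (v x) * bump m x = 0" by (intro AE_all_countable[THEN iffD2] allI)
  then show ?thesis
  proof eventually_elim
    case (elim x)
    obtain m where "norm x \<le> real m" using real_arch_simple by blast
    then show ?case using elim[rule_format, of m] by (simp add: bump_bounds)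
  qed
qed

text \<open>The dilates of K form an approximate identity of nonzero mass. Pairing the vanishing
  averages of v with a test function \<open>phi\<close> gives 0 for every R. By a change of
  variables this number is, up to a power of R, the average under K of the correlation
  \<open>J\<close> of v and \<open>phi\<close> at scale 1/R, and the average tends to
  \<open>J 0\<close> times the integral of K.\<close>

lemma zero_if_mollified_zero:
  fixes v K :: "'a::euclidean_space \<Rightarrow> complex"
  assumes p: "1 < p" and v [measurable]: "v \<in> borel_measurable borel" and fin: "cN p v < \<infinity>"
    and K: "integrable lborel K" "(LINT z|lborel. K z) \<noteq> 0" "\<And>z. norm (K z) \<le> B"
    and zero: "\<And>R y. 0 < R \<Longrightarrow> (LINT x|lborel. v x * K (real R *\<^sub>R (x - y))) = 0"
  shows "AE x in lborel. v x = 0"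
proof (rule zero_if_test_zero[OF p v fin])
  fix phi :: "'a \<Rightarrow> complex" assume phi: "bsupp phi"
  have Km [measurable]: "K \<in> borel_measurable borel" using K by auto
  note [measurable] = bsupp_measurable[OF phi]
  obtain C where C: "C < \<infinity>" "\<And>s. (\<integral>\<^sup>+x. ennreal (norm (v x * phi (x - s))) \<partial>lborel) \<le> cN p v * C"
    using lpn_test_bound[OF p v phi] by blast
  define D where "D = enn2real (cN p v * C)"
  have D: "cN p v * C = ennreal D" "0 \<le> D" using fin C by (auto simp: D_def ennreal_mult_less_top less_top)
  have Kfin: "(\<integral>\<^sup>+x. ennreal (norm (K x)) \<partial>lborel) < \<infinity>" using K by (simp add: integrable_iff_nn)
  define J where "J s = (LINT x|lborel. v x * phi (x - s))" for s
  have Jb: "norm (J s) \<le> D" for s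
  proof -
    have "ennreal (norm (J s)) \<le> ennreal D"
      unfolding J_def using norm_lint_le_nn C(2) unfolding D by (rule order_trans)
    then show ?thesis using D by simp
  qed
  have Jm [measurable]: "J \<in> borel_measurable borel"
    unfolding J_def[abs_def] by (intro lborel.borel_measurable_lebesgue_integral) measurable
  have E0: "(LINT z|lborel. K z * J (inverse (real R) *\<^sub>R z)) = 0" if R: "0 < R" for R :: nat
  proof -
    have f1: "(\<integral>\<^sup>+z. (\<integral>\<^sup>+x. ennreal (norm (K z * (v x * phi (x - inverse (real R) *\<^sub>R z)))) \<partial>lborel) \<partial>lborel) < \<infinity>"
    proof -
      have "(\<integral>\<^sup>+z. (\<integral>\<^sup>+x. ennreal (norm (K z * (v x * phi (x - inverse (real R) *\<^sub>R z)))) \<partial>lborel) \<partial>lborel) =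
        (\<integral>\<^sup>+z. ennreal (norm (K z)) * (\<integral>\<^sup>+x. ennreal (norm (v x * phi (x - inverse (real R) *\<^sub>R z))) \<partial>lborel) \<partial>lborel)"
        by (simp add: norm_mult ennreal_mult nn_integral_cmult)
      also have "\<dots> \<le> (\<integral>\<^sup>+z. ennreal (norm (K z)) * ennreal D \<partial>lborel)"
        unfolding D(1)[symmetric] by (intro nn_integral_mono mult_left_mono C) auto
      also have "\<dots> < \<infinity>" using Kfin by (simp add: nn_integral_multc ennreal_mult_less_top)
      finally show ?thesis .
    qed
    have f2: "(\<integral>\<^sup>+y. (\<integral>\<^sup>+x. ennreal (norm (v x * (phi y * K (real R *\<^sub>R (x - y))))) \<partial>lborel) \<partial>lborel) < \<infinity>"
    proof -
      define Q where "Q = 1 + ennreal (max 1 B powr (1 / (p - 1))) * (\<integral>\<^sup>+x. ennreal (norm (K (real R *\<^sub>R x))) \<partial>lborel)"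
      have "ennreal (\<bar>real R\<bar> ^ DIM('a)) * (\<integral>\<^sup>+x. ennreal (norm (K (0 + real R *\<^sub>R x))) \<partial>lborel) < \<infinity>"
        using nn_integral_lborel_affine[of "\<lambda>x. ennreal (norm (K x))" "real R" 0] R Kfin by simp
      then have Q: "Q < \<infinity>" using R by (auto simp: Q_def ennreal_mult_less_top)
      have q: "(\<integral>\<^sup>+x. ennreal (norm (v x)) * ennreal (norm (K (real R *\<^sub>R (x - y)))) \<partial>lborel) \<le> cN p v * Q" for y
      proof -
        have "(\<integral>\<^sup>+x. ennreal (norm (v x)) * ennreal (norm (K (real R *\<^sub>R (x - y)))) \<partial>lborel) \<le>
          lpn lborel p (\<lambda>x. ennreal (norm (v x))) * (1 + ennreal (max 1 B powr (1 / (p - 1))) * (\<integral>\<^sup>+x. ennreal (norm (K (real R *\<^sub>R (x - y)))) \<partial>lborel))"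
          by (rule lpn_hoelder[OF p]) (use K in \<open>auto intro!: ennreal_leI simp: le_max_iff_disj\<close>)
        also have "(\<integral>\<^sup>+x. ennreal (norm (K (real R *\<^sub>R (x - y)))) \<partial>lborel) = (\<integral>\<^sup>+x. ennreal (norm (K (real R *\<^sub>R x))) \<partial>lborel)"
          by (rule nn_integral_lborel_shift(3)) measurable
        finally show ?thesis by (simp add: Q_def cN_def)
      qed
      have "(\<integral>\<^sup>+y. (\<integral>\<^sup>+x. ennreal (norm (v x * (phi y * K (real R *\<^sub>R (x - y))))) \<partial>lborel) \<partial>lborel) =
        (\<integral>\<^sup>+y. ennreal (norm (phi y)) * (\<integral>\<^sup>+x. ennreal (norm (v x)) * ennreal (norm (K (real R *\<^sub>R (x - y)))) \<partial>lborel) \<partial>lborel)"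
        by (simp add: norm_mult ennreal_mult mult.left_commute nn_integral_cmult)
      also have "\<dots> \<le> (\<integral>\<^sup>+y. ennreal (norm (phi y)) * (cN p v * Q) \<partial>lborel)"
        by (intro nn_integral_mono mult_left_mono q) auto
      also have "\<dots> = (\<integral>\<^sup>+y. ennreal (norm (phi y)) \<partial>lborel) * (cN p v * Q)" by (simp add: nn_integral_multc)
      also have "\<dots> < \<infinity>" using Q fin bsupp_integrable[OF phi] by (simp add: integrable_iff_nn ennreal_mult_less_top)
      finally show ?thesis .
    qed
    have "(LINT z|lborel. K z * J (inverse (real R) *\<^sub>R z)) =
       (LINT z|lborel. LINT x|lborel. K z * (v x * phi (x - inverse (real R) *\<^sub>R z)))"
      by (simp add: J_def)
    also have "\<dots> = (LINT x|lborel. LINT z|lborel. K z * (v x * phi (x - inverse (real R) *\<^sub>R z)))"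
      by (rule lint_swap_lborel) (use f1 in \<open>measurable\<close>)
    also have "\<dots> = (LINT x|lborel. of_real (real R ^ DIM('a)) * (LINT y|lborel. v x * (phi y * K (real R *\<^sub>R (x - y)))))"
    proof (rule Bochner_Integration.integral_cong[OF refl])
      fix x
      have eq: "K (real R *\<^sub>R x + - real R *\<^sub>R y) * (v x * phi (x - inverse (real R) *\<^sub>R (real R *\<^sub>R x + - real R *\<^sub>R y))) =
         v x * (phi y * K (real R *\<^sub>R (x - y)))" for y
        using R by (simp add: algebra_simps)
      have "(LINT z|lborel. K z * (v x * phi (x - inverse (real R) *\<^sub>R z))) =
         of_real (\<bar>- real R\<bar> ^ DIM('a)) * (LINT y|lborel. K (real R *\<^sub>R x + - real R *\<^sub>R y) * (v x * phi (x - inverse (real R) *\<^sub>R (real R *\<^sub>R x + - real R *\<^sub>R y))))"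
        by (rule lint_lborel_affine) (use R in auto)
      then show "(LINT z|lborel. K z * (v x * phi (x - inverse (real R) *\<^sub>R z))) =
         of_real (real R ^ DIM('a)) * (LINT y|lborel. v x * (phi y * K (real R *\<^sub>R (x - y))))"
        unfolding eq by simp
    qed
    also have "\<dots> = of_real (real R ^ DIM('a)) * (LINT x|lborel. LINT y|lborel. v x * (phi y * K (real R *\<^sub>R (x - y))))"
      by simp
    also have "(LINT x|lborel. LINT y|lborel. v x * (phi y * K (real R *\<^sub>R (x - y)))) =
       (LINT y|lborel. LINT x|lborel. v x * (phi y * K (real R *\<^sub>R (x - y))))"
      by (rule lint_swap_lborel[symmetric]) (use f2 in \<open>measurable\<close>)
    also have "\<dots> = (LINT (y::'a)|lborel. 0)"
    proof (rule Bochner_Integration.integral_cong[OF refl])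
      fix y
      have "v x * (phi y * K (real R *\<^sub>R (x - y))) = phi y * (v x * K (real R *\<^sub>R (x - y)))" for x by simp
      then show "(LINT x|lborel. v x * (phi y * K (real R *\<^sub>R (x - y)))) = 0"
        using zero[OF R, of y] by (simp only: integral_mult_right_zero) simp
    qed
    finally show ?thesis by simp
  qed
  have Jlim: "(\<lambda>n. J (inverse (real (Suc n)) *\<^sub>R z)) \<longlonglongrightarrow> J 0" for z :: 'a
  proof -
    \<comment> \<open>Skipping the first m indices makes all translations of length at most 1, so
      that a single cut-off \<open>bump k\<close> dominates the integrands.\<close>
    define m where "m = nat \<lceil>norm z\<rceil>"
    have mz: "norm z \<le> real m" by (simp add: m_def real_nat_ceiling_ge)
    obtain r where r: "\<And>\<xi>. r < norm \<xi> \<Longrightarrow> phi \<xi> = 0" using phi by (auto simp: bsupp_def)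
    obtain A where A: "0 \<le> A" "\<And>x. norm (phi x) \<le> A" using bsupp_bounded[OF phi] by blast
    define k where "k = nat \<lceil>r + 1\<rceil>"
    have bm: "bsupp (\<lambda>x::'a. complex_of_real (bump k x))"
      using bsupp_mult_bump[of "\<lambda>_. 1" k] by simp
    note [measurable] = bsupp_measurable[OF bm]
    have int: "integrable lborel (\<lambda>x. v x * of_real (bump k x))"
      by (rule test_integrable[OF p v fin bm])
    have "(\<lambda>n. LINT x|lborel. v x * phi (x - inverse (real (Suc (n + m))) *\<^sub>R z)) \<longlonglongrightarrow> (LINT x|lborel. v x * phi (x - 0))"
    proof (rule integral_dominated_convergence[where w="\<lambda>x. norm (v x * of_real (bump k x)) * A"])
      show "integrable lborel (\<lambda>x. norm (v x * of_real (bump k x)) * A)" using int by auto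
      show "AE x in lborel. (\<lambda>n. v x * phi (x - inverse (real (Suc (n + m))) *\<^sub>R z)) \<longlonglongrightarrow> v x * phi (x - 0)"
      proof (intro AE_I2 tendsto_mult tendsto_const)
        fix x
        have "(\<lambda>n. inverse (real (Suc n)) *\<^sub>R z) \<longlonglongrightarrow> 0 *\<^sub>R z"
          by (rule tendsto_scaleR[OF LIMSEQ_inverse_real_of_nat tendsto_const])
        then have "(\<lambda>n. x - inverse (real (Suc (n + m))) *\<^sub>R z) \<longlonglongrightarrow> x - 0 *\<^sub>R z"
          by (intro tendsto_diff tendsto_const) (rule LIMSEQ_ignore_initial_segment)
        then show "(\<lambda>n. phi (x - inverse (real (Suc (n + m))) *\<^sub>R z)) \<longlonglongrightarrow> phi (x - 0)"
          using phi by (auto simp: bsupp_def continuous_on_eq_continuous_at intro!: isCont_tendsto_compose[of x phi])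
      qed
      show "AE x in lborel. norm (v x * phi (x - inverse (real (Suc (n + m))) *\<^sub>R z)) \<le> norm (v x * of_real (bump k x)) * A" for n
      proof (intro AE_I2)
        fix x
        have "norm (inverse (real (Suc (n + m))) *\<^sub>R z) \<le> 1"
          using mz by (simp add: field_simps)
        then have "norm x \<le> norm (x - inverse (real (Suc (n + m))) *\<^sub>R z) + 1"
          using norm_triangle_sub[of x "inverse (real (Suc (n + m))) *\<^sub>R z"] by (smt (verit) norm_minus_commute norm_triangle_ineq2)
        then have "norm (phi (x - inverse (real (Suc (n + m))) *\<^sub>R z)) \<le> bump k x * A"
        proof (cases "norm x \<le> real k")
          case True then show ?thesis using A by (simp add: bump_bounds)
        next
          case False
          then have "r + 1 < norm x" unfolding k_def by (smt (verit) real_nat_ceiling_ge)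
          then have "phi (x - inverse (real (Suc (n + m))) *\<^sub>R z) = 0"
            using \<open>norm x \<le> _\<close> by (intro r) linarith
          then show ?thesis using A bump_bounds(1)[of k x] by simp
        qed
        then have "norm (v x) * norm (phi (x - inverse (real (Suc (n + m))) *\<^sub>R z)) \<le> norm (v x) * (bump k x * A)"
          by (rule mult_left_mono) simp
        then show "norm (v x * phi (x - inverse (real (Suc (n + m))) *\<^sub>R z)) \<le> norm (v x * of_real (bump k x)) * A"
          by (simp only: norm_mult norm_of_real abs_of_nonneg[OF bump_bounds(1)] mult.assoc)
      qed
    qed measurable
    then have "(\<lambda>n. J (inverse (real (Suc (n + m))) *\<^sub>R z)) \<longlonglongrightarrow> J 0" by (simp add: J_def)
    then show ?thesis by (rule LIMSEQ_offset)
  qed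
  have "(\<lambda>n. LINT z|lborel. K z * J (inverse (real (Suc n)) *\<^sub>R z)) \<longlonglongrightarrow> (LINT z|lborel. K z * J 0)"
  proof (rule integral_dominated_convergence[where w="\<lambda>z. norm (K z) * D"])
    show "integrable lborel (\<lambda>z. norm (K z) * D)" using K by auto
    show "AE z in lborel. (\<lambda>n. K z * J (inverse (real (Suc n)) *\<^sub>R z)) \<longlonglongrightarrow> K z * J 0"
      by (intro AE_I2 tendsto_mult tendsto_const Jlim)
    show "AE z in lborel. norm (K z * J (inverse (real (Suc n)) *\<^sub>R z)) \<le> norm (K z) * D" for n
      using Jb by (intro AE_I2) (auto simp: norm_mult intro!: mult_left_mono)
  qed measurable
  moreover have "(LINT z|lborel. K z * J (inverse (real (Suc n)) *\<^sub>R z)) = 0" for n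
    by (rule E0) simp
  ultimately have "(LINT z|lborel. K z * J 0) = 0"
    by (simp only: LIMSEQ_const_iff)
  then have "J 0 = 0" using K(2) by simp
  then show "(LINT x|lborel. v x * phi x) = 0" by (simp add: J_def)
qed

section \<open>Convolution of sequences and weights\<close>

text \<open>Sums are taken as integrals over the counting measure: every function is then
  measurable, and interchanging sums with each other or with integrals is an instance of Tonelli's
  theorem.\<close>

abbreviation csum :: "('g \<Rightarrow> ennreal) \<Rightarrow> ennreal" where
  "csum f \<equiv> (\<integral>\<^sup>+k. f k \<partial>count_space UNIV)"

definition sconv :: "('g::{ab_group_add,countable} \<Rightarrow> ennreal) \<Rightarrow> ('g \<Rightarrow> ennreal) \<Rightarrow> 'g \<Rightarrow> ennreal" where
  "sconv f g m = csum (\<lambda>k. f k * g (m - k))"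

lemma csum_reindex: "bij g \<Longrightarrow> csum (\<lambda>k. f (g k)) = csum f"
  by (rule nn_integral_bij_count_space) simp

lemma bij_diff: "bij (\<lambda>k::'g::ab_group_add. m - k)" "bij (\<lambda>k::'g::ab_group_add. k - m)"
  by (rule o_bij[where g="\<lambda>k. m - k"]; auto) (rule o_bij[where g="\<lambda>k. k + m"]; auto)

lemma csum_swap:
  fixes f :: "'g::countable \<Rightarrow> 'h::countable \<Rightarrow> ennreal"
  shows "csum (\<lambda>k. csum (\<lambda>l. f k l)) = csum (\<lambda>l. csum (\<lambda>k. f k l))"
proof -
  interpret pair_sigma_finite "count_space (UNIV::'g set)" "count_space (UNIV::'h set)"
    by (intro pair_sigma_finite.intro sigma_finite_measure_count_space_countable) auto
  show ?thesis
    by (rule Fubini'[symmetric]) (simp add: pair_measure_countable)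
qed

lemma sconv_commute: "sconv f g = sconv g f"
proof
  fix m
  show "sconv f g m = sconv g f m"
    unfolding sconv_def using csum_reindex[OF bij_diff(1)[of m], of "\<lambda>k. f k * g (m - k)"]
    by (simp add: mult.commute)
qed

lemma sconv_left_commute: "sconv f (sconv g h) = sconv g (sconv f h)"
proof
  fix m
  have "sconv f (sconv g h) m = csum (\<lambda>k. csum (\<lambda>l. f k * (g l * h (m - k - l))))"
    by (simp add: sconv_def nn_integral_cmult)
  also have "\<dots> = csum (\<lambda>l. csum (\<lambda>k. f k * (g l * h (m - k - l))))" by (rule csum_swap)
  also have "\<dots> = sconv g (sconv f h) m"
    by (simp add: sconv_def nn_integral_cmult[symmetric] mult.left_commute diff_diff_eq add.commute)
  finally show "sconv f (sconv g h) m = sconv g (sconv f h) m" .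
qed

lemma csum_sconv: "csum (sconv f g) = csum f * csum g"
proof -
  have "csum (sconv f g) = csum (\<lambda>k. csum (\<lambda>m. f k * g (m - k)))"
    unfolding sconv_def by (rule csum_swap)
  also have "\<dots> = csum (\<lambda>k. f k * csum g)"
    using csum_reindex[OF bij_diff(2), of g] by (simp add: nn_integral_cmult)
  finally show ?thesis by (simp add: nn_integral_multc)
qed

lemma sconv_mono: "(\<And>k. f k \<le> f' k) \<Longrightarrow> (\<And>k. g k \<le> g' k) \<Longrightarrow> sconv f g m \<le> sconv f' g' m"
  unfolding sconv_def by (intro nn_integral_mono mult_mono) auto

lemma sconv_add_right: "sconv f (\<lambda>k. g k + h k) m = sconv f g m + sconv f h m"
  by (simp add: sconv_def distrib_left nn_integral_add)

lemma sconv_cmult_right: "sconv f (\<lambda>k. c * g k) m = c * sconv f g m"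
  by (simp add: sconv_def nn_integral_cmult[symmetric] mult.left_commute)

lemma sconv_cmult_left: "sconv (\<lambda>k. c * f k) g m = c * sconv f g m"
  by (simp add: sconv_def nn_integral_cmult[symmetric] mult.assoc)

lemma sconv_csum_right: "sconv f (\<lambda>k. csum (\<lambda>j::'j::countable. g j k)) m = csum (\<lambda>j. sconv f (g j) m)"
proof -
  have "sconv f (\<lambda>k. csum (\<lambda>j. g j k)) m = csum (\<lambda>k. csum (\<lambda>j. f k * g j (m - k)))"
    by (simp add: sconv_def nn_integral_cmult)
  also have "\<dots> = csum (\<lambda>j. csum (\<lambda>k. f k * g j (m - k)))" by (rule csum_swap)
  finally show ?thesis by (simp add: sconv_def)
qed

lemma csum_pow_fact:
  assumes "0 \<le> r" shows "csum (\<lambda>j::nat. ennreal (r ^ j / fact j)) = ennreal (exp r)"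
proof -
  have eq: "r ^ j /\<^sub>R fact j = r ^ j / fact j" for j by (simp add: divide_inverse mult.commute)
  have "(\<lambda>j. r ^ j / fact j) sums exp r" using exp_converges[of r] by (simp only: eq)
  then show ?thesis
    unfolding nn_integral_count_space_nat using assms by (intro suminf_ennreal_eq) auto
qed

lemma csum_inverse_fact_weighted: "csum (\<lambda>j::nat. ennreal (real j / fact j)) = ennreal (exp 1)"
proof -
  have eq: "1 ^ j /\<^sub>R fact j = real (Suc j) / fact (Suc j)" for j
    by (simp add: divide_inverse)
  have "(\<lambda>j. real (Suc j) / fact (Suc j)) sums exp 1"
    using exp_converges[of "1::real"] by (simp only: eq)
  then have "(\<lambda>j. real j / fact j) sums (exp 1 + real 0 / fact 0)" by (rule sums_Suc)
  then have "(\<lambda>j. real j / fact j) sums exp 1" by simp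
  then show ?thesis
    unfolding nn_integral_count_space_nat by (intro suminf_ennreal_eq) auto
qed

fun iter_conv :: "('g::{ab_group_add,countable} \<Rightarrow> ennreal) \<Rightarrow> ('g \<Rightarrow> ennreal) \<Rightarrow> nat \<Rightarrow> 'g \<Rightarrow> ennreal" where
  "iter_conv b d 0 = d"
| "iter_conv b d (Suc j) = sconv b (iter_conv b d j)"

text \<open>By \<open>W_add\<close> one of two summands enters only with the factor \<beta>. The
  gain shows when \<beta> < 1: coefficients whose products with exp W are merely bounded become
  summable against exp (\<beta> W).\<close>

locale seq_weight =
  fixes W :: "'g::{ab_group_add,countable} \<Rightarrow> real" and \<beta> C0 :: real
  assumes W_nonneg: "0 \<le> W k" and beta: "0 \<le> \<beta>" "\<beta> \<le> 1" and C0: "0 \<le> C0"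
    and W_add: "W (k + l) \<le> max (W k + \<beta> * W l) (W l + \<beta> * W k) + C0"
begin

lemma W_subadd: "W (k + l) \<le> W k + W l + C0"
proof -
  have "\<beta> * W l \<le> W l" "\<beta> * W k \<le> W k"
    using beta W_nonneg by (auto intro: mult_left_le_one_le)
  then show ?thesis using W_add[of k l] by linarith
qed

lemma exp_W_add:
  "ennreal (exp (W (k + l))) \<le> ennreal (exp C0) *
     (ennreal (exp (W k)) * ennreal (exp (\<beta> * W l)) + ennreal (exp (\<beta> * W k)) * ennreal (exp (W l)))"
proof -
  have "exp (W (k + l)) \<le> exp C0 * (exp (W k) * exp (\<beta> * W l) + exp (\<beta> * W k) * exp (W l))"
  proof (cases "W (k + l) \<le> W k + \<beta> * W l + C0")
    case True
    then have "exp (W (k + l)) \<le> exp C0 * (exp (W k) * exp (\<beta> * W l))"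
      by (simp add: exp_add[symmetric] algebra_simps)
    then show ?thesis by (simp add: distrib_left) (smt (verit) exp_gt_zero mult_pos_pos)
  next
    case False
    then have "exp (W (k + l)) \<le> exp C0 * (exp (\<beta> * W k) * exp (W l))"
      using W_add[of k l] by (simp add: exp_add[symmetric] algebra_simps max_def split: if_splits)
    then show ?thesis by (simp add: distrib_left) (smt (verit) exp_gt_zero mult_pos_pos)
  qed
  then have "ennreal (exp (W (k + l))) \<le> ennreal (exp C0 * (exp (W k) * exp (\<beta> * W l) + exp (\<beta> * W k) * exp (W l)))"
    by (rule ennreal_leI)
  then show ?thesis by (simp add: ennreal_mult)
qed

lemma exp_beta_W_add:
  "ennreal (exp (\<beta> * W (k + l))) \<le> ennreal (exp C0) * (ennreal (exp (\<beta> * W k)) * ennreal (exp (\<beta> * W l)))"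
proof -
  have "\<beta> * W (k + l) \<le> \<beta> * (W k + W l) + \<beta> * C0"
    using mult_left_mono[OF W_subadd[of k l] beta(1)] by (simp add: algebra_simps)
  also have "\<beta> * C0 \<le> C0" using beta C0 by (intro mult_left_le_one_le) auto
  finally have "exp (\<beta> * W (k + l)) \<le> exp C0 * (exp (\<beta> * W k) * exp (\<beta> * W l))"
    by (simp add: exp_add[symmetric] algebra_simps)
  then have "ennreal (exp (\<beta> * W (k + l))) \<le> ennreal (exp C0 * (exp (\<beta> * W k) * exp (\<beta> * W l)))"
    by (rule ennreal_leI)
  then show ?thesis by (simp add: ennreal_mult)
qed

text \<open>The products in which all j factors b enter with damped weight and the remaining full
  weight rests on d.\<close>

definition bound_main :: "('g \<Rightarrow> ennreal) \<Rightarrow> ('g \<Rightarrow> ennreal) \<Rightarrow> nat \<Rightarrow> 'g \<Rightarrow> ennreal" where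
  "bound_main b d = iter_conv (\<lambda>k. ennreal (exp C0) * (b k * ennreal (exp (\<beta> * W k))))
     (\<lambda>k. ennreal (exp C0) * (ennreal (exp (W k)) * d k))"

text \<open>The products in which one factor b carries the full weight; it has been taken out as the
  sequence A, hence the value 0 when there are no factors. The first summand arises when the newest
  factor is the one taken out, the second when it is one of the others.\<close>

fun bound_rest :: "('g \<Rightarrow> ennreal) \<Rightarrow> ('g \<Rightarrow> ennreal) \<Rightarrow> ennreal \<Rightarrow> nat \<Rightarrow> 'g \<Rightarrow> ennreal" where
  "bound_rest b d C 0 = (\<lambda>k. 0)"
| "bound_rest b d C (Suc j) = (\<lambda>z. C * bound_main b d j z +
     sconv (\<lambda>k. ennreal (exp C0) * (b k * ennreal (exp (\<beta> * W k)))) (bound_rest b d C j) z)"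

text \<open>In a product the weight of the largest frequency enters fully, all others only with the factor \<open>\<beta>\<close>.
  The term with \<open>bound_main\<close> keeps the frequency \<open>k\<close> as the largest one, the other term
  passes this role to a factor of \<open>A\<close>.\<close>

lemma iter_conv_weight:
  assumes b: "\<And>k. ennreal (exp C0) * (b k * ennreal (exp (W k))) \<le> C * A k"
  shows "ennreal (exp (W (k + z))) * iter_conv b d j z \<le>
     ennreal (exp (W k)) * bound_main b d j z + ennreal (exp (\<beta> * W k)) * sconv A (bound_rest b d C j) z"
proof (induction j arbitrary: k z)
  case 0
  have "ennreal (exp (W (k + z))) \<le> ennreal (exp (W k)) * (ennreal (exp C0) * ennreal (exp (W z)))"
  proof -
    have "exp (W (k + z)) \<le> exp (W k) * (exp C0 * exp (W z))"
      using W_subadd[of k z] by (simp add: exp_add[symmetric] algebra_simps)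
    then have "ennreal (exp (W (k + z))) \<le> ennreal (exp (W k) * (exp C0 * exp (W z)))" by (rule ennreal_leI)
    then show ?thesis by (simp add: ennreal_mult)
  qed
  then have "ennreal (exp (W (k + z))) * d z \<le> ennreal (exp (W k)) * (ennreal (exp C0) * ennreal (exp (W z))) * d z"
    by (rule mult_right_mono) simp
  then show ?case by (simp add: bound_main_def mult.assoc sconv_def)
next
  case (Suc j)
  let ?e = "\<lambda>x. ennreal (exp x)"
  let ?E = "\<lambda>k. ?e C0 * (b k * ?e (\<beta> * W k))"
  have "?e (W (k + z)) * iter_conv b d (Suc j) z = csum (\<lambda>l. b l * (?e (W ((k + l) + (z - l))) * iter_conv b d j (z - l)))"
    by (simp add: sconv_def nn_integral_cmult[symmetric] mult.left_commute)
  \<comment> \<open>The induction hypothesis is used with k + l in place of k: the frequency of the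
    newest factor joins the outer one, and \<open>exp_W_add\<close> afterwards separates the cases
    of which of the two keeps the full weight.\<close>
  also have "\<dots> \<le> csum (\<lambda>l. b l * (?e (W (k + l)) * bound_main b d j (z - l) +
        ?e (\<beta> * W (k + l)) * sconv A (bound_rest b d C j) (z - l)))"
    by (intro nn_integral_mono mult_left_mono Suc.IH) auto
  also have "\<dots> \<le> csum (\<lambda>l. b l * (?e C0 * (?e (W k) * ?e (\<beta> * W l) + ?e (\<beta> * W k) * ?e (W l)) * bound_main b d j (z - l) +
        ?e C0 * (?e (\<beta> * W k) * ?e (\<beta> * W l)) * sconv A (bound_rest b d C j) (z - l)))"
    by (intro nn_integral_mono mult_left_mono add_mono mult_right_mono exp_W_add exp_beta_W_add) auto
  also have "\<dots> = csum (\<lambda>l. ?e (W k) * (?E l * bound_main b d j (z - l)) +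
       (?e (\<beta> * W k) * (?e C0 * (b l * ?e (W l)) * bound_main b d j (z - l)) +
        ?e (\<beta> * W k) * (?E l * sconv A (bound_rest b d C j) (z - l))))"
    by (simp add: distrib_left distrib_right mult_ac add_ac)
  also have "\<dots> = ?e (W k) * sconv ?E (bound_main b d j) z +
       (?e (\<beta> * W k) * sconv (\<lambda>l. ?e C0 * (b l * ?e (W l))) (bound_main b d j) z +
        ?e (\<beta> * W k) * sconv ?E (sconv A (bound_rest b d C j)) z)"
    by (simp add: nn_integral_add nn_integral_cmult sconv_def)
  also have "\<dots> \<le> ?e (W k) * sconv ?E (bound_main b d j) z +
       (?e (\<beta> * W k) * sconv (\<lambda>l. C * A l) (bound_main b d j) z +
        ?e (\<beta> * W k) * sconv ?E (sconv A (bound_rest b d C j)) z)"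
    by (intro add_mono mult_left_mono sconv_mono b) auto
  also have "\<dots> = ?e (W k) * bound_main b d (Suc j) z + ?e (\<beta> * W k) * sconv A (bound_rest b d C (Suc j)) z"
    by (simp add: bound_main_def sconv_add_right sconv_cmult_left sconv_cmult_right
        sconv_left_commute[of A] distrib_left)
  finally show ?case .
qed

lemma csum_bound_main:
  assumes "csum (\<lambda>k. ennreal (exp C0) * (b k * ennreal (exp (\<beta> * W k)))) \<le> \<epsilon>"
  shows "csum (bound_main b d j) \<le> \<epsilon> ^ j * csum (\<lambda>k. ennreal (exp C0) * (ennreal (exp (W k)) * d k))"
proof (induction j)
  case (Suc j)
  have "csum (bound_main b d (Suc j)) = csum (\<lambda>k. ennreal (exp C0) * (b k * ennreal (exp (\<beta> * W k)))) * csum (bound_main b d j)"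
    by (simp add: bound_main_def csum_sconv)
  also have "\<dots> \<le> \<epsilon> * (\<epsilon> ^ j * csum (\<lambda>k. ennreal (exp C0) * (ennreal (exp (W k)) * d k)))"
    by (intro mult_mono assms Suc) auto
  finally show ?case by (simp add: mult.assoc)
qed (simp add: bound_main_def)

text \<open>One of j + 1 factors has been taken out, so j damped factors remain, each of sum at most
  \<epsilon>; the multiplicity j + 1 counts the possible positions of the missing one.\<close>

lemma csum_bound_rest:
  assumes "csum (\<lambda>k. ennreal (exp C0) * (b k * ennreal (exp (\<beta> * W k)))) \<le> \<epsilon>"
  shows "csum (bound_rest b d C (Suc j)) \<le>
    of_nat (Suc j) * (C * (\<epsilon> ^ j * csum (\<lambda>k. ennreal (exp C0) * (ennreal (exp (W k)) * d k))))"
proof (induction j)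
  case 0
  then show ?case using csum_bound_main[OF assms, of d 0]
    by (simp add: nn_integral_cmult sconv_def mult_left_mono)
next
  case (Suc j)
  define T where "T = csum (\<lambda>k. ennreal (exp C0) * (ennreal (exp (W k)) * d k))"
  have "csum (bound_rest b d C (Suc (Suc j))) = C * csum (bound_main b d (Suc j)) +
     csum (\<lambda>k. ennreal (exp C0) * (b k * ennreal (exp (\<beta> * W k)))) * csum (bound_rest b d C (Suc j))"
    by (simp add: nn_integral_add nn_integral_cmult csum_sconv del: bound_rest.simps(2))
       (simp add: nn_integral_add nn_integral_cmult csum_sconv)
  also have "\<dots> \<le> C * (\<epsilon> ^ Suc j * T) + \<epsilon> * (of_nat (Suc j) * (C * (\<epsilon> ^ j * T)))"
    unfolding T_def by (intro add_mono mult_mono mult_left_mono assms Suc csum_bound_main[OF assms]) auto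
  also have "\<epsilon> * (of_nat (Suc j) * (C * (\<epsilon> ^ j * T))) = of_nat (Suc j) * (C * (\<epsilon> ^ Suc j * T))"
    by (simp add: mult_ac del: of_nat_Suc)
  also have "C * (\<epsilon> ^ Suc j * T) + of_nat (Suc j) * (C * (\<epsilon> ^ Suc j * T)) = of_nat (Suc (Suc j)) * (C * (\<epsilon> ^ Suc j * T))"
    by (simp only: of_nat_Suc[of "Suc j"] distrib_right mult_1_left)
  finally show ?case unfolding T_def .
qed

text \<open>Since the damped sums are at most 1/r, the powers of r cancel: the j-th term of the
  exponential series contributes 1 / fact j. The terms with a factor taken out contribute j / fact j
  times C r, as one damped factor is missing there. Both series have the sum
  \<open>exp 1\<close>.\<close>

lemma weighted_exponential_series:
  assumes b: "\<And>k. ennreal (exp C0) * (b k * ennreal (exp (W k))) \<le> ennreal C * A k"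
    and r: "0 < r" and C: "0 \<le> C"
    and eps: "csum (\<lambda>k. ennreal (exp C0) * (b k * ennreal (exp (\<beta> * W k)))) \<le> ennreal (1 / r)"
    and a: "\<And>k. a k * ennreal (exp (W k)) \<le> A k"
  obtains c where "\<And>m. ennreal (exp (W m)) * sconv a (\<lambda>z. csum (\<lambda>j. ennreal (r ^ j / fact j) * iter_conv b d j z)) m \<le> sconv A c m"
    "csum c \<le> csum (\<lambda>k. ennreal (exp C0) * (ennreal (exp (W k)) * d k)) *
       (ennreal (exp 1) * (1 + ennreal (C * r) * csum (\<lambda>k. a k * ennreal (exp (\<beta> * W k)))))"
proof -
  let ?e = "\<lambda>x. ennreal (exp x)"
  define T where "T = csum (\<lambda>k. ?e C0 * (?e (W k) * d k))"
  define E where "E k = a k * ?e (\<beta> * W k)" for k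
  \<comment> \<open>The sequence a enters in two ways: with its full weight, bounded by A, against
    \<open>bound_main\<close>; or damped as E, and then A comes out of one of the factors b.\<close>
  define c where "c = (\<lambda>z. csum (\<lambda>j. ennreal (r ^ j / fact j) * (bound_main b d j z + sconv E (bound_rest b d (ennreal C) j) z)))"
  have 1: "?e (W m) * sconv a (\<lambda>z. csum (\<lambda>j. ennreal (r ^ j / fact j) * iter_conv b d j z)) m \<le> sconv A c m" for m
  proof -
    have j: "?e (W m) * sconv a (iter_conv b d j) m \<le> sconv A (\<lambda>z. bound_main b d j z + sconv E (bound_rest b d (ennreal C) j) z) m" for j
    proof -
      have "?e (W m) * sconv a (iter_conv b d j) m = csum (\<lambda>k. a k * (?e (W (k + (m - k))) * iter_conv b d j (m - k)))"
        by (simp add: sconv_def nn_integral_cmult[symmetric] mult.left_commute)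
      also have "\<dots> \<le> csum (\<lambda>k. a k * (?e (W k) * bound_main b d j (m - k) + ?e (\<beta> * W k) * sconv A (bound_rest b d (ennreal C) j) (m - k)))"
        by (intro nn_integral_mono mult_left_mono iter_conv_weight b) auto
      also have "\<dots> = csum (\<lambda>k. (a k * ?e (W k)) * bound_main b d j (m - k)) + sconv E (sconv A (bound_rest b d (ennreal C) j)) m"
        by (simp add: distrib_left nn_integral_add sconv_def E_def mult.assoc)
      also have "\<dots> \<le> sconv A (bound_main b d j) m + sconv E (sconv A (bound_rest b d (ennreal C) j)) m"
        unfolding sconv_def[of A "bound_main b d j"] by (intro add_mono nn_integral_mono mult_right_mono a) auto
      finally show ?thesis by (simp add: sconv_add_right sconv_left_commute[of E])
    qed
    have "?e (W m) * sconv a (\<lambda>z. csum (\<lambda>j. ennreal (r ^ j / fact j) * iter_conv b d j z)) m =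
      csum (\<lambda>j. ennreal (r ^ j / fact j) * (?e (W m) * sconv a (iter_conv b d j) m))"
      by (simp add: sconv_csum_right sconv_cmult_right nn_integral_cmult[symmetric] mult.left_commute)
    also have "\<dots> \<le> csum (\<lambda>j. ennreal (r ^ j / fact j) * sconv A (\<lambda>z. bound_main b d j z + sconv E (bound_rest b d (ennreal C) j) z) m)"
      by (intro nn_integral_mono mult_left_mono j) auto
    also have "\<dots> = sconv A c m"
      by (simp add: c_def sconv_csum_right sconv_cmult_right)
    finally show ?thesis .
  qed
  have b1: "csum (bound_main b d j) \<le> ennreal ((1/r) ^ j) * T" for j
    using csum_bound_main[OF eps, of d j] r by (simp add: T_def ennreal_power)
  have b2: "csum (bound_rest b d (ennreal C) j) \<le> ennreal (real j * (C * r * (1/r) ^ j)) * T" for j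
  proof (cases j)
    case (Suc i)
    have "csum (bound_rest b d (ennreal C) j) \<le> of_nat (Suc i) * (ennreal C * (ennreal (1/r) ^ i * T))"
      unfolding Suc T_def by (rule csum_bound_rest[OF eps])
    also have "\<dots> = ennreal (real (Suc i) * (C * (1/r) ^ i)) * T"
      using r C by (simp add: ennreal_power ennreal_mult ennreal_of_nat_eq_real_of_nat mult.assoc del: of_nat_Suc)
    also have "C * (1/r) ^ i = C * r * (1/r) ^ j" using r by (simp add: Suc)
    finally show ?thesis unfolding Suc by simp
  qed simp
  have "csum c = csum (\<lambda>j. csum (\<lambda>z. ennreal (r ^ j / fact j) * (bound_main b d j z + sconv E (bound_rest b d (ennreal C) j) z)))"
    unfolding c_def by (rule csum_swap)
  also have "\<dots> = csum (\<lambda>j. ennreal (r ^ j / fact j) * (csum (bound_main b d j) + csum E * csum (bound_rest b d (ennreal C) j)))"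
    by (simp add: nn_integral_cmult nn_integral_add csum_sconv)
  also have "\<dots> \<le> csum (\<lambda>j. ennreal (r ^ j / fact j) * (ennreal ((1/r) ^ j) * T + csum E * (ennreal (real j * (C * r * (1/r) ^ j)) * T)))"
    by (intro nn_integral_mono mult_left_mono add_mono b1 b2) auto
  also have "\<dots> = csum (\<lambda>j. ennreal (1 ^ j / fact j) * T + ennreal (real j / fact j) * (csum E * (ennreal (C * r) * T)))"
  proof (rule nn_integral_cong)
    fix j :: nat
    have alg: "x * (y * T + e * (z * T)) = (x * y) * T + (x * z) * (e * T)" for x y e z :: ennreal
      by (simp add: distrib_left mult_ac)
    have "r ^ j / fact j * (1/r) ^ j = 1 ^ j / fact j" using r by (simp add: power_one_over)
    moreover have "ennreal (r ^ j / fact j) * ennreal ((1/r) ^ j) = ennreal (r ^ j / fact j * (1/r) ^ j)"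
      using r by (intro ennreal_mult[symmetric]) auto
    ultimately have 1: "ennreal (r ^ j / fact j) * ennreal ((1/r) ^ j) = ennreal (1 ^ j / fact j)" by (simp only:)
    have "r ^ j / fact j * (real j * (C * r * (1/r) ^ j)) = real j / fact j * (C * r)"
      using r by (simp add: power_one_over)
    moreover have "ennreal (r ^ j / fact j) * ennreal (real j * (C * r * (1/r) ^ j)) = ennreal (r ^ j / fact j * (real j * (C * r * (1/r) ^ j)))"
      using r C by (intro ennreal_mult[symmetric]) auto
    moreover have "ennreal (real j / fact j) * ennreal (C * r) = ennreal (real j / fact j * (C * r))"
      using r C by (intro ennreal_mult[symmetric]) auto
    ultimately have 2: "ennreal (r ^ j / fact j) * ennreal (real j * (C * r * (1/r) ^ j)) = ennreal (real j / fact j) * ennreal (C * r)"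
      by (simp only:)
    show "ennreal (r ^ j / fact j) * (ennreal ((1/r) ^ j) * T + csum E * (ennreal (real j * (C * r * (1/r) ^ j)) * T)) =
      ennreal (1 ^ j / fact j) * T + ennreal (real j / fact j) * (csum E * (ennreal (C * r) * T))"
      unfolding alg 1 2 by (simp only: mult_ac)
  qed
  also have "\<dots> = ennreal (exp 1) * T + ennreal (exp 1) * (csum E * (ennreal (C * r) * T))"
    by (simp only: nn_integral_add[OF borel_measurable_count_space borel_measurable_count_space]
         nn_integral_multc[OF borel_measurable_count_space] csum_pow_fact[OF zero_le_one] csum_inverse_fact_weighted)
  also have "\<dots> = T * (ennreal (exp 1) * (1 + ennreal (C * r) * csum E))"
    by (simp add: distrib_left mult_ac)
  finally show ?thesis using 1 unfolding T_def E_def by (intro that[of c]) auto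
qed

end

section \<open>Uniform decompositions\<close>

lemma real_vec_simps: "real_vec (k + l) = real_vec k + real_vec l" "real_vec (k - l) = real_vec k - real_vec l" "real_vec 0 = 0"
  by (simp_all add: real_vec_def vec_eq_iff)

lemma finite_lattice_ball: "finite {m. norm (real_vec m) \<le> r}"
proof -
  define c where "c = \<lceil>r\<rceil>"
  have "m \<in> vec_lambda ` (UNIV \<rightarrow>\<^sub>E {-c..c})" if "norm (real_vec m) \<le> r" for m :: "int^'n"
  proof -
    have "m $ i \<in> {-c..c}" for i
    proof -
      have "\<bar>real_of_int (m $ i)\<bar> \<le> r"
        using component_le_norm_cart[of "real_vec m" i] that by (simp add: real_vec_def)
      then show ?thesis unfolding c_def by (simp add: abs_le_iff) linarith
    qed
    then show ?thesis by (intro image_eqI[of _ _ "vec_nth m"]) auto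
  qed
  then have "{m :: int^'n. norm (real_vec m) \<le> r} \<subseteq> vec_lambda ` (UNIV \<rightarrow>\<^sub>E {-c..c})" by auto
  then show ?thesis by (rule finite_subset) (intro finite_imageI finite_PiE; simp)
qed

lemma conv_op_zero_symbol: "(\<And>\<xi>. b \<xi> = 0) \<Longrightarrow> conv_op b f y = 0"
  by (simp add: conv_op_def ker_def)

lemma conv_op_countable:
  fixes g :: "'k \<Rightarrow> 'a::euclidean_space \<Rightarrow> complex"
  assumes p: "1 < p" and a: "wsym a" and A: "countable A"
    and g: "\<And>k. k \<in> A \<Longrightarrow> g k \<in> borel_measurable borel"
    and fin: "(\<integral>\<^sup>+k. cN p (g k) \<partial>count_space A) < \<infinity>"
    and X: "X \<in> borel_measurable borel" and eq: "AE x in lborel. X x = (LINT k|count_space A. g k x)"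
  shows conv_op_countable_eq: "conv_op a X y = (LINT k|count_space A. conv_op a (g k) y)"
    and cN_conv_op_countable: "cN p (conv_op a X) \<le> (\<integral>\<^sup>+k. cN p (conv_op a (g k)) \<partial>count_space A)"
proof -
  have m: "(\<lambda>(k, x). g k x) \<in> borel_measurable (count_space A \<Otimes>\<^sub>M lborel)"
    using g by (intro measurable_pair_measure_countable1[OF A]) auto
  note * = p a sigma_finite_measure_count_space_countable[OF A] m fin X eq
  show "conv_op a X y = (LINT k|count_space A. conv_op a (g k) y)" by (rule conv_op_param_eq[OF *])
  show "cN p (conv_op a X) \<le> (\<integral>\<^sup>+k. cN p (conv_op a (g k)) \<partial>count_space A)" by (rule cN_conv_op_param[OF *])
qed

lemma borel_measurable_count_space_integral:
  fixes g :: "'k \<Rightarrow> 'a::euclidean_space \<Rightarrow> complex"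
  assumes A: "countable A" and g: "\<And>k. k \<in> A \<Longrightarrow> g k \<in> borel_measurable borel"
  shows "(\<lambda>x. LINT k|count_space A. g k x) \<in> borel_measurable borel"
proof -
  interpret sigma_finite_measure "count_space A" by (rule sigma_finite_measure_count_space_countable[OF A])
  have m: "(\<lambda>(k, x). g k x) \<in> borel_measurable (count_space A \<Otimes>\<^sub>M borel)"
    using g by (intro measurable_pair_measure_countable1[OF A]) auto
  show ?thesis
    by (rule borel_measurable_lebesgue_integral) (use measurable_pair_swap[OF m] in simp)
qed

lemma exp_count_space_integral:
  fixes z :: complex
  shows "(LINT l|count_space UNIV. z ^ l / fact l) = exp z"
proof -
  have eq: "z ^ l /\<^sub>R fact l = z ^ l / fact l" for l
    by (simp add: scaleR_conv_of_real divide_inverse mult.commute)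
  have "summable (\<lambda>l. norm (z ^ l / fact l))" using summable_norm_exp[of z] by (simp only: eq)
  then have i: "integrable (count_space UNIV) (\<lambda>l. z ^ l / fact l)" by (simp add: integrable_count_space_nat_iff)
  have "(\<lambda>l. z ^ l / fact l) sums exp z" using exp_converges[of z] by (simp only: eq)
  then show ?thesis using integral_count_space_nat[OF i] by (simp add: sums_iff)
qed

text \<open>The partition of unity is stated through finite sums over any set containing the
  relevant lattice points, so that the set can be adapted: to a neighbourhood of 0 for
  \<open>fat\<close>, to the support of a dilated symbol for the decomposition of u.\<close>

locale uniform_decomp =
  fixes sig :: "real^'n \<Rightarrow> real" and S :: real
  assumes sig_wsym: "wsym (\<lambda>\<xi>. complex_of_real (sig \<xi>))"
    and sig_nonneg: "\<And>\<xi>. 0 \<le> sig \<xi>" and sig_pos: "0 < sig 0"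
    and sig_supp: "\<And>\<xi>. S < norm \<xi> \<Longrightarrow> sig \<xi> = 0" and S1: "1 \<le> S"
    and sig_part: "\<And>M \<xi>. finite M \<Longrightarrow> {m. norm (\<xi> - real_vec m) \<le> S} \<subseteq> M \<Longrightarrow> (\<Sum>m\<in>M. sig (\<xi> - real_vec m)) = 1"

sublocale uniform_decomp \<subseteq> wiener_base "\<lambda>\<xi>. complex_of_real (sig \<xi>)" sig
  by standard (use sig_wsym sig_nonneg sig_pos in auto)

context uniform_decomp
begin

definition sg :: "int^'n \<Rightarrow> real^'n \<Rightarrow> complex" where
  "sg k \<xi> = of_real (sig (\<xi> - real_vec k))"

text \<open>The sum of the neighbours of \<open>sg k\<close>, equal to 1 on its support: supports of
  radius S can overlap only if the indices differ by at most 2 S. Its multiplier therefore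
  reproduces the pieces, and its own support has radius 3 S.\<close>

definition fat :: "int^'n \<Rightarrow> real^'n \<Rightarrow> complex" where
  "fat k \<xi> = (\<Sum>m\<in>{m. norm (real_vec m) \<le> 2 * S}. sg m (\<xi> - real_vec k))"

text \<open>Division by \<open>kap\<close> undoes the missing normalisation of
  \<open>conv_op\<close>, so that the pieces add up to u itself.\<close>

definition piece :: "(real^'n \<Rightarrow> complex) \<Rightarrow> int^'n \<Rightarrow> real^'n \<Rightarrow> complex" where
  "piece u k y = conv_op (sg k) u y / kap"

definition Cb :: "real \<Rightarrow> ennreal" where
  "Cb p = kC p (fat 0) * ennreal (inverse (norm kap))"

lemma wsym_sg: "wsym (sg k)"
  unfolding sg_def using wsym_translate[OF sig_wsym] .

lemma fat_translate: "fat k = (\<lambda>\<xi>. fat 0 (\<xi> - real_vec k))"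
  by (simp add: fat_def fun_eq_iff real_vec_simps)

lemma wsym_fat: "wsym (fat k)"
proof -
  have "wsym (fat 0)" unfolding fat_def using finite_lattice_ball
    by (intro wsym_sum) (auto simp: real_vec_simps wsym_sg)
  then show ?thesis unfolding fat_translate[of k] by (rule wsym_translate)
qed

lemma Cb_finite: "Cb p < \<infinity>"
  using kC_finite[OF wsym_fat[of 0]] by (simp add: Cb_def ennreal_mult_less_top)

lemma kC_fat: "kC p (fat k) * ennreal (inverse (norm kap)) = Cb p"
  unfolding fat_translate[of k] Cb_def kC_translate[OF wsym_bsupp[OF wsym_fat]] ..

lemma kI_sg: "kI (sg k) = kI (\<lambda>\<xi>. complex_of_real (sig \<xi>))"
  unfolding sg_def by (rule kI_translate[OF wsym_bsupp[OF sig_wsym]])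

lemma sg_zero: "S < norm (\<xi> - real_vec k) \<Longrightarrow> sg k \<xi> = 0"
  by (simp add: sg_def sig_supp)

lemma fat_zero: assumes "\<xi> \<notin> cball (real_vec k) (3 * S)" shows "fat k \<xi> = 0"
  unfolding fat_def
proof (intro sum.neutral ballI sg_zero)
  fix m :: "int^'n" assume "m \<in> {m. norm (real_vec m) \<le> 2 * S}"
  moreover have "3 * S < norm (\<xi> - real_vec k)" using assms by (simp add: dist_norm norm_minus_commute)
  ultimately show "S < norm (\<xi> - real_vec k - real_vec m)"
    using norm_triangle_ineq2[of "\<xi> - real_vec k" "real_vec m"] by simp
qed

lemma fat_sg: "fat k \<xi> * sg k \<xi> = sg k \<xi>"
proof (cases "S < norm (\<xi> - real_vec k)")
  case False
  have "(\<Sum>m\<in>{m. norm (real_vec m) \<le> 2 * S}. sig ((\<xi> - real_vec k) - real_vec m)) = 1"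
  proof (rule sig_part[OF finite_lattice_ball])
    show "{m. norm (\<xi> - real_vec k - real_vec m) \<le> S} \<subseteq> {m. norm (real_vec m) \<le> 2 * S}"
      using False norm_triangle_ineq2[of "real_vec _" "\<xi> - real_vec k"] norm_minus_commute[of _ "\<xi> - real_vec k"] by (smt (verit) Collect_mono)
  qed
  then have "fat k \<xi> = 1" by (simp add: fat_def sg_def flip: of_real_sum)
  then show ?thesis by simp
qed (simp add: sg_zero)

end

text \<open>Summability of the pieces is the form in which membership in a modulation space is used
  for every q alike; it follows there from the summability of exp (- w) over the lattice.\<close>

locale decomp_fun = uniform_decomp sig S for sig :: "real^'n \<Rightarrow> real" and S +
  fixes p :: real and u :: "real^'n \<Rightarrow> complex"
  assumes p: "1 < p" and u [measurable]: "u \<in> borel_measurable borel" and u_fin: "cN p u < \<infinity>"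
    and a_fin: "csum (\<lambda>k. cN p (piece u k)) < \<infinity>"
begin

definition a :: "int^'n \<Rightarrow> ennreal" where "a k = cN p (piece u k)"

abbreviation "V \<equiv> piece u"
abbreviation "K1 \<equiv> kI (\<lambda>\<xi>. complex_of_real (sig \<xi>))"

lemma K1_finite: "K1 < \<infinity>" by (rule kI_finite[OF sig_wsym])

lemma V_meas [measurable]: "V k \<in> borel_measurable borel"
  unfolding piece_def[abs_def] using conv_op_measurable[OF wsym_sg u] by measurable

lemma a_le: "a k \<le> csum a"
  by (rule nn_integral_ge_point) simp

lemma csum_a_finite: "csum a < \<infinity>"
  using a_fin by (simp add: a_def[abs_def])

lemma a_finite: "a k < \<infinity>"
  using a_le csum_a_finite by (rule le_less_trans)

lemma conv_V: "wsym b \<Longrightarrow> conv_op b (V k) y = conv_op (\<lambda>\<xi>. b \<xi> * sg k \<xi>) u y"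
proof -
  assume b: "wsym b"
  have "conv_op b (V k) y = inverse kap * conv_op b (conv_op (sg k) u) y"
    unfolding piece_def[abs_def] by (subst conv_op_cmult[symmetric]) (simp add: divide_inverse mult.commute)
  then show ?thesis using conv_op_comp[OF p b wsym_sg u u_fin] kap_nonzero by simp
qed

lemma V_rep: "conv_op (fat k) (V k) y = kap * V k y"
  using kap_nonzero by (simp add: conv_V[OF wsym_fat] fat_sg piece_def)

lemma V_spec: "spec p (real_vec k) S (V k)"
  unfolding spec_def
proof (intro conjI allI impI)
  show "cN p (V k) < \<infinity>" using a_finite by (simp add: a_def)
  fix b y assume b: "wsym b" "\<forall>\<xi>\<in>cball (real_vec k) S. b \<xi> = 0"
  have "b \<xi> * sg k \<xi> = 0" for \<xi>
    using b(2) sg_zero[of \<xi> k] by (cases "\<xi> \<in> cball (real_vec k) S") (auto simp: dist_norm norm_minus_commute not_le)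
  then show "conv_op b (V k) y = 0" by (simp add: conv_V[OF b(1)] conv_op_zero_symbol)
qed measurable

lemma V_bound: "ennreal (norm (V k y)) \<le> a k * Cb p"
proof -
  have "ennreal (norm (V k y)) = ennreal (norm (conv_op (fat k) (V k) y)) * ennreal (inverse (norm kap))"
    using kap_nonzero by (simp add: V_rep norm_mult flip: ennreal_mult)
  also have "\<dots> \<le> (cN p (V k) * kC p (fat k)) * ennreal (inverse (norm kap))"
    by (intro mult_right_mono norm_conv_op_le[OF p wsym_fat]) auto
  finally show ?thesis by (simp add: a_def kC_fat mult.assoc)
qed

text \<open>The radius grows by that of \<open>fat k\<close>, which reproduces the new factor;
  Bernstein's inequality turns the L^p norm of that factor into a bound for its values.\<close>

lemma spec_step:
  assumes "spec p c L F"
  shows "spec p (c + real_vec k) (L + 3 * S) (\<lambda>x. F x * V k x)" "cN p (\<lambda>x. F x * V k x) \<le> cN p F * (a k * Cb p)"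
  using spec_mult[OF p assms wsym_fat fat_zero V_meas a_finite[unfolded a_def] V_rep]
  by (auto simp: a_def kC_fat mult.assoc)

lemma V_csum_bound: "(\<integral>\<^sup>+k. ennreal (norm (V k x)) \<partial>count_space A) \<le> (\<integral>\<^sup>+k. a k \<partial>count_space A) * Cb p"
proof -
  have "(\<integral>\<^sup>+k. ennreal (norm (V k x)) \<partial>count_space A) \<le> (\<integral>\<^sup>+k. a k * Cb p \<partial>count_space A)"
    by (intro nn_integral_mono V_bound)
  then show ?thesis by (simp add: nn_integral_multc)
qed

lemma sum_a_subset: "(\<integral>\<^sup>+k. a k \<partial>count_space A) \<le> csum a"
  by (subst nn_integral_count_space_indicator) (auto intro!: nn_integral_mono simp: indicator_def)

lemma V_integrable: "integrable (count_space A) (\<lambda>k. V k x)"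
proof (subst integrable_iff_nn)
  have "(\<integral>\<^sup>+k. a k \<partial>count_space A) * Cb p \<le> csum a * Cb p" by (intro mult_right_mono sum_a_subset) simp
  also have "\<dots> < \<infinity>" using csum_a_finite Cb_finite by (simp add: ennreal_mult_less_top)
  finally show "(\<integral>\<^sup>+k. ennreal (norm (V k x)) \<partial>count_space A) < \<infinity>"
    using V_csum_bound by (rule le_less_trans[rotated])
qed simp

text \<open>Both sides have the same image under the multiplier \<open>\<xi> \<mapsto> sig (\<xi> / R)\<close>, whose support meets only
  finitely many supports \<open>sg k\<close>; as \<open>R \<rightarrow> \<infinity>\<close> these multipliers form an approximate identity.\<close>

lemma decomposition: "AE x in lborel. u x = (LINT k|count_space UNIV. V k x)"
proof -
  define g where "g x = (LINT k|count_space UNIV. V k x)" for x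
  have gm [measurable]: "g \<in> borel_measurable borel"
    unfolding g_def[abs_def] by (rule borel_measurable_count_space_integral) auto
  have gfin: "cN p g < \<infinity>"
  proof -
    have "cN p g \<le> lpn lborel p (\<lambda>x. csum (\<lambda>k. ennreal (norm (V k x))))"
      unfolding cN_def g_def using p by (intro lpn_mono norm_lint_le_nn) auto
    also have "\<dots> \<le> csum (\<lambda>k. lpn lborel p (\<lambda>x. ennreal (norm (V k x))))"
      using p by (intro lpn_minkowski sigma_finite_measure_count_space_countable lborel.sigma_finite_measure_axioms
        measurable_pair_measure_countable1) auto
    also have "\<dots> = csum a" by (simp add: a_def[abs_def] cN_def)
    finally show ?thesis using csum_a_finite by (rule le_less_trans)
  qed
  have vfin: "cN p (\<lambda>x. u x - g x) < \<infinity>"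
  proof -
    have "cN p (\<lambda>x. u x - g x) \<le> lpn lborel p (\<lambda>x. \<integral>\<^sup>+b. ennreal (norm (if b then u x else g x)) \<partial>count_space (UNIV::bool set))"
      unfolding cN_def
    proof (rule lpn_mono)
      fix x show "ennreal (norm (u x - g x)) \<le> (\<integral>\<^sup>+b. ennreal (norm (if b then u x else g x)) \<partial>count_space (UNIV::bool set))"
        using norm_triangle_ineq4[of "u x" "g x"]
        by (simp add: nn_integral_count_space_finite UNIV_bool ennreal_leI add.commute flip: ennreal_plus)
    qed (use p in simp)
    also have "\<dots> \<le> (\<integral>\<^sup>+b. lpn lborel p (\<lambda>x. ennreal (norm (if b then u x else g x))) \<partial>count_space (UNIV::bool set))"
      using p by (intro lpn_minkowski sigma_finite_measure_count_space_countable lborel.sigma_finite_measure_axioms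
        measurable_pair_measure_countable1) auto
    also have "\<dots> < \<infinity>" using gfin u_fin by (simp add: nn_integral_count_space_finite UNIV_bool cN_def)
    finally show ?thesis .
  qed
  have "AE x in lborel. u x - g x = 0"
  proof (rule zero_if_mollified_zero[OF p _ vfin, where K="ker (\<lambda>\<xi>. complex_of_real (sig \<xi>))"])
    show "integrable lborel (ker (\<lambda>\<xi>. complex_of_real (sig \<xi>)))" using sig_wsym by auto
    show "(LINT z|lborel. ker (\<lambda>\<xi>. complex_of_real (sig \<xi>)) z) \<noteq> 0" using kap_nonzero by (auto simp: kap_def)
    show "norm (ker (\<lambda>\<xi>. complex_of_real (sig \<xi>)) z) \<le> (LINT \<xi>|lborel. norm (complex_of_real (sig \<xi>)))" for z
      by (rule norm_ker_le)
    fix R :: nat and y :: "real^'n" assume R: "0 < R"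
    let ?d = "\<lambda>\<xi>. complex_of_real (sig (inverse (real R) *\<^sub>R \<xi>))"
    have d: "wsym ?d" using wsym_dilate[OF sig_wsym, of "real R"] R by simp
    \<comment> \<open>Only for these k can the support of \<open>sg k\<close> meet that of the
      dilated symbol, which lies in the ball of radius R S.\<close>
    define M where "M = {m::int^'n. norm (real_vec m) \<le> real R * S + S}"
    have M: "finite M" unfolding M_def by (rule finite_lattice_ball)
    have dz: "?d \<xi> = 0" if "real R * S < norm \<xi>" for \<xi>
      using that R by (simp add: sig_supp field_simps)
    have dsg: "?d \<xi> * sg k \<xi> = 0" if "k \<notin> M" for k \<xi>
    proof (cases "real R * S < norm \<xi>")
      case False
      then have "S < norm (\<xi> - real_vec k)"
        using that norm_triangle_ineq2[of "real_vec k" \<xi>] by (auto simp: M_def norm_minus_commute)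
      then show ?thesis by (simp add: sg_zero)
    qed (simp add: dz)
    have part: "(\<Sum>k\<in>M. ?d \<xi> * sg k \<xi>) = ?d \<xi>" for \<xi>
    proof (cases "real R * S < norm \<xi>")
      case False
      have "(\<Sum>m\<in>M. sig (\<xi> - real_vec m)) = 1"
      proof (rule sig_part[OF M], rule subsetI)
        fix m assume "m \<in> {m. norm (\<xi> - real_vec m) \<le> S}"
        then show "m \<in> M" using False norm_triangle_ineq2[of "real_vec m" \<xi>] by (auto simp: M_def norm_minus_commute)
      qed
      then show ?thesis by (simp add: sg_def flip: sum_distrib_left of_real_sum)
    qed (simp add: dz)
    have "conv_op ?d g y = (LINT k|count_space UNIV. conv_op ?d (V k) y)"
      by (rule conv_op_countable_eq[OF p d]) (use a_fin in \<open>auto simp: g_def\<close>)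
    also have "\<dots> = (LINT k|count_space UNIV. conv_op (\<lambda>\<xi>. ?d \<xi> * sg k \<xi>) u y)"
      by (simp add: conv_V[OF d])
    also have "\<dots> = (\<Sum>k\<in>M. conv_op (\<lambda>\<xi>. ?d \<xi> * sg k \<xi>) u y)"
    proof -
      have z: "conv_op (\<lambda>\<xi>. ?d \<xi> * sg k \<xi>) u y = 0" if "k \<notin> M" for k
        by (rule conv_op_zero_symbol) (rule dsg[OF that])
      have "(LINT k|count_space UNIV. conv_op (\<lambda>\<xi>. ?d \<xi> * sg k \<xi>) u y) =
         (\<Sum>k | k \<in> UNIV \<and> conv_op (\<lambda>\<xi>. ?d \<xi> * sg k \<xi>) u y \<noteq> 0. conv_op (\<lambda>\<xi>. ?d \<xi> * sg k \<xi>) u y)"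
        by (rule lebesgue_integral_count_space_finite_support) (use z in \<open>auto intro: finite_subset[OF _ M]\<close>)
      also have "\<dots> = (\<Sum>k\<in>M. conv_op (\<lambda>\<xi>. ?d \<xi> * sg k \<xi>) u y)"
        using z M by (intro sum.mono_neutral_left) auto
      finally show ?thesis .
    qed
    also have "\<dots> = conv_op (\<lambda>\<xi>. \<Sum>k\<in>M. ?d \<xi> * sg k \<xi>) u y"
    proof -
      have k: "ker (\<lambda>\<xi>. \<Sum>k\<in>M'. ?d \<xi> * sg k \<xi>) z = (\<Sum>k\<in>M'. ker (\<lambda>\<xi>. ?d \<xi> * sg k \<xi>) z)" if "finite M'" for M' z
        using that
      proof (induction M')
        case (insert m M')
        have "bsupp (\<lambda>\<xi>. \<Sum>k\<in>M'. ?d \<xi> * sg k \<xi>)"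
          using insert by (intro wsym_bsupp wsym_sum wsym_mult d wsym_sg)
        then show ?case using insert ker_add[OF wsym_bsupp[OF wsym_mult[OF d wsym_sg[of m]]]] by simp
      qed (simp add: ker_def)
      show ?thesis unfolding conv_op_def k[OF M] sum_distrib_left
        by (rule Bochner_Integration.integral_sum[symmetric]) (intro conv_integrable[OF p _ u u_fin] wsym_mult d wsym_sg)
    qed
    also have "\<dots> = conv_op ?d u y" by (simp only: part)
    finally have "conv_op ?d g y = conv_op ?d u y" .
    then have "(LINT x|lborel. (u x - g x) * ker ?d (x - y)) = 0"
      unfolding conv_op_def left_diff_distrib
      using conv_integrable[OF p d u u_fin, of y] conv_integrable[OF p d gm gfin, of y]
      by (subst Bochner_Integration.integral_diff) auto
    then have "(LINT x|lborel. of_real (real R ^ DIM(real^'n)) * ((u x - g x) * ker (\<lambda>\<xi>. complex_of_real (sig \<xi>)) (real R *\<^sub>R (x - y)))) = 0"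
      using ker_dilate[OF wsym_bsupp[OF sig_wsym], of "real R"] R by (simp add: mult.left_commute)
    then show "(LINT x|lborel. (u x - g x) * ker (\<lambda>\<xi>. complex_of_real (sig \<xi>)) (real R *\<^sub>R (x - y))) = 0"
      using R by (subst (asm) integral_mult_right_zero) simp
  qed measurable
  then show ?thesis unfolding g_def by simp
qed

end

lemma borel_measurable_complex_exp [measurable]: "(exp :: complex \<Rightarrow> complex) \<in> borel_measurable borel"
  by (intro borel_measurable_continuous_onI continuous_intros)

lemma integral_count_space_subset:
  fixes f :: "'k \<Rightarrow> complex"
  shows "(LINT k|count_space A. f k) = (LINT k|count_space UNIV. indicator A k *\<^sub>R f k)"
  using integral_restrict_space[of A "count_space UNIV" f] by (simp add: restrict_count_space)

section \<open>Exponentials of the low and of the high frequency part\<close>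

context decomp_fun
begin

text \<open>Every factor \<open>V k\<close> moves the spectrum by at most \<open>norm (real_vec k) + 3 * S\<close>; the exponential
  weight records this movement multiplicatively.\<close>

lemma low_power:
  fixes lo :: "(int^'n) set"
  assumes lo: "finite lo" and y: "0 \<le> y" and "spec p c L F"
  defines "v \<equiv> \<lambda>x. \<Sum>k\<in>lo. V k x"
    and "G \<equiv> (\<Sum>k\<in>lo. a k * ennreal (exp (y * norm (real_vec k)))) * (Cb p * ennreal (exp (3 * S * y)))"
  shows "cN p (conv_op (sg m) (\<lambda>x. v x ^ l * F x)) \<le>
     K1 * cN p F * G ^ l * ennreal (exp (- y * (norm (real_vec m - c) - L - S)))"
  using assms(3)
proof (induction l arbitrary: c L F)
  case 0
  have F [measurable]: "F \<in> borel_measurable borel" and Ff: "cN p F < \<infinity>"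
    and Fz: "\<And>b y. wsym b \<Longrightarrow> \<forall>\<xi>\<in>cball c L. b \<xi> = 0 \<Longrightarrow> conv_op b F y = 0"
    using 0 by (auto simp: spec_def)
  show ?case
  \<comment> \<open>Either the spectrum of F misses the support of \<open>sg m\<close> and the
    result is 0, or the exponent on the right is nonnegative and the trivial bound suffices.\<close>
  proof (cases "L + S < norm (real_vec m - c)")
    case True
    have "sg m \<xi> = 0" if "\<xi> \<in> cball c L" for \<xi>
    proof (rule sg_zero)
      have "norm (real_vec m - c) \<le> norm (real_vec m - \<xi>) + norm (\<xi> - c)"
        using norm_triangle_ineq[of "real_vec m - \<xi>" "\<xi> - c"] by simp
      then show "S < norm (\<xi> - real_vec m)"
        using that True by (simp add: dist_norm norm_minus_commute)
    qed
    then have "conv_op (sg m) F = (\<lambda>_. 0)" using Fz[OF wsym_sg] by auto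
    then show ?thesis by simp
  next
    case False
    have "cN p (conv_op (sg m) F) \<le> K1 * cN p F"
      using cN_conv_op_le[OF p wsym_sg[of m] F] by (simp add: kI_sg)
    also have "\<dots> \<le> K1 * cN p F * ennreal (exp (- y * (norm (real_vec m - c) - L - S)))"
    proof -
      have "0 \<le> - y * (norm (real_vec m - c) - L - S)"
        using False y by (simp add: mult_nonneg_nonpos mult_nonpos_nonneg)
      then have "(1::ennreal) \<le> ennreal (exp (- y * (norm (real_vec m - c) - L - S)))"
        by (simp only: ennreal_1[symmetric], intro ennreal_leI) simp
      then have "K1 * cN p F * 1 \<le> K1 * cN p F * ennreal (exp (- y * (norm (real_vec m - c) - L - S)))"
        by (intro mult_left_mono) auto
      then show ?thesis by simp
    qed
    finally show ?thesis by simp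
  qed
next
  case (Suc l)
  have F [measurable]: "F \<in> borel_measurable borel" and Ff: "cN p F < \<infinity>"
    using Suc.prems by (auto simp: spec_def)
  have vm [measurable]: "v \<in> borel_measurable borel" unfolding v_def by measurable
  define Vb where "Vb = enn2real (csum a * Cb p)"
  have Vb: "csum a * Cb p = ennreal Vb" "0 \<le> Vb"
    using csum_a_finite Cb_finite by (auto simp: Vb_def ennreal_mult_less_top less_top)
  have Vk: "norm (V k x) \<le> Vb" for k x
  proof -
    have "ennreal (norm (V k x)) \<le> csum a * Cb p"
      using V_bound[of k x] mult_right_mono[OF a_le[of k], of "Cb p"] by (simp add: order_trans)
    then show ?thesis using Vb by simp
  qed
  have vb: "norm (v x ^ l * V k x) \<le> (real (card lo) * Vb) ^ l * Vb" for x k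
  proof -
    have "norm (v x) \<le> real (card lo) * Vb"
      unfolding v_def by (rule order_trans[OF norm_sum]) (use sum_bounded_above[of lo "\<lambda>k. norm (V k x)" Vb] Vk in auto)
    then show ?thesis using Vk[of k x] Vb by (auto simp: norm_mult norm_power intro!: mult_mono power_mono)
  qed
  have "cN p (conv_op (sg m) (\<lambda>x. v x ^ Suc l * F x)) \<le>
    (\<integral>\<^sup>+k. cN p (conv_op (sg m) (\<lambda>x. v x ^ l * (F x * V k x))) \<partial>count_space lo)"
  proof (rule cN_conv_op_countable[OF p wsym_sg])
    show "countable lo" using lo by (rule countable_finite)
    have "cN p (\<lambda>x. v x ^ l * (F x * V k x)) < \<infinity>" for k
    proof -
      have "cN p (\<lambda>x. v x ^ l * (F x * V k x)) = cN p (\<lambda>x. F x * (v x ^ l * V k x))" by (simp add: mult.left_commute)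
      also have "\<dots> \<le> cN p F * ennreal ((real (card lo) * Vb) ^ l * Vb)"
        using p by (intro cN_mult_bounded) (auto intro: vb simp: Vb)
      also have "\<dots> < \<infinity>" using Ff by (simp add: ennreal_mult_less_top)
      finally show ?thesis .
    qed
    then show "(\<integral>\<^sup>+k. cN p (\<lambda>x. v x ^ l * (F x * V k x)) \<partial>count_space lo) < \<infinity>"
      using lo by (simp add: nn_integral_count_space_finite)
    show "AE x in lborel. v x ^ Suc l * F x = (LINT k|count_space lo. v x ^ l * (F x * V k x))"
    proof (intro AE_I2)
      fix x
      have "v x ^ Suc l * F x = v x ^ l * (F x * (\<Sum>k\<in>lo. V k x))" by (simp add: v_def)
      then show "v x ^ Suc l * F x = (LINT k|count_space lo. v x ^ l * (F x * V k x))"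
        by (simp add: lebesgue_integral_count_space_finite[OF lo] sum_distrib_left)
    qed
  qed measurable
  also have "\<dots> = (\<Sum>k\<in>lo. cN p (conv_op (sg m) (\<lambda>x. v x ^ l * (F x * V k x))))"
    by (rule nn_integral_count_space_finite[OF lo])
  \<comment> \<open>One factor v has been expanded into its pieces and merged with F. The new centre
    c + k and radius L + 3 S worsen the exponent by at most y (|k| + 3 S), which the exponential
    factors in G pay for.\<close>
  also have "\<dots> \<le> (\<Sum>k\<in>lo. K1 * cN p F * G ^ l * ennreal (exp (- y * (norm (real_vec m - c) - L - S))) *
     (a k * ennreal (exp (y * norm (real_vec k))) * (Cb p * ennreal (exp (3 * S * y)))))"
  proof (rule sum_mono)
    fix k assume "k \<in> lo"
    note st = spec_step[OF Suc.prems, of k]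
    have "cN p (conv_op (sg m) (\<lambda>x. v x ^ l * (F x * V k x))) \<le>
       K1 * cN p (\<lambda>x. F x * V k x) * G ^ l * ennreal (exp (- y * (norm (real_vec m - (c + real_vec k)) - (L + 3 * S) - S)))"
      by (rule Suc.IH[OF st(1)])
    also have "\<dots> \<le> K1 * (cN p F * (a k * Cb p)) * G ^ l *
      ennreal (exp (- y * (norm (real_vec m - c) - L - S)) * (exp (y * norm (real_vec k)) * exp (3 * S * y)))"
    proof (intro mult_mono mult_left_mono st(2) ennreal_leI)
      have "norm (real_vec m - c) \<le> norm (real_vec m - (c + real_vec k)) + norm (real_vec k)"
        using norm_triangle_ineq[of "real_vec m - (c + real_vec k)" "real_vec k"] by (simp add: algebra_simps)
      then have "y * norm (real_vec m - c) \<le> y * (norm (real_vec m - (c + real_vec k)) + norm (real_vec k))"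
        using y by (rule mult_left_mono)
      then show "exp (- y * (norm (real_vec m - (c + real_vec k)) - (L + 3 * S) - S)) \<le>
         exp (- y * (norm (real_vec m - c) - L - S)) * (exp (y * norm (real_vec k)) * exp (3 * S * y))"
        by (simp add: exp_add[symmetric] algebra_simps)
    qed auto
    also have "\<dots> = K1 * cN p F * G ^ l * ennreal (exp (- y * (norm (real_vec m - c) - L - S))) *
     (a k * ennreal (exp (y * norm (real_vec k))) * (Cb p * ennreal (exp (3 * S * y))))"
      by (simp add: ennreal_mult mult_ac)
    finally show "cN p (conv_op (sg m) (\<lambda>x. v x ^ l * (F x * V k x))) \<le>
      K1 * cN p F * G ^ l * ennreal (exp (- y * (norm (real_vec m - c) - L - S))) *
     (a k * ennreal (exp (y * norm (real_vec k))) * (Cb p * ennreal (exp (3 * S * y))))" .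
  qed
  also have "\<dots> = K1 * cN p F * G ^ Suc l * ennreal (exp (- y * (norm (real_vec m - c) - L - S)))"
    unfolding sum_distrib_left[symmetric] sum_distrib_right[symmetric] G_def[symmetric]
    by (simp add: mult_ac)
  finally show ?case .
qed

text \<open>As g is bounded, the exponential series times F converges absolutely in L^p, and the
  multiplier may be applied term by term.\<close>

lemma exp_power_expansion:
  assumes F [measurable]: "F \<in> borel_measurable borel" "cN p F < \<infinity>"
    and g [measurable]: "g \<in> borel_measurable borel" and gb: "\<And>x. norm (g x) \<le> B" "0 \<le> B" and s: "\<bar>s\<bar> \<le> r"
  shows "cN p (conv_op (sg m) (\<lambda>x. exp (\<i> * of_real s * g x) * F x)) \<le>
    csum (\<lambda>l::nat. ennreal (r ^ l / fact l) * cN p (conv_op (sg m) (\<lambda>x. g x ^ l * F x)))"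
proof -
  have r: "0 \<le> r" using s by simp
  define q where "q l x = (\<i> * of_real s * g x) ^ l / fact l * F x" for l :: nat and x
  have q: "q l x = (\<i> * of_real s) ^ l / fact l * (g x ^ l * F x)" for l x
    by (simp add: q_def power_mult_distrib)
  have nq: "norm ((\<i> * complex_of_real s) ^ l / fact l) \<le> r ^ l / fact l" for l :: nat
    using s by (simp add: norm_divide norm_power norm_mult divide_right_mono power_mono)
  have [measurable]: "q l \<in> borel_measurable borel" for l unfolding q_def[abs_def] by measurable
  have "cN p (conv_op (sg m) (\<lambda>x. exp (\<i> * of_real s * g x) * F x)) \<le> csum (\<lambda>l. cN p (conv_op (sg m) (q l)))"
  proof (rule cN_conv_op_countable[OF p wsym_sg])
    have "cN p (q l) \<le> cN p F * ennreal ((r * B) ^ l / fact l)" for l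
    proof -
      have "cN p (q l) = cN p (\<lambda>x. F x * ((\<i> * of_real s * g x) ^ l / fact l))"
        by (simp add: q_def[abs_def] mult.commute)
      also have "\<dots> \<le> cN p F * ennreal ((r * B) ^ l / fact l)"
      proof (rule cN_mult_bounded)
        have "norm ((\<i> * of_real s * g x) ^ l / fact l) \<le> (r * B) ^ l / fact l" for x
          using s gb r by (auto simp: norm_divide norm_power norm_mult intro!: divide_right_mono power_mono mult_mono)
        then show "AE x in lborel. norm ((\<i> * of_real s * g x) ^ l / fact l) \<le> (r * B) ^ l / fact l" by auto
      qed (use p r gb F in auto)
      finally show ?thesis .
    qed
    then have "csum (\<lambda>l. cN p (q l)) \<le> csum (\<lambda>l. cN p F * ennreal ((r * B) ^ l / fact l))"
      by (intro nn_integral_mono)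
    also have "\<dots> = cN p F * ennreal (exp (r * B))"
      using r gb by (subst nn_integral_cmult) (auto simp: csum_pow_fact)
    also have "\<dots> < \<infinity>" using F by (simp add: ennreal_mult_less_top)
    finally show "csum (\<lambda>l. cN p (q l)) < \<infinity>" .
    show "AE x in lborel. exp (\<i> * of_real s * g x) * F x = (LINT l|count_space UNIV. q l x)"
    proof (intro AE_I2)
      fix x
      have "exp (\<i> * of_real s * g x) * F x = (LINT l|count_space UNIV. (\<i> * of_real s * g x) ^ l / fact l) * F x"
        by (simp only: exp_count_space_integral)
      also have "\<dots> = (LINT l|count_space UNIV. q l x)"
        unfolding q_def by (rule integral_mult_left_zero[symmetric])
      finally show "exp (\<i> * of_real s * g x) * F x = (LINT l|count_space UNIV. q l x)" .
    qed
    show "countable (UNIV :: nat set)" by simp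
    show "(\<lambda>x. exp (\<i> * of_real s * g x) * F x) \<in> borel_measurable borel" by measurable
  qed measurable
  also have "\<dots> \<le> csum (\<lambda>l. ennreal (r ^ l / fact l) * cN p (conv_op (sg m) (\<lambda>x. g x ^ l * F x)))"
  proof (rule nn_integral_mono)
    fix l :: nat
    have "conv_op (sg m) (q l) = (\<lambda>y. ((\<i> * of_real s) ^ l / fact l) * conv_op (sg m) (\<lambda>x. g x ^ l * F x) y)"
      unfolding q[abs_def] by (intro ext conv_op_cmult)
    then have "cN p (conv_op (sg m) (q l)) = ennreal (norm ((\<i> * complex_of_real s) ^ l / fact l)) * cN p (conv_op (sg m) (\<lambda>x. g x ^ l * F x))"
      using p by (simp only:) (intro cN_cmult conv_op_measurable wsym_sg; measurable)
    also have "\<dots> \<le> ennreal (r ^ l / fact l) * cN p (conv_op (sg m) (\<lambda>x. g x ^ l * F x))"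
      by (intro mult_right_mono ennreal_leI nq) simp
    finally show "cN p (conv_op (sg m) (q l)) \<le> ennreal (r ^ l / fact l) * cN p (conv_op (sg m) (\<lambda>x. g x ^ l * F x))" .
  qed
  finally show ?thesis .
qed

end

text \<open>\<open>V1\<close> bounds the low part in the exponential weight of strip width y and
  thereby the growth of exp (i s v) with r. The assumption \<open>high\<close> makes r times the
  supremum of the high part at most 1. As y \<le> 1, the factor \<open>exp (3 * S)\<close> covers
  the spectral enlargement \<open>exp (3 * S * y)\<close>.\<close>

locale split_fun = decomp_fun sig S p "\<lambda>x. complex_of_real (ur x)"
  for sig :: "real^'n \<Rightarrow> real" and S and p and ur :: "real^'n \<Rightarrow> real" +
  fixes R y r V1 s :: real
  assumes y: "0 \<le> y" "y \<le> 1" and s: "\<bar>s\<bar> \<le> r" and V1: "0 \<le> V1"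
    and low: "(\<Sum>k\<in>{k. norm (real_vec k) \<le> R}. a k * ennreal (exp (y * norm (real_vec k)))) * (Cb p * ennreal (exp (3 * S))) \<le> ennreal V1"
    and high: "ennreal r * ((\<integral>\<^sup>+k. a k \<partial>count_space {k. R < norm (real_vec k)}) * Cb p) \<le> 1"
begin

definition v where "v x = (\<Sum>k\<in>{k. norm (real_vec k) \<le> R}. V k x)"
definition h where "h x = (LINT k|count_space {k. R < norm (real_vec k)}. V k x)"
definition E where "E x = exp (\<i> * of_real s * v x)"

text \<open>The cost of one high factor: Bernstein's constant and the exponential of the enlargement
  of the spectral radius.\<close>

definition hb :: "int^'n \<Rightarrow> ennreal" where
  "hb k = (if R < norm (real_vec k) then Cb p * ennreal (exp (3 * S)) * a k else 0)"
text \<open>Envelope of the multiplier pieces of exp (i s v) F, indexed relative to the centre of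
  the spectrum of F: the trivial bound up to distance (r V1 + S) / y, exponential decay
  beyond.\<close>

definition d0 :: "int^'n \<Rightarrow> ennreal" where
  "d0 k = ennreal (min 1 (exp (r * V1 + S - y * norm (real_vec k))))"

lemma r_nonneg: "0 \<le> r" using s by simp

lemma v_meas [measurable]: "v \<in> borel_measurable borel" unfolding v_def[abs_def] by measurable

lemma h_meas [measurable]: "h \<in> borel_measurable borel"
  unfolding h_def[abs_def] by (rule borel_measurable_count_space_integral) auto

lemma E_meas [measurable]: "E \<in> borel_measurable borel"
  unfolding E_def[abs_def] by measurable

lemma h_bound: "ennreal r * ennreal (norm (h x)) \<le> 1"
proof -
  have "ennreal (norm (h x)) \<le> (\<integral>\<^sup>+k. a k \<partial>count_space {k. R < norm (real_vec k)}) * Cb p"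
    unfolding h_def by (rule order_trans[OF norm_lint_le_nn V_csum_bound])
  then show ?thesis using high by (meson mult_left_mono order_trans zero_le)
qed

lemma s_h: "\<bar>s\<bar> * norm (h x) \<le> 1"
proof -
  have "r * norm (h x) \<le> 1"
    using h_bound[of x] r_nonneg by (simp flip: ennreal_mult)
  then show ?thesis using s by (smt (verit) mult_right_mono norm_ge_zero)
qed

lemma u_split: "AE x in lborel. complex_of_real (ur x) = v x + h x"
  using decomposition
proof eventually_elim
  case (elim x)
  have "(LINT k|count_space UNIV. V k x) = (LINT k|count_space UNIV. indicator {k. norm (real_vec k) \<le> R} k *\<^sub>R V k x + indicator {k. R < norm (real_vec k)} k *\<^sub>R V k x)"
    by (rule Bochner_Integration.integral_cong) (auto simp: indicator_def)
  also have "\<dots> = (LINT k|count_space UNIV. indicator {k. norm (real_vec k) \<le> R} k *\<^sub>R V k x) + (LINT k|count_space UNIV. indicator {k. R < norm (real_vec k)} k *\<^sub>R V k x)"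
    using V_integrable[of UNIV x] by (intro Bochner_Integration.integral_add integrable_mult_indicator) auto
  also have "\<dots> = v x + h x"
    unfolding v_def h_def lebesgue_integral_count_space_finite[OF finite_lattice_ball, symmetric]
    by (simp only: integral_count_space_subset[symmetric])
  finally show ?case using elim by simp
qed

text \<open>Since v + h is real, Im v = - Im h; hence |exp (i s v)| = exp (- s Im v) is at most exp
  (|s| |h|), and |s| |h| \<le> 1.\<close>

lemma E_bound: "AE x in lborel. norm (E x) \<le> exp 1"
  using u_split
proof eventually_elim
  case (elim x)
  have "Im (v x) = - Im (h x)" using elim by (metis Im_complex_of_real add_eq_0_iff plus_complex.simps(2) add.commute)
  then have "\<bar>Im (v x)\<bar> \<le> norm (h x)" using abs_Im_le_cmod[of "h x"] by simp
  then have "\<bar>s\<bar> * \<bar>Im (v x)\<bar> \<le> \<bar>s\<bar> * norm (h x)" by (rule mult_left_mono) simp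
  then have "\<bar>s * Im (v x)\<bar> \<le> 1" using s_h[of x] by (simp add: abs_mult)
  then show ?case by (simp add: E_def norm_exp_eq_Re)
qed

lemma v_bounded: obtains B where "0 \<le> B" "\<And>x. norm (v x) \<le> B"
proof -
  have "ennreal (norm (v x)) \<le> csum a * Cb p" for x
    unfolding v_def lebesgue_integral_count_space_finite[OF finite_lattice_ball, symmetric]
    by (rule order_trans[OF norm_lint_le_nn order_trans[OF V_csum_bound]]) (intro mult_right_mono sum_a_subset, simp)
  moreover have "csum a * Cb p < \<infinity>" using csum_a_finite Cb_finite by (simp add: ennreal_mult_less_top)
  ultimately show ?thesis
  proof (intro that[of "enn2real (csum a * Cb p)"])
    fix x
    assume 1: "\<And>x. ennreal (norm (v x)) \<le> csum a * Cb p" and 2: "csum a * Cb p < \<infinity>"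
    have "csum a * Cb p = ennreal (enn2real (csum a * Cb p))" using 2 by (simp add: less_top)
    then have "ennreal (norm (v x)) \<le> ennreal (enn2real (csum a * Cb p))" using 1[of x] by simp
    then show "norm (v x) \<le> enn2real (csum a * Cb p)" by simp
  qed simp
qed

text \<open>The bounds of \<open>low_power\<close> are summed against r^l / fact l: the powers of V1
  add up to exp (r V1), while the decay factor does not depend on l.\<close>

lemma low_exp:
  assumes F: "spec p c L F"
  shows "cN p (conv_op (sg m) (\<lambda>x. E x * F x)) \<le>
     K1 * cN p F * ennreal (exp (r * V1 - y * (norm (real_vec m - c) - L - S)))"
proof -
  have Fm: "F \<in> borel_measurable borel" and Ff: "cN p F < \<infinity>" using F by (auto simp: spec_def)
  define G where "G = (\<Sum>k\<in>{k. norm (real_vec k) \<le> R}. a k * ennreal (exp (y * norm (real_vec k)))) * (Cb p * ennreal (exp (3 * S * y)))"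
  have G: "G \<le> ennreal V1"
  proof -
    have "G \<le> (\<Sum>k\<in>{k. norm (real_vec k) \<le> R}. a k * ennreal (exp (y * norm (real_vec k)))) * (Cb p * ennreal (exp (3 * S)))"
      unfolding G_def using y S1 by (intro mult_left_mono ennreal_leI) (auto simp: mult_le_cancel_left1)
    then show ?thesis using low by (rule order_trans)
  qed
  obtain B where B: "0 \<le> B" "\<And>x. norm (v x) \<le> B" using v_bounded by blast
  let ?X = "ennreal (exp (- y * (norm (real_vec m - c) - L - S)))"
  have "cN p (conv_op (sg m) (\<lambda>x. E x * F x)) \<le> csum (\<lambda>l::nat. ennreal (r ^ l / fact l) * cN p (conv_op (sg m) (\<lambda>x. v x ^ l * F x)))"
    unfolding E_def by (rule exp_power_expansion[OF Fm Ff v_meas B(2,1) s])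
  also have "\<dots> \<le> csum (\<lambda>l. ennreal (r ^ l / fact l) * (K1 * cN p F * ennreal V1 ^ l * ?X))"
  proof (intro nn_integral_mono mult_left_mono)
    fix l :: nat
    have "cN p (conv_op (sg m) (\<lambda>x. v x ^ l * F x)) \<le> K1 * cN p F * G ^ l * ?X"
      unfolding v_def G_def by (rule low_power[OF finite_lattice_ball y(1) F])
    also have "\<dots> \<le> K1 * cN p F * ennreal V1 ^ l * ?X"
      by (intro mult_left_mono mult_right_mono power_mono G) auto
    finally show "cN p (conv_op (sg m) (\<lambda>x. v x ^ l * F x)) \<le> K1 * cN p F * ennreal V1 ^ l * ?X" .
  qed auto
  also have "\<dots> = csum (\<lambda>l::nat. ennreal ((r * V1) ^ l / fact l) * (K1 * cN p F * ?X))"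
  proof (rule nn_integral_cong)
    fix l :: nat
    have "ennreal (r ^ l / fact l) * ennreal V1 ^ l = ennreal (r ^ l / fact l) * ennreal (V1 ^ l)"
      using V1 by (simp only: ennreal_power)
    also have "\<dots> = ennreal (r ^ l / fact l * V1 ^ l)"
      using r_nonneg V1 by (intro ennreal_mult[symmetric]) auto
    also have "r ^ l / fact l * V1 ^ l = (r * V1) ^ l / fact l" by (simp add: power_mult_distrib)
    finally have *: "ennreal (r ^ l / fact l) * ennreal V1 ^ l = ennreal ((r * V1) ^ l / fact l)" .
    have "ennreal (r ^ l / fact l) * (K1 * cN p F * ennreal V1 ^ l * ?X) = (ennreal (r ^ l / fact l) * ennreal V1 ^ l) * (K1 * cN p F * ?X)"
      by (simp only: mult_ac)
    then show "ennreal (r ^ l / fact l) * (K1 * cN p F * ennreal V1 ^ l * ?X) = ennreal ((r * V1) ^ l / fact l) * (K1 * cN p F * ?X)"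
      unfolding * .
  qed
  also have "\<dots> = ennreal (exp (r * V1)) * (K1 * cN p F * ?X)"
    using r_nonneg V1 by (subst nn_integral_multc) (auto simp: csum_pow_fact)
  also have "\<dots> = K1 * cN p F * (ennreal (exp (r * V1)) * ?X)" by (simp only: mult_ac)
  also have "ennreal (exp (r * V1)) * ?X = ennreal (exp (r * V1 - y * (norm (real_vec m - c) - L - S)))"
    by (subst ennreal_mult[symmetric]) (auto simp: exp_add[symmetric])
  finally show ?thesis .
qed

definition K0 :: ennreal where "K0 = K1 * ennreal (exp 1)"

text \<open>Each factor h is expanded into its pieces, which moves the centre of the spectrum from c
  to c + k and so adds one convolution with \<open>hb\<close>. The factor E is touched only in the
  base case, when all pieces have been absorbed into F.\<close>

lemma high_power:
  assumes "spec p (real_vec c) L F" "0 \<le> L"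
  shows "cN p (conv_op (sg m) (\<lambda>x. E x * (h x ^ j * F x))) \<le> K0 * cN p F * ennreal (exp (y * L)) * iter_conv hb d0 j (m - c)"
  using assms
proof (induction j arbitrary: c L F)
  case 0
  have Fm [measurable]: "F \<in> borel_measurable borel" and Ff: "cN p F < \<infinity>" using 0 by (auto simp: spec_def)
  let ?t = "norm (real_vec m - real_vec c)"
  have K10: "K1 \<le> K0"
    using mult_left_mono[of 1 "ennreal (exp 1)" K1] ennreal_leI[of 1 "exp 1"] by (simp add: K0_def)
  \<comment> \<open>Two bounds for E F, one from the boundedness of E and one from the strip
    estimate \<open>low_exp\<close>; \<open>d0\<close> is their minimum.\<close>
  have A: "cN p (conv_op (sg m) (\<lambda>x. E x * F x)) \<le> K0 * cN p F * ennreal (exp (y * L) * 1)"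
  proof -
    have "cN p (conv_op (sg m) (\<lambda>x. E x * F x)) \<le> K1 * cN p (\<lambda>x. F x * E x)"
      using cN_conv_op_le[OF p wsym_sg[of m], of "\<lambda>x. E x * F x"] by (simp add: kI_sg mult.commute)
    also have "\<dots> \<le> K1 * (cN p F * ennreal (exp 1))"
      using p E_bound by (intro mult_left_mono cN_mult_bounded) auto
    also have "\<dots> = K0 * cN p F * ennreal 1" by (simp add: K0_def mult_ac)
    also have "\<dots> \<le> K0 * cN p F * ennreal (exp (y * L) * 1)"
      using y 0 by (intro mult_left_mono ennreal_leI) auto
    finally show ?thesis .
  qed
  have B: "cN p (conv_op (sg m) (\<lambda>x. E x * F x)) \<le> K0 * cN p F * ennreal (exp (y * L) * exp (r * V1 + S - y * ?t))"
  proof -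
    have "y * S \<le> S" using y S1 by (simp add: mult_left_le_one_le)
    then have "exp (r * V1 - y * (?t - L - S)) \<le> exp (y * L) * exp (r * V1 + S - y * ?t)"
      by (simp add: exp_add[symmetric] algebra_simps)
    then have "K1 * cN p F * ennreal (exp (r * V1 - y * (?t - L - S))) \<le> K0 * cN p F * ennreal (exp (y * L) * exp (r * V1 + S - y * ?t))"
      using K10 by (intro mult_mono ennreal_leI) auto
    then show ?thesis using low_exp[OF 0(1)] by (rule order_trans[rotated])
  qed
  have "cN p (conv_op (sg m) (\<lambda>x. E x * F x)) \<le> K0 * cN p F * ennreal (exp (y * L) * min 1 (exp (r * V1 + S - y * ?t)))"
    using A B by (cases "1 \<le> exp (r * V1 + S - y * ?t)") (simp_all add: min_def)
  then show ?case by (simp add: d0_def real_vec_simps ennreal_mult mult.assoc)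
next
  case (Suc j)
  let ?hi = "{k::int^'n. R < norm (real_vec k)}"
  have Fm [measurable]: "F \<in> borel_measurable borel" and Ff: "cN p F < \<infinity>" using Suc by (auto simp: spec_def)
  define Hb where "Hb = enn2real (csum a * Cb p)"
  have Hb: "csum a * Cb p = ennreal Hb" "0 \<le> Hb"
    using csum_a_finite Cb_finite by (auto simp: Hb_def ennreal_mult_less_top less_top)
  have hle: "norm (h x) \<le> Hb" for x
  proof -
    have "ennreal (norm (h x)) \<le> csum a * Cb p"
      unfolding h_def by (rule order_trans[OF norm_lint_le_nn order_trans[OF V_csum_bound]]) (intro mult_right_mono sum_a_subset, simp)
    then show ?thesis using Hb by simp
  qed
  have "cN p (conv_op (sg m) (\<lambda>x. E x * (h x ^ Suc j * F x))) \<le>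
    (\<integral>\<^sup>+k. cN p (conv_op (sg m) (\<lambda>x. E x * (h x ^ j * (F x * V k x)))) \<partial>count_space ?hi)"
  proof (rule cN_conv_op_countable[OF p wsym_sg])
    have "cN p (\<lambda>x. E x * (h x ^ j * (F x * V k x))) \<le> cN p F * (a k * Cb p) * ennreal (exp 1 * Hb ^ j)" for k
    proof -
      have "cN p (\<lambda>x. E x * (h x ^ j * (F x * V k x))) = cN p (\<lambda>x. (F x * V k x) * (E x * h x ^ j))" by (simp add: mult_ac)
      also have "\<dots> \<le> cN p (\<lambda>x. F x * V k x) * ennreal (exp 1 * Hb ^ j)"
      proof (rule cN_mult_bounded)
        show "AE x in lborel. norm (E x * h x ^ j) \<le> exp 1 * Hb ^ j"
          using E_bound by eventually_elim (auto simp: norm_mult norm_power intro!: mult_mono power_mono hle)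
      qed (use p Hb in auto)
      also have "\<dots> \<le> cN p F * (a k * Cb p) * ennreal (exp 1 * Hb ^ j)"
        by (intro mult_right_mono spec_step[OF Suc.prems(1)]) auto
      finally show ?thesis .
    qed
    then have "(\<integral>\<^sup>+k. cN p (\<lambda>x. E x * (h x ^ j * (F x * V k x))) \<partial>count_space ?hi) \<le>
       (\<integral>\<^sup>+k. (cN p F * Cb p * ennreal (exp 1 * Hb ^ j)) * a k \<partial>count_space ?hi)"
      by (intro nn_integral_mono) (simp add: mult_ac)
    also have "\<dots> = (cN p F * Cb p * ennreal (exp 1 * Hb ^ j)) * (\<integral>\<^sup>+k. a k \<partial>count_space ?hi)"
      by (rule nn_integral_cmult) simp
    also have "\<dots> < \<infinity>"
      using Ff Cb_finite[of p] le_less_trans[OF sum_a_subset csum_a_finite, of ?hi] by (simp add: ennreal_mult_less_top)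
    finally show "(\<integral>\<^sup>+k. cN p (\<lambda>x. E x * (h x ^ j * (F x * V k x))) \<partial>count_space ?hi) < \<infinity>" .
    show "AE x in lborel. E x * (h x ^ Suc j * F x) = (LINT k|count_space ?hi. E x * (h x ^ j * (F x * V k x)))"
    proof (intro AE_I2)
      fix x
      have "E x * (h x ^ Suc j * F x) = E x * (h x ^ j * (F x * (LINT k|count_space ?hi. V k x)))" by (simp add: h_def)
      then show "E x * (h x ^ Suc j * F x) = (LINT k|count_space ?hi. E x * (h x ^ j * (F x * V k x)))"
        by simp
    qed
  qed auto
  also have "\<dots> \<le> (\<integral>\<^sup>+k. K0 * cN p F * ennreal (exp (y * L)) * (hb k * iter_conv hb d0 j (m - c - k)) \<partial>count_space ?hi)"
  proof (rule nn_integral_mono)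
    fix k assume "k \<in> space (count_space ?hi)"
    then have k: "R < norm (real_vec k)" by simp
    note st = spec_step[OF Suc.prems(1), of k]
    have "cN p (conv_op (sg m) (\<lambda>x. E x * (h x ^ j * (F x * V k x)))) \<le>
       K0 * cN p (\<lambda>x. F x * V k x) * ennreal (exp (y * (L + 3 * S))) * iter_conv hb d0 j (m - (c + k))"
      using Suc.IH[of "c + k" "L + 3 * S"] st(1) Suc.prems(2) S1 by (simp add: real_vec_simps)
    also have "\<dots> \<le> K0 * (cN p F * (a k * Cb p)) * ennreal (exp (y * L) * exp (3 * S)) * iter_conv hb d0 j (m - (c + k))"
    proof (intro mult_mono mult_right_mono mult_left_mono st(2) ennreal_leI)
      have "y * (3 * S) \<le> 3 * S" using y S1 by (simp add: mult_left_le_one_le)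
      then show "exp (y * (L + 3 * S)) \<le> exp (y * L) * exp (3 * S)" by (simp add: exp_add[symmetric] algebra_simps)
    qed auto
    also have "\<dots> = K0 * cN p F * ennreal (exp (y * L)) * (hb k * iter_conv hb d0 j (m - c - k))"
      using k by (simp add: hb_def ennreal_mult mult_ac diff_diff_eq)
    finally show "cN p (conv_op (sg m) (\<lambda>x. E x * (h x ^ j * (F x * V k x)))) \<le>
       K0 * cN p F * ennreal (exp (y * L)) * (hb k * iter_conv hb d0 j (m - c - k))" .
  qed
  also have "\<dots> \<le> csum (\<lambda>k. K0 * cN p F * ennreal (exp (y * L)) * (hb k * iter_conv hb d0 j (m - c - k)))"
    by (subst nn_integral_count_space_indicator) (auto intro!: nn_integral_mono simp: indicator_def)
  also have "\<dots> = K0 * cN p F * ennreal (exp (y * L)) * iter_conv hb d0 (Suc j) (m - c)"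
    by (simp add: nn_integral_cmult sconv_def)
  finally show ?case .
qed

text \<open>The factor u is expanded into its pieces V c, whose spectra are known; each of them
  starts the recursion of \<open>high_power\<close>. The expansion converges in L^p because the
  product E H has modulus 1 almost everywhere.\<close>

lemma composition_estimate:
  "cN p (conv_op (sg m) (\<lambda>x. of_real (ur x) * exp (\<i> * of_real (s * ur x)))) \<le>
     K0 * ennreal (exp S) * sconv a (\<lambda>z. csum (\<lambda>j. ennreal (r ^ j / fact j) * iter_conv hb d0 j z)) m"
proof -
  have urm [measurable]: "ur \<in> borel_measurable borel"
    using measurable_compose[OF u borel_measurable_Re] by simp
  define H where "H x = exp (\<i> * of_real s * h x)" for x
  have [measurable]: "H \<in> borel_measurable borel"
    unfolding H_def[abs_def] by measurable
  have EH: "AE x in lborel. E x * H x = exp (\<i> * of_real (s * ur x))"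
    using u_split
  proof eventually_elim
    case (elim x)
    have "E x * H x = exp (\<i> * of_real s * (v x + h x))"
      by (simp add: E_def H_def exp_add[symmetric] distrib_left)
    also have "\<i> * of_real s * (v x + h x) = \<i> * of_real (s * ur x)"
      unfolding elim[symmetric] by (simp only: of_real_mult mult.assoc)
    finally show ?case .
  qed
  have 1: "cN p (conv_op (sg m) (\<lambda>x. H x * (E x * V c x))) \<le>
      K0 * ennreal (exp S) * (a c * csum (\<lambda>j. ennreal (r ^ j / fact j) * iter_conv hb d0 j (m - c)))" for c
  proof -
    have f: "cN p (\<lambda>x. E x * V c x) < \<infinity>"
    proof -
      have "cN p (\<lambda>x. V c x * E x) \<le> cN p (V c) * ennreal (exp 1)"
        using p E_bound by (intro cN_mult_bounded) auto
      also have "\<dots> < \<infinity>" using a_finite[of c] by (simp add: a_def ennreal_mult_less_top)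
      finally show ?thesis by (simp add: mult.commute)
    qed
    define Hb where "Hb = enn2real (csum a * Cb p)"
    have Hb: "csum a * Cb p = ennreal Hb" "0 \<le> Hb"
      using csum_a_finite Cb_finite by (auto simp: Hb_def ennreal_mult_less_top less_top)
    have hle: "norm (h x) \<le> Hb" for x
    proof -
      have "ennreal (norm (h x)) \<le> csum a * Cb p"
        unfolding h_def by (rule order_trans[OF norm_lint_le_nn order_trans[OF V_csum_bound]]) (intro mult_right_mono sum_a_subset, simp)
      then show ?thesis using Hb by simp
    qed
    have "cN p (conv_op (sg m) (\<lambda>x. H x * (E x * V c x))) \<le>
      csum (\<lambda>j::nat. ennreal (r ^ j / fact j) * cN p (conv_op (sg m) (\<lambda>x. h x ^ j * (E x * V c x))))"
      unfolding H_def by (rule exp_power_expansion[OF _ f h_meas hle Hb(2) s]) measurable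
    also have "\<dots> \<le> csum (\<lambda>j::nat. ennreal (r ^ j / fact j) * (K0 * a c * ennreal (exp S) * iter_conv hb d0 j (m - c)))"
    proof (intro nn_integral_mono mult_left_mono)
      fix j
      have "cN p (conv_op (sg m) (\<lambda>x. E x * (h x ^ j * V c x))) \<le> K0 * cN p (V c) * ennreal (exp (y * S)) * iter_conv hb d0 j (m - c)"
        by (rule high_power[OF V_spec]) (use S1 in simp)
      also have "\<dots> \<le> K0 * a c * ennreal (exp S) * iter_conv hb d0 j (m - c)"
        unfolding a_def using y S1 by (intro mult_left_mono mult_right_mono ennreal_leI) (auto simp: mult_left_le_one_le)
      finally show "cN p (conv_op (sg m) (\<lambda>x. h x ^ j * (E x * V c x))) \<le> K0 * a c * ennreal (exp S) * iter_conv hb d0 j (m - c)"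
        by (simp add: mult.left_commute)
    qed auto
    also have "\<dots> = csum (\<lambda>j::nat. (K0 * ennreal (exp S) * a c) * (ennreal (r ^ j / fact j) * iter_conv hb d0 j (m - c)))"
      by (simp add: mult_ac)
    also have "\<dots> = K0 * ennreal (exp S) * (a c * csum (\<lambda>j. ennreal (r ^ j / fact j) * iter_conv hb d0 j (m - c)))"
      by (subst nn_integral_cmult) (auto simp: mult.assoc)
    finally show ?thesis .
  qed
  have "cN p (conv_op (sg m) (\<lambda>x. of_real (ur x) * exp (\<i> * of_real (s * ur x)))) \<le>
    csum (\<lambda>c. cN p (conv_op (sg m) (\<lambda>x. H x * (E x * V c x))))"
  proof (rule cN_conv_op_countable[OF p wsym_sg])
    have "cN p (\<lambda>x. H x * (E x * V c x)) \<le> a c" for c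
    proof -
      have "AE x in lborel. norm (E x * H x) \<le> 1"
        using EH by eventually_elim simp
      then have "cN p (\<lambda>x. V c x * (E x * H x)) \<le> cN p (V c) * ennreal 1"
        using p by (intro cN_mult_bounded) auto
      then show ?thesis by (simp add: a_def mult_ac)
    qed
    then have "csum (\<lambda>c. cN p (\<lambda>x. H x * (E x * V c x))) \<le> csum a" by (intro nn_integral_mono)
    then show "csum (\<lambda>c. cN p (\<lambda>x. H x * (E x * V c x))) < \<infinity>" using csum_a_finite by (rule le_less_trans)
    show "AE x in lborel. complex_of_real (ur x) * exp (\<i> * of_real (s * ur x)) = (LINT c|count_space UNIV. H x * (E x * V c x))"
      using EH decomposition by eventually_elim (simp add: mult_ac)
    show "(\<lambda>x. complex_of_real (ur x) * exp (\<i> * of_real (s * ur x))) \<in> borel_measurable borel"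
      by measurable
  qed auto
  also have "\<dots> \<le> csum (\<lambda>c. K0 * ennreal (exp S) * (a c * csum (\<lambda>j. ennreal (r ^ j / fact j) * iter_conv hb d0 j (m - c))))"
    by (intro nn_integral_mono 1)
  also have "\<dots> = K0 * ennreal (exp S) * sconv a (\<lambda>z. csum (\<lambda>j. ennreal (r ^ j / fact j) * iter_conv hb d0 j z)) m"
    unfolding sconv_def by (rule nn_integral_cmult) simp
  finally show ?thesis .
qed

end

section \<open>Decay of the kernels\<close>

text \<open>On the shell between the radii j and j + 1 the function is at most C (1 + j)^(-n-2),
  while the ball of radius j + 1 has volume of order (j + 1)^n; the sum over j of (j + 1)^(-2)
  remains.\<close>

lemma nn_integral_decay_finite:
  fixes f :: "'a::euclidean_space \<Rightarrow> complex"
  assumes [measurable]: "f \<in> borel_measurable borel" and C: "\<And>z. (1 + norm z) ^ (DIM('a) + 2) * norm (f z) \<le> C"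
  shows "(\<integral>\<^sup>+z. ennreal (norm (f z)) \<partial>lborel) < \<infinity>"
proof -
  define n where "n = DIM('a)"
  have C0: "0 \<le> C" using C[of 0] by (smt (verit) mult_nonneg_nonneg norm_ge_zero zero_le_power)
  define c where "c j = C / (1 + real j) ^ (n + 2)" for j :: nat
  have c0: "0 \<le> c j" for j using C0 by (simp add: c_def)
  have "(\<integral>\<^sup>+z. ennreal (norm (f z)) \<partial>lborel) \<le> (\<integral>\<^sup>+z. (\<Sum>j. ennreal (c j) * indicator (cball (0::'a) (real j + 1)) z) \<partial>lborel)"
  proof (rule nn_integral_mono)
    fix z :: 'a
    define j where "j = nat \<lfloor>norm z\<rfloor>"
    have "real j = of_int \<lfloor>norm z\<rfloor>" by (simp add: j_def)
    then have j: "real j \<le> norm z" "norm z \<le> real j + 1" by linarith+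
    have "0 < (1 + norm z) ^ (n + 2)" by (intro zero_less_power add_pos_nonneg) auto
    then have "norm (f z) \<le> C / (1 + norm z) ^ (n + 2)"
      using C[of z] by (simp only: pos_le_divide_eq n_def mult.commute)
    also have "\<dots> \<le> c j" unfolding c_def using j C0 by (intro divide_left_mono power_mono mult_pos_pos) auto
    finally have "ennreal (norm (f z)) \<le> ennreal (c j) * indicator (cball 0 (real j + 1)) z"
      using j by (simp add: ennreal_leI)
    also have "\<dots> = (\<Sum>i\<in>{j}. ennreal (c i) * indicator (cball 0 (real i + 1)) z)"
      by (simp only: sum.insert finite.emptyI empty_iff not_False_eq_True sum.empty add_0_right)
    also have "\<dots> \<le> (\<Sum>i. ennreal (c i) * indicator (cball 0 (real i + 1)) z)"
      by (intro sum_le_suminf) auto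
    finally show "ennreal (norm (f z)) \<le> (\<Sum>j. ennreal (c j) * indicator (cball 0 (real j + 1)) z)" .
  qed
  also have "\<dots> = (\<Sum>j. ennreal (c j) * emeasure lborel (cball (0::'a) (real j + 1)))"
  proof (subst nn_integral_suminf)
    show "(\<lambda>z. ennreal (c i) * indicator (cball (0::'a) (real i + 1)) z) \<in> borel_measurable lborel" for i
      by (intro borel_measurable_times_ennreal borel_measurable_const borel_measurable_indicator) auto
    show "(\<Sum>i. \<integral>\<^sup>+ z. ennreal (c i) * indicator (cball (0::'a) (real i + 1)) z \<partial>lborel) =
      (\<Sum>j. ennreal (c j) * emeasure lborel (cball (0::'a) (real j + 1)))"
      by (intro suminf_cong nn_integral_cmult_indicator) auto
  qed
  also have "\<dots> = (\<Sum>j. ennreal (C * unit_ball_vol (real n) * inverse (real (Suc j) ^ 2)))"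
  proof (rule suminf_cong)
    fix j
    have "ennreal (c j) * emeasure lborel (cball (0::'a) (real j + 1)) = ennreal (c j * (unit_ball_vol (real n) * (real j + 1) ^ n))"
      using c0 by (simp add: emeasure_cball n_def ennreal_mult unit_ball_vol_nonneg)
    also have "c j * (unit_ball_vol (real n) * (real j + 1) ^ n) = C * unit_ball_vol (real n) * inverse (real (Suc j) ^ 2)"
      unfolding c_def power_add by (simp add: field_simps)
    finally show "ennreal (c j) * emeasure lborel (cball (0::'a) (real j + 1)) = ennreal (C * unit_ball_vol (real n) * inverse (real (Suc j) ^ 2))" .
  qed
  also have "\<dots> < \<infinity>"
  proof -
    have "summable (\<lambda>j. inverse (real j ^ 2))" using inverse_power_summable[of 2, where 'a=real] by simp
    then have "summable (\<lambda>j. inverse (real (Suc j) ^ 2))" by (subst summable_Suc_iff)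
    then have "summable (\<lambda>j. C * unit_ball_vol (real n) * inverse (real (Suc j) ^ 2))" by (rule summable_mult)
    then show ?thesis using C0 by (subst suminf_ennreal2) (auto simp: unit_ball_vol_nonneg)
  qed
  finally show ?thesis .
qed

section \<open>Differentiability along a direction\<close>

text \<open>N-fold continuous differentiability along the single direction b, which is what yields
  decay of the kernel in the coordinate z \<bullet> b. The class is closed under products,
  reciprocals and locally finite sums, the operations that build the symbols from \<rho>.\<close>

primrec dirC :: "nat \<Rightarrow> 'a::euclidean_space \<Rightarrow> ('a \<Rightarrow> real) \<Rightarrow> bool" where
  "dirC 0 b f \<longleftrightarrow> continuous_on UNIV f"
| "dirC (Suc N) b f \<longleftrightarrow> continuous_on UNIV f \<and>
     (\<exists>f'. (\<forall>x. ((\<lambda>t. f (x + t *\<^sub>R b)) has_real_derivative f' x) (at 0)) \<and> dirC N b f')"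

lemma dirC_SucI:
  "continuous_on UNIV f \<Longrightarrow> (\<And>x. ((\<lambda>t. f (x + t *\<^sub>R b)) has_real_derivative f' x) (at 0)) \<Longrightarrow> dirC N b f' \<Longrightarrow> dirC (Suc N) b f"
  by auto

lemma dirC_continuous: "dirC N b f \<Longrightarrow> continuous_on UNIV f"
  by (cases N) auto

lemma dirC_Suc_imp: "dirC (Suc N) b f \<Longrightarrow> dirC N b f"
proof (induction N arbitrary: f)
  case (Suc N)
  then obtain f' where "continuous_on UNIV f" "\<forall>x. ((\<lambda>t. f (x + t *\<^sub>R b)) has_real_derivative f' x) (at 0)" "dirC (Suc N) b f'"
    by auto
  then show ?case using Suc.IH[of f'] by auto
qed simp

lemma dirC_add: "dirC N b f \<Longrightarrow> dirC N b g \<Longrightarrow> dirC N b (\<lambda>x. f x + g x)"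
proof (induction N arbitrary: f g)
  case (Suc N)
  obtain f' g' where f: "continuous_on UNIV f" "\<And>x. ((\<lambda>t. f (x + t *\<^sub>R b)) has_real_derivative f' x) (at 0)" "dirC N b f'"
    and g: "continuous_on UNIV g" "\<And>x. ((\<lambda>t. g (x + t *\<^sub>R b)) has_real_derivative g' x) (at 0)" "dirC N b g'"
    using Suc.prems by auto
  show ?case
    by (rule dirC_SucI[OF continuous_on_add[OF f(1) g(1)] _ Suc.IH[OF f(3) g(3)]])
       (rule DERIV_add[OF f(2) g(2)])
qed (auto intro: continuous_intros)

lemma dirC_mult: "dirC N b f \<Longrightarrow> dirC N b g \<Longrightarrow> dirC N b (\<lambda>x. f x * g x)"
proof (induction N arbitrary: f g)
  case (Suc N)
  obtain f' g' where f: "continuous_on UNIV f" "\<And>x. ((\<lambda>t. f (x + t *\<^sub>R b)) has_real_derivative f' x) (at 0)" "dirC N b f'"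
    and g: "continuous_on UNIV g" "\<And>x. ((\<lambda>t. g (x + t *\<^sub>R b)) has_real_derivative g' x) (at 0)" "dirC N b g'"
    using Suc.prems by auto
  have "((\<lambda>t. f (x + t *\<^sub>R b) * g (x + t *\<^sub>R b)) has_real_derivative (f' x * g x + g' x * f x)) (at 0)" for x
    using DERIV_mult[OF f(2) g(2), of x x] by simp
  moreover have "dirC N b (\<lambda>x. f' x * g x + g' x * f x)"
    by (rule dirC_add[OF Suc.IH[OF f(3) dirC_Suc_imp[OF Suc.prems(2)]] Suc.IH[OF g(3) dirC_Suc_imp[OF Suc.prems(1)]]])
  ultimately show ?case by (rule dirC_SucI[OF continuous_on_mult[OF f(1) g(1)]])
qed (auto intro: continuous_intros)

lemma dirC_const: "dirC N b (\<lambda>x. c)"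
proof (induction N arbitrary: c)
  case (Suc N)
  show ?case by (rule dirC_SucI[OF continuous_on_const DERIV_const Suc])
qed simp

text \<open>The derivative of 1/f is, up to sign, f' times two copies of 1/f, and the induction
  hypothesis covers these at the lower order.\<close>

lemma dirC_inverse: "dirC N b f \<Longrightarrow> (\<And>x. f x \<noteq> 0) \<Longrightarrow> dirC N b (\<lambda>x. inverse (f x))"
proof (induction N arbitrary: f)
  case (Suc N)
  obtain f' where f: "continuous_on UNIV f" "\<And>x. ((\<lambda>t. f (x + t *\<^sub>R b)) has_real_derivative f' x) (at 0)" "dirC N b f'"
    using Suc.prems by auto
  have "((\<lambda>t. inverse (f (x + t *\<^sub>R b))) has_real_derivative (-1) * (f' x * (inverse (f x) * inverse (f x)))) (at 0)" for x
    using DERIV_inverse_fun[OF f(2)[of x]] Suc.prems(2)[of x] by (simp add: power2_eq_square mult_ac)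
  moreover have "dirC N b (\<lambda>x. (-1) * (f' x * (inverse (f x) * inverse (f x))))"
    using Suc.IH[OF dirC_Suc_imp[OF Suc.prems(1)] Suc.prems(2)]
    by (intro dirC_mult[OF dirC_const dirC_mult[OF f(3) dirC_mult]])
  moreover have "continuous_on UNIV (\<lambda>x. inverse (f x))"
    using f(1) Suc.prems(2) by (intro continuous_on_inverse) auto
  ultimately show ?case by (intro dirC_SucI)
qed (auto intro!: continuous_intros)

lemma dirC_derivative_support:
  assumes "\<And>x. ((\<lambda>t. f (x + t *\<^sub>R b)) has_real_derivative f' x) (at 0)" "\<And>x. r < norm x \<Longrightarrow> f x = (0::real)" "r < norm x"
  shows "f' x = 0"
proof -
  have "isCont (\<lambda>t::real. norm (x + t *\<^sub>R b)) 0" by (intro continuous_intros)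
  then have "((\<lambda>t::real. norm (x + t *\<^sub>R b)) \<longlongrightarrow> norm (x + 0 *\<^sub>R b)) (nhds 0)"
    by (simp add: continuous_at tendsto_nhds_iff)
  then have "eventually (\<lambda>t. r < norm (x + t *\<^sub>R b)) (nhds 0)"
    using assms(3) by (intro order_tendstoD(1)) auto
  then have "eventually (\<lambda>t. f (x + t *\<^sub>R b) = 0) (nhds 0)"
    by eventually_elim (rule assms(2))
  then have "((\<lambda>t. f (x + t *\<^sub>R b)) has_real_derivative 0) (at 0)"
    by (subst DERIV_cong_ev[OF refl _ refl, where g="\<lambda>_. 0"]) auto
  then show ?thesis using assms(1)[of x] DERIV_unique by blast
qed

text \<open>Near each point the moving index set may be replaced by one fixed finite set, as the
  additional terms vanish; continuity and derivative are then those of a finite sum, and the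
  derivative has the same form again.\<close>

lemma dirC_locally_finite_sum:
  fixes f :: "real^'n \<Rightarrow> real"
  assumes "dirC N b f" "\<And>x. S < norm x \<Longrightarrow> f x = 0"
  shows "dirC N b (\<lambda>x. \<Sum>m\<in>{m. norm (x - real_vec m) \<le> S}. f (x - real_vec m))"
  using assms
proof (induction N arbitrary: f)
  have loc: "\<forall>\<^sub>F x' in nhds x. (\<Sum>m\<in>{m. norm (x' - real_vec m) \<le> S}. f (x' - real_vec m)) = (\<Sum>m\<in>{m. norm (real_vec m) \<le> norm x + 1 + S}. f (x' - real_vec m))"
    if fz: "\<And>x. S < norm x \<Longrightarrow> f x = 0" for f :: "real^'n \<Rightarrow> real" and x
  proof -
    have "\<forall>\<^sub>F x' in nhds x. x' \<in> ball x 1" by (rule eventually_nhds_in_open) auto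
    then show ?thesis
    proof eventually_elim
      case (elim x')
      show ?case
      proof (rule sum.mono_neutral_left)
        have "norm x' \<le> norm x + 1" using elim norm_triangle_ineq2[of x' x] by (simp add: dist_norm norm_minus_commute)
        then show "{m. norm (x' - real_vec m) \<le> S} \<subseteq> {m. norm (real_vec m) \<le> norm x + 1 + S}"
          using norm_triangle_ineq2[of "real_vec _" x'] norm_minus_commute[of x'] by (smt (verit) Collect_mono)
      qed (auto simp: finite_lattice_ball intro!: fz)
    qed
  qed
  have cont: "continuous_on UNIV (\<lambda>x. \<Sum>m\<in>{m. norm (x - real_vec m) \<le> S}. f (x - real_vec m))"
    if fz: "\<And>x. S < norm x \<Longrightarrow> f x = 0" and f: "continuous_on UNIV f" for f :: "real^'n \<Rightarrow> real"
    unfolding continuous_on_eq_continuous_at[OF open_UNIV]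
  proof (intro ballI)
    fix x
    have "isCont (\<lambda>x'. \<Sum>m\<in>{m. norm (real_vec m) \<le> norm x + 1 + S}. f (x' - real_vec m)) x"
    proof -
      have "continuous_on UNIV (\<lambda>x'. \<Sum>m\<in>{m. norm (real_vec m) \<le> norm x + 1 + S}. f (x' - real_vec m))"
        by (intro continuous_intros continuous_on_compose2[OF f]) auto
      then show ?thesis by (simp add: continuous_on_eq_continuous_at)
    qed
    then show "isCont (\<lambda>x. \<Sum>m\<in>{m. norm (x - real_vec m) \<le> S}. f (x - real_vec m)) x"
      by (subst isCont_cong[OF loc[where f=f and x=x, OF fz]])
  qed
  {
    case 0
    then show ?case using cont[of f] by simp
  next
    case (Suc N)
    obtain f' where f: "continuous_on UNIV f" "\<And>x. ((\<lambda>t. f (x + t *\<^sub>R b)) has_real_derivative f' x) (at 0)" "dirC N b f'"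
      using Suc.prems by auto
    have f'z: "\<And>x. S < norm x \<Longrightarrow> f' x = 0"
      using dirC_derivative_support[of f b f' S] f(2) Suc.prems(2) by blast
    have "((\<lambda>t. \<Sum>m\<in>{m. norm (x + t *\<^sub>R b - real_vec m) \<le> S}. f (x + t *\<^sub>R b - real_vec m)) has_real_derivative
       (\<Sum>m\<in>{m. norm (x - real_vec m) \<le> S}. f' (x - real_vec m))) (at 0)" for x
    proof -
      let ?M = "{m. norm (real_vec m) \<le> norm x + 1 + S}"
      have tend: "((\<lambda>t::real. x + t *\<^sub>R b) \<longlongrightarrow> x) (nhds 0)"
      proof -
        have "isCont (\<lambda>t::real. x + t *\<^sub>R b) 0" by (intro continuous_intros)
        then show ?thesis by (simp add: continuous_at tendsto_nhds_iff)
      qed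
      have ev: "\<forall>\<^sub>F t in nhds 0. (\<Sum>m\<in>{m. norm (x + t *\<^sub>R b - real_vec m) \<le> S}. f (x + t *\<^sub>R b - real_vec m)) = (\<Sum>m\<in>?M. f (x + t *\<^sub>R b - real_vec m))"
        by (rule eventually_compose_filterlim[OF loc[where f=f and x=x, OF Suc.prems(2)] tend])
      have "((\<lambda>t. f (x + t *\<^sub>R b - real_vec m)) has_real_derivative f' (x - real_vec m)) (at 0)" for m
        using f(2)[of "x - real_vec m"] by (simp add: algebra_simps)
      then have "((\<lambda>t. \<Sum>m\<in>?M. f (x + t *\<^sub>R b - real_vec m)) has_real_derivative (\<Sum>m\<in>?M. f' (x - real_vec m))) (at 0)"
        by (intro DERIV_sum)
      moreover have "(\<Sum>m\<in>?M. f' (x - real_vec m)) = (\<Sum>m\<in>{m. norm (x - real_vec m) \<le> S}. f' (x - real_vec m))"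
        using eventually_nhds_x_imp_x[OF loc[where f=f' and x=x, OF f'z]] by simp
      ultimately show ?thesis by (subst DERIV_cong_ev[OF refl ev refl]) simp
    qed
    note D = this
    show ?case
    proof (rule dirC_SucI)
      show "continuous_on UNIV (\<lambda>x. \<Sum>m\<in>{m. norm (x - real_vec m) \<le> S}. f (x - real_vec m))"
        by (rule cont[where f=f, OF Suc.prems(2) f(1)])
      show "((\<lambda>t. \<Sum>m\<in>{m. norm (x + t *\<^sub>R b - real_vec m) \<le> S}. f (x + t *\<^sub>R b - real_vec m)) has_real_derivative
         (\<Sum>m\<in>{m. norm (x - real_vec m) \<le> S}. f' (x - real_vec m))) (at 0)" for x
        by (rule D)
      show "dirC N b (\<lambda>x. \<Sum>m\<in>{m. norm (x - real_vec m) \<le> S}. f' (x - real_vec m))"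
        by (rule Suc.IH[OF f(3) f'z])
    qed
  }
qed

text \<open>The induction on N runs over all iterated derivatives along b at once, since the
  derivative of the i-th of them is the next one.\<close>

lemma smooth_on_iterated:
  assumes "smooth_on UNIV f" "b \<in> Basis"
  shows "dirC N b (iterated_partial (replicate i b) f)"
proof (induction N arbitrary: i)
  have d: "iterated_partial (replicate i b) f differentiable (at x)" for i x
    using assms unfolding smooth_on_def by (auto simp: set_replicate_conv_if)
  have c: "continuous_on UNIV (iterated_partial (replicate i b) f)" for i
    using differentiable_imp_continuous_within[OF d] by (simp add: continuous_on_eq_continuous_within)
  {
    case 0 then show ?case using c by simp
  next
    case (Suc N)
    have "((\<lambda>t. iterated_partial (replicate i b) f (x + t *\<^sub>R b)) has_real_derivative iterated_partial (replicate (Suc i) b) f x) (at 0)" for x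
    proof -
      have 1: "(iterated_partial (replicate i b) f has_derivative frechet_derivative (iterated_partial (replicate i b) f) (at x)) (at (x + 0 *\<^sub>R b))"
        using d[of i x] frechet_derivative_works by auto
      have 2: "((\<lambda>t. x + t *\<^sub>R b) has_derivative (\<lambda>t. t *\<^sub>R b)) (at (0::real))"
        by (auto intro!: derivative_eq_intros)
      have "((\<lambda>t. iterated_partial (replicate i b) f (x + t *\<^sub>R b)) has_derivative (\<lambda>t. frechet_derivative (iterated_partial (replicate i b) f) (at x) (t *\<^sub>R b))) (at 0)"
        using has_derivative_compose[OF 2 1] by simp
      moreover have "linear (frechet_derivative (iterated_partial (replicate i b) f) (at x))"
        using d linear_frechet_derivative by blast
      then have "(\<lambda>t. frechet_derivative (iterated_partial (replicate i b) f) (at x) (t *\<^sub>R b)) =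
          (*) (iterated_partial (replicate (Suc i) b) f x)"
        by (auto simp: linear_scale mult.commute)
      ultimately show ?thesis unfolding has_field_derivative_def by simp
    qed
    then show ?case by (rule dirC_SucI[OF c _ Suc])
  }
qed

lemma smooth_on_dirC: "smooth_on UNIV f \<Longrightarrow> b \<in> Basis \<Longrightarrow> dirC N b f"
  using smooth_on_iterated[of f b N 0] by simp

text \<open>Iterated differences replace integration by parts: on the kernel, one difference with
  step c acts as multiplication by cis (z \<bullet> c) - 1, which uses only translation of the
  symbol.\<close>

primrec fdiff :: "'a::euclidean_space \<Rightarrow> nat \<Rightarrow> ('a \<Rightarrow> real) \<Rightarrow> 'a \<Rightarrow> real" where
  "fdiff c 0 f = f"
| "fdiff c (Suc N) f = (\<lambda>x. fdiff c N f (x + c) - fdiff c N f x)"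

lemma fdiff_derivative:
  assumes "\<And>x. ((\<lambda>t. f (x + t *\<^sub>R b)) has_real_derivative f' x) (at 0)"
  shows "((\<lambda>t. fdiff c N f (x + t *\<^sub>R b)) has_real_derivative fdiff c N f' x) (at 0)"
proof (induction N arbitrary: x)
  case (Suc N)
  have "((\<lambda>t. fdiff c N f (x + t *\<^sub>R b + c) - fdiff c N f (x + t *\<^sub>R b)) has_real_derivative fdiff c N f' (x + c) - fdiff c N f' x) (at 0)"
    using DERIV_diff[OF Suc[of "x + c"] Suc[of x]] by (simp add: algebra_simps)
  then show ?case by simp
qed (simp add: assms)

text \<open>Differences commute with the derivative along b, so the mean value inequality on the
  line through x trades one more difference for a factor |h| and one derivative.\<close>

lemma fdiff_bound:
  assumes "dirC N b f" "\<And>x. r < norm x \<Longrightarrow> f x = 0"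
  shows "\<exists>M\<ge>0. \<forall>h x. \<bar>fdiff (h *\<^sub>R b) N f x\<bar> \<le> M * \<bar>h\<bar> ^ N"
  using assms
proof (induction N arbitrary: f)
  case 0
  have "bsupp (\<lambda>x. complex_of_real (f x))"
    using 0 unfolding bsupp_def by (auto intro!: continuous_intros)
  from bsupp_bounded[OF this] obtain B where "0 \<le> B" "\<And>x. norm (complex_of_real (f x)) \<le> B" by blast
  then show ?case by auto
next
  case (Suc N)
  obtain f' where f: "continuous_on UNIV f" "\<And>x. ((\<lambda>t. f (x + t *\<^sub>R b)) has_real_derivative f' x) (at 0)" "dirC N b f'"
    using Suc.prems by auto
  have f'z: "\<And>x. r < norm x \<Longrightarrow> f' x = 0"
    using dirC_derivative_support[of f b f' r] f(2) Suc.prems(2) by blast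
  obtain M where M: "0 \<le> M" "\<And>h x. \<bar>fdiff (h *\<^sub>R b) N f' x\<bar> \<le> M * \<bar>h\<bar> ^ N" using Suc.IH[OF f(3) f'z] by auto
  have "\<bar>fdiff (h *\<^sub>R b) (Suc N) f x\<bar> \<le> M * \<bar>h\<bar> ^ Suc N" for h x
  proof -
    let ?\<phi> = "\<lambda>t. fdiff (h *\<^sub>R b) N f (x + t *\<^sub>R b)"
    have D: "(?\<phi> has_real_derivative fdiff (h *\<^sub>R b) N f' (x + t *\<^sub>R b)) (at t)" for t
      using DERIV_shift[of ?\<phi> "fdiff (h *\<^sub>R b) N f' (x + t *\<^sub>R b)" 0 t]
        fdiff_derivative[of f b f' "h *\<^sub>R b" N "x + t *\<^sub>R b", OF f(2)] by (simp add: algebra_simps)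
    have "norm (?\<phi> h - ?\<phi> 0) \<le> (M * \<bar>h\<bar> ^ N) * norm (h - 0)"
      by (rule field_differentiable_bound[of UNIV ?\<phi> "\<lambda>t. fdiff (h *\<^sub>R b) N f' (x + t *\<^sub>R b)"]) (use D M in auto)
    then show ?thesis by (simp add: mult_ac)
  qed
  then show ?case using M(1) by blast
qed

lemma fdiff_bsupp:
  assumes "bsupp (\<lambda>x. complex_of_real (f x))"
  shows "bsupp (\<lambda>x. complex_of_real (fdiff c N f x))"
    and "ker (\<lambda>x. complex_of_real (fdiff c N f x)) z = (cis (z \<bullet> c) - 1) ^ N * ker (\<lambda>x. complex_of_real (f x)) z"
proof (induction N)
  case (Suc N)
  let ?g = "\<lambda>x. complex_of_real (fdiff c N f x)"
  {
    case 1
    show ?case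
      using bsupp_add[OF bsupp_translate[OF Suc(1), of "- c"] bsupp_mult[OF Suc(1), of "\<lambda>_. -1"]] by simp
  next
    case 2
    have b: "bsupp (\<lambda>x. - ?g x)" using bsupp_mult[OF Suc(1), of "\<lambda>_. -1"] by simp
    have "ker (\<lambda>x. complex_of_real (fdiff c (Suc N) f x)) z = ker (\<lambda>x. ?g (x - (- c)) + - ?g x) z" by simp
    also have "\<dots> = ker (\<lambda>x. ?g (x - (- c))) z + ker (\<lambda>x. - ?g x) z"
      by (rule ker_add[OF bsupp_translate[OF Suc(1)] b])
    also have "\<dots> = cis (z \<bullet> c) * ker ?g z - ker ?g z"
      unfolding ker_translate[OF Suc(1)] by (simp add: ker_def)
    finally show ?case unfolding Suc(2) by (simp add: algebra_simps)
  }
qed (use assms in auto)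

lemma fdiff_support:
  assumes "\<And>x. r < norm x \<Longrightarrow> f x = 0" "r + real N * norm c < norm x"
  shows "fdiff c N f x = 0"
  using assms(2)
proof (induction N arbitrary: x)
  case (Suc N)
  have "norm x \<le> norm (x + c) + norm c" using norm_triangle_ineq4[of "x + c" c] by simp
  moreover have "r + real N * norm c + norm c < norm x" using Suc.prems by (simp add: algebra_simps)
  ultimately have "r + real N * norm c < norm (x + c)" "r + real N * norm c < norm x"
    using norm_ge_zero[of c] by linarith+
  then show ?case using Suc.IH by simp
qed (use assms in simp)

text \<open>Smoothness along a coordinate direction gives decay of the kernel in that coordinate,
  and the largest coordinate controls |z|.\<close>

lemma wsym_dirC:
  fixes f :: "'a::euclidean_space \<Rightarrow> real"
  assumes f: "\<And>b N. b \<in> Basis \<Longrightarrow> dirC N b f" and fz: "\<And>x. r < norm x \<Longrightarrow> f x = 0"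
  shows "wsym (\<lambda>x. complex_of_real (f x))"
proof -
  let ?f = "\<lambda>x. complex_of_real (f x)"
  \<comment> \<open>Two orders more than the dimension, as \<open>nn_integral_decay_finite\<close>
    asks.\<close>
  define N where "N = DIM('a) + 2"
  obtain b0 :: 'a where b0: "b0 \<in> Basis" using nonempty_Basis by blast
  have bs: "bsupp ?f"
    using dirC_continuous[OF f[OF b0, of 0]] fz unfolding bsupp_def by (auto intro!: continuous_intros)
  define K where "K = (LINT \<xi>|lborel. norm (?f \<xi>))"
  have K: "norm (ker ?f z) \<le> K" for z unfolding K_def by (rule norm_ker_le)
  then have K0: "0 \<le> K" using norm_ge_zero order_trans by blast
  have "\<exists>C\<ge>0. \<forall>z. \<bar>z \<bullet> b\<bar> ^ N * norm (ker ?f z) \<le> C" if b: "b \<in> Basis" for b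
  proof -
    obtain M where M: "0 \<le> M" "\<And>h x. \<bar>fdiff (h *\<^sub>R b) N f x\<bar> \<le> M * \<bar>h\<bar> ^ N"
      using fdiff_bound[where r=r and N=N, OF f[OF b] fz] by auto
    define B :: "'a set" where "B = cball 0 (r + real N)"
    define q where "q = norm (cis 1 - 1)"
    have q: "0 < q"
    proof -
      have "cis 1 \<noteq> 1"
      proof
        assume "cis 1 = 1"
        then have "sin (1::real) = 0" by (simp add: complex_eq_iff)
        then show False using sin_gt_zero[of 1] pi_gt3 by simp
      qed
      then show ?thesis by (simp add: q_def)
    qed
    define C where "C = max K (M * measure lborel B / q ^ N)"
    have "\<bar>z \<bullet> b\<bar> ^ N * norm (ker ?f z) \<le> C" for z
    proof (cases "1 \<le> \<bar>z \<bullet> b\<bar>")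
      case False
      then have "\<bar>z \<bullet> b\<bar> ^ N * norm (ker ?f z) \<le> 1 * K"
        by (intro mult_mono K power_le_one) auto
      then show ?thesis by (simp add: C_def)
    next
      case True
      \<comment> \<open>The step is adapted to z: now cis (z \<bullet> h b) = cis 1, so the kernel
        is multiplied by a power of a fixed nonzero number, while the N-th difference is of order
        |h|^N = |z \<bullet> b|^(-N). As |h| \<le> 1, the supports stay in a fixed ball.\<close>
      define h where "h = 1 / (z \<bullet> b)"
      have h: "z \<bullet> (h *\<^sub>R b) = 1" "\<bar>h\<bar> \<le> 1" "\<bar>h\<bar> * \<bar>z \<bullet> b\<bar> = 1"
        using True by (auto simp: h_def abs_mult[symmetric])
      let ?g = "\<lambda>x. complex_of_real (fdiff (h *\<^sub>R b) N f x)"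
      have gz: "norm (?g x) \<le> M * \<bar>h\<bar> ^ N * indicator B x" for x
      proof (cases "x \<in> B")
        case False
        have "real N * norm (h *\<^sub>R b) \<le> real N" using h b by (simp add: mult_left_le)
        then have "fdiff (h *\<^sub>R b) N f x = 0" using False by (intro fdiff_support[OF fz]) (auto simp: B_def)
        then show ?thesis using False by simp
      qed (use M in simp)
      have "q ^ N * norm (ker ?f z) = norm (ker ?g z)"
        unfolding fdiff_bsupp(2)[OF bs] h q_def by (simp add: norm_mult norm_power)
      also have "\<dots> \<le> (LINT \<xi>|lborel. norm (?g \<xi>))" by (rule norm_ker_le)
      also have "\<dots> \<le> (LINT \<xi>|lborel. M * \<bar>h\<bar> ^ N * indicator B \<xi>)"
      proof (rule integral_mono)
        show "integrable lborel (\<lambda>\<xi>. norm (?g \<xi>))" by (intro integrable_norm bsupp_integrable fdiff_bsupp bs)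
        show "integrable lborel (\<lambda>\<xi>. M * \<bar>h\<bar> ^ N * indicator B \<xi>)"
        proof (intro integrable_mult_right integrable_real_indicator)
          show "B \<in> sets lborel" by (simp add: B_def)
          show "emeasure lborel B < \<infinity>" unfolding B_def by (rule emeasure_bounded_finite) simp
        qed
      qed (use gz in auto)
      also have "\<dots> = M * \<bar>h\<bar> ^ N * measure lborel B" by (simp add: B_def)
      finally have "\<bar>z \<bullet> b\<bar> ^ N * (q ^ N * norm (ker ?f z)) \<le> \<bar>z \<bullet> b\<bar> ^ N * (M * \<bar>h\<bar> ^ N * measure lborel B)"
        by (intro mult_left_mono) auto
      also have "\<dots> = M * measure lborel B * (\<bar>h\<bar> * \<bar>z \<bullet> b\<bar>) ^ N" by (simp add: power_mult_distrib mult_ac)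
      finally have "\<bar>z \<bullet> b\<bar> ^ N * norm (ker ?f z) \<le> M * measure lborel B / q ^ N"
        using q h by (simp add: field_simps)
      then show ?thesis by (simp add: C_def)
    qed
    moreover have "0 \<le> C" using K0 by (simp add: C_def)
    ultimately show ?thesis by blast
  qed
  then obtain C where C: "\<And>b. b \<in> Basis \<Longrightarrow> 0 \<le> C b" "\<And>b z. b \<in> Basis \<Longrightarrow> \<bar>z \<bullet> b\<bar> ^ N * norm (ker ?f z) \<le> C b"
    by metis
  define D where "D = (\<Sum>b\<in>Basis. C b)"
  have D: "norm z ^ N * norm (ker ?f z) \<le> real DIM('a) ^ N * D" for z
  proof -
    define m where "m = Max ((\<lambda>b. \<bar>z \<bullet> b\<bar>) ` Basis)"
    have "m \<in> (\<lambda>b. \<bar>z \<bullet> b\<bar>) ` Basis" unfolding m_def by (intro Max_in) auto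
    then obtain b where b: "b \<in> Basis" "m = \<bar>z \<bullet> b\<bar>" by auto
    have "norm z \<le> (\<Sum>b\<in>Basis. \<bar>z \<bullet> b\<bar>)" by (rule norm_le_l1)
    also have "\<dots> \<le> real DIM('a) * m"
      using sum_bounded_above[of Basis "\<lambda>b. \<bar>z \<bullet> b\<bar>" m] by (simp add: m_def)
    finally have "norm z ^ N \<le> (real DIM('a) * m) ^ N" by (intro power_mono) auto
    then have "norm z ^ N * norm (ker ?f z) \<le> real DIM('a) ^ N * (\<bar>z \<bullet> b\<bar> ^ N * norm (ker ?f z))"
      using mult_right_mono[of _ _ "norm (ker ?f z)"] b by (fastforce simp: power_mult_distrib mult.assoc)
    also have "\<dots> \<le> real DIM('a) ^ N * D"
      unfolding D_def using C b member_le_sum[of b Basis C] by (intro mult_left_mono) (force intro: order_trans)+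
    finally show ?thesis .
  qed
  show ?thesis
  proof (rule wsymI[OF bs], rule nn_integral_decay_finite)
    show "ker ?f \<in> borel_measurable borel" by (rule ker_measurable[OF bs])
    show "(1 + norm z) ^ (DIM('a) + 2) * norm (ker ?f z) \<le> 2 ^ N * (K + real DIM('a) ^ N * D)" for z
    proof -
      have "(1 + norm z) ^ N \<le> 2 ^ N * (1 + norm z ^ N)"
      proof (cases "norm z \<le> 1")
        case True
        then have "(1 + norm z) ^ N \<le> 2 ^ N" by (intro power_mono) auto
        also have "\<dots> \<le> 2 ^ N * (1 + norm z ^ N)" by simp
        finally show ?thesis .
      next
        case False
        then have "(1 + norm z) ^ N \<le> (2 * norm z) ^ N" by (intro power_mono) auto
        then show ?thesis by (simp add: power_mult_distrib distrib_left) (smt (verit) zero_le_power)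
      qed
      then have "(1 + norm z) ^ N * norm (ker ?f z) \<le> 2 ^ N * (1 + norm z ^ N) * norm (ker ?f z)"
        by (rule mult_right_mono) simp
      also have "\<dots> = 2 ^ N * (norm (ker ?f z) + norm z ^ N * norm (ker ?f z))" by (simp add: algebra_simps)
      also have "\<dots> \<le> 2 ^ N * (K + real DIM('a) ^ N * D)" by (intro mult_left_mono add_mono K D) auto
      finally show ?thesis by (simp add: N_def)
    qed
  qed
qed

section \<open>The partition of unity\<close>

text \<open>The support in the cube is used in the form |\<xi>| \<le> CARD('n), since the Euclidean
  norm is at most the sum of the moduli of the coordinates.\<close>

lemma decomposition_function_dest:
  fixes \<rho> :: "real^'n \<Rightarrow> real"
  assumes "decomposition_function \<rho>"
  shows "smooth_on UNIV \<rho>" "0 \<le> \<rho> \<xi>" "\<rho> \<xi> \<le> 1" "real CARD('n) < norm \<xi> \<Longrightarrow> \<rho> \<xi> = 0"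
    "(\<And>i. \<bar>\<xi> $ i\<bar> \<le> 1/2) \<Longrightarrow> \<rho> \<xi> = 1"
proof -
  have sub: "closure {\<xi>. \<rho> \<xi> \<noteq> 0} \<subseteq> {\<xi>. \<forall>i. \<bar>\<xi> $ i\<bar> \<le> 1}"
    using assms by (simp only: decomposition_function_def)
  show "real CARD('n) < norm \<xi> \<Longrightarrow> \<rho> \<xi> = 0"
  proof (rule ccontr)
    assume n: "real CARD('n) < norm \<xi>" "\<rho> \<xi> \<noteq> 0"
    then have "\<xi> \<in> closure {\<xi>. \<rho> \<xi> \<noteq> 0}" by (intro subsetD[OF closure_subset]) simp
    from subsetD[OF sub this] have "\<bar>\<xi> $ i\<bar> \<le> 1" for i by simp
    then have "(\<Sum>i\<in>UNIV. \<bar>\<xi> $ i\<bar>) \<le> real CARD('n)" using sum_bounded_above[of UNIV "\<lambda>i. \<bar>\<xi> $ i\<bar>" 1] by simp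
    then show False using norm_le_l1_cart[of \<xi>] n by simp
  qed
  show "smooth_on UNIV \<rho>" "0 \<le> \<rho> \<xi>" "\<rho> \<xi> \<le> 1"
    using assms by (simp_all only: decomposition_function_def)
  show "(\<And>i. \<bar>\<xi> $ i\<bar> \<le> 1/2) \<Longrightarrow> \<rho> \<xi> = 1"
    using assms by (simp only: decomposition_function_def) metis
qed

context
  fixes \<rho> :: "real^'n \<Rightarrow> real"
  assumes rho: "decomposition_function \<rho>"
begin

definition lattice_sum :: "real^'n \<Rightarrow> real" where
  "lattice_sum \<xi> = (\<Sum>m\<in>{m. norm (\<xi> - real_vec m) \<le> real CARD('n)}. \<rho> (\<xi> - real_vec m))"

lemma finite_lattice_ball': "finite {m. norm (\<xi> - real_vec m) \<le> r}"
proof (rule finite_subset[OF _ finite_lattice_ball])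
  show "{m. norm (\<xi> - real_vec m) \<le> r} \<subseteq> {m. norm (real_vec m) \<le> norm \<xi> + r}"
    using norm_triangle_ineq2[of "real_vec _" \<xi>] norm_minus_commute[of \<xi>] by (smt (verit) Collect_mono)
qed

lemma sum_rho_eq:
  assumes "finite M" "{m. norm (\<xi> - real_vec m) \<le> real CARD('n)} \<subseteq> M"
  shows "(\<Sum>m\<in>M. \<rho> (\<xi> - real_vec m)) = lattice_sum \<xi>"
  unfolding lattice_sum_def
  by (rule sum.mono_neutral_right) (use assms decomposition_function_dest(4)[OF rho] in auto)

lemma infsum_rho: "(\<Sum>\<^sub>\<infinity>m\<in>UNIV. \<rho> (\<xi> - real_vec m)) = lattice_sum \<xi>"
proof -
  have "(\<Sum>\<^sub>\<infinity>m\<in>UNIV. \<rho> (\<xi> - real_vec m)) = (\<Sum>\<^sub>\<infinity>m\<in>{m. norm (\<xi> - real_vec m) \<le> real CARD('n)}. \<rho> (\<xi> - real_vec m))"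
    by (rule infsum_cong_neutral) (use decomposition_function_dest(4)[OF rho] in auto)
  then show ?thesis by (simp add: finite_lattice_ball' lattice_sum_def)
qed

text \<open>Rounding every coordinate of \<xi> gives a lattice point m whose difference to \<xi>
  lies in the cube where \<rho> equals 1.\<close>

lemma lattice_sum_ge_1: "1 \<le> lattice_sum \<xi>"
proof -
  define m :: "int^'n" where "m = (\<chi> i. round (\<xi> $ i))"
  have "\<rho> (\<xi> - real_vec m) = 1"
  proof (rule decomposition_function_dest(5)[OF rho])
    show "\<bar>(\<xi> - real_vec m) $ i\<bar> \<le> 1/2" for i
      using of_int_round_abs_le[of "\<xi> $ i"] by (simp add: m_def real_vec_def abs_minus_commute)
  qed
  moreover from this have "m \<in> {m. norm (\<xi> - real_vec m) \<le> real CARD('n)}"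
    using decomposition_function_dest(4)[OF rho, of "\<xi> - real_vec m"] by force
  moreover have "\<rho> (\<xi> - real_vec m) \<le> lattice_sum \<xi>"
    unfolding lattice_sum_def
    by (rule member_le_sum) (use calculation finite_lattice_ball' decomposition_function_dest(2)[OF rho] in auto)
  ultimately show ?thesis by simp
qed

text \<open>By this periodicity all symbols of the decomposition are translates of the single
  function \<open>sigma0\<close>.\<close>

lemma lattice_sum_periodic: "lattice_sum (\<xi> - real_vec k) = lattice_sum \<xi>"
proof -
  have "lattice_sum (\<xi> - real_vec k) = (\<Sum>\<^sub>\<infinity>m\<in>UNIV. \<rho> (\<xi> - real_vec (k + m)))"
    by (simp add: infsum_rho[symmetric] real_vec_simps diff_diff_eq)
  also have "\<dots> = (\<Sum>\<^sub>\<infinity>m\<in>UNIV. \<rho> (\<xi> - real_vec m))"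
    by (rule infsum_reindex_bij_betw[of "\<lambda>m. k + m" UNIV UNIV "\<lambda>m. \<rho> (\<xi> - real_vec m)"]) (rule o_bij[where g="\<lambda>m. m - k"], auto simp: fun_eq_iff)
  finally show ?thesis by (simp add: infsum_rho)
qed

definition sigma0 :: "real^'n \<Rightarrow> real" where "sigma0 \<xi> = \<rho> \<xi> / lattice_sum \<xi>"

lemma decomposition_symbol_eq: "decomposition_symbol \<rho> k \<xi> = sigma0 (\<xi> - real_vec k)"
  by (simp add: decomposition_symbol_def sigma0_def infsum_rho lattice_sum_periodic)

lemma sigma0_uniform_decomp: "uniform_decomp sigma0 (real CARD('n))"
proof
  have lpos: "lattice_sum \<xi> \<noteq> 0" for \<xi> using lattice_sum_ge_1[of \<xi>] by linarith
  have "dirC N b sigma0" if b: "b \<in> Basis" for b N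
  proof -
    have r: "dirC N b \<rho>" by (rule smooth_on_dirC[OF decomposition_function_dest(1)[OF rho] b])
    have "dirC N b lattice_sum" unfolding lattice_sum_def[abs_def]
      by (rule dirC_locally_finite_sum[OF r]) (use decomposition_function_dest(4)[OF rho] in auto)
    from dirC_mult[OF r dirC_inverse[OF this lpos]]
    show ?thesis by (simp add: sigma0_def[abs_def] divide_inverse)
  qed
  then show "wsym (\<lambda>\<xi>. complex_of_real (sigma0 \<xi>))"
    by (rule wsym_dirC[where r="real CARD('n)"]) (auto simp: sigma0_def decomposition_function_dest(4)[OF rho])
  show "0 \<le> sigma0 \<xi>" for \<xi>
    using decomposition_function_dest(2)[OF rho] lattice_sum_ge_1[of \<xi>] by (auto simp: sigma0_def)
  show "0 < sigma0 0"
    using decomposition_function_dest(5)[OF rho, of 0] lattice_sum_ge_1[of 0] by (auto simp: sigma0_def)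
  show "real CARD('n) < norm \<xi> \<Longrightarrow> sigma0 \<xi> = 0" for \<xi>
    by (simp add: sigma0_def decomposition_function_dest(4)[OF rho])
  show "1 \<le> real CARD('n)" by (simp add: Suc_leI)
  fix M :: "(int^'n) set" and \<xi>
  assume M: "finite M" "{m. norm (\<xi> - real_vec m) \<le> real CARD('n)} \<subseteq> M"
  have "(\<Sum>m\<in>M. sigma0 (\<xi> - real_vec m)) = (\<Sum>m\<in>M. \<rho> (\<xi> - real_vec m)) / lattice_sum \<xi>"
    by (simp add: sigma0_def lattice_sum_periodic sum_divide_distrib)
  then show "(\<Sum>m\<in>M. sigma0 (\<xi> - real_vec m)) = 1"
    using sum_rho_eq[OF M] lpos by simp
qed

end

section \<open>The box operators\<close>

lemma iterated_partial_support:
  fixes f :: "'a::euclidean_space \<Rightarrow> complex"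
  assumes "\<And>x. r < norm x \<Longrightarrow> f x = 0" "r < norm x"
  shows "iterated_partial bs f x = 0"
  using assms(2)
proof (induction bs arbitrary: x)
  case (Cons b bs)
  have "((\<lambda>_. 0) has_derivative (\<lambda>_. 0)) (at x)" by simp
  then have "(iterated_partial bs f has_derivative (\<lambda>_. 0)) (at x)"
  proof (rule has_derivative_transform_within_open)
    have "{x::'a. r < norm x} = - cball 0 r" by auto
    then show "open {x::'a. r < norm x}" by (simp add: open_Compl)
  qed (use Cons in auto)
  then have "frechet_derivative (iterated_partial bs f) (at x) = (\<lambda>_. 0)"
    by (rule frechet_derivative_at[symmetric])
  then show ?case by simp
qed (use assms in simp)

text \<open>Supplies test functions: the dilated translates of \<rho> belong to
  \<open>schwartz\<close>, which is enough to identify the function that represents a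
  distribution.\<close>

lemma schwartz_compact_support:
  fixes f :: "'a::euclidean_space \<Rightarrow> complex"
  assumes f: "smooth_on UNIV f" and fz: "\<And>x. r < norm x \<Longrightarrow> f x = 0"
  shows "f \<in> schwartz"
  unfolding schwartz_def
proof (intro CollectI conjI allI impI f)
  fix bs :: "'a list" and N assume bs: "set bs \<subseteq> Basis"
  have "continuous_on UNIV (iterated_partial bs f)"
    using f bs unfolding smooth_on_def
    by (auto intro!: differentiable_imp_continuous_on simp: differentiable_on_def differentiable_at_withinI)
  note c = this
  have "bsupp (\<lambda>x. complex_of_real ((1 + norm x) ^ N) * iterated_partial bs f x)"
    unfolding bsupp_def
  proof (intro conjI exI allI impI)
    show "continuous_on UNIV (\<lambda>x. complex_of_real ((1 + norm x) ^ N) * iterated_partial bs f x)"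
      by (intro continuous_on_mult c continuous_intros)
    show "complex_of_real ((1 + norm x) ^ N) * iterated_partial bs f x = 0" if "r < norm x" for x
      using iterated_partial_support[OF fz that] by simp
  qed
  from bsupp_bounded[OF this] obtain B
    where B: "\<And>x. norm (complex_of_real ((1 + norm x) ^ N) * iterated_partial bs f x) \<le> B" by blast
  have "norm (complex_of_real ((1 + norm x) ^ N)) = (1 + norm x) ^ N" for x :: 'a
    by (simp only: norm_of_real abs_of_nonneg zero_le_power add_nonneg_nonneg zero_le_one norm_ge_zero)
  then show "\<exists>C. \<forall>x. (1 + norm x) ^ N * norm (iterated_partial bs f x) \<le> C"
    using B by (intro exI[of _ B]) (simp only: norm_mult simp_thms)
qed

lemma iterated_partial_dilate:
  fixes f :: "'a::euclidean_space \<Rightarrow> real"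
  assumes f: "smooth_on UNIV f" and bs: "set bs \<subseteq> Basis"
  shows "iterated_partial bs (\<lambda>x. complex_of_real (f (c *\<^sub>R (x - y)))) =
     (\<lambda>x. complex_of_real (c ^ length bs * iterated_partial bs f (c *\<^sub>R (x - y))))"
    and "iterated_partial bs (\<lambda>x. complex_of_real (f (c *\<^sub>R (x - y)))) differentiable (at x)"
proof -
  have D: "((\<lambda>x. complex_of_real (c ^ n * iterated_partial bs f (c *\<^sub>R (x - y)))) has_derivative
     (\<lambda>h. complex_of_real (c ^ n * frechet_derivative (iterated_partial bs f) (at (c *\<^sub>R (x - y))) (c *\<^sub>R h)))) (at x)"
    if "set bs \<subseteq> Basis" for bs n x
  proof -
    have 1: "(iterated_partial bs f has_derivative frechet_derivative (iterated_partial bs f) (at (c *\<^sub>R (x - y)))) (at (c *\<^sub>R (x - y)))"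
      using f that unfolding smooth_on_def by (simp add: frechet_derivative_works[symmetric])
    have 2: "((\<lambda>x. c *\<^sub>R (x - y)) has_derivative (\<lambda>h. c *\<^sub>R h)) (at x)"
      by (auto intro!: derivative_eq_intros)
    show ?thesis
      by (intro has_derivative_of_real has_derivative_mult_right has_derivative_compose[OF 2 1])
  qed
  have eq: "iterated_partial bs (\<lambda>x. complex_of_real (f (c *\<^sub>R (x - y)))) =
     (\<lambda>x. complex_of_real (c ^ length bs * iterated_partial bs f (c *\<^sub>R (x - y))))" if "set bs \<subseteq> Basis" for bs
    using that
  proof (induction bs)
    case (Cons b bs)
    then have bs: "set bs \<subseteq> Basis" by simp
    show ?case
    proof
      fix x
      have lin: "linear (frechet_derivative (iterated_partial bs f) (at (c *\<^sub>R (x - y))))"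
        using f bs unfolding smooth_on_def by (auto intro: linear_frechet_derivative)
      have "frechet_derivative (\<lambda>x. complex_of_real (c ^ length bs * iterated_partial bs f (c *\<^sub>R (x - y)))) (at x) b =
         complex_of_real (c ^ length bs * frechet_derivative (iterated_partial bs f) (at (c *\<^sub>R (x - y))) (c *\<^sub>R b))"
        by (rule fun_cong[OF frechet_derivative_at[OF D[OF bs], symmetric]])
      then show "iterated_partial (b # bs) (\<lambda>x. complex_of_real (f (c *\<^sub>R (x - y)))) x =
        complex_of_real (c ^ length (b # bs) * iterated_partial (b # bs) f (c *\<^sub>R (x - y)))"
        by (simp only: iterated_partial.simps Cons.IH[OF bs] linear_scale[OF lin] list.size real_scaleR_def power_add power_one_right mult.assoc)
           (simp add: mult_ac)
    qed
  qed simp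
  show "iterated_partial bs (\<lambda>x. complex_of_real (f (c *\<^sub>R (x - y)))) =
     (\<lambda>x. complex_of_real (c ^ length bs * iterated_partial bs f (c *\<^sub>R (x - y))))" by (rule eq[OF bs])
  show "iterated_partial bs (\<lambda>x. complex_of_real (f (c *\<^sub>R (x - y)))) differentiable (at x)"
    unfolding eq[OF bs] using D[OF bs] unfolding differentiable_def by blast
qed

lemma schwartz_measurable_integrable:
  assumes "\<phi> \<in> schwartz"
  shows "\<phi> \<in> borel_measurable borel" "(\<integral>\<^sup>+x. ennreal (norm (\<phi> x)) \<partial>lborel) < \<infinity>"
proof -
  have "iterated_partial [] \<phi> differentiable (at x)" for x
    using assms unfolding schwartz_def smooth_on_def
    by (metis (mono_tags, lifting) UNIV_I empty_subsetI list.set(1) mem_Collect_eq)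
  then have "continuous_on UNIV \<phi>"
    by (auto intro!: differentiable_imp_continuous_on simp: differentiable_on_def differentiable_at_withinI)
  then show m: "\<phi> \<in> borel_measurable borel" by (rule borel_measurable_continuous_onI)
  have "\<forall>bs N. set bs \<subseteq> Basis \<longrightarrow> (\<exists>C. \<forall>x. (1 + norm x) ^ N * norm (iterated_partial bs \<phi> x) \<le> C)"
    using assms unfolding schwartz_def by simp
  from this[rule_format, of "[]" "DIM('a) + 2"]
  obtain C where C: "\<And>x. (1 + norm x) ^ (DIM('a) + 2) * norm (\<phi> x) \<le> C" by auto
  show "(\<integral>\<^sup>+x. ennreal (norm (\<phi> x)) \<partial>lborel) < \<infinity>"
    by (rule nn_integral_decay_finite[OF m C])
qed

text \<open>The triangle inequality is Minkowski's inequality for the counting measure on the two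
  truth values.\<close>

lemma cN_diff_finite:
  assumes p: "1 < p" and [measurable]: "f \<in> borel_measurable borel" "g \<in> borel_measurable borel"
    and fin: "cN p f < \<infinity>" "cN p g < \<infinity>"
  shows "cN p (\<lambda>x. f x - g x) < \<infinity>"
proof -
  have "cN p (\<lambda>x. f x - g x) \<le> lpn lborel p (\<lambda>x. \<integral>\<^sup>+b. ennreal (norm (if b then f x else g x)) \<partial>count_space (UNIV::bool set))"
    unfolding cN_def
  proof (rule lpn_mono)
    fix x show "ennreal (norm (f x - g x)) \<le> (\<integral>\<^sup>+b. ennreal (norm (if b then f x else g x)) \<partial>count_space (UNIV::bool set))"
      using norm_triangle_ineq4[of "f x" "g x"]
      by (simp add: nn_integral_count_space_finite UNIV_bool ennreal_leI add.commute flip: ennreal_plus)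
  qed (use p in simp)
  also have "\<dots> \<le> (\<integral>\<^sup>+b. lpn lborel p (\<lambda>x. ennreal (norm (if b then f x else g x))) \<partial>count_space (UNIV::bool set))"
    using p by (intro lpn_minkowski sigma_finite_measure_count_space_countable lborel.sigma_finite_measure_axioms
      measurable_pair_measure_countable1) auto
  also have "\<dots> < \<infinity>" using fin by (simp add: nn_integral_count_space_finite UNIV_bool cN_def)
  finally show ?thesis .
qed

lemma Lp_norm_eq_cN:
  fixes f :: "real^'n \<Rightarrow> complex"
  assumes P: "0 < P" and f': "f' \<in> borel_measurable borel" "AE x in lborel. f x = f' x"
  shows "Lp_norm (ennreal P) f = cN P f'"
proof -
  note [measurable] = f'(1)
  have ae: "AE x in lebesgue. f x = f' x" using f'(2) by (rule AE_completion)
  have "(\<integral>\<^sup>+x. ennreal (norm (f x) powr P) \<partial>lebesgue) = (\<integral>\<^sup>+x. ennreal (norm (f' x) powr P) \<partial>lebesgue)"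
    using ae by (intro nn_integral_cong_AE) auto
  also have "\<dots> = (\<integral>\<^sup>+x. ennreal (norm (f' x) powr P) \<partial>lborel)" by (rule nn_integral_completion)
  finally show ?thesis using P by (simp add: Lp_norm_def cN_def lpn_def)
qed

lemma borel_representative:
  fixes f :: "real^'n \<Rightarrow> complex"
  assumes "f \<in> borel_measurable lebesgue"
  obtains f' where "f' \<in> borel_measurable borel" "AE x in lborel. f x = f' x"
proof -
  have re: "(\<lambda>x. Re (f x)) \<in> borel_measurable lebesgue" and im: "(\<lambda>x. Im (f x)) \<in> borel_measurable lebesgue"
    using measurable_compose[OF assms borel_measurable_Re] measurable_compose[OF assms borel_measurable_Im] by auto
  from completion_ex_borel_measurable_real[OF re]
  obtain g where g: "g \<in> borel_measurable lborel" "AE x in lborel. Re (f x) = g x" by auto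
  from completion_ex_borel_measurable_real[OF im]
  obtain h where h: "h \<in> borel_measurable lborel" "AE x in lborel. Im (f x) = h x" by auto
  show ?thesis
  proof (rule that)
    show "(\<lambda>x. complex_of_real (g x) + \<i> * complex_of_real (h x)) \<in> borel_measurable borel"
      using g(1) h(1) by simp
    show "AE x in lborel. f x = complex_of_real (g x) + \<i> * complex_of_real (h x)"
      using g(2) h(2) by eventually_elim (simp add: complex_eq_iff)
  qed
qed

lemma exp_ii_eq_cis: "exp (\<i> * of_real t) = cis t" "exp (- \<i> * of_real t) = cis (- t)"
  by (simp_all add: cis_conv_exp)

context
  fixes \<rho> :: "real^'n \<Rightarrow> real" and P :: real
  assumes rho: "decomposition_function \<rho>" and P: "1 < P"
begin

interpretation U: uniform_decomp "sigma0 \<rho>" "real CARD('n)" by (rule sigma0_uniform_decomp[OF rho])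

text \<open>One normalising factor comes from \<open>fourier\<close> and one from
  \<open>inv_fourier\<close>, each of which occurs once in \<open>box_op\<close>.\<close>

definition c2 :: real where "c2 = ((2 * pi) powr (- real CARD('n) / 2))\<^sup>2"

lemma c2_pos: "0 < c2" by (simp add: c2_def)

lemma symbol_eq: "complex_of_real (decomposition_symbol \<rho> k \<xi>) = U.sg k \<xi>"
  by (simp add: decomposition_symbol_eq[OF rho] U.sg_def)

text \<open>The transpose of \<open>box_op\<close> on a test function: interchanging the two
  integrals leaves a convolution with the kernel of \<open>sg k\<close>. A further interchange in
  \<open>box_op_eq\<close> shows that the distribution is, up to \<open>c2\<close>, the function
  \<open>conv_op\<close> of f.\<close>

lemma multiplier_kernel:
  assumes phi: "\<phi> \<in> schwartz"
  shows "fourier (\<lambda>\<xi>. of_real (decomposition_symbol \<rho> k \<xi>) * inv_fourier \<phi> \<xi>) x =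
     of_real c2 * (LINT y|lborel. \<phi> y * ker (U.sg k) (x - y))"
proof -
  let ?c = "complex_of_real ((2 * pi) powr (- real CARD('n) / 2))"
  note [measurable] = schwartz_measurable_integrable(1)[OF phi]
  note sgm [measurable] = bsupp_measurable[OF wsym_bsupp[OF U.wsym_sg[of k]]]
  have inv: "inv_fourier \<phi> \<xi> = ?c * (LINT y|lborel. \<phi> y * cis (\<xi> \<bullet> y))" for \<xi>
    unfolding inv_fourier_def exp_ii_eq_cis by (subst integral_completion) auto
  have m: "(\<lambda>\<xi>. LINT y|lborel. \<phi> y * cis (\<xi> \<bullet> y)) \<in> borel_measurable borel"
    by (intro lborel.borel_measurable_lebesgue_integral) measurable
  note [measurable] = m
  have "fourier (\<lambda>\<xi>. of_real (decomposition_symbol \<rho> k \<xi>) * inv_fourier \<phi> \<xi>) x =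
     ?c * (LINT \<xi>|lborel. U.sg k \<xi> * (?c * (LINT y|lborel. \<phi> y * cis (\<xi> \<bullet> y))) * cis (- (\<xi> \<bullet> x)))"
    unfolding fourier_def exp_ii_eq_cis symbol_eq inv by (subst integral_completion) auto
  also have "(LINT \<xi>|lborel. U.sg k \<xi> * (?c * (LINT y|lborel. \<phi> y * cis (\<xi> \<bullet> y))) * cis (- (\<xi> \<bullet> x))) =
     (LINT \<xi>|lborel. ?c * (LINT y|lborel. U.sg k \<xi> * (\<phi> y * cis (- ((x - y) \<bullet> \<xi>)))))"
  proof (rule Bochner_Integration.integral_cong[OF refl])
    fix \<xi>
    have eq: "U.sg k \<xi> * (\<phi> y * cis (- ((x - y) \<bullet> \<xi>))) = U.sg k \<xi> * cis (- (\<xi> \<bullet> x)) * (\<phi> y * cis (\<xi> \<bullet> y))" for y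
    proof -
      have "cis (- ((x - y) \<bullet> \<xi>)) = cis (- (\<xi> \<bullet> x)) * cis (\<xi> \<bullet> y)"
        by (simp add: cis_mult inner_commute[of _ \<xi>] inner_diff_right)
      then show ?thesis by (simp only: mult_ac)
    qed
    show "U.sg k \<xi> * (?c * (LINT y|lborel. \<phi> y * cis (\<xi> \<bullet> y))) * cis (- (\<xi> \<bullet> x)) =
      ?c * (LINT y|lborel. U.sg k \<xi> * (\<phi> y * cis (- ((x - y) \<bullet> \<xi>))))"
      unfolding eq integral_mult_right_zero by (simp only: mult_ac)
  qed
  also have "\<dots> = ?c * (LINT \<xi>|lborel. LINT y|lborel. U.sg k \<xi> * (\<phi> y * cis (- ((x - y) \<bullet> \<xi>))))"
    by (rule integral_mult_right_zero)
  also have "(LINT \<xi>|lborel. LINT y|lborel. U.sg k \<xi> * (\<phi> y * cis (- ((x - y) \<bullet> \<xi>)))) =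
     (LINT y|lborel. LINT \<xi>|lborel. U.sg k \<xi> * (\<phi> y * cis (- ((x - y) \<bullet> \<xi>))))"
  proof (rule lint_swap_lborel)
    have "(\<integral>\<^sup>+\<xi>. (\<integral>\<^sup>+y. ennreal (norm (U.sg k \<xi> * (\<phi> y * cis (- ((x - y) \<bullet> \<xi>))))) \<partial>lborel) \<partial>lborel) =
      (\<integral>\<^sup>+\<xi>. ennreal (norm (U.sg k \<xi>)) \<partial>lborel) * (\<integral>\<^sup>+y. ennreal (norm (\<phi> y)) \<partial>lborel)"
      by (simp add: norm_mult ennreal_mult nn_integral_cmult nn_integral_multc)
    also have "\<dots> < \<infinity>"
      using schwartz_measurable_integrable(2)[OF phi] bsupp_integrable[OF wsym_bsupp[OF U.wsym_sg[of k]]]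
      by (simp add: integrable_iff_nn ennreal_mult_less_top)
    finally show "(\<integral>\<^sup>+\<xi>. (\<integral>\<^sup>+y. ennreal (norm (U.sg k \<xi> * (\<phi> y * cis (- ((x - y) \<bullet> \<xi>))))) \<partial>lborel) \<partial>lborel) < \<infinity>" .
  qed measurable
  also have "\<dots> = (LINT y|lborel. \<phi> y * ker (U.sg k) (x - y))"
  proof (rule Bochner_Integration.integral_cong[OF refl])
    fix y
    have eq: "U.sg k \<xi> * (\<phi> y * cis (- ((x - y) \<bullet> \<xi>))) = \<phi> y * (U.sg k \<xi> * cis (- ((x - y) \<bullet> \<xi>)))" for \<xi>
      by (simp only: mult_ac)
    show "(LINT \<xi>|lborel. U.sg k \<xi> * (\<phi> y * cis (- ((x - y) \<bullet> \<xi>)))) = \<phi> y * ker (U.sg k) (x - y)"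
      unfolding eq integral_mult_right_zero ker_def ..
  qed
  finally show ?thesis by (simp add: c2_def power2_eq_square)
qed

lemma box_op_eq:
  assumes f: "f \<in> borel_measurable lebesgue" and f' [measurable]: "f' \<in> borel_measurable borel"
    and ae: "AE x in lborel. f x = f' x" and fin: "cN P f' < \<infinity>" and phi: "\<phi> \<in> schwartz"
  shows "box_op \<rho> k f \<phi> = (LINT y|lborel. of_real c2 * conv_op (U.sg k) f' y * \<phi> y)"
proof -
  note [measurable] = schwartz_measurable_integrable(1)[OF phi]
  note [measurable] = ker_measurable[OF wsym_bsupp[OF U.wsym_sg[of k]]]
  have m: "(\<lambda>x. LINT y|lborel. \<phi> y * ker (U.sg k) (x - y)) \<in> borel_measurable borel"
    by (intro lborel.borel_measurable_lebesgue_integral) measurable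
  note [measurable] = m
  have "box_op \<rho> k f \<phi> = (LINT x|lebesgue. f x * (of_real c2 * (LINT y|lborel. \<phi> y * ker (U.sg k) (x - y))))"
    unfolding box_op_def dist_inv_fourier_def dist_mult_def dist_fourier_def dist_of_fun_def multiplier_kernel[OF phi] ..
  also have "\<dots> = (LINT x|lebesgue. f' x * (of_real c2 * (LINT y|lborel. \<phi> y * ker (U.sg k) (x - y))))"
  proof (rule integral_cong_AE)
    have m': "(\<lambda>x. of_real c2 * (LINT y|lborel. \<phi> y * ker (U.sg k) (x - y))) \<in> borel_measurable lebesgue"
      by (intro measurable_completion) measurable
    show "(\<lambda>x. f x * (of_real c2 * (LINT y|lborel. \<phi> y * ker (U.sg k) (x - y)))) \<in> borel_measurable lebesgue"
      by (intro borel_measurable_times f m')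
    show "(\<lambda>x. f' x * (of_real c2 * (LINT y|lborel. \<phi> y * ker (U.sg k) (x - y)))) \<in> borel_measurable lebesgue"
      by (intro measurable_completion) measurable
    show "AE x in lebesgue. f x * (of_real c2 * (LINT y|lborel. \<phi> y * ker (U.sg k) (x - y))) =
       f' x * (of_real c2 * (LINT y|lborel. \<phi> y * ker (U.sg k) (x - y)))"
      using AE_completion[OF ae] by eventually_elim simp
  qed
  also have "\<dots> = (LINT x|lborel. f' x * (of_real c2 * (LINT y|lborel. \<phi> y * ker (U.sg k) (x - y))))"
    by (rule integral_completion) measurable
  also have "\<dots> = (LINT x|lborel. of_real c2 * (LINT y|lborel. \<phi> y * (f' x * ker (U.sg k) (x - y))))"
  proof (rule Bochner_Integration.integral_cong[OF refl])
    fix x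
    have eq: "\<phi> y * (f' x * ker (U.sg k) (x - y)) = f' x * (\<phi> y * ker (U.sg k) (x - y))" for y by (simp only: mult_ac)
    show "f' x * (of_real c2 * (LINT y|lborel. \<phi> y * ker (U.sg k) (x - y))) = of_real c2 * (LINT y|lborel. \<phi> y * (f' x * ker (U.sg k) (x - y)))"
      unfolding eq integral_mult_right_zero by (simp only: mult_ac)
  qed
  also have "\<dots> = of_real c2 * (LINT x|lborel. LINT y|lborel. \<phi> y * (f' x * ker (U.sg k) (x - y)))"
    by (rule integral_mult_right_zero)
  also have "(LINT x|lborel. LINT y|lborel. \<phi> y * (f' x * ker (U.sg k) (x - y))) =
      (LINT y|lborel. LINT x|lborel. \<phi> y * (f' x * ker (U.sg k) (x - y)))"
  proof (rule lint_swap_lborel[symmetric])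
    have "(\<integral>\<^sup>+y. (\<integral>\<^sup>+x. ennreal (norm (\<phi> y * (f' x * ker (U.sg k) (x - y)))) \<partial>lborel) \<partial>lborel) =
       (\<integral>\<^sup>+y. ennreal (norm (\<phi> y)) * (\<integral>\<^sup>+x. ennreal (norm (f' x * ker (U.sg k) (x - y))) \<partial>lborel) \<partial>lborel)"
      by (simp add: norm_mult ennreal_mult nn_integral_cmult)
    also have "\<dots> \<le> (\<integral>\<^sup>+y. ennreal (norm (\<phi> y)) * (cN P f' * kC P (U.sg k)) \<partial>lborel)"
      by (intro nn_integral_mono mult_left_mono conv_bound[OF P U.wsym_sg]) auto
    also have "\<dots> = (\<integral>\<^sup>+y. ennreal (norm (\<phi> y)) \<partial>lborel) * (cN P f' * kC P (U.sg k))" by (simp add: nn_integral_multc)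
    also have "\<dots> < \<infinity>"
      using schwartz_measurable_integrable(2)[OF phi] fin kC_finite[OF U.wsym_sg[of k]] by (simp add: ennreal_mult_less_top)
    finally show "(\<integral>\<^sup>+y. (\<integral>\<^sup>+x. ennreal (norm (\<phi> y * (f' x * ker (U.sg k) (x - y)))) \<partial>lborel) \<partial>lborel) < \<infinity>" .
  qed measurable
  also have "\<dots> = (LINT y|lborel. \<phi> y * conv_op (U.sg k) f' y)"
    unfolding integral_mult_right_zero conv_op_def ..
  also have "of_real c2 * \<dots> = (LINT y|lborel. of_real c2 * (\<phi> y * conv_op (U.sg k) f' y))"
    by (rule integral_mult_right_zero[symmetric])
  also have "\<dots> = (LINT y|lborel. of_real c2 * conv_op (U.sg k) f' y * \<phi> y)"
    by (simp only: mult_ac)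
  finally show ?thesis .
qed

lemma dist_norm_box_le:
  assumes f: "f \<in> borel_measurable lebesgue" and f' [measurable]: "f' \<in> borel_measurable borel"
    and ae: "AE x in lborel. f x = f' x" and fin: "cN P f' < \<infinity>"
  shows "dist_Lp_norm (ennreal P) (box_op \<rho> k f) \<le> ennreal c2 * cN P (conv_op (U.sg k) f')"
proof -
  define g where "g y = of_real c2 * conv_op (U.sg k) f' y" for y
  have cm [measurable]: "conv_op (U.sg k) f' \<in> borel_measurable borel" by (rule conv_op_measurable[OF U.wsym_sg f'])
  have gm [measurable]: "g \<in> borel_measurable borel" unfolding g_def[abs_def] by measurable
  have Lg: "Lp_norm (ennreal P) g = ennreal c2 * cN P (conv_op (U.sg k) f')"
    using Lp_norm_eq_cN[of P g g] gm P c2_pos by (simp add: g_def[abs_def] cN_cmult)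
  have "cN P (conv_op (U.sg k) f') \<le> kI (U.sg k) * cN P f'" by (rule cN_conv_op_le[OF P U.wsym_sg f'])
  also have "\<dots> < \<infinity>" using fin kI_finite[OF U.wsym_sg[of k]] by (simp add: ennreal_mult_less_top)
  finally have "Lp_norm (ennreal P) g < \<infinity>" by (simp add: Lg ennreal_mult_less_top)
  then have g: "g \<in> Lp_space (ennreal P)" by (simp add: Lp_space_def measurable_completion)
  have "box_op \<rho> k f \<phi> = dist_of_fun g \<phi>" if "\<phi> \<in> schwartz" for \<phi>
    unfolding box_op_eq[OF assms that] dist_of_fun_def g_def
    using schwartz_measurable_integrable(1)[OF that] by (subst integral_completion) auto
  then have "dist_Lp_norm (ennreal P) (box_op \<rho> k f) \<le> Lp_norm (ennreal P) g"
    unfolding dist_Lp_norm_def using g by (intro INF_lower) auto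
  then show ?thesis by (simp add: Lg)
qed

text \<open>Every L^p function that represents the distribution coincides almost everywhere with the
  convolution, so the infimum runs over a single value. Testing with dilated translates of \<rho>
  suffices to see this, as they form an approximate identity.\<close>

lemma dist_norm_box_ge:
  assumes f: "f \<in> borel_measurable lebesgue" and f' [measurable]: "f' \<in> borel_measurable borel"
    and ae: "AE x in lborel. f x = f' x" and fin: "cN P f' < \<infinity>"
  shows "ennreal c2 * cN P (conv_op (U.sg k) f') \<le> dist_Lp_norm (ennreal P) (box_op \<rho> k f)"
  unfolding dist_Lp_norm_def
proof (rule INF_greatest)
  fix g assume "g \<in> {g \<in> Lp_space (ennreal P). \<forall>\<phi>\<in>schwartz. box_op \<rho> k f \<phi> = dist_of_fun g \<phi>}"
  then have gL: "g \<in> borel_measurable lebesgue" "Lp_norm (ennreal P) g < \<infinity>"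
    and gphi: "\<And>\<phi>. \<phi> \<in> schwartz \<Longrightarrow> box_op \<rho> k f \<phi> = dist_of_fun g \<phi>"
    by (auto simp: Lp_space_def)
  obtain g' where g' [measurable]: "g' \<in> borel_measurable borel" and gae: "AE x in lborel. g x = g' x"
    using borel_representative[OF gL(1)] by blast
  have Lg: "Lp_norm (ennreal P) g = cN P g'" using Lp_norm_eq_cN[OF _ g' gae] P by simp
  define q where "q y = of_real c2 * conv_op (U.sg k) f' y" for y
  have cm [measurable]: "conv_op (U.sg k) f' \<in> borel_measurable borel" by (rule conv_op_measurable[OF U.wsym_sg f'])
  have qm [measurable]: "q \<in> borel_measurable borel" unfolding q_def[abs_def] by measurable
  have cq: "cN P q = ennreal c2 * cN P (conv_op (U.sg k) f')"
    using P c2_pos by (simp add: q_def[abs_def] cN_cmult)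
  have "cN P (conv_op (U.sg k) f') \<le> kI (U.sg k) * cN P f'" by (rule cN_conv_op_le[OF P U.wsym_sg f'])
  also have "\<dots> < \<infinity>" using fin kI_finite[OF U.wsym_sg[of k]] by (simp add: ennreal_mult_less_top)
  finally have qfin: "cN P q < \<infinity>" by (simp add: cq ennreal_mult_less_top)
  have gfin: "cN P g' < \<infinity>" using gL Lg by simp
  let ?K = "\<lambda>x. complex_of_real (\<rho> x)"
  have rz: "\<And>x. real CARD('n) < norm x \<Longrightarrow> \<rho> x = 0" by (rule decomposition_function_dest(4)[OF rho])
  obtain b0 :: "real^'n" where b0: "b0 \<in> Basis" using nonempty_Basis by blast
  have rc: "continuous_on UNIV \<rho>"
    using dirC_continuous[OF smooth_on_dirC[OF decomposition_function_dest(1)[OF rho] b0]] .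
  have Kb: "bsupp ?K" unfolding bsupp_def using rc rz by (auto intro!: continuous_intros)
  have "AE x in lborel. q x - g' x = 0"
  proof (rule zero_if_mollified_zero[OF P _ cN_diff_finite[OF P qm g' qfin gfin], where K="?K" and B=1])
    show Ki: "integrable lborel ?K" by (rule bsupp_integrable[OF Kb])
    show "norm (?K z) \<le> 1" for z using decomposition_function_dest(2,3)[OF rho, of z] by simp
    show "(LINT z|lborel. ?K z) \<noteq> 0"
    proof
      assume "(LINT z|lborel. ?K z) = 0"
      then have 0: "(LINT z|lborel. \<rho> z) = 0" by (simp only: integral_complex_of_real of_real_eq_0_iff)
      have "integrable lborel \<rho>"
        using integrable_norm[OF Ki] decomposition_function_dest(2)[OF rho] by simp
      then have "AE z in lborel. \<rho> z = 0"
        using 0 decomposition_function_dest(2)[OF rho] by (subst (asm) integral_nonneg_eq_0_iff_AE) auto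
      then have "?K 0 = 0" by (intro AE_zero_continuous[of ?K]) (use Kb in \<open>auto simp: bsupp_def\<close>)
      then show False using decomposition_function_dest(5)[OF rho, of 0] by simp
    qed
    show "(\<lambda>x. q x - g' x) \<in> borel_measurable borel" by measurable
    fix R :: nat and y :: "real^'n" assume R: "0 < R"
    let ?\<phi> = "\<lambda>x. ?K (real R *\<^sub>R (x - y))"
    have phi: "?\<phi> \<in> schwartz"
    proof (rule schwartz_compact_support[where r="real CARD('n) / real R + norm y"])
      show "smooth_on UNIV ?\<phi>"
        unfolding smooth_on_def using iterated_partial_dilate(2)[OF decomposition_function_dest(1)[OF rho]] by blast
      fix x :: "real^'n" assume "real CARD('n) / real R + norm y < norm x"
      then have "real CARD('n) / real R < norm (x - y)" using norm_triangle_ineq2[of x y] by simp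
      then have "real CARD('n) < norm (real R *\<^sub>R (x - y))" using R unfolding norm_scaleR by (simp add: field_simps)
      then show "?\<phi> x = 0" using rz by simp
    qed
    have pb: "bsupp ?\<phi>"
      unfolding bsupp_def
    proof (intro conjI exI allI impI)
      show "continuous_on UNIV ?\<phi>"
        by (intro continuous_intros continuous_on_compose2[OF rc]) auto
      fix x :: "real^'n" assume "real CARD('n) / real R + norm y < norm x"
      then have "real CARD('n) / real R < norm (x - y)" using norm_triangle_ineq2[of x y] by simp
      then have "real CARD('n) < norm (real R *\<^sub>R (x - y))" using R unfolding norm_scaleR by (simp add: field_simps)
      then show "?\<phi> x = 0" using rz by simp
    qed
    have "(LINT x|lborel. q x * ?\<phi> x) = dist_of_fun g ?\<phi>"
      using box_op_eq[OF assms phi] gphi[OF phi] by (simp add: q_def)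
    also have "\<dots> = (LINT x|lebesgue. g' x * ?\<phi> x)"
      unfolding dist_of_fun_def
    proof (rule integral_cong_AE)
      note pm = bsupp_measurable[OF pb]
      show "(\<lambda>x. g x * ?\<phi> x) \<in> borel_measurable lebesgue"
        using pm by (intro borel_measurable_times gL measurable_completion) simp
      show "(\<lambda>x. g' x * ?\<phi> x) \<in> borel_measurable lebesgue"
        using pm by (intro measurable_completion borel_measurable_times) auto
      show "AE x in lebesgue. g x * ?\<phi> x = g' x * ?\<phi> x"
        using AE_completion[OF gae] by eventually_elim simp
    qed
    also have "\<dots> = (LINT x|lborel. g' x * ?\<phi> x)"
      using bsupp_measurable[OF pb] by (intro integral_completion borel_measurable_times) auto
    finally show "(LINT x|lborel. (q x - g' x) * ?K (real R *\<^sub>R (x - y))) = 0"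
      using test_integrable[OF P qm qfin pb] test_integrable[OF P g' gfin pb]
      by (simp add: left_diff_distrib)
  qed
  then have "AE x in lborel. q x = g' x" by simp
  then have "cN P q = cN P g'" using P by (intro cN_cong_AE) auto
  then show "ennreal c2 * cN P (conv_op (U.sg k) f') \<le> Lp_norm (ennreal P) g" by (simp add: cq Lg)
qed

end

section \<open>Variations of complex measures\<close>

lemma ennreal_le_suminf_of_sums:
  fixes f :: "nat \<Rightarrow> real"
  assumes "f sums s" shows "ennreal s \<le> (\<Sum>i. ennreal (f i))"
proof (cases "(\<Sum>i. ennreal (f i)) = \<infinity>")
  case False
  define T where "T = enn2real (\<Sum>i. ennreal (f i))"
  have T: "(\<Sum>i. ennreal (f i)) = ennreal T" "0 \<le> T" using False by (auto simp: T_def less_top)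
  have "(\<Sum>i<n. f i) \<le> T" for n
  proof -
    have "ennreal (\<Sum>i<n. f i) \<le> ennreal (\<Sum>i<n. max 0 (f i))" by (intro ennreal_leI sum_mono) auto
    also have "\<dots> = (\<Sum>i<n. ennreal (max 0 (f i)))" by (rule sum_ennreal[symmetric]) auto
    also have "\<dots> = (\<Sum>i<n. ennreal (f i))" by (rule sum.cong) (auto simp: max_def ennreal_neg)
    also have "\<dots> \<le> ennreal T" unfolding T(1)[symmetric] by (rule sum_le_suminf) auto
    finally show ?thesis using T by (simp add: ennreal_le_iff)
  qed
  then have "s \<le> T" using assms unfolding sums_def by (intro LIMSEQ_le_const2) auto
  then show ?thesis by (simp add: T ennreal_leI)
qed simp

lemma ennreal_norm_le_suminf_of_sums:
  fixes f :: "nat \<Rightarrow> complex"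
  assumes "f sums s" shows "ennreal (norm s) \<le> (\<Sum>i. ennreal (norm (f i)))"
proof (cases "(\<Sum>i. ennreal (norm (f i))) = \<infinity>")
  case False
  define T where "T = enn2real (\<Sum>i. ennreal (norm (f i)))"
  have T: "(\<Sum>i. ennreal (norm (f i))) = ennreal T" "0 \<le> T" using False by (auto simp: T_def less_top)
  have "norm (\<Sum>i<n. f i) \<le> T" for n
  proof -
    have "ennreal (norm (\<Sum>i<n. f i)) \<le> ennreal (\<Sum>i<n. norm (f i))" by (intro ennreal_leI norm_sum)
    also have "\<dots> = (\<Sum>i<n. ennreal (norm (f i)))" by (rule sum_ennreal[symmetric]) auto
    also have "\<dots> \<le> ennreal T" unfolding T(1)[symmetric] by (rule sum_le_suminf) auto
    finally show ?thesis using T by simp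
  qed
  moreover have "(\<lambda>n. norm (\<Sum>i<n. f i)) \<longlonglongrightarrow> norm s"
    using assms unfolding sums_def by (rule tendsto_norm)
  ultimately have "norm s \<le> T" by (intro LIMSEQ_le_const2) auto
  then show ?thesis by (simp add: T ennreal_leI)
qed simp

lemma SUP_add_le_ennreal:
  fixes f g :: "'i \<Rightarrow> ennreal"
  assumes "\<And>i j. i \<in> I \<Longrightarrow> j \<in> J \<Longrightarrow> f i + g j \<le> T" "I \<noteq> {}" "J \<noteq> {}"
  shows "(SUP i\<in>I. f i) + (SUP j\<in>J. g j) \<le> T"
proof -
  have "(SUP i\<in>I. f i) + g j \<le> T" if j: "j \<in> J" for j
    using assms(1)[OF _ j] assms(2) by (subst ennreal_SUP_add_left[symmetric]) (auto intro: SUP_least)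
  then have "(SUP j\<in>J. (SUP i\<in>I. f i) + g j) \<le> T" by (rule SUP_least)
  then show ?thesis using ennreal_SUP_add_left[OF assms(3), of g "SUP i\<in>I. f i"] by (simp add: add.commute)
qed

text \<open>Superadditivity and monotonicity give one inequality between the value of a disjoint
  union and the sum, countable subadditivity the other. Where countable additivity fails,
  \<open>measure_of\<close> returns the zero measure, so it has to be established before the
  variations can be evaluated.\<close>

lemma countably_additiveI_super:
  fixes F :: "real set \<Rightarrow> ennreal"
  assumes empty: "F {} = 0"
    and mono: "\<And>A B. A \<in> sets borel \<Longrightarrow> B \<in> sets borel \<Longrightarrow> A \<subseteq> B \<Longrightarrow> F A \<le> F B"
    and super: "\<And>A B. A \<in> sets borel \<Longrightarrow> B \<in> sets borel \<Longrightarrow> A \<inter> B = {} \<Longrightarrow> F A + F B \<le> F (A \<union> B)"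
    and sub: "\<And>A. range A \<subseteq> sets borel \<Longrightarrow> disjoint_family A \<Longrightarrow> F (\<Union>i. A i) \<le> (\<Sum>i::nat. F (A i))"
  shows "sets (measure_of UNIV (sets borel) F) = sets borel"
    and "E \<in> sets borel \<Longrightarrow> emeasure (measure_of UNIV (sets borel) F) E = F E"
proof -
  show s: "sets (measure_of UNIV (sets borel) F) = sets borel"
    by (metis sets.sigma_sets_eq sets_measure_of space_borel subset_UNIV Pow_UNIV)
  have ca: "countably_additive (sets (measure_of UNIV (sets borel) F)) F"
    unfolding s
  proof (rule countably_additiveI)
    fix A :: "nat \<Rightarrow> real set" assume A: "range A \<subseteq> sets borel" "disjoint_family A" "(\<Union>i. A i) \<in> sets borel"
    have fin: "(\<Sum>i<n. F (A i)) \<le> F (\<Union>i<n. A i)" for n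
    proof (induction n)
      case (Suc n)
      have "A i \<inter> A n = {}" if "i < n" for i
        using A(2) that unfolding disjoint_family_on_def by (metis UNIV_I less_irrefl)
      then have "(\<Union>i<n. A i) \<inter> A n = {}" by blast
      then have "F (\<Union>i<n. A i) + F (A n) \<le> F ((\<Union>i<n. A i) \<union> A n)"
        using A(1) by (intro super) auto
      moreover have "(\<Union>i<n. A i) \<union> A n = (\<Union>i<Suc n. A i)" by (auto simp: less_Suc_eq)
      ultimately have "F (\<Union>i<n. A i) + F (A n) \<le> F (\<Union>i<Suc n. A i)" by simp
      moreover have "(\<Sum>i<Suc n. F (A i)) \<le> F (\<Union>i<n. A i) + F (A n)" using add_right_mono[OF Suc] by simp
      ultimately show ?case by (rule order_trans[rotated])
    qed (simp add: empty)
    have "(\<Sum>i<n. F (A i)) \<le> F (\<Union>i. A i)" for n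
      by (rule order_trans[OF fin mono]) (use A in auto)
    then have "(\<Sum>i. F (A i)) \<le> F (\<Union>i. A i)" by (intro suminf_le_const summableI)
    then show "(\<Sum>i. F (A i)) = F (\<Union>i. A i)" using sub[OF A(1,2)] by (rule antisym)
  qed
  show "emeasure (measure_of UNIV (sets borel) F) E = F E" if "E \<in> sets borel"
    by (rule emeasure_measure_of[OF refl _ _ ca]) (use that s empty in \<open>auto simp: positive_def\<close>)
qed

lemma binaryset_borel:
  assumes "A \<in> sets borel" "B \<in> sets borel" "A \<inter> B = {}"
  shows "range (binaryset A B) \<subseteq> sets borel" "disjoint_family (binaryset A B)"
proof -
  show "range (binaryset A B) \<subseteq> sets borel" using assms(1,2) by (simp add: range_binaryset_eq)
  show "disjoint_family (binaryset A B)"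
    using assms(3) unfolding disjoint_family_on_def binaryset_def by (auto split: if_splits)
qed

locale signed_measure =
  fixes \<nu> :: "real set \<Rightarrow> real"
  assumes nu_empty: "\<nu> {} = 0"
    and nu_sums: "\<And>A :: nat \<Rightarrow> real set. range A \<subseteq> sets borel \<Longrightarrow> disjoint_family A \<Longrightarrow> (\<lambda>i. \<nu> (A i)) sums \<nu> (\<Union>i. A i)"
begin

lemma nu_union:
  assumes "A \<in> sets borel" "B \<in> sets borel" "A \<inter> B = {}"
  shows "\<nu> (A \<union> B) = \<nu> A + \<nu> B"
proof -
  have "(\<lambda>i. \<nu> (binaryset A B i)) sums \<nu> (\<Union>i. binaryset A B i)"
    by (rule nu_sums[OF binaryset_borel[OF assms]])
  moreover have "(\<lambda>i. \<nu> (binaryset A B i)) sums (\<nu> A + \<nu> B)"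
    by (rule binaryset_sums) (rule nu_empty)
  ultimately show ?thesis using sums_unique2 by (simp add: UN_binaryset_eq) blast
qed

lemma nu_diff:
  assumes "A \<in> sets borel" "B \<in> sets borel" "A \<subseteq> B"
  shows "\<nu> (B - A) = \<nu> B - \<nu> A"
  using nu_union[of A "B - A"] assms by (simp add: Un_absorb1)

definition PV :: "real set \<Rightarrow> ennreal" where
  "PV E = (SUP A \<in> {A \<in> sets borel. A \<subseteq> E}. ennreal (\<nu> A))"

lemma PV_upper: "A \<in> sets borel \<Longrightarrow> A \<subseteq> E \<Longrightarrow> ennreal (\<nu> A) \<le> PV E"
  unfolding PV_def by (rule SUP_upper) auto

lemma PV_mono: "A \<subseteq> B \<Longrightarrow> PV A \<le> PV B"
  unfolding PV_def by (rule SUP_subset_mono) auto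

lemma PV_sub:
  assumes A: "range A \<subseteq> sets borel" "disjoint_family A"
  shows "PV (\<Union>i. A i) \<le> (\<Sum>i::nat. PV (A i))"
  unfolding PV_def[of "\<Union>i. A i"]
proof (rule SUP_least)
  fix B assume "B \<in> {B \<in> sets borel. B \<subseteq> (\<Union>i. A i)}"
  then have B: "B \<in> sets borel" "B \<subseteq> (\<Union>i. A i)" by auto
  have "(\<lambda>i. \<nu> (B \<inter> A i)) sums \<nu> (\<Union>i. B \<inter> A i)"
    by (rule nu_sums) (use A B in \<open>auto simp: disjoint_family_on_def\<close>)
  moreover have "(\<Union>i. B \<inter> A i) = B" using B by auto
  ultimately have "ennreal (\<nu> B) \<le> (\<Sum>i. ennreal (\<nu> (B \<inter> A i)))"
    by (intro ennreal_le_suminf_of_sums) simp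
  also have "\<dots> \<le> (\<Sum>i. PV (A i))"
    using A B by (intro suminf_le PV_upper) auto
  finally show "ennreal (\<nu> B) \<le> (\<Sum>i. PV (A i))" .
qed

lemma PV_super:
  assumes "A \<in> sets borel" "B \<in> sets borel" "A \<inter> B = {}"
  shows "PV A + PV B \<le> PV (A \<union> B)"
  unfolding PV_def[of A] PV_def[of B]
proof (rule SUP_add_le_ennreal)
  fix C D assume "C \<in> {C \<in> sets borel. C \<subseteq> A}" "D \<in> {D \<in> sets borel. D \<subseteq> B}"
  then have C: "C \<in> sets borel" "C \<subseteq> A" and D: "D \<in> sets borel" "D \<subseteq> B" by auto
  show "ennreal (\<nu> C) + ennreal (\<nu> D) \<le> PV (A \<union> B)"
  proof (cases "\<nu> C \<le> 0 \<or> \<nu> D \<le> 0")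
    case True
    moreover have "ennreal (\<nu> C) \<le> PV (A \<union> B)" "ennreal (\<nu> D) \<le> PV (A \<union> B)"
      using C D by (intro PV_upper; auto)+
    ultimately show ?thesis by (auto simp: ennreal_neg)
  next
    case False
    then have "ennreal (\<nu> C) + ennreal (\<nu> D) = ennreal (\<nu> (C \<union> D))"
      using C D assms by (subst nu_union) auto
    then show ?thesis using PV_upper[of "C \<union> D" "A \<union> B"] C D by auto
  qed
qed auto

lemma PV_empty: "PV {} = 0"
  by (simp add: PV_def nu_empty)

lemma
  shows sets_positive_variation: "sets (positive_variation \<nu>) = sets borel"
    and emeasure_positive_variation: "E \<in> sets borel \<Longrightarrow> emeasure (positive_variation \<nu>) E = PV E"
proof -
  have mono: "A \<in> sets borel \<Longrightarrow> B \<in> sets borel \<Longrightarrow> A \<subseteq> B \<Longrightarrow> PV A \<le> PV B" for A B by (rule PV_mono)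
  have eq: "positive_variation \<nu> = measure_of UNIV (sets borel) PV"
    unfolding positive_variation_def PV_def[abs_def] ..
  show "sets (positive_variation \<nu>) = sets borel"
    unfolding eq by (rule countably_additiveI_super(1)[where F=PV, OF PV_empty mono PV_super PV_sub])
  show "E \<in> sets borel \<Longrightarrow> emeasure (positive_variation \<nu>) E = PV E"
    unfolding eq by (rule countably_additiveI_super(2)[where F=PV, OF PV_empty mono PV_super PV_sub])
qed

text \<open>Some B inside E has \<nu> B larger than |c| + |\<nu> E|; then \<nu> (E - B) = \<nu> E -
  \<nu> B is large in modulus too. By subadditivity one of B and E - B has infinite variation
  again.\<close>

lemma PV_infinite_step:
  assumes "PV E = \<infinity>" "E \<in> sets borel"
  shows "\<exists>A. A \<in> sets borel \<and> A \<subseteq> E \<and> c \<le> \<bar>\<nu> A\<bar> \<and> PV A = \<infinity>"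
proof -
  have "ennreal (\<bar>c\<bar> + \<bar>\<nu> E\<bar>) < PV E" using assms by simp
  then obtain B where B: "B \<in> sets borel" "B \<subseteq> E" "ennreal (\<bar>c\<bar> + \<bar>\<nu> E\<bar>) < ennreal (\<nu> B)"
    unfolding PV_def less_SUP_iff by auto
  have b: "\<bar>c\<bar> + \<bar>\<nu> E\<bar> < \<nu> B" using B(3) by (simp add: ennreal_less_iff del: ennreal_plus)
  have "PV (\<Union>i. binaryset B (E - B) i) \<le> (\<Sum>i. PV (binaryset B (E - B) i))"
    by (rule PV_sub; rule binaryset_borel) (use assms B in auto)
  also have "\<dots> = PV B + PV (E - B)" by (rule suminf_binaryset_eq) (rule PV_empty)
  finally have "PV B + PV (E - B) = \<infinity>" using assms B by (simp add: UN_binaryset_eq Un_absorb1 top_unique)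
  then consider "PV B = \<infinity>" | "PV (E - B) = \<infinity>" by auto
  then show ?thesis
  proof cases
    case 1
    then show ?thesis using B b by (intro exI[of _ B]) auto
  next
    case 2
    then show ?thesis using B b nu_diff[OF B(1) assms(2) B(2)] assms by (intro exI[of _ "E - B"]) auto
  qed
qed

text \<open>Otherwise the preceding step, iterated, gives a decreasing sequence of sets with
  unbounded values |\<nu> (A n)|. The differences of consecutive sets are disjoint, so their values
  form a convergent series; its partial sums \<nu> (A 0) - \<nu> (A n) would be bounded.\<close>

lemma PV_finite: "PV UNIV < \<infinity>"
proof (rule ccontr)
  assume "\<not> PV UNIV < \<infinity>"
  then have inf: "PV UNIV = \<infinity>" by (metis infinity_ennreal_def top.not_eq_extremum)
  have "\<exists>A. \<forall>n. (A n \<in> sets borel \<and> PV (A n) = \<infinity>) \<and> (A (Suc n) \<subseteq> A n \<and> real n \<le> \<bar>\<nu> (A (Suc n))\<bar>)"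
  proof (rule dependent_nat_choice)
    show "\<exists>A. A \<in> sets borel \<and> PV A = \<infinity>" using inf by (intro exI[of _ UNIV]) auto
    fix A n assume "A \<in> sets borel \<and> PV A = \<infinity>"
    then show "\<exists>B. (B \<in> sets borel \<and> PV B = \<infinity>) \<and> (B \<subseteq> A \<and> real n \<le> \<bar>\<nu> B\<bar>)"
      using PV_infinite_step[of A "real n"] by auto
  qed
  then obtain A where A: "\<And>n. A n \<in> sets borel" "\<And>n. A (Suc n) \<subseteq> A n" "\<And>n. real n \<le> \<bar>\<nu> (A (Suc n))\<bar>" by metis
  have anti: "A m \<subseteq> A n" if "n \<le> m" for m n using A(2) lift_Suc_antimono_le[of A] that by blast
  define D where "D i = A i - A (Suc i)" for i
  have "disjoint_family D"
    unfolding disjoint_family_on_def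
  proof (intro ballI impI)
    fix i j :: nat assume "i \<noteq> j"
    then show "D i \<inter> D j = {}"
    proof (induction i j rule: linorder_wlog)
      case (le i j)
      then have "A j \<subseteq> A (Suc i)" by (intro anti) auto
      then show ?case by (auto simp: D_def)
    qed (auto simp: Int_commute)
  qed
  then have "(\<lambda>i. \<nu> (D i)) sums \<nu> (\<Union>i. D i)"
  proof (rule nu_sums[rotated])
    show "range D \<subseteq> sets borel" using A(1) by (auto simp: D_def)
  qed
  then have "(\<lambda>n. \<Sum>i<n. \<nu> (D i)) \<longlonglongrightarrow> \<nu> (\<Union>i. D i)" by (simp add: sums_def)
  moreover have "(\<Sum>i<n. \<nu> (D i)) = \<nu> (A 0) - \<nu> (A n)" for n
  proof (induction n)
    case (Suc n)
    then show ?case using nu_diff[OF A(1) A(1) A(2), of n] by (simp add: D_def)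
  qed simp
  ultimately have "convergent (\<lambda>n. \<nu> (A 0) - \<nu> (A n))" by (auto simp: convergent_def)
  then have "Bseq (\<lambda>n. \<nu> (A 0) - \<nu> (A n))" by (rule convergent_imp_Bseq)
  then obtain K where K: "\<And>n. norm (\<nu> (A 0) - \<nu> (A n)) \<le> K" by (auto simp: Bseq_def)
  obtain n :: nat where n: "K + \<bar>\<nu> (A 0)\<bar> < real n" using reals_Archimedean2 by blast
  then show False using K[of "Suc n"] A(3)[of n] by auto
qed

end

lemma signed_measure_uminus: "signed_measure \<nu> \<Longrightarrow> signed_measure (\<lambda>A. - \<nu> A)"
  unfolding signed_measure_def by (auto intro: sums_minus)

text \<open>From \<nu> A = \<nu> UNIV - \<nu> (UNIV - A), with the last term controlled by the
  negative variation, one inequality follows; the other is the same for -\<nu>. This carries the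
  hypothesis \<mu> UNIV = 0 over to the masses of the parts.\<close>

lemma jordan_total:
  assumes "signed_measure \<nu>"
  shows "measure (positive_variation \<nu>) UNIV - measure (positive_variation (\<lambda>A. - \<nu> A)) UNIV = \<nu> UNIV"
proof -
  have le: "measure (positive_variation \<nu>) UNIV \<le> \<nu> UNIV + measure (positive_variation (\<lambda>A. - \<nu> A)) UNIV"
    if "signed_measure \<nu>" for \<nu>
  proof -
    interpret P: signed_measure \<nu> by fact
    interpret M: signed_measure "\<lambda>A. - \<nu> A" by (rule signed_measure_uminus) fact
    have f1: "P.PV UNIV = ennreal (measure (positive_variation \<nu>) UNIV)"
      using P.PV_finite P.emeasure_positive_variation[of UNIV] by (simp add: measure_def less_top)
    have f2: "M.PV UNIV = ennreal (measure (positive_variation (\<lambda>A. - \<nu> A)) UNIV)"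
      using M.PV_finite M.emeasure_positive_variation[of UNIV] by (simp add: measure_def less_top)
    have *: "\<nu> A \<le> \<nu> UNIV + measure (positive_variation (\<lambda>A. - \<nu> A)) UNIV" if "A \<in> sets borel" for A
    proof -
      have "ennreal (- \<nu> (UNIV - A)) \<le> M.PV UNIV" using that by (intro M.PV_upper) auto
      then have "- \<nu> (UNIV - A) \<le> measure (positive_variation (\<lambda>A. - \<nu> A)) UNIV" unfolding f2 using ennreal_le_iff[OF measure_nonneg] by blast
      then show ?thesis using P.nu_diff[of A UNIV] that by simp
    qed
    have "P.PV UNIV \<le> ennreal (\<nu> UNIV + measure (positive_variation (\<lambda>A. - \<nu> A)) UNIV)"
      unfolding P.PV_def by (intro SUP_least ennreal_leI *) auto
    moreover have "0 \<le> \<nu> UNIV + measure (positive_variation (\<lambda>A. - \<nu> A)) UNIV" using *[of "{}"] by (simp add: P.nu_empty)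
    ultimately show ?thesis unfolding f1 by simp
  qed
  show ?thesis using le[OF assms] le[OF signed_measure_uminus[OF assms]] by simp
qed

lemma finite_measure_positive_variation:
  assumes "signed_measure \<nu>" shows "finite_measure (positive_variation \<nu>)"
proof -
  interpret signed_measure \<nu> by fact
  have "space (positive_variation \<nu>) = UNIV" using sets_eq_imp_space_eq[OF sets_positive_variation] by simp
  then show ?thesis using PV_finite emeasure_positive_variation[of UNIV] by (intro finite_measureI) auto
qed

section \<open>Total variation and the four positive parts of a complex measure\<close>

definition TV :: "(real set \<Rightarrow> complex) \<Rightarrow> real set \<Rightarrow> ennreal" where
  "TV \<mu> E = (SUP A \<in> {A :: nat \<Rightarrow> real set. range A \<subseteq> sets borel \<and> disjoint_family A \<and> (\<Union>i. A i) = E}. \<Sum>i. ennreal (norm (\<mu> (A i))))"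

lemma TV_upper:
  "range A \<subseteq> sets borel \<Longrightarrow> disjoint_family A \<Longrightarrow> (\<Sum>i. ennreal (norm (\<mu> (A i)))) \<le> TV \<mu> (\<Union>i. A i)"
  unfolding TV_def by (rule SUP_upper) auto

lemma suminf_ennreal_swap:
  fixes f :: "nat \<Rightarrow> nat \<Rightarrow> ennreal"
  shows "(\<Sum>i. \<Sum>j. f i j) = (\<Sum>j. \<Sum>i. f i j)"
  using csum_swap[of f] by (simp add: nn_integral_count_space_nat)

text \<open>For subadditivity, a partition of the union is refined by the given sets; for
  superadditivity, partitions of two disjoint sets are merged into one partition of their
  union.\<close>

lemma total_variation_facts:
  assumes mu: "complex_measure \<mu>"
  shows "sets (total_variation \<mu>) = sets borel"
    and "E \<in> sets borel \<Longrightarrow> emeasure (total_variation \<mu>) E = TV \<mu> E"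
    and "A \<in> sets borel \<Longrightarrow> E \<in> sets borel \<Longrightarrow> A \<subseteq> E \<Longrightarrow> ennreal (norm (\<mu> A)) \<le> TV \<mu> E"
proof -
  have mu0: "\<mu> {} = 0" and sums: "\<And>A :: nat \<Rightarrow> real set. range A \<subseteq> sets borel \<Longrightarrow> disjoint_family A \<Longrightarrow> (\<lambda>i. \<mu> (A i)) sums \<mu> (\<Union>i. A i)"
    using mu by (auto simp: complex_measure_def)
  have two: "ennreal (norm (\<mu> A)) + ennreal (norm (\<mu> B)) \<le> TV \<mu> (A \<union> B)"
    if "A \<in> sets borel" "B \<in> sets borel" "A \<inter> B = {}" for A B
  proof -
    have 1: "(\<Sum>i. ennreal (norm (\<mu> (binaryset A B i)))) \<le> TV \<mu> (\<Union>i. binaryset A B i)"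
      by (rule TV_upper[where \<mu>=\<mu>, OF binaryset_borel[OF that]])
    have 2: "(\<Sum>i. ennreal (norm (\<mu> (binaryset A B i)))) = ennreal (norm (\<mu> A)) + ennreal (norm (\<mu> B))"
      by (rule suminf_binaryset_eq[of "\<lambda>A. ennreal (norm (\<mu> A))"]) (simp add: mu0)
    show ?thesis using 1 unfolding 2 UN_binaryset_eq .
  qed
  show upper: "ennreal (norm (\<mu> A)) \<le> TV \<mu> E" if "A \<in> sets borel" "E \<in> sets borel" "A \<subseteq> E" for A E
  proof -
    have "ennreal (norm (\<mu> A)) + ennreal (norm (\<mu> (E - A))) \<le> TV \<mu> (A \<union> (E - A))"
      using that by (intro two) auto
    moreover have "A \<union> (E - A) = E" using that by auto
    ultimately have "ennreal (norm (\<mu> A)) + ennreal (norm (\<mu> (E - A))) \<le> TV \<mu> E" by (simp only:)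
    then show ?thesis by (rule order_trans[rotated]) simp
  qed
  have empty: "TV \<mu> {} = 0"
  proof -
    have "TV \<mu> {} \<le> 0" unfolding TV_def by (rule SUP_least) (auto simp: mu0)
    then show ?thesis by simp
  qed
  have super: "TV \<mu> A + TV \<mu> B \<le> TV \<mu> (A \<union> B)" if AB: "A \<in> sets borel" "B \<in> sets borel" "A \<inter> B = {}" for A B
    unfolding TV_def[of _ A] TV_def[of _ B]
  proof (rule SUP_add_le_ennreal)
    have part: "binaryset C {} \<in> {A :: nat \<Rightarrow> real set. range A \<subseteq> sets borel \<and> disjoint_family A \<and> (\<Union>i. A i) = C}" if "C \<in> sets borel" for C
      using binaryset_borel[of C "{}"] that by (simp add: UN_binaryset_eq)
    have ne: "x \<in> S \<Longrightarrow> S \<noteq> {}" for x :: "nat \<Rightarrow> real set" and S by auto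
    show "{C :: nat \<Rightarrow> real set. range C \<subseteq> sets borel \<and> disjoint_family C \<and> (\<Union>i. C i) = A} \<noteq> {}"
      by (rule ne[OF part[OF AB(1)]])
    show "{C :: nat \<Rightarrow> real set. range C \<subseteq> sets borel \<and> disjoint_family C \<and> (\<Union>i. C i) = B} \<noteq> {}"
      by (rule ne[OF part[OF AB(2)]])
    fix C D :: "nat \<Rightarrow> real set"
    assume "C \<in> {C. range C \<subseteq> sets borel \<and> disjoint_family C \<and> (\<Union>i. C i) = A}"
      "D \<in> {C. range C \<subseteq> sets borel \<and> disjoint_family C \<and> (\<Union>i. C i) = B}"
    then have C: "range C \<subseteq> sets borel" "disjoint_family C" "(\<Union>i. C i) = A"
      and D: "range D \<subseteq> sets borel" "disjoint_family D" "(\<Union>i. D i) = B" by auto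
    \<comment> \<open>The two partitions are interleaved: even indices take the sets of C, odd ones
      those of D.\<close>
    define Q where "Q n = (if even n then C (n div 2) else D (n div 2))" for n
    have Q: "range Q \<subseteq> sets borel" using C D by (auto simp: Q_def)
    have CD: "C i \<inter> D j = {}" for i j using C(3) D(3) AB(3) by blast
    have "disjoint_family Q"
      unfolding disjoint_family_on_def
    proof (intro ballI impI)
      fix m n :: nat assume "m \<noteq> n"
      then have "m div 2 \<noteq> n div 2 \<or> even m \<noteq> even n"
        by (metis div_mult_mod_eq even_iff_mod_2_eq_zero odd_iff_mod_2_eq_one)
      moreover have "C (m div 2) \<inter> C (n div 2) = {}" "D (m div 2) \<inter> D (n div 2) = {}" if "m div 2 \<noteq> n div 2"
        using C(2) D(2) that unfolding disjoint_family_on_def by simp_all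
      ultimately show "Q m \<inter> Q n = {}"
        using CD[of "m div 2" "n div 2"] CD[of "n div 2" "m div 2"] unfolding Q_def
        by (cases "even m"; cases "even n") (simp_all add: Int_commute)
    qed
    then have "(\<Sum>i. ennreal (norm (\<mu> (Q i)))) \<le> TV \<mu> (\<Union>i. Q i)" by (rule TV_upper[where \<mu>=\<mu>, OF Q])
    moreover have "(\<Union>i. Q i) = A \<union> B"
    proof -
      have "C i = Q (2 * i)" "D i = Q (2 * i + 1)" for i by (simp_all add: Q_def)
      then have "A \<union> B \<subseteq> (\<Union>i. Q i)" unfolding C(3)[symmetric] D(3)[symmetric] by blast
      moreover have "(\<Union>i. Q i) \<subseteq> A \<union> B" unfolding C(3)[symmetric] D(3)[symmetric] Q_def by auto
      ultimately show ?thesis by blast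
    qed
    moreover have "(\<Sum>i. ennreal (norm (\<mu> (C i)))) + (\<Sum>i. ennreal (norm (\<mu> (D i)))) \<le> (\<Sum>i. ennreal (norm (\<mu> (Q i))))"
    proof -
      have "(\<Sum>i. ennreal (norm (\<mu> (C i))) + ennreal (norm (\<mu> (D i)))) \<le> (\<Sum>i. ennreal (norm (\<mu> (Q i))))"
      proof (rule suminf_le_const[OF summableI])
        fix n
        have "(\<Sum>i<n. ennreal (norm (\<mu> (C i))) + ennreal (norm (\<mu> (D i)))) = (\<Sum>i<2*n. ennreal (norm (\<mu> (Q i))))"
          by (induction n) (auto simp: Q_def add.assoc)
        also have "\<dots> \<le> (\<Sum>i. ennreal (norm (\<mu> (Q i))))" by (rule sum_le_suminf) auto
        finally show "(\<Sum>i<n. ennreal (norm (\<mu> (C i))) + ennreal (norm (\<mu> (D i)))) \<le> (\<Sum>i. ennreal (norm (\<mu> (Q i))))" .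
      qed
      then show ?thesis by (subst suminf_add) auto
    qed
    ultimately show "(\<Sum>i. ennreal (norm (\<mu> (C i)))) + (\<Sum>i. ennreal (norm (\<mu> (D i)))) \<le> TV \<mu> (A \<union> B)" by simp
  qed
  have mono: "TV \<mu> A \<le> TV \<mu> B" if "A \<in> sets borel" "B \<in> sets borel" "A \<subseteq> B" for A B
  proof -
    have "TV \<mu> A + TV \<mu> (B - A) \<le> TV \<mu> (A \<union> (B - A))" using that by (intro super) auto
    moreover have "A \<union> (B - A) = B" using that by auto
    ultimately have "TV \<mu> A + TV \<mu> (B - A) \<le> TV \<mu> B" by (simp only:)
    then show ?thesis by (rule order_trans[rotated]) simp
  qed
  have sub: "TV \<mu> (\<Union>i. A i) \<le> (\<Sum>i. TV \<mu> (A i))" if A: "range A \<subseteq> sets borel" "disjoint_family A" for A :: "nat \<Rightarrow> real set"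
    unfolding TV_def[of _ "\<Union>i. A i"]
  proof (rule SUP_least)
    fix B :: "nat \<Rightarrow> real set"
    assume "B \<in> {B. range B \<subseteq> sets borel \<and> disjoint_family B \<and> (\<Union>i. B i) = (\<Union>i. A i)}"
    then have B: "range B \<subseteq> sets borel" "disjoint_family B" "(\<Union>i. B i) = (\<Union>i. A i)" by auto
    have "(\<Sum>j. ennreal (norm (\<mu> (B j)))) \<le> (\<Sum>j. \<Sum>i. ennreal (norm (\<mu> (B j \<inter> A i))))"
    proof (intro suminf_le summableI ennreal_norm_le_suminf_of_sums)
      fix j
      have "(\<lambda>i. \<mu> (B j \<inter> A i)) sums \<mu> (\<Union>i. B j \<inter> A i)"
        using A B by (intro sums) (auto simp: disjoint_family_on_def)
      moreover have "(\<Union>i. B j \<inter> A i) = B j" using B(3) by blast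
      ultimately show "(\<lambda>i. \<mu> (B j \<inter> A i)) sums \<mu> (B j)" by simp
    qed
    also have "\<dots> = (\<Sum>i. \<Sum>j. ennreal (norm (\<mu> (B j \<inter> A i))))" by (rule suminf_ennreal_swap)
    also have "\<dots> \<le> (\<Sum>i. TV \<mu> (A i))"
    proof (intro suminf_le summableI)
      fix i
      have "disjoint_family (\<lambda>j. B j \<inter> A i)" using B(2) unfolding disjoint_family_on_def by blast
      moreover have "range (\<lambda>j. B j \<inter> A i) \<subseteq> sets borel" using A B by auto
      ultimately have "(\<Sum>j. ennreal (norm (\<mu> (B j \<inter> A i)))) \<le> TV \<mu> (\<Union>j. B j \<inter> A i)"
        by (intro TV_upper[where \<mu>=\<mu>])
      moreover have "(\<Union>j. B j \<inter> A i) = A i" using B(3) by blast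
      ultimately show "(\<Sum>j. ennreal (norm (\<mu> (B j \<inter> A i)))) \<le> TV \<mu> (A i)" by simp
    qed
    finally show "(\<Sum>j. ennreal (norm (\<mu> (B j)))) \<le> (\<Sum>i. TV \<mu> (A i))" .
  qed
  have eq: "total_variation \<mu> = measure_of UNIV (sets borel) (TV \<mu>)"
    unfolding total_variation_def TV_def[abs_def] ..
  show "sets (total_variation \<mu>) = sets borel"
    unfolding eq by (rule countably_additiveI_super(1)[OF empty mono super sub])
  show "E \<in> sets borel \<Longrightarrow> emeasure (total_variation \<mu>) E = TV \<mu> E"
    unfolding eq by (rule countably_additiveI_super(2)[OF empty mono super sub])
qed

text \<open>The Jordan decompositions of real and imaginary part split \<mu> into four finite
  positive measures with the coefficients 1, -1, i, -i of \<open>part_sign\<close>. Estimates are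
  made for each of these, where integration theory for positive measures applies.\<close>

definition variation_parts :: "(real set \<Rightarrow> complex) \<Rightarrow> nat \<Rightarrow> real measure" where
  "variation_parts \<mu> i = positive_variation (\<lambda>A. [Re (\<mu> A), - Re (\<mu> A), Im (\<mu> A), - Im (\<mu> A)] ! i)"

definition part_sign :: "nat \<Rightarrow> complex" where
  "part_sign i = [1, -1, \<i>, -\<i>] ! i"

lemma less_4_cases: "i < (4::nat) \<Longrightarrow> i = 0 \<or> i = 1 \<or> i = 2 \<or> i = 3" by linarith

lemma signed_measure_parts:
  assumes mu: "complex_measure \<mu>" and i: "i < 4"
  shows "signed_measure (\<lambda>A. [Re (\<mu> A), - Re (\<mu> A), Im (\<mu> A), - Im (\<mu> A)] ! i)"
proof -
  have "signed_measure (\<lambda>A. Re (\<mu> A))" "signed_measure (\<lambda>A. Im (\<mu> A))"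
    using mu unfolding complex_measure_def signed_measure_def
    by (auto intro: bounded_linear.sums[OF bounded_linear_Re] bounded_linear.sums[OF bounded_linear_Im])
  then show ?thesis using less_4_cases[OF i] signed_measure_uminus
    by (auto simp: numeral_2_eq_2 numeral_3_eq_3)
qed

text \<open>Re \<mu>, Im \<mu> and their negatives are at most |\<mu>| on every set, so each part is
  dominated by the total variation and inherits its exponential moments.\<close>

lemma variation_parts_facts:
  assumes mu: "complex_measure \<mu>" and i: "i < 4"
  shows "finite_measure (variation_parts \<mu> i)" "sets (variation_parts \<mu> i) = sets borel"
    "(\<integral>\<^sup>+x. g x \<partial>variation_parts \<mu> i) \<le> (\<integral>\<^sup>+x. g x \<partial>total_variation \<mu>)"
proof -
  let ?\<nu> = "\<lambda>A. [Re (\<mu> A), - Re (\<mu> A), Im (\<mu> A), - Im (\<mu> A)] ! i"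
  interpret signed_measure ?\<nu> by (rule signed_measure_parts[OF mu i])
  show "finite_measure (variation_parts \<mu> i)"
    unfolding variation_parts_def by (rule finite_measure_positive_variation[OF signed_measure_parts[OF mu i]])
  show s: "sets (variation_parts \<mu> i) = sets borel"
    unfolding variation_parts_def by (rule sets_positive_variation)
  have le: "?\<nu> A \<le> norm (\<mu> A)" for A
    using less_4_cases[OF i] abs_Re_le_cmod[of "\<mu> A"] abs_Im_le_cmod[of "\<mu> A"]
    by (auto simp: numeral_2_eq_2 numeral_3_eq_3 abs_le_iff)
  have "PV E \<le> TV \<mu> E" if "E \<in> sets borel" for E
    unfolding PV_def
    by (intro SUP_least order_trans[OF ennreal_leI[OF le]] total_variation_facts(3)[OF mu]) (use that in auto)
  then have "emeasure (variation_parts \<mu> i) E \<le> emeasure (total_variation \<mu>) E" if "E \<in> sets borel" for E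
    using that by (simp add: variation_parts_def emeasure_positive_variation total_variation_facts(2)[OF mu])
  then show "(\<integral>\<^sup>+x. g x \<partial>variation_parts \<mu> i) \<le> (\<integral>\<^sup>+x. g x \<partial>total_variation \<mu>)"
    using s total_variation_facts(1)[OF mu]
    by (intro nn_integral_mono_measure) (auto simp: le_measure)
qed

lemma complex_measure_integral_parts:
  "complex_measure_integral \<mu> g = (\<Sum>i<4. part_sign i * (LINT x|variation_parts \<mu> i. g x))"
  by (simp add: complex_measure_integral_def signed_integral_def variation_parts_def part_sign_def
      numeral_eq_Suc algebra_simps)

lemma variation_parts_total:
  assumes mu: "complex_measure \<mu>"
  shows "(\<Sum>i<4. part_sign i * of_real (measure (variation_parts \<mu> i) UNIV)) = \<mu> UNIV"
proof -
  have "signed_measure (\<lambda>A. Re (\<mu> A))" "signed_measure (\<lambda>A. Im (\<mu> A))"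
    using signed_measure_parts[OF mu, of 0] signed_measure_parts[OF mu, of 2] by (auto simp: numeral_2_eq_2)
  from jordan_total[OF this(1)] jordan_total[OF this(2)] show ?thesis
    by (simp add: variation_parts_def part_sign_def numeral_eq_Suc complex_eq_iff)
qed

section \<open>Smoothness\<close>

lemma has_vector_derivative_quadratic:
  fixes f :: "real \<Rightarrow> complex"
  assumes "\<And>h. norm (f (t + h) - f t - h *\<^sub>R D) \<le> C * h\<^sup>2"
  shows "(f has_vector_derivative D) (at t)"
  unfolding has_vector_derivative_def has_derivative_at
proof (intro conjI)
  show "bounded_linear (\<lambda>h. h *\<^sub>R D)" by (rule bounded_linear_scaleR_left)
  show "((\<lambda>h. norm (f (t + h) - f t - h *\<^sub>R D) / norm h) \<longlongrightarrow> 0) (at 0)"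
  proof (rule tendsto_sandwich[of "\<lambda>_. 0" _ _ "\<lambda>h. C * \<bar>h\<bar>"])
    have nonzero: "\<forall>\<^sub>F h::real in at 0. h \<noteq> 0" by (simp add: eventually_at_filter)
    show "\<forall>\<^sub>F h in at 0. norm (f (t + h) - f t - h *\<^sub>R D) / norm h \<le> C * \<bar>h\<bar>"
      using nonzero
    proof (rule eventually_mono)
      fix h :: real assume "h \<noteq> 0"
      then have "0 < \<bar>h\<bar>" by auto
      have "norm (f (t + h) - f t - h *\<^sub>R D) \<le> C * \<bar>h\<bar> * \<bar>h\<bar>"
      proof -
        have "C * \<bar>h\<bar> * \<bar>h\<bar> = C * h\<^sup>2" by (simp only: mult.assoc abs_mult_self_eq power2_eq_square)
        then show ?thesis using assms[of h] by (simp only:)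
      qed
      then show "norm (f (t + h) - f t - h *\<^sub>R D) / norm h \<le> C * \<bar>h\<bar>"
        unfolding real_norm_def by (simp only: pos_divide_le_eq[OF \<open>0 < \<bar>h\<bar>\<close>])
    qed
    have "((\<lambda>h::real. C * \<bar>h\<bar>) \<longlongrightarrow> C * \<bar>0\<bar>) (at 0)" by (intro tendsto_intros)
    then show "((\<lambda>h::real. C * \<bar>h\<bar>) \<longlongrightarrow> 0) (at 0)" by simp
  qed auto
qed

definition char_deriv :: "real measure \<Rightarrow> nat \<Rightarrow> real \<Rightarrow> complex" where
  "char_deriv M n t = (LINT \<xi>|M. (\<i> * of_real \<xi>) ^ n * exp (\<i> * of_real (t * \<xi>)))"

text \<open>Differentiation under the integral with an explicit remainder: exp (i h \<xi>) - 1 - i h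
  \<xi> is at most (h \<xi>)^2 in modulus, and the moment of order n + 2 is finite.\<close>

lemma char_deriv_has_derivative:
  assumes M: "finite_measure M" "sets M = sets borel" and mom: "\<And>n. integrable M (\<lambda>\<xi>. \<bar>\<xi>\<bar> ^ n)"
  shows "(char_deriv M n has_vector_derivative char_deriv M (Suc n) t) (at t)"
proof (rule has_vector_derivative_quadratic)
  fix h
  let ?e = "\<lambda>t \<xi>. exp (\<i> * complex_of_real (t * \<xi>))"
  have meas: "(\<lambda>\<xi>. (\<i> * complex_of_real \<xi>) ^ n * ?e t \<xi>) \<in> borel_measurable M" for n t
    unfolding measurable_cong_sets[OF M(2) refl] by (intro borel_measurable_continuous_onI continuous_intros)
  have int: "integrable M (\<lambda>\<xi>. (\<i> * complex_of_real \<xi>) ^ n * ?e t \<xi>)" for n t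
    by (rule Bochner_Integration.integrable_bound[OF mom[of n] meas]) (auto simp: norm_mult norm_power)
  have pt: "norm ((\<i> * complex_of_real \<xi>) ^ n * ?e (t + h) \<xi> - (\<i> * complex_of_real \<xi>) ^ n * ?e t \<xi> - h *\<^sub>R ((\<i> * complex_of_real \<xi>) ^ Suc n * ?e t \<xi>)) \<le> h\<^sup>2 * \<bar>\<xi>\<bar> ^ (n + 2)" for \<xi>
  proof -
    have eq: "(\<i> * complex_of_real \<xi>) ^ n * ?e (t + h) \<xi> - (\<i> * complex_of_real \<xi>) ^ n * ?e t \<xi> - h *\<^sub>R ((\<i> * complex_of_real \<xi>) ^ Suc n * ?e t \<xi>) =
      (\<i> * complex_of_real \<xi>) ^ n * ?e t \<xi> * (?e h \<xi> - 1 - \<i> * of_real (h * \<xi>))"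
      by (simp add: distrib_right exp_add distrib_left scaleR_conv_of_real algebra_simps)
    have "norm (?e h \<xi> - 1 - \<i> * of_real (h * \<xi>)) \<le> \<bar>h * \<xi>\<bar>\<^sup>2"
    proof -
      have "norm (?e h \<xi> - (\<Sum>k\<le>1. (\<i> * complex_of_real (h * \<xi>)) ^ k / fact k)) \<le> \<bar>h * \<xi>\<bar> ^ Suc 1 / fact (Suc 1)"
        by (rule iexp_approx1)
      also have "\<bar>h * \<xi>\<bar> ^ Suc 1 / fact (Suc 1) = \<bar>h * \<xi>\<bar>\<^sup>2 / 2" by (simp only: numeral_2_eq_2 One_nat_def) simp
      also have "\<dots> \<le> \<bar>h * \<xi>\<bar>\<^sup>2" using zero_le_power2[of "\<bar>h * \<xi>\<bar>"] by linarith
      finally show ?thesis by (simp add: diff_diff_eq)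
    qed
    then have "\<bar>\<xi>\<bar> ^ n * norm (?e h \<xi> - 1 - \<i> * of_real (h * \<xi>)) \<le> \<bar>\<xi>\<bar> ^ n * \<bar>h * \<xi>\<bar>\<^sup>2"
      by (rule mult_left_mono) simp
    also have "\<dots> = h\<^sup>2 * \<bar>\<xi>\<bar> ^ (n + 2)"
      by (simp only: abs_mult power_mult_distrib power_add power2_abs mult_ac)
    also have "\<bar>\<xi>\<bar> ^ n * norm (?e h \<xi> - 1 - \<i> * of_real (h * \<xi>)) = norm ((\<i> * complex_of_real \<xi>) ^ n * ?e t \<xi> * (?e h \<xi> - 1 - \<i> * of_real (h * \<xi>)))"
      by (simp only: norm_mult norm_power norm_ii norm_of_real norm_exp_i_times mult_1_right mult_1_left)
    finally show ?thesis unfolding eq .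
  qed
  have "norm (char_deriv M n (t + h) - char_deriv M n t - h *\<^sub>R char_deriv M (Suc n) t) =
    norm (LINT \<xi>|M. (\<i> * complex_of_real \<xi>) ^ n * ?e (t + h) \<xi> - (\<i> * complex_of_real \<xi>) ^ n * ?e t \<xi> - h *\<^sub>R ((\<i> * complex_of_real \<xi>) ^ Suc n * ?e t \<xi>))"
  proof -
    let ?A = "\<lambda>n t \<xi>. (\<i> * complex_of_real \<xi>) ^ n * ?e t \<xi>"
    have "(LINT \<xi>|M. ?A n (t + h) \<xi> - ?A n t \<xi> - h *\<^sub>R ?A (Suc n) t \<xi>) =
      (LINT \<xi>|M. ?A n (t + h) \<xi> - ?A n t \<xi>) - (LINT \<xi>|M. h *\<^sub>R ?A (Suc n) t \<xi>)"
      by (rule Bochner_Integration.integral_diff)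
        (rule Bochner_Integration.integrable_diff[OF int int], simp only: integrable_scaleR_right int)
    also have "(LINT \<xi>|M. ?A n (t + h) \<xi> - ?A n t \<xi>) = (LINT \<xi>|M. ?A n (t + h) \<xi>) - (LINT \<xi>|M. ?A n t \<xi>)"
      by (rule Bochner_Integration.integral_diff[OF int int])
    also have "(LINT \<xi>|M. h *\<^sub>R ?A (Suc n) t \<xi>) = h *\<^sub>R (LINT \<xi>|M. ?A (Suc n) t \<xi>)"
      by (rule Bochner_Integration.integral_scaleR_right)
    finally show ?thesis unfolding char_deriv_def by (simp only:)
  qed
  also have "\<dots> \<le> (LINT \<xi>|M. norm ((\<i> * complex_of_real \<xi>) ^ n * ?e (t + h) \<xi> - (\<i> * complex_of_real \<xi>) ^ n * ?e t \<xi> - h *\<^sub>R ((\<i> * complex_of_real \<xi>) ^ Suc n * ?e t \<xi>)))"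
    by (rule integral_norm_bound)
  also have "\<dots> \<le> (LINT \<xi>|M. h\<^sup>2 * \<bar>\<xi>\<bar> ^ (n + 2))"
    by (intro integral_mono pt integrable_norm integrable_mult_right mom Bochner_Integration.integrable_diff int integrable_scaleR_right)
  also have "\<dots> = (LINT \<xi>|M. \<bar>\<xi>\<bar> ^ (n + 2)) * h\<^sup>2" by simp
  finally show "norm (char_deriv M n (t + h) - char_deriv M n t - h *\<^sub>R char_deriv M (Suc n) t) \<le> (LINT \<xi>|M. \<bar>\<xi>\<bar> ^ (n + 2)) * h\<^sup>2" .
qed

text \<open>On the real line the only basis vector is 1, so an iterated partial derivative is
  determined by the length of its list.\<close>

lemma smooth_on_real_chain:
  fixes G :: "nat \<Rightarrow> real \<Rightarrow> complex"
  assumes "\<And>n t. (G n has_vector_derivative G (Suc n) t) (at t)"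
  shows "smooth_on UNIV (G 0)"
proof -
  have eq: "iterated_partial bs (G 0) = G (length bs)" if "set bs \<subseteq> Basis" for bs
    using that
  proof (induction bs)
    case (Cons b bs)
    then have b: "b = 1" and IH: "iterated_partial bs (G 0) = G (length bs)" by auto
    have "frechet_derivative (G (length bs)) (at x) = (\<lambda>h. h *\<^sub>R G (Suc (length bs)) x)" for x
      using assms[of "length bs" x] unfolding has_vector_derivative_def by (rule frechet_derivative_at[symmetric])
    then show ?case by (simp add: IH b fun_eq_iff)
  qed simp
  show ?thesis unfolding smooth_on_def
    using eq assms by (auto intro: differentiableI_vector)
qed

lemma smooth_inv_fourier_measure:
  assumes mu: "complex_measure \<mu>" and mom: "\<And>i n. i < 4 \<Longrightarrow> integrable (variation_parts \<mu> i) (\<lambda>\<xi>. \<bar>\<xi>\<bar> ^ n)"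
  shows "smooth_on UNIV (inv_fourier_measure \<mu>)"
proof -
  define G where "G n t = of_real (1 / sqrt (2 * pi)) * (\<Sum>i<4. part_sign i * char_deriv (variation_parts \<mu> i) n t)" for n t
  have "(G n has_vector_derivative G (Suc n) t) (at t)" for n t
    unfolding G_def
    by (intro has_vector_derivative_mult_right has_vector_derivative_sum char_deriv_has_derivative variation_parts_facts mu mom) auto
  then have "smooth_on UNIV (G 0)" by (rule smooth_on_real_chain)
  moreover have "G 0 = inv_fourier_measure \<mu>"
    by (simp add: G_def fun_eq_iff inv_fourier_measure_def complex_measure_integral_parts char_deriv_def)
  ultimately show ?thesis by simp
qed

section \<open>Weights of regular variation\<close>

text \<open>Counting in shells: at most (2 j + 3)^n lattice points have norm at most j + 1, against
  a decay of order n + 2.\<close>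

lemma csum_lattice_decay_finite:
  fixes g :: "int^'n \<Rightarrow> ennreal"
  assumes g: "\<And>k. g k \<le> ennreal (C / (1 + norm (real_vec k)) ^ (CARD('n) + 2))" and C: "0 \<le> C"
  shows "csum g < \<infinity>"
proof -
  define n where "n = CARD('n)"
  define c where "c j = C / (1 + real j) ^ (n + 2)" for j :: nat
  have c0: "0 \<le> c j" for j using C by (simp add: c_def)
  let ?B = "\<lambda>j::nat. {k :: int^'n. norm (real_vec k) \<le> real j + 1}"
  have card: "card (?B j) \<le> (2 * j + 3) ^ n" for j
  proof -
    have "?B j \<subseteq> vec_lambda ` (UNIV \<rightarrow>\<^sub>E {- (int j + 1)..int j + 1})"
    proof
      fix k :: "int^'n" assume "k \<in> ?B j"
      then have "\<bar>real_of_int (k $ i)\<bar> \<le> real j + 1" for i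
        using component_le_norm_cart[of "real_vec k" i] by (simp add: real_vec_def)
      then have "k $ i \<in> {- (int j + 1)..int j + 1}" for i
        by (simp add: abs_le_iff) (smt (verit) of_int_1 of_int_add of_int_le_iff of_int_minus of_int_of_nat_eq)
      then show "k \<in> vec_lambda ` (UNIV \<rightarrow>\<^sub>E {- (int j + 1)..int j + 1})"
        by (intro image_eqI[of _ _ "vec_nth k"]) auto
    qed
    moreover have fin: "finite (UNIV \<rightarrow>\<^sub>E {- (int j + 1)..int j + 1} :: ('n \<Rightarrow> int) set)" by (intro finite_PiE) auto
    ultimately have "card (?B j) \<le> card (UNIV \<rightarrow>\<^sub>E {- (int j + 1)..int j + 1} :: ('n \<Rightarrow> int) set)"
      by (meson card_image_le card_mono finite_imageI order_trans)
    also have "\<dots> = (2 * j + 3) ^ n"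
      by (simp add: card_PiE n_def nat_add_distrib nat_mult_distrib numeral_eq_Suc algebra_simps)
    finally show ?thesis .
  qed
  have "csum g \<le> csum (\<lambda>k. csum (\<lambda>j. ennreal (c j) * indicator (?B j) k))"
  proof (rule nn_integral_mono)
    fix k :: "int^'n"
    define j where "j = nat \<lfloor>norm (real_vec k)\<rfloor>"
    have "real j = of_int \<lfloor>norm (real_vec k)\<rfloor>" by (simp add: j_def)
    then have j: "real j \<le> norm (real_vec k)" "norm (real_vec k) \<le> real j + 1" by linarith+
    have "C / (1 + norm (real_vec k)) ^ (n + 2) \<le> c j"
      unfolding c_def using j C by (intro divide_left_mono power_mono mult_pos_pos zero_less_power add_pos_nonneg) auto
    then have "g k \<le> ennreal (c j) * indicator (?B j) k"
      using order_trans[OF g[of k] ennreal_leI] j by (simp add: n_def)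
    also have "\<dots> \<le> csum (\<lambda>j. ennreal (c j) * indicator (?B j) k)"
      by (rule nn_integral_ge_point) simp
    finally show "g k \<le> csum (\<lambda>j. ennreal (c j) * indicator (?B j) k)" .
  qed
  also have "\<dots> = csum (\<lambda>j. csum (\<lambda>k. ennreal (c j) * indicator (?B j) k))" by (rule csum_swap)
  also have "\<dots> = csum (\<lambda>j. ennreal (c j) * of_nat (card (?B j)))"
  proof (rule nn_integral_cong)
    fix j
    have "csum (\<lambda>k. ennreal (c j) * indicator (?B j) k) = ennreal (c j) * emeasure (count_space UNIV) (?B j)"
      by (rule nn_integral_cmult_indicator) simp
    then show "csum (\<lambda>k. ennreal (c j) * indicator (?B j) k) = ennreal (c j) * of_nat (card (?B j))"
      by (simp add: finite_lattice_ball)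
  qed
  also have "\<dots> \<le> csum (\<lambda>j. ennreal (C * 3 ^ n * inverse (real (Suc j) ^ 2)))"
  proof (rule nn_integral_mono)
    fix j
    have "real (card (?B j)) \<le> real ((2 * j + 3) ^ n)" using card[of j] by (simp only: of_nat_le_iff)
    also have "\<dots> \<le> (3 * (1 + real j)) ^ n" unfolding of_nat_power by (intro power_mono) auto
    finally have "c j * real (card (?B j)) \<le> c j * (3 * (1 + real j)) ^ n" using c0 by (intro mult_left_mono)
    also have "\<dots> = C * 3 ^ n * inverse (real (Suc j) ^ 2)"
      unfolding c_def power_add power_mult_distrib by (simp add: field_simps)
    finally have "c j * real (card (?B j)) \<le> C * 3 ^ n * inverse (real (Suc j) ^ 2)" .
    then have "ennreal (c j * real (card (?B j))) \<le> ennreal (C * 3 ^ n * inverse (real (Suc j) ^ 2))" by (rule ennreal_leI)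
    then show "ennreal (c j) * of_nat (card (?B j)) \<le> ennreal (C * 3 ^ n * inverse (real (Suc j) ^ 2))"
      using c0 by (simp only: ennreal_mult'' of_nat_0_le_iff ennreal_of_nat_eq_real_of_nat)
  qed
  also have "\<dots> < \<infinity>"
  proof -
    have "summable (\<lambda>j. inverse (real j ^ 2))" using inverse_power_summable[of 2, where 'a=real] by simp
    then have "summable (\<lambda>j. inverse (real (Suc j) ^ 2))" by (subst summable_Suc_iff)
    then have "summable (\<lambda>j. C * 3 ^ n * inverse (real (Suc j) ^ 2))" by (rule summable_mult)
    then show ?thesis using C unfolding nn_integral_count_space_nat by (subst suminf_ennreal2) auto
  qed
  finally show ?thesis .
qed

locale reg_weight =
  fixes w :: "real \<Rightarrow> real" and \<alpha> :: real
  assumes w_class: "w \<in> weight_class" and w_var: "regularly_varying \<alpha> w" and alpha: "0 < \<alpha>" "\<alpha> < 1"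
begin

lemma w_ge_1: "0 \<le> x \<Longrightarrow> 1 \<le> w x"
  using w_class by (auto simp: weight_class_def)

lemma w_mono: "0 \<le> x \<Longrightarrow> x \<le> y \<Longrightarrow> w x \<le> w y"
  using w_class strict_mono_on_imp_mono_on[of "{0..}" w] by (auto simp: weight_class_def mono_on_def)

lemma w_log: "filterlim (\<lambda>t. w t - M * ln t) at_top at_top"
  using w_class by (auto simp: weight_class_def)

lemma w_deriv_both:
  assumes x: "0 < x"
  shows "(w has_real_derivative deriv w x) (at x)" "(deriv w has_real_derivative deriv (deriv w) x) (at x)"
proof -
  have sm: "smooth_on {0<..} w" using w_class by (auto simp: weight_class_def)
  have d: "(w has_real_derivative frechet_derivative w (at x) 1) (at x)" if "0 < x" for x
  proof -
    have "iterated_partial [] w differentiable (at x)"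
      using sm that unfolding smooth_on_def by (metis empty_subsetI greaterThan_iff list.set(1))
    then have diff: "w differentiable (at x)" by simp
    then have 1: "(w has_derivative frechet_derivative w (at x)) (at x)" by (simp add: frechet_derivative_works)
    have "frechet_derivative w (at x) = (*) (frechet_derivative w (at x) 1)"
    proof
      fix h
      have "frechet_derivative w (at x) (h *\<^sub>R 1) = h *\<^sub>R frechet_derivative w (at x) 1"
        by (rule linear_scale[OF linear_frechet_derivative[OF diff]])
      then show "frechet_derivative w (at x) h = frechet_derivative w (at x) 1 * h" by (simp add: mult.commute)
    qed
    then show ?thesis using 1 unfolding has_field_derivative_def by simp
  qed
  then have eq: "deriv w x = frechet_derivative w (at x) 1" if "0 < x" for x using that by (blast intro: DERIV_imp_deriv)
  show "(w has_real_derivative deriv w x) (at x)" using d[OF x] eq[OF x] by simp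
  have "iterated_partial [1] w differentiable (at x)"
    using sm x unfolding smooth_on_def by (metis Basis_real_def greaterThan_iff list.set(1) list.set(2) order_refl)
  then have "(\<lambda>x. frechet_derivative w (at x) 1) differentiable (at x)" by simp
  then obtain D where "((\<lambda>x. frechet_derivative w (at x) 1) has_real_derivative D) (at x)"
    by (auto simp: real_differentiable_def)
  then have "(deriv w has_real_derivative D) (at x)"
  proof (rule DERIV_cong_ev[THEN iffD1, rotated -1])
    have "\<forall>\<^sub>F y in nhds x. y \<in> {0<..}" using x by (intro eventually_nhds_in_open) auto
    then show "\<forall>\<^sub>F x in nhds x. frechet_derivative w (at x) 1 = deriv w x" by eventually_elim (simp add: eq)
  qed auto
  then show "(deriv w has_real_derivative deriv (deriv w) x) (at x)" using DERIV_imp_deriv by force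
qed

lemmas w_deriv = w_deriv_both(1) and w_deriv2 = w_deriv_both(2)

text \<open>Regular variation is exploited at the dilation factor 2; iteration over dyadic blocks
  yields the power bounds below.\<close>

lemma w_ratio: "0 < c \<Longrightarrow> c < 2 powr \<alpha> \<Longrightarrow> \<forall>\<^sub>F t in at_top. c * w t \<le> w (2 * t)"
  "2 powr \<alpha> < c \<Longrightarrow> \<forall>\<^sub>F t in at_top. w (2 * t) \<le> c * w t"
proof -
  have lim: "((\<lambda>t. w (t * 2) / w t) \<longlongrightarrow> 2 powr \<alpha>) at_top" and pos: "\<And>x. 0 < x \<Longrightarrow> 0 < w x"
    using w_var by (auto simp: regularly_varying_def)
  show "\<forall>\<^sub>F t in at_top. c * w t \<le> w (2 * t)" if "0 < c" "c < 2 powr \<alpha>"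
    using order_tendstoD(1)[OF lim that(2)] eventually_gt_at_top[of 0]
    by eventually_elim (use pos in \<open>simp add: less_divide_eq mult.commute less_imp_le\<close>)
  show "\<forall>\<^sub>F t in at_top. w (2 * t) \<le> c * w t" if "2 powr \<alpha> < c"
    using order_tendstoD(2)[OF lim that] eventually_gt_at_top[of 0]
    by eventually_elim (use pos in \<open>simp add: divide_less_eq mult.commute less_imp_le\<close>)
qed

text \<open>Beyond \<tau> the weight is concave, so for x \<ge> y the increment w (x + y) - w x is
  at most its value w (2 y) - w y at x = y. Regular variation bounds w (2 y) by (1 + \<beta>) w y
  for large y, with \<beta> < 1 because \<alpha> < 1.\<close>

lemma w_add_aux:
  obtains \<beta> C where "0 \<le> \<beta>" "\<beta> < 1" "0 \<le> C" "\<And>x y. 0 \<le> y \<Longrightarrow> y \<le> x \<Longrightarrow> w (x + y) \<le> w x + \<beta> * w y + C"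
proof -
  obtain \<tau> where tau: "0 \<le> \<tau>" "\<And>x. \<tau> < x \<Longrightarrow> deriv (deriv w) x < 0"
    using w_class by (auto simp: weight_class_def)
  have a2: "1 < 2 powr \<alpha>" "2 powr \<alpha> < 2"
    using alpha powr_less_mono[of 0 \<alpha> 2] powr_less_mono[of \<alpha> 1 2] by auto
  \<comment> \<open>As 2 powr \<alpha> < 2, this number lies below 1, and 1 + \<beta> exceeds 2 powr
    \<alpha>, which leaves room for the passage from the limit to large arguments.\<close>
  define \<beta> where "\<beta> = 2 powr \<alpha> / 2"
  have b: "0 \<le> \<beta>" "\<beta> < 1" "2 powr \<alpha> < 1 + \<beta>" using a2 by (auto simp: \<beta>_def)
  obtain T where T: "\<And>t. T \<le> t \<Longrightarrow> w (2 * t) \<le> (1 + \<beta>) * w t"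
    using w_ratio(2)[OF b(3)] unfolding eventually_at_top_linorder by blast
  define Y where "Y = max T (\<tau> + 1)"
  have Y: "0 < Y" "\<tau> < Y" "T \<le> Y" using tau by (auto simp: Y_def)
  have inc: "w (x + y) - w x \<le> w (y + y) - w y" if "Y \<le> y" "y \<le> x" for x y
  proof -
    have "(\<lambda>t. w (t + y) - w t) x \<le> (\<lambda>t. w (t + y) - w t) y"
    proof (rule DERIV_nonpos_imp_nonincreasing[of _ _ "\<lambda>t. w (t + y) - w t", OF that(2)])
      fix t assume t: "y \<le> t" "t \<le> x"
      have pos: "0 < t" "0 < t + y" "\<tau> < t" using t that Y by auto
      have "((\<lambda>t. w (t + y)) has_real_derivative deriv w (t + y)) (at t)"
        using DERIV_shift[of w "deriv w (t + y)" t y] w_deriv[OF pos(2)] by simp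
      then have "((\<lambda>t. w (t + y) - w t) has_real_derivative deriv w (t + y) - deriv w t) (at t)"
        by (intro DERIV_diff w_deriv pos)
      moreover have "deriv w (t + y) \<le> deriv w t"
      proof (rule DERIV_nonpos_imp_nonincreasing[of _ _ "deriv w"])
        show "t \<le> t + y" using that Y by simp
        fix z assume "t \<le> z" "z \<le> t + y"
        then show "\<exists>d. (deriv w has_real_derivative d) (at z) \<and> d \<le> 0"
          using w_deriv2[of z] tau(2)[of z] pos by (intro exI[of _ "deriv (deriv w) z"]) auto
      qed
      ultimately show "\<exists>d. ((\<lambda>t. w (t + y) - w t) has_real_derivative d) (at t) \<and> d \<le> 0" by force
    qed
    then show ?thesis by simp
  qed
  have big: "w (x + y) \<le> w x + \<beta> * w y" if "Y \<le> y" "y \<le> x" for x y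
    using inc[OF that] T[of y] that Y by (simp add: distrib_right)
  show ?thesis
  \<comment> \<open>The additive constant absorbs all y below Y: either x \<ge> Y and y may be
    enlarged to Y, or x + y \<le> 2 Y.\<close>
  proof (rule that[of \<beta> "w (2 * Y)"])
    show "0 \<le> w (2 * Y)" using w_ge_1[of "2 * Y"] Y by simp
    fix x y :: real assume y: "0 \<le> y" "y \<le> x"
    have wy: "0 \<le> \<beta> * w y" using b w_ge_1[OF y(1)] by simp
    show "w (x + y) \<le> w x + \<beta> * w y + w (2 * Y)"
    proof (cases "Y \<le> y")
      case True
      then show ?thesis using big[OF True y(2)] \<open>0 \<le> w (2 * Y)\<close> by simp
    next
      case False
      show ?thesis
      proof (cases "Y \<le> x")
        case True
        have "w (x + y) \<le> w (x + Y)" using y False by (intro w_mono) auto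
        also have "\<dots> \<le> w x + w (Y + Y) - w Y" using inc[OF order_refl True] by simp
        also have "\<dots> \<le> w x + w (2 * Y)" using w_ge_1[of Y] Y by simp
        finally show ?thesis using wy by simp
      next
        case F: False
        have "w (x + y) \<le> w (2 * Y)" using y False F by (intro w_mono) auto
        then show ?thesis using wy w_ge_1[of x] y by simp
      qed
    qed
  qed (use b in auto)
qed

lemma w_add:
  obtains \<beta> C where "0 \<le> \<beta>" "\<beta> < 1" "0 \<le> C"
    "\<And>x y z. 0 \<le> x \<Longrightarrow> 0 \<le> y \<Longrightarrow> 0 \<le> z \<Longrightarrow> z \<le> x + y \<Longrightarrow> w z \<le> max (w x + \<beta> * w y) (w y + \<beta> * w x) + C"
proof -
  obtain \<beta> C where b: "0 \<le> \<beta>" "\<beta> < 1" "0 \<le> C" "\<And>x y. 0 \<le> y \<Longrightarrow> y \<le> x \<Longrightarrow> w (x + y) \<le> w x + \<beta> * w y + C"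
    using w_add_aux by blast
  show ?thesis
  proof (rule that[OF b(1-3)])
    fix x y z :: real assume "0 \<le> x" "0 \<le> y" "0 \<le> z" "z \<le> x + y"
    then show "w z \<le> max (w x + \<beta> * w y) (w y + \<beta> * w x) + C"
      using w_mono[of z "x + y"] b(4)[of x y] b(4)[of y x] by (cases "y \<le> x") (auto simp: add.commute max_def)
  qed
qed

text \<open>Iterated subadditivity; the additive constants are absorbed because w \<ge> 1.\<close>

lemma w_scale:
  obtains D where "1 \<le> D" "\<And>m x. 0 \<le> x \<Longrightarrow> w (real m * x) \<le> (real m + 1) * D * w x"
proof -
  obtain \<beta> C where b: "0 \<le> \<beta>" "\<beta> < 1" "0 \<le> C"
    "\<And>x y z. 0 \<le> x \<Longrightarrow> 0 \<le> y \<Longrightarrow> 0 \<le> z \<Longrightarrow> z \<le> x + y \<Longrightarrow> w z \<le> max (w x + \<beta> * w y) (w y + \<beta> * w x) + C"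
    using w_add by blast
  have sub: "w (x + y) \<le> w x + w y + C" if "0 \<le> x" "0 \<le> y" for x y
  proof -
    have "\<beta> * w x \<le> w x" "\<beta> * w y \<le> w y"
      using b w_ge_1[of x] w_ge_1[of y] that by (auto intro!: mult_left_le_one_le)
    then show ?thesis using b(4)[OF that _ order_refl] that by (simp add: max_def split: if_splits)
  qed
  show ?thesis
  proof (rule that[of "1 + C"])
    fix m :: nat and x :: real assume x: "0 \<le> x"
    show "w (real m * x) \<le> (real m + 1) * (1 + C) * w x"
    proof (induction m)
      case 0
      have "w 0 \<le> w x" using x by (intro w_mono) auto
      also have "\<dots> \<le> (1 + C) * w x" using b w_ge_1[OF x] by (simp add: mult_le_cancel_right1)
      finally show ?case by simp
    next
      case (Suc m)
      have "w (real (Suc m) * x) = w (real m * x + x)" by (simp add: algebra_simps)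
      also have "\<dots> \<le> w (real m * x) + w x + C" using x by (intro sub) auto
      also have "C \<le> C * w x" using b w_ge_1[OF x] by (simp add: mult_le_cancel_left1)
      finally show ?case using Suc by (simp add: algebra_simps)
    qed
  qed (use b in simp)
qed

text \<open>A Potter bound: a doubling multiplies w by at most 2 powr g with g above \<alpha>, and
  induction over dyadic blocks does the rest. The exponent (1 + \<alpha>) / 2 is chosen above
  \<alpha> and below 1, so that w t becomes small against y t.\<close>

lemma w_upper_power:
  obtains C where "0 < C" "\<And>t. 1 \<le> t \<Longrightarrow> w t \<le> C * t powr ((1 + \<alpha>) / 2)"
proof -
  define g where "g = (1 + \<alpha>) / 2"
  have g: "\<alpha> < g" "0 < g" using alpha by (auto simp: g_def)
  have "2 powr \<alpha> < 2 powr g" using g by simp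
  from w_ratio(2)[OF this] obtain T where T: "\<And>t. T \<le> t \<Longrightarrow> w (2 * t) \<le> 2 powr g * w t"
    unfolding eventually_at_top_linorder by blast
  define t0 where "t0 = max T 1"
  have t0: "1 \<le> t0" "T \<le> t0" by (auto simp: t0_def)
  define A where "A = w (2 * t0)"
  have A: "1 \<le> A" unfolding A_def using t0 by (intro w_ge_1) auto
  have P: "w t \<le> A * (t / t0) powr g" if "t0 \<le> t" "t \<le> t0 * 2 ^ Suc k" for t k
    using that
  proof (induction k arbitrary: t)
    case 0
    have "w t \<le> A" unfolding A_def using 0 t0 by (intro w_mono) auto
    also have "\<dots> \<le> A * (t / t0) powr g" using A 0 t0 g by (simp add: mult_le_cancel_left1 ge_one_powr_ge_zero)
    finally show ?case .
  next
    case (Suc k)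
    show ?case
    proof (cases "t \<le> 2 * t0")
      case True
      have "w t \<le> A" unfolding A_def using Suc.prems True t0 by (intro w_mono) auto
      also have "\<dots> \<le> A * (t / t0) powr g" using A Suc.prems t0 g by (simp add: mult_le_cancel_left1 ge_one_powr_ge_zero)
      finally show ?thesis .
    next
      case False
      have "w t \<le> 2 powr g * w (t / 2)" using T[of "t / 2"] False t0 by simp
      also have "w (t / 2) \<le> A * (t / 2 / t0) powr g" using Suc.prems False by (intro Suc.IH) auto
      also have "2 powr g * (A * (t / 2 / t0) powr g) = A * (2 * (t / 2 / t0)) powr g"
        using Suc.prems t0 by (subst powr_mult) auto
      finally show ?thesis by simp
    qed
  qed
  show ?thesis
  proof (rule that[of A])
    fix t :: real assume t: "1 \<le> t"
    have "w t \<le> A * t powr g"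
    proof (cases "t0 \<le> t")
      case True
      obtain k :: nat where k: "t / t0 < 2 ^ k" using real_arch_pow[of 2 "t / t0"] by auto
      then have "t \<le> t0 * 2 ^ Suc k" using t0 True by (simp add: field_simps)
      then have "w t \<le> A * (t / t0) powr g" by (rule P[OF True])
      also have "\<dots> \<le> A * t powr g" using A t t0 g by (intro mult_left_mono powr_mono2) (auto simp: divide_le_eq)
      finally show ?thesis .
    next
      case False
      then have "w t \<le> A" unfolding A_def using t t0 by (intro w_mono) auto
      also have "\<dots> \<le> A * t powr g" using A t g by (simp add: mult_le_cancel_left1 ge_one_powr_ge_zero)
      finally show ?thesis .
    qed
    then show "w t \<le> A * t powr ((1 + \<alpha>) / 2)" by (simp add: g_def)
  qed (use A in simp)
qed

text \<open>The counterpart from below. The exponent \<alpha> / (1 + \<alpha>) is less than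
  \<alpha>, and its reciprocal 1 / \<alpha> + 1 is what bounds R / w R by a multiple of (ln
  r)^(1/\<alpha>) when w R is a multiple of ln r.\<close>

lemma w_lower_power:
  obtains c where "0 < c" "\<And>t. 1 \<le> t \<Longrightarrow> c * t powr (\<alpha> / (1 + \<alpha>)) \<le> w t"
proof -
  define g where "g = \<alpha> / (1 + \<alpha>)"
  have g: "g < \<alpha>" "0 < g" using alpha by (auto simp: g_def field_simps)
  have "2 powr g < 2 powr \<alpha>" "0 < 2 powr g" using g by auto
  from w_ratio(1)[OF this(2,1)] obtain T where T: "\<And>t. T \<le> t \<Longrightarrow> 2 powr g * w t \<le> w (2 * t)"
    unfolding eventually_at_top_linorder by blast
  define t0 where "t0 = max T 1"
  have t0: "1 \<le> t0" "T \<le> t0" by (auto simp: t0_def)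
  have small: "(t / (2 * t0)) powr g \<le> w t" if "1 \<le> t" "t \<le> 2 * t0" for t
  proof -
    have "(t / (2 * t0)) powr g \<le> 1" using that t0 g by (intro powr_le1) auto
    then show ?thesis using w_ge_1[of t] that by simp
  qed
  have P: "(t / (2 * t0)) powr g \<le> w t" if "t0 \<le> t" "t \<le> t0 * 2 ^ Suc k" for t k
    using that
  proof (induction k arbitrary: t)
    case 0
    then show ?case using t0 by (intro small) auto
  next
    case (Suc k)
    show ?case
    proof (cases "t \<le> 2 * t0")
      case True
      then show ?thesis using Suc.prems t0 by (intro small) auto
    next
      case False
      have "(t / (2 * t0)) powr g = (2 * (t / 2 / (2 * t0))) powr g" by simp
      also have "\<dots> = 2 powr g * (t / 2 / (2 * t0)) powr g" using Suc.prems t0 by (subst powr_mult) auto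
      also have "(t / 2 / (2 * t0)) powr g \<le> w (t / 2)" using Suc.prems False by (intro Suc.IH) auto
      also have "2 powr g * w (t / 2) \<le> w t" using T[of "t / 2"] False t0 by simp
      finally show ?thesis by simp
    qed
  qed
  show ?thesis
  proof (rule that[of "1 / (2 * t0) powr g"])
    fix t :: real assume t: "1 \<le> t"
    have "(t / (2 * t0)) powr g \<le> w t"
    proof (cases "t0 \<le> t")
      case True
      obtain k :: nat where k: "t / t0 < 2 ^ k" using real_arch_pow[of 2 "t / t0"] by auto
      then have "t \<le> t0 * 2 ^ Suc k" using t0 True by (simp add: field_simps)
      then show ?thesis by (rule P[OF True])
    qed (use t t0 small in auto)
    then show "1 / (2 * t0) powr g * t powr (\<alpha> / (1 + \<alpha>)) \<le> w t"
      using t t0 by (simp add: powr_divide g_def)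
  qed (use t0 in simp)
qed

text \<open>The logarithmic growth condition lets \<delta> w t exceed any multiple of ln t for large
  t, so exp (- \<delta> w) decays faster than any power.\<close>

lemma w_summable:
  assumes d: "0 < \<delta>"
  shows "csum (\<lambda>k::int^'n. ennreal (exp (- \<delta> * w (norm (real_vec k))))) < \<infinity>"
proof -
  define N where "N = CARD('n) + 2"
  have "\<forall>\<^sub>F t in at_top. 0 \<le> w t - (real N / \<delta>) * ln t" using w_log[of "real N / \<delta>"] unfolding filterlim_at_top by blast
  then obtain T where "\<And>t. T \<le> t \<Longrightarrow> 0 \<le> w t - (real N / \<delta>) * ln t" unfolding eventually_at_top_linorder by blast
  then have T: "\<And>t. T \<le> t \<Longrightarrow> (real N / \<delta>) * ln t \<le> w t" by (simp only: diff_ge_0_iff_ge)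
  define T' where "T' = max T 1"
  define C where "C = (1 + T') ^ N + 2 ^ N"
  have key: "exp (- \<delta> * w t) * (1 + t) ^ N \<le> C" if t: "0 \<le> t" for t
  proof (cases "T' \<le> t")
    case True
    then have t1: "1 \<le> t" "T \<le> t" by (auto simp: T'_def)
    have "real N * ln t \<le> \<delta> * w t" using T[OF t1(2)] d by (simp add: field_simps)
    then have "exp (- \<delta> * w t) \<le> exp (- (real N * ln t))" by simp
    also have "\<dots> = inverse (t ^ N)" using t1 by (simp add: exp_minus exp_of_nat_mult)
    finally have "exp (- \<delta> * w t) * (1 + t) ^ N \<le> inverse (t ^ N) * (2 * t) ^ N"
      using t1 by (intro mult_mono power_mono) auto
    also have "\<dots> = 2 ^ N" using t1 by (simp add: power_mult_distrib)
    finally show ?thesis using T'_def by (simp add: C_def) (smt (verit) zero_le_power)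
  next
    case False
    have "exp (- \<delta> * w t) * (1 + t) ^ N \<le> 1 * (1 + T') ^ N"
      using False t d w_ge_1[OF t] by (intro mult_mono power_mono) auto
    then show ?thesis by (simp add: C_def) (smt (verit) zero_le_power)
  qed
  show ?thesis
  proof (rule csum_lattice_decay_finite[of _ C])
    fix k :: "int^'n"
    have "0 < (1 + norm (real_vec k)) ^ N" by (intro zero_less_power add_pos_nonneg) auto
    then show "ennreal (exp (- \<delta> * w (norm (real_vec k)))) \<le> ennreal (C / (1 + norm (real_vec k)) ^ (CARD('n) + 2))"
      using key[of "norm (real_vec k)"] by (intro ennreal_leI) (simp add: pos_le_divide_eq N_def)
    show "0 \<le> C" using T'_def by (simp add: C_def)
  qed
qed

text \<open>\<open>R\<close> is the frequency cut and \<open>y\<close> the width of the strip to which the low frequency part extends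
  with bounded weight.\<close>

lemma parameters:
  assumes C4: "0 < C4" and V1: "1 \<le> V1" and S: "1 \<le> S"
  obtains r0 CX where "3 \<le> r0" "0 < CX"
    "\<And>r. r0 \<le> r \<Longrightarrow> \<exists>R y. 1 \<le> R \<and> 0 < y \<and> y \<le> 1 \<and> w R = C4 * ln r \<and> (\<forall>t. 0 \<le> t \<and> t \<le> R \<longrightarrow> y * t \<le> w t / 2) \<and>
       2 * (r * V1 + S) / y \<le> CX * (r * ln r powr (1 / \<alpha>)) \<and> (\<forall>t\<ge>2 * (r * V1 + S) / y. 4 * w t \<le> y * t)"
proof -
  obtain D where D: "1 \<le> D" "\<And>m x. 0 \<le> x \<Longrightarrow> w (real m * x) \<le> (real m + 1) * D * w x" using w_scale by blast
  obtain Cu where Cu: "0 < Cu" "\<And>t. 1 \<le> t \<Longrightarrow> w t \<le> Cu * t powr ((1 + \<alpha>) / 2)" using w_upper_power by blast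
  obtain cl where cl: "0 < cl" "\<And>t. 1 \<le> t \<Longrightarrow> cl * t powr (\<alpha> / (1 + \<alpha>)) \<le> w t" using w_lower_power by blast
  have w1: "1 \<le> w 1" by (rule w_ge_1) simp
  \<comment> \<open>Up to a constant, w t / t is decreasing: R is covered by about R / t steps of
    length t. This replaces concavity, which is available only beyond \<tau>.\<close>
  have wR: "w R \<le> 3 * D * (R / t) * w t" if "0 < t" "t \<le> R" for R t
  proof -
    define m where "m = nat \<lceil>R / t\<rceil>"
    have m: "R / t \<le> real m" "real m \<le> R / t + 1" using that real_nat_ceiling_ge[of "R / t"] of_nat_ceiling[of "R / t"] ceiling_correct[of "R / t"]
      by (auto simp: m_def)
    have "w R \<le> w (real m * t)" using m that by (intro w_mono) (auto simp: field_simps)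
    also have "\<dots> \<le> (real m + 1) * D * w t" using that by (intro D(2)) auto
    also have "\<dots> \<le> (3 * (R / t)) * D * w t"
      using m that D(1) w_ge_1[of t] by (intro mult_right_mono) (auto simp: field_simps)
    finally show ?thesis by (simp add: mult_ac)
  qed
  \<comment> \<open>\<open>wR\<close> costs 3 D, and the factor 1/2 in y t \<le> w t / 2 doubles
    this; the factor w 1 yields y \<le> 1 through \<open>wR\<close> at t = 1.\<close>
  define c2 where "c2 = 1 / (6 * D * w 1)"
  have c2: "0 < c2" using D w1 by (simp add: c2_def)
  define E where "E = (C4 / cl) powr (1 / \<alpha> + 1)"
  have E: "0 < E" using C4 cl by (simp add: E_def)
  define K where "K = 4 * Cu"
  define g where "g = (1 - \<alpha>) / 2"
  have g: "0 < g" "g < 1" using alpha by (auto simp: g_def)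
  define q where "q = c2 * C4 / E"
  have q: "0 < q" using c2 C4 E by (simp add: q_def)
  \<comment> \<open>With y \<ge> q (ln r)^(-1/\<alpha>) and t \<ge> r / y this quantity bounds y t^g
    from below. Once it exceeds K = 4 Cu, the upper power bound gives 4 w t \<le> K t^(1-g) \<le> y
    t.\<close>
  have "filterlim (\<lambda>r::real. r powr g * (q * ln r powr (- 1 / \<alpha>)) powr (1 - g)) at_top at_top"
    using g q alpha by real_asymp
  then have ev1: "\<forall>\<^sub>F r in at_top. K \<le> r powr g * (q * ln r powr (- 1 / \<alpha>)) powr (1 - g)"
    unfolding filterlim_at_top by blast
  have "filterlim (\<lambda>r::real. C4 * ln r) at_top at_top" using C4 by real_asymp
  then have ev2: "\<forall>\<^sub>F r in at_top. w 1 \<le> C4 * ln r" unfolding filterlim_at_top by blast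
  have "\<forall>\<^sub>F r in at_top. K \<le> r powr g * (q * ln r powr (- 1 / \<alpha>)) powr (1 - g) \<and> w 1 \<le> C4 * ln r \<and> S \<le> r \<and> 3 \<le> r"
    using ev1 ev2 eventually_ge_at_top[of S] eventually_ge_at_top[of 3] by eventually_elim auto
  then obtain r1 where r1: "\<And>r. r1 \<le> r \<Longrightarrow> K \<le> r powr g * (q * ln r powr (- 1 / \<alpha>)) powr (1 - g)"
    "\<And>r. r1 \<le> r \<Longrightarrow> w 1 \<le> C4 * ln r" "\<And>r. r1 \<le> r \<Longrightarrow> S \<le> r" "\<And>r. r1 \<le> r \<Longrightarrow> 3 \<le> r"
    unfolding eventually_at_top_linorder by blast
  define CX where "CX = 4 * V1 * E / (c2 * C4)"
  show ?thesis
  proof (rule that[of "max r1 3" CX])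
    show "0 < CX" using V1 E c2 C4 by (simp add: CX_def)
    fix r assume "max r1 3 \<le> r"
    then have r: "r1 \<le> r" "3 \<le> r" by auto
    have lnr: "0 < ln r" using r by simp
    have cont: "continuous_on {1..x} w" for x
      by (intro continuous_at_imp_continuous_on ballI DERIV_isCont[OF w_deriv]) auto
    have "\<forall>\<^sub>F x in at_top. 0 \<le> w x - 1 * ln x" using w_log[of 1] unfolding filterlim_at_top by blast
    moreover have "\<forall>\<^sub>F x::real in at_top. C4 * ln r \<le> ln x" by real_asymp
    ultimately have "\<forall>\<^sub>F x in at_top. C4 * ln r \<le> w x \<and> 1 \<le> x"
      using eventually_ge_at_top[of 1] by eventually_elim auto
    then obtain x where x: "C4 * ln r \<le> w x" "1 \<le> x" by (auto simp: eventually_at_top_linorder)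
    obtain R where R: "1 \<le> R" "w R = C4 * ln r"
      using IVT'[of w 1 "C4 * ln r" x] r1(2)[OF r(1)] x cont by auto
    define y where "y = c2 * w R / R"
    have wRpos: "0 < w R" using w_ge_1[of R] R by simp
    have y0: "0 < y" using c2 wRpos R by (simp add: y_def)
    have y1: "y \<le> 1"
    proof -
      have "0 < D * w 1 * R" using D(1) w1 R by simp
      moreover have "w R \<le> 3 * (D * w 1 * R)" using wR[of 1 R] R by (simp add: mult_ac)
      ultimately have "w R \<le> 6 * (D * w 1 * R)" by linarith
      moreover have "y = w R / (6 * (D * w 1 * R))" by (simp add: y_def c2_def mult_ac)
      ultimately show ?thesis using \<open>0 < D * w 1 * R\<close> by (simp add: divide_le_eq)
    qed
    have yt: "y * t \<le> w t / 2" if t: "0 \<le> t" "t \<le> R" for t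
    proof (cases "t = 0")
      case False
      then have "w R \<le> 3 * D * (R / t) * w t" using t by (intro wR) auto
      then have "w R * t \<le> 3 * D * R * w t" using False t by (simp add: field_simps)
      then have "c2 * (w R * t) \<le> c2 * (3 * D * R * w t)" using c2 by (intro mult_left_mono) auto
      also have "\<dots> = R * w t / (2 * w 1)" using D w1 by (simp add: c2_def)
      also have "\<dots> \<le> R * w t / 2" using R w1 w_ge_1[OF t(1)] by (intro divide_left_mono) auto
      finally show ?thesis using R by (simp add: y_def field_simps)
    qed (use w_ge_1[of 0] in simp)
    \<comment> \<open>The lower power bound is raised to the exponent 1 / \<alpha> + 1; the later
      division by w R = C4 ln r removes one logarithm and leaves (ln r)^(1/\<alpha>).\<close>
    have RE: "R \<le> E * (ln r * ln r powr (1 / \<alpha>))"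
    proof -
      have "cl * R powr (\<alpha> / (1 + \<alpha>)) \<le> C4 * ln r" using cl(2)[OF R(1)] R(2) by simp
      then have "R powr (\<alpha> / (1 + \<alpha>)) \<le> C4 / cl * ln r" using cl by (simp add: field_simps)
      then have "(R powr (\<alpha> / (1 + \<alpha>))) powr (1 / \<alpha> + 1) \<le> (C4 / cl * ln r) powr (1 / \<alpha> + 1)"
        using alpha by (intro powr_mono2) auto
      moreover have "\<alpha> + \<alpha> * \<alpha> \<noteq> 0" using alpha add_pos_pos[of \<alpha> "\<alpha> * \<alpha>"] by simp
      then have "(\<alpha> / (1 + \<alpha>)) * (1 / \<alpha> + 1) = 1" using alpha by (simp add: field_simps)
      ultimately have "R \<le> (C4 / cl * ln r) powr (1 / \<alpha> + 1)" using R by (simp only: powr_powr powr_one)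
      also have "\<dots> = E * ln r powr (1 / \<alpha> + 1)" using C4 cl(1) lnr unfolding E_def by (subst powr_mult) auto
      also have "ln r powr (1 / \<alpha> + 1) = ln r * ln r powr (1 / \<alpha>)" using lnr by (simp add: powr_add)
      finally show ?thesis .
    qed
    have yq: "q * ln r powr (- 1 / \<alpha>) \<le> y"
    proof -
      have "q * ln r powr (- 1 / \<alpha>) = c2 * C4 * ln r / (E * (ln r * ln r powr (1 / \<alpha>)))"
        using lnr E by (simp add: q_def powr_minus divide_inverse powr_divide mult_ac minus_divide_left[symmetric])
      also have "\<dots> \<le> c2 * C4 * ln r / R"
        using RE R c2 C4 lnr E by (intro divide_left_mono) auto
      also have "\<dots> = y" by (simp add: y_def R mult.assoc)
      finally show ?thesis .
    qed
    have Xle: "2 * (r * V1 + S) / y \<le> CX * (r * ln r powr (1 / \<alpha>))"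
    proof -
      have "r * V1 + S \<le> 2 * (r * V1)" using r1(3)[OF r(1)] mult_left_mono[OF V1, of r] r(2) by linarith
      then have "2 * (r * V1 + S) / y \<le> 4 * r * V1 / y" using y0 by (intro divide_right_mono) auto
      also have "\<dots> = 4 * r * V1 * R / (c2 * (C4 * ln r))" by (simp add: y_def R)
      also have "\<dots> \<le> 4 * r * V1 * (E * (ln r * ln r powr (1 / \<alpha>))) / (c2 * (C4 * ln r))"
        using RE r V1 c2 C4 lnr by (intro divide_right_mono mult_left_mono) auto
      also have "\<dots> = CX * (r * ln r powr (1 / \<alpha>))" using lnr c2 C4 by (simp add: CX_def)
      finally show ?thesis .
    qed
    have big: "4 * w t \<le> y * t" if t: "2 * (r * V1 + S) / y \<le> t" for t
    proof -
      have "r * 1 \<le> r * V1" using V1 r by (intro mult_left_mono) auto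
      then have "r \<le> r * V1 + S" using S by simp
      then have "r \<le> 2 * (r * V1 + S)" using r(2) by (simp only: mult_2)
      then have "r / y \<le> 2 * (r * V1 + S) / y" using y0 by (intro divide_right_mono) auto
      then have ry: "r / y \<le> t" using t by simp
      have "1 \<le> r / y" using y0 y1 r by (simp add: field_simps)
      then have t1: "1 \<le> t" using ry by simp
      have "K \<le> r powr g * (q * ln r powr (- 1 / \<alpha>)) powr (1 - g)" by (rule r1(1)[OF r(1)])
      also have "\<dots> \<le> r powr g * y powr (1 - g)"
        using yq q lnr g by (intro mult_left_mono powr_mono2) auto
      also have "\<dots> = y * (r / y) powr g" using y0 r by (simp add: powr_divide powr_diff)
      also have "\<dots> \<le> y * t powr g" using ry y0 r g by (intro mult_left_mono powr_mono2) auto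
      finally have "K * t powr (1 - g) \<le> y * t powr g * t powr (1 - g)" by (rule mult_right_mono) simp
      also have "\<dots> = y * t" using t1 by (simp add: mult.assoc powr_add[symmetric])
      finally have "K * t powr (1 - g) \<le> y * t" .
      moreover have "4 * w t \<le> K * t powr (1 - g)"
      proof -
        have "1 - g = (1 + \<alpha>) / 2" by (simp add: g_def field_simps)
        then show ?thesis using Cu(2)[OF t1] unfolding K_def \<open>1 - g = (1 + \<alpha>) / 2\<close> by linarith
      qed
      ultimately show ?thesis by simp
    qed
    show "\<exists>R y. 1 \<le> R \<and> 0 < y \<and> y \<le> 1 \<and> w R = C4 * ln r \<and> (\<forall>t. 0 \<le> t \<and> t \<le> R \<longrightarrow> y * t \<le> w t / 2) \<and>
       2 * (r * V1 + S) / y \<le> CX * (r * ln r powr (1 / \<alpha>)) \<and> (\<forall>t\<ge>2 * (r * V1 + S) / y. 4 * w t \<le> y * t)"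
      using R y0 y1 yt Xle big by (intro exI[of _ R] exI[of _ y]) auto
  qed auto
qed

end

section \<open>Moments of the frequency measure\<close>

context reg_weight
begin

abbreviation phi :: "real \<Rightarrow> real" where "phi x \<equiv> x * ln x powr (1 / \<alpha>)"

lemma phi_mono: "1 \<le> x \<Longrightarrow> x \<le> y \<Longrightarrow> phi x \<le> phi y"
  using alpha by (intro mult_mono powr_mono2) auto

lemma ln_ge_1: "3 \<le> x \<Longrightarrow> 1 \<le> ln (x::real)"
  using exp_le by (subst ln_ge_iff) auto

lemma phi_ge: "3 \<le> x \<Longrightarrow> x \<le> phi x"
  using ln_ge_1[of x] alpha by (simp add: mult_le_cancel_left1 ge_one_powr_ge_zero)

text \<open>Allows powers of x to be absorbed into exp (l w (phi x)) at the price of a larger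
  l.\<close>

lemma ln_le_weight:
  obtains c where "0 \<le> c" "\<And>x. 3 \<le> x \<Longrightarrow> ln x \<le> w (phi x) + c"
proof -
  have "\<forall>\<^sub>F t in at_top. 0 \<le> w t - 1 * ln t" using w_log[of 1] unfolding filterlim_at_top by blast
  then obtain T where T: "\<And>t. T \<le> t \<Longrightarrow> 0 \<le> w t - 1 * ln t" unfolding eventually_at_top_linorder by blast
  show ?thesis
  proof (rule that[of "ln (max T 1)"])
    fix x :: real assume x: "3 \<le> x"
    have "ln x \<le> ln (phi x)" using phi_ge[OF x] x by simp
    also have "\<dots> \<le> w (phi x) + ln (max T 1)"
    proof (cases "T \<le> phi x")
      case True
      have "0 \<le> ln (max T 1)" by simp
      then show ?thesis using T[OF True] by linarith
    next
      case False
      have "ln (phi x) \<le> ln (max T 1)" using False phi_ge[OF x] x by (subst ln_le_cancel_iff) auto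
      moreover have "1 \<le> w (phi x)" using phi_ge[OF x] x by (intro w_ge_1) linarith
      ultimately show ?thesis by linarith
    qed
    finally show "ln x \<le> w (phi x) + ln (max T 1)" .
  qed simp
qed

lemma power_moment_pointwise:
  obtains l K where "0 < l" "0 \<le> K"
    "\<And>x. \<bar>x\<bar> ^ n \<le> K + K * (exp (l * w (phi \<bar>x\<bar>)) * indicator {x. 3 \<le> \<bar>x\<bar>} (x::real))"
proof -
  obtain c where c: "0 \<le> c" "\<And>x. 3 \<le> x \<Longrightarrow> ln x \<le> w (phi x) + c" using ln_le_weight by blast
  define K where "K = max (3 ^ n) (exp (real n * c))"
  show ?thesis
  proof (rule that[of "real n + 1" K])
    show "0 \<le> K" by (simp add: K_def le_max_iff_disj)
    fix x :: real
    show "\<bar>x\<bar> ^ n \<le> K + K * (exp ((real n + 1) * w (phi \<bar>x\<bar>)) * indicator {x. 3 \<le> \<bar>x\<bar>} x)"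
    proof (cases "3 \<le> \<bar>x\<bar>")
      case True
      have "1 \<le> w (phi \<bar>x\<bar>)" using phi_ge[OF True] True by (intro w_ge_1) linarith
      have "\<bar>x\<bar> ^ n = exp (real n * ln \<bar>x\<bar>)" using True by (simp add: exp_of_nat_mult)
      also have "\<dots> \<le> exp (real n * (w (phi \<bar>x\<bar>) + c))" using c(2)[OF True] by (simp add: mult_left_mono)
      also have "\<dots> = exp (real n * c) * exp (real n * w (phi \<bar>x\<bar>))" by (simp add: distrib_left exp_add)
      also have "\<dots> \<le> K * exp ((real n + 1) * w (phi \<bar>x\<bar>))"
      proof (intro mult_mono)
        show "exp (real n * c) \<le> K" by (simp add: K_def)
      qed (use \<open>0 \<le> K\<close> \<open>1 \<le> w (phi \<bar>x\<bar>)\<close> in \<open>auto simp: distrib_right\<close>)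
      finally show ?thesis using True \<open>0 \<le> K\<close> by simp
    next
      case False
      then have "\<bar>x\<bar> ^ n \<le> 3 ^ n" by (intro power_mono) auto
      also have "\<dots> \<le> K" by (simp add: K_def)
      finally show ?thesis using False by simp
    qed
  qed simp
qed

text \<open>The radius r is |x| rounded up, hence at most 2 |x| for large |x|, and w (CX phi (2
  |x|)) is at most a multiple of w (phi |x|) by \<open>w_scale\<close>. Small |x| contribute only to
  the constant K.\<close>

lemma exp_moment_pointwise:
  assumes B: "0 \<le> B" and CX: "0 < CX" and N: "1 \<le> N"
  obtains l K where "0 < l" "0 \<le> K"
    "\<forall>x r. r = max (real N) (of_int \<lceil>\<bar>x\<bar>\<rceil>) \<longrightarrow> \<bar>x\<bar> * (B * r * exp (2 * w (CX * phi r))) \<le>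
      K + K * (exp (l * w (phi \<bar>x\<bar>)) * indicator {x. 3 \<le> \<bar>x\<bar>} x)"
proof -
  obtain c where c: "0 \<le> c" "\<And>x. 3 \<le> x \<Longrightarrow> ln x \<le> w (phi x) + c" using ln_le_weight by blast
  obtain D where D: "1 \<le> D" "\<And>m x. 0 \<le> x \<Longrightarrow> w (real m * x) \<le> (real m + 1) * D * w x" using w_scale by blast
  define m where "m = nat \<lceil>CX * (2 * 2 powr (1 / \<alpha>))\<rceil>"
  have m: "CX * (2 * 2 powr (1 / \<alpha>)) \<le> real m" by (simp add: m_def real_nat_ceiling_ge)
  define N1 where "N1 = max (real N) 3"
  define K1 where "K1 = N1 * (B * N1 * exp (2 * w (CX * phi N1)))"
  \<comment> \<open>The summand 2 absorbs the factors |x| and r through \<open>ln_le_weight\<close>;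
    the other summand is \<open>w_scale\<close> inside the exponent 2 w.\<close>
  define l where "l = 2 + 2 * ((real m + 1) * D)"
  have mono: "w (CX * phi r) \<le> w (CX * phi r')" if "1 \<le> r" "r \<le> r'" for r r'
    using that CX phi_mono[OF that] by (intro w_mono mult_left_mono) auto
  show ?thesis
  proof (rule that[of l "max K1 (2 * B * exp (2 * c))"])
    show "0 < l" using D by (simp add: l_def add_pos_nonneg)
    show K0: "0 \<le> max K1 (2 * B * exp (2 * c))" using B by (simp add: le_max_iff_disj)
    show "\<forall>x r. r = max (real N) (of_int \<lceil>\<bar>x\<bar>\<rceil>) \<longrightarrow> \<bar>x\<bar> * (B * r * exp (2 * w (CX * phi r))) \<le>
      max K1 (2 * B * exp (2 * c)) + max K1 (2 * B * exp (2 * c)) * (exp (l * w (phi \<bar>x\<bar>)) * indicator {x. 3 \<le> \<bar>x\<bar>} x)"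
    proof (intro allI impI)
    fix x r :: real assume r: "r = max (real N) (of_int \<lceil>\<bar>x\<bar>\<rceil>)"
    have r1: "1 \<le> r" using N r by simp
    show "\<bar>x\<bar> * (B * r * exp (2 * w (CX * phi r))) \<le> max K1 (2 * B * exp (2 * c)) +
       max K1 (2 * B * exp (2 * c)) * (exp (l * w (phi \<bar>x\<bar>)) * indicator {x. 3 \<le> \<bar>x\<bar>} x)"
    proof (cases "\<bar>x\<bar> \<le> N1")
      case True
      have N1: "N1 = of_int (int (max N 3))" by (simp add: N1_def)
      then have "\<lceil>\<bar>x\<bar>\<rceil> \<le> int (max N 3)" using True unfolding ceiling_le_iff by simp
      then have "of_int \<lceil>\<bar>x\<bar>\<rceil> \<le> N1" unfolding N1 of_int_le_iff .
      then have "r \<le> N1" unfolding r by (simp add: N1_def)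
      then have "\<bar>x\<bar> * (B * r * exp (2 * w (CX * phi r))) \<le> K1"
        unfolding K1_def using True B r1 mono[OF r1 \<open>r \<le> N1\<close>] by (intro mult_mono) auto
      moreover have "0 \<le> max K1 (2 * B * exp (2 * c)) * (exp (l * w (phi \<bar>x\<bar>)) * indicator {x. 3 \<le> \<bar>x\<bar>} x)"
        by (intro mult_nonneg_nonneg K0) auto
      ultimately show ?thesis by linarith
    next
      case False
      define z where "z = \<bar>x\<bar>"
      have z: "3 \<le> z" "real N \<le> z" using False by (auto simp: N1_def z_def)
      have r2: "r \<le> 2 * z" using ceiling_correct[of z] z unfolding r z_def by linarith
      have wz: "1 \<le> w (phi z)" using phi_ge[OF z(1)] z by (intro w_ge_1) linarith
      \<comment> \<open>As z \<ge> 2, the logarithm at most doubles, so phi (2 z) is at most a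
        constant times phi z.\<close>
      have "ln 2 \<le> ln z" using z by simp
      then have "ln (2 * z) \<le> 2 * ln z" using z by (simp add: ln_mult)
      then have "ln (2 * z) powr (1 / \<alpha>) \<le> (2 * ln z) powr (1 / \<alpha>)" using alpha z by (intro powr_mono2) auto
      also have "\<dots> = 2 powr (1 / \<alpha>) * ln z powr (1 / \<alpha>)" using z by (subst powr_mult) auto
      finally have "phi (2 * z) \<le> (2 * z) * (2 powr (1 / \<alpha>) * ln z powr (1 / \<alpha>))" using z by (intro mult_left_mono) auto
      then have "CX * phi (2 * z) \<le> CX * ((2 * z) * (2 powr (1 / \<alpha>) * ln z powr (1 / \<alpha>)))" using CX by (simp only: mult_le_cancel_left_pos)
      also have "\<dots> = CX * (2 * 2 powr (1 / \<alpha>)) * phi z" by (simp only: mult_ac)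
      also have "\<dots> \<le> real m * phi z" using m z by (intro mult_right_mono) auto
      finally have le: "CX * phi (2 * z) \<le> real m * phi z" .
      have "w (CX * phi r) \<le> w (CX * phi (2 * z))" by (rule mono[OF r1 r2])
      also have "\<dots> \<le> w (real m * phi z)" using le CX z by (intro w_mono) auto
      also have "\<dots> \<le> (real m + 1) * D * w (phi z)" using z by (intro D(2)) auto
      finally have wr: "w (CX * phi r) \<le> (real m + 1) * D * w (phi z)" .
      have "z * (B * r * exp (2 * w (CX * phi r))) \<le> z * (B * (2 * z) * exp (2 * ((real m + 1) * D * w (phi z))))"
        using wr r2 r1 z B by (intro mult_mono) auto
      also have "\<dots> = 2 * B * (exp (ln z) * exp (ln z)) * exp (2 * ((real m + 1) * D * w (phi z)))" using z by simp
      also have "\<dots> \<le> 2 * B * (exp (w (phi z) + c) * exp (w (phi z) + c)) * exp (2 * ((real m + 1) * D * w (phi z)))"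
        using c(2)[OF z(1)] B z unfolding exp_le_cancel_iff[symmetric, of "ln z"]
        by (intro mult_right_mono mult_left_mono mult_mono) auto
      also have "\<dots> = 2 * B * exp (2 * c) * exp (l * w (phi z))"
        by (simp add: l_def mult.assoc distrib_right exp_double mult_exp_exp algebra_simps)
      also have "\<dots> \<le> max K1 (2 * B * exp (2 * c)) * exp (l * w (phi z))" by (intro mult_right_mono) auto
      finally show ?thesis using z K0 by (simp add: z_def)
    qed
    qed
  qed
qed

end

section \<open>Weighted estimates for exponentials\<close>

lemma one_le_ennreal_exp: "0 \<le> x \<Longrightarrow> 1 \<le> ennreal (exp x)"
  using ennreal_leI[of 1 "exp x"] by simp

lemma sum_le_csum: "finite F \<Longrightarrow> sum f F \<le> csum f"
  by (subst nn_integral_count_space_finite[symmetric], simp)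
     (simp add: nn_integral_count_space_indicator[of F] nn_integral_mono indicator_def)

text \<open>Only a bound for the weighted norms enters the constants, which is available for every
  q; the finer information of l^q is carried along in the sequence \<open>A\<close>.\<close>

locale weighted_fun = decomp_fun sig S p "\<lambda>x. complex_of_real (ur x)" + reg_weight w \<alpha>
  for sig :: "real^'n \<Rightarrow> real" and S and p and ur :: "real^'n \<Rightarrow> real" and w \<alpha> +
  fixes Ab :: real
  assumes Ab: "0 \<le> Ab" and A_le: "a k * ennreal (exp (w (norm (real_vec k)))) \<le> ennreal Ab"
begin

abbreviation W :: "int^'n \<Rightarrow> real" where "W k \<equiv> w (norm (real_vec k))"

definition A :: "int^'n \<Rightarrow> ennreal" where "A k = a k * ennreal (exp (W k))"

definition G :: "real \<Rightarrow> real" where "G t = enn2real (csum (\<lambda>k::int^'n. ennreal (exp (- t * W k))))"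

definition Qc :: real where "Qc = enn2real (Cb p * ennreal (exp (3 * S)))"

lemma G: "0 < t \<Longrightarrow> csum (\<lambda>k::int^'n. ennreal (exp (- t * W k))) = ennreal (G t)"
  unfolding G_def using w_summable[of t, where 'n='n] by (simp add: ennreal_enn2real_if)

lemma G_nonneg: "0 \<le> G t" by (simp add: G_def)

lemma Qc: "Cb p * ennreal (exp (3 * S)) = ennreal Qc" "0 \<le> Qc"
  unfolding Qc_def using Cb_finite[of p] by (simp_all add: ennreal_enn2real_if ennreal_mult_eq_top_iff)

lemma Cb_le: "Cb p \<le> ennreal Qc"
  using mult_left_mono[OF one_le_ennreal_exp[of "3 * S"], of "Cb p"] S1 by (simp add: Qc)

lemma a_exp_le: "a k * ennreal (exp e) \<le> ennreal Ab * ennreal (exp (e - W k))"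
proof -
  have "ennreal (exp e) = ennreal (exp (W k)) * ennreal (exp (e - W k))" by (simp add: mult_exp_exp flip: ennreal_mult)
  then show ?thesis using mult_right_mono[OF A_le[of k]] by (simp add: mult.assoc[symmetric])
qed

text \<open>The parameters R and y depend on r but neither on s nor on m, so that one sequence c
  serves all |s| \<le> r. This uniformity permits the later integration over s.\<close>

lemma composition_weighted:
  obtains B CX r0 where "3 \<le> r0" "0 \<le> B" "0 < CX"
    "\<forall>r\<ge>r0. \<exists>c. (\<forall>m s. \<bar>s\<bar> \<le> r \<longrightarrow> ennreal (exp (W m)) *
        cN p (conv_op (sg m) (\<lambda>x. of_real (ur x) * exp (\<i> * of_real (s * ur x)))) \<le> sconv A c m) \<and>
      csum c \<le> ennreal (B * r * exp (2 * w (CX * phi r)))"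
proof -
  obtain \<beta> C0 where b: "0 \<le> \<beta>" "\<beta> < 1" "0 \<le> C0"
    "\<And>x y z. 0 \<le> x \<Longrightarrow> 0 \<le> y \<Longrightarrow> 0 \<le> z \<Longrightarrow> z \<le> x + y \<Longrightarrow> w z \<le> max (w x + \<beta> * w y) (w y + \<beta> * w x) + C0"
    using w_add by blast
  interpret sw: seq_weight W \<beta> C0
  proof
    show "0 \<le> W k" for k using w_ge_1[of "norm (real_vec k)"] by simp
    show "W (k + l) \<le> max (W k + \<beta> * W l) (W l + \<beta> * W k) + C0" for k l
      by (rule b(4)) (simp_all add: real_vec_simps norm_triangle_ineq)
  qed (use b in auto)
  \<comment> \<open>The gap 1 - \<beta> is halved: one half provides the small factor exp (-
    \<delta> w R) on high frequencies, the other keeps exp (- \<delta> W) summable.\<close>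
  define \<delta> where "\<delta> = (1 - \<beta>) / 2"
  have d: "0 < \<delta>" using b by (simp add: \<delta>_def)
  have "2 * \<delta> = 1 - \<beta>" by (simp add: \<delta>_def)
  then have bW: "\<beta> * t - t = - (2 * \<delta>) * t" for t by (simp only:) (simp add: algebra_simps)
  define V1 where "V1 = max 1 (Ab * G (1/2) * Qc)"
  \<comment> \<open>Chosen such that exp (- \<delta> w R) = 1 / r^2; with r \<ge> M0 the high part
    then has damped sum at most 1/r.\<close>
  define C4 where "C4 = 2 / \<delta>"
  have C4: "0 < C4" using d by (simp add: C4_def)
  define M0 where "M0 = exp C0 * Qc * Ab * G \<delta>"
  define Kc where "Kc = enn2real (K1 * ennreal (exp 1) * ennreal (exp S))"
  have Kc: "K1 * ennreal (exp 1) * ennreal (exp S) = ennreal Kc" "0 \<le> Kc"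
    unfolding Kc_def using K1_finite by (simp_all add: ennreal_enn2real_if ennreal_mult_eq_top_iff)
  define C where "C = exp C0 * Qc"
  have C: "0 \<le> C" using Qc by (simp add: C_def)
  define B where "B = Kc * (exp C0 * G 1) * (exp 1 * (1 + C * (Ab * G (2 * \<delta>))))"
  have V1: "1 \<le> V1" by (simp add: V1_def)
  obtain r1 CX where par: "3 \<le> r1" "0 < CX"
    "\<And>r. r1 \<le> r \<Longrightarrow> \<exists>R y. 1 \<le> R \<and> 0 < y \<and> y \<le> 1 \<and> w R = C4 * ln r \<and> (\<forall>t. 0 \<le> t \<and> t \<le> R \<longrightarrow> y * t \<le> w t / 2) \<and>
       2 * (r * V1 + S) / y \<le> CX * (r * ln r powr (1 / \<alpha>)) \<and> (\<forall>t\<ge>2 * (r * V1 + S) / y. 4 * w t \<le> y * t)"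
    using parameters[OF C4 V1 S1] by blast
  have E1: "csum (\<lambda>k. a k * ennreal (exp (\<beta> * W k))) \<le> ennreal (Ab * G (2 * \<delta>))"
  proof -
    have "csum (\<lambda>k. a k * ennreal (exp (\<beta> * W k))) \<le> csum (\<lambda>k. ennreal Ab * ennreal (exp (- (2 * \<delta>) * W k)))"
      unfolding bW[symmetric] by (intro nn_integral_mono a_exp_le)
    also have "\<dots> = ennreal (Ab * G (2 * \<delta>))" using d Ab G_nonneg by (simp only: nn_integral_cmult borel_measurable_count_space G mult_pos_pos zero_less_numeral ennreal_mult)
    finally show ?thesis .
  qed
  show ?thesis
  proof (rule that[of "max r1 M0" B CX])
    show "3 \<le> max r1 M0" using par by simp
    show "0 \<le> B" using Kc G_nonneg C Ab by (simp add: B_def)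
    show "\<forall>r\<ge>max r1 M0. \<exists>c. (\<forall>m s. \<bar>s\<bar> \<le> r \<longrightarrow> ennreal (exp (W m)) *
        cN p (conv_op (sg m) (\<lambda>x. of_real (ur x) * exp (\<i> * of_real (s * ur x)))) \<le> sconv A c m) \<and>
      csum c \<le> ennreal (B * r * exp (2 * w (CX * phi r)))"
    proof (intro allI impI)
    fix r assume "max r1 M0 \<le> r"
    then have r: "r1 \<le> r" "M0 \<le> r" "3 \<le> r" using par by auto
    obtain R y where R: "1 \<le> R" "w R = C4 * ln r" and y: "0 < y" "y \<le> 1"
      and yt: "\<And>t. 0 \<le> t \<Longrightarrow> t \<le> R \<Longrightarrow> y * t \<le> w t / 2"
      and X: "2 * (r * V1 + S) / y \<le> CX * phi r" and big: "\<And>t. 2 * (r * V1 + S) / y \<le> t \<Longrightarrow> 4 * w t \<le> y * t"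
      using par(3)[OF r(1)] by blast
    define hb where "hb k = (if R < norm (real_vec k) then Cb p * ennreal (exp (3 * S)) * a k else 0)" for k :: "int^'n"
    define dd where "dd k = ennreal (min 1 (exp (r * V1 + S - y * norm (real_vec k))))" for k :: "int^'n"
    have low: "(\<Sum>k\<in>{k. norm (real_vec k) \<le> R}. a k * ennreal (exp (y * norm (real_vec k)))) * (Cb p * ennreal (exp (3 * S))) \<le> ennreal V1"
    proof -
      have "(\<Sum>k\<in>{k. norm (real_vec k) \<le> R}. a k * ennreal (exp (y * norm (real_vec k)))) \<le>
        (\<Sum>k\<in>{k. norm (real_vec k) \<le> R}. ennreal Ab * ennreal (exp (- (1/2) * W k)))"
      proof (rule sum_mono)
        fix k :: "int^'n" assume "k \<in> {k. norm (real_vec k) \<le> R}"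
        then have "y * norm (real_vec k) - W k \<le> - (1/2) * W k" using yt[of "norm (real_vec k)"] by simp
        then have "ennreal (exp (y * norm (real_vec k) - W k)) \<le> ennreal (exp (- (1/2) * W k))" by (simp add: ennreal_leI)
        from order_trans[OF a_exp_le mult_left_mono[OF this]]
        show "a k * ennreal (exp (y * norm (real_vec k))) \<le> ennreal Ab * ennreal (exp (- (1/2) * W k))" by simp
      qed
      also have "\<dots> \<le> csum (\<lambda>k::int^'n. ennreal Ab * ennreal (exp (- (1/2) * W k)))"
        by (rule sum_le_csum[OF finite_lattice_ball])
      also have "\<dots> = ennreal (Ab * G (1/2))"
        using Ab G_nonneg G[of "1/2"] by (subst nn_integral_cmult) (auto simp: ennreal_mult)
      finally have "(\<Sum>k\<in>{k. norm (real_vec k) \<le> R}. a k * ennreal (exp (y * norm (real_vec k)))) * (Cb p * ennreal (exp (3 * S)))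
         \<le> ennreal (Ab * G (1/2)) * ennreal Qc" unfolding Qc by (rule mult_right_mono) simp
      also have "\<dots> \<le> ennreal V1" using Ab G_nonneg Qc by (simp add: V1_def ennreal_leI flip: ennreal_mult)
      finally show ?thesis .
    qed
    have eps: "csum (\<lambda>k. ennreal (exp C0) * (hb k * ennreal (exp (\<beta> * W k)))) \<le> ennreal (1 / r)"
    proof -
      have "csum (\<lambda>k. ennreal (exp C0) * (hb k * ennreal (exp (\<beta> * W k)))) \<le>
         csum (\<lambda>k::int^'n. ennreal (exp C0 * Qc * Ab * exp (- \<delta> * w R)) * ennreal (exp (- \<delta> * W k)))"
      proof (rule nn_integral_mono)
        fix k :: "int^'n"
        show "ennreal (exp C0) * (hb k * ennreal (exp (\<beta> * W k))) \<le> ennreal (exp C0 * Qc * Ab * exp (- \<delta> * w R)) * ennreal (exp (- \<delta> * W k))"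
        proof (cases "R < norm (real_vec k)")
          case True
          have "w R \<le> W k" using True R by (intro w_mono) auto
          then have "\<delta> * w R \<le> \<delta> * W k" using d by simp
          then have "\<beta> * W k - W k \<le> - \<delta> * w R + - \<delta> * W k" unfolding bW by simp
          then have "exp (\<beta> * W k - W k) \<le> exp (- \<delta> * w R) * exp (- \<delta> * W k)" by (simp only: mult_exp_exp exp_le_cancel_iff)
          from order_trans[OF a_exp_le mult_left_mono[OF ennreal_leI[OF this]]]
          have "a k * ennreal (exp (\<beta> * W k)) \<le> ennreal Ab * (ennreal (exp (- \<delta> * w R)) * ennreal (exp (- \<delta> * W k)))"
            by (simp only: ennreal_mult'' exp_ge_zero zero_le)
          then have "ennreal (exp C0) * (ennreal Qc * (a k * ennreal (exp (\<beta> * W k)))) \<le>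
            ennreal (exp C0) * (ennreal Qc * (ennreal Ab * (ennreal (exp (- \<delta> * w R)) * ennreal (exp (- \<delta> * W k)))))"
            by (intro mult_left_mono) auto
          also have "\<dots> = ennreal (exp C0 * Qc * Ab * exp (- \<delta> * w R)) * ennreal (exp (- \<delta> * W k))"
            using Qc Ab by (simp only: ennreal_mult exp_ge_zero mult_nonneg_nonneg mult.assoc)
          finally show ?thesis using True by (simp only: hb_def if_True Qc mult.assoc)
        qed (simp add: hb_def)
      qed
      also have "\<dots> = ennreal (exp C0 * Qc * Ab * exp (- \<delta> * w R)) * ennreal (G \<delta>)"
        by (subst nn_integral_cmult) (simp_all only: G[OF d] borel_measurable_count_space)
      also have "\<dots> = ennreal (M0 * exp (- \<delta> * w R))"
        using Qc Ab G_nonneg by (simp add: M0_def mult_ac flip: ennreal_mult)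
      also have "\<dots> \<le> ennreal (1 / r)"
      proof (rule ennreal_leI)
        have "- \<delta> * w R = - (ln r + ln r)" using d by (simp add: R C4_def)
        then have "exp (- \<delta> * w R) = inverse (exp (ln r + ln r))" by (simp only: exp_minus)
        also have "exp (ln r + ln r) = r * r" using r by (simp only: exp_add) simp
        finally have "exp (- \<delta> * w R) = inverse (r * r)" .
        moreover have "M0 * inverse (r * r) \<le> r * inverse (r * r)" using r by (intro mult_right_mono) auto
        ultimately have "M0 * exp (- \<delta> * w R) \<le> r * inverse (r * r)" by (simp only:)
        then show "M0 * exp (- \<delta> * w R) \<le> 1 / r" using r by (simp add: inverse_eq_divide)
      qed
      finally show ?thesis .
    qed
    have high: "ennreal r * ((\<integral>\<^sup>+k. a k \<partial>count_space {k. R < norm (real_vec k)}) * Cb p) \<le> 1"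
    proof -
      have "(\<integral>\<^sup>+k. a k \<partial>count_space {k. R < norm (real_vec k)}) * Cb p = (\<integral>\<^sup>+k. a k * Cb p \<partial>count_space {k. R < norm (real_vec k)})"
        by (rule nn_integral_multc[symmetric]) simp
      also have "\<dots> \<le> csum (\<lambda>k. ennreal (exp C0) * (hb k * ennreal (exp (\<beta> * W k))))"
      proof (subst nn_integral_count_space_indicator, simp, rule nn_integral_mono)
        fix k :: "int^'n"
        have *: "1 * (ennreal Qc * a k * 1) \<le> ennreal (exp C0) * (ennreal Qc * a k * ennreal (exp (\<beta> * W k)))"
          using b sw.W_nonneg[of k] by (intro mult_mono one_le_ennreal_exp) auto
        have "a k * Cb p \<le> a k * ennreal Qc" by (intro mult_left_mono Cb_le) simp
        with * have "a k * Cb p \<le> ennreal (exp C0) * (ennreal Qc * a k * ennreal (exp (\<beta> * W k)))" by (simp add: mult.commute)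
        then show "a k * Cb p * indicator {k. R < norm (real_vec k)} k \<le> ennreal (exp C0) * (hb k * ennreal (exp (\<beta> * W k)))"
          by (cases "R < norm (real_vec k)") (simp_all add: hb_def Qc)
      qed
      also have "\<dots> \<le> ennreal (1 / r)" by (rule eps)
      finally have "ennreal r * ((\<integral>\<^sup>+k. a k \<partial>count_space {k. R < norm (real_vec k)}) * Cb p) \<le> ennreal r * ennreal (1 / r)"
        by (rule mult_left_mono) simp
      also have "\<dots> = 1" using r by (simp flip: ennreal_mult)
      finally show ?thesis .
    qed
    have b': "ennreal (exp C0) * (hb k * ennreal (exp (W k))) \<le> ennreal C * A k" for k
    proof (cases "R < norm (real_vec k)")
      case True
      have "hb k = ennreal Qc * a k" using True by (simp only: hb_def if_True Qc(1))
      moreover have "ennreal C = ennreal (exp C0) * ennreal Qc" using Qc(2) by (simp add: C_def ennreal_mult)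
      ultimately have "ennreal (exp C0) * (hb k * ennreal (exp (W k))) = ennreal C * A k" by (simp only: A_def mult.assoc)
      then show ?thesis by (simp only: order_refl)
    qed (simp add: hb_def)
    have r0: "0 < r" using r by simp
    have aA: "a k * ennreal (exp (W k)) \<le> A k" for k by (simp add: A_def)
    obtain c where c: "\<And>m. ennreal (exp (W m)) * sconv a (\<lambda>z. csum (\<lambda>j. ennreal (r ^ j / fact j) * iter_conv hb dd j z)) m \<le> sconv A c m"
      "csum c \<le> csum (\<lambda>k. ennreal (exp C0) * (ennreal (exp (W k)) * dd k)) *
       (ennreal (exp 1) * (1 + ennreal (C * r) * csum (\<lambda>k. a k * ennreal (exp (\<beta> * W k)))))"
      using sw.weighted_exponential_series[where b=hb and d=dd and a=a and A=A, OF b' r0 C eps aA] by blast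
    \<comment> \<open>The crossover of the two bounds in \<open>dd\<close>. Up to X the weight is
      estimated by w X; beyond, y t dominates both 4 w t and 2 (r V1 + S), so the decay beats the
      weight. The coefficient 2 in the final exponent leaves a factor exp (- w t) for the
      summation.\<close>
    define X where "X = 2 * (r * V1 + S) / y"
    have Xpos: "0 \<le> X" using r V1 S1 y by (simp add: X_def)
    have wX: "w X \<le> w (CX * phi r)" using Xpos X by (intro w_mono) (auto simp: X_def)
    have theta: "csum (\<lambda>k. ennreal (exp C0) * (ennreal (exp (W k)) * dd k)) \<le> ennreal (exp C0 * G 1 * exp (2 * w (CX * phi r)))"
    proof -
      have "csum (\<lambda>k. ennreal (exp C0) * (ennreal (exp (W k)) * dd k)) \<le>
        csum (\<lambda>k::int^'n. ennreal (exp C0 * exp (2 * w (CX * phi r))) * ennreal (exp (- 1 * W k)))"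
      proof (rule nn_integral_mono)
        fix k :: "int^'n"
        define t where "t = norm (real_vec k)"
        have t: "0 \<le> t" by (simp add: t_def)
        have "exp (w t) * min 1 (exp (r * V1 + S - y * t)) \<le> exp (2 * w (CX * phi r) + - 1 * w t)"
        proof (cases "t \<le> X")
          case True
          have "w t \<le> w (CX * phi r)" using w_mono[OF t True] wX by simp
          then have "exp (w t) \<le> exp (2 * w (CX * phi r) + - 1 * w t)" by simp
          moreover have "exp (w t) * min 1 (exp (r * V1 + S - y * t)) \<le> exp (w t) * 1" by (intro mult_left_mono) auto
          ultimately show ?thesis by linarith
        next
          case False
          then have "4 * w t \<le> y * t" using big[of t] by (simp add: X_def)
          moreover have "2 * (r * V1 + S) \<le> y * t" using False y by (simp add: X_def field_simps)
          moreover have "c - b \<le> - 2 * e" if "4 * e \<le> b" "2 * c \<le> b" for b c e :: real using that by linarith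
          ultimately have "r * V1 + S - y * t \<le> - 2 * w t" by blast
          then have "exp (w t) * min 1 (exp (r * V1 + S - y * t)) \<le> exp (w t) * exp (- 2 * w t)"
            by (intro mult_left_mono) (auto simp: min_le_iff_disj)
          also have "\<dots> = exp (- 1 * w t)" by (simp add: mult_exp_exp)
          also have "\<dots> \<le> exp (2 * w (CX * phi r) + - 1 * w t)" using wX w_ge_1[OF Xpos] by simp
          finally show ?thesis .
        qed
        then have "exp C0 * (exp (w t) * min 1 (exp (r * V1 + S - y * t))) \<le> exp C0 * exp (2 * w (CX * phi r) + - 1 * w t)"
          by (intro mult_left_mono) auto
        then have "ennreal (exp C0 * (exp (w t) * min 1 (exp (r * V1 + S - y * t)))) \<le> ennreal (exp C0 * exp (2 * w (CX * phi r)) * exp (- 1 * w t))"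
          by (intro ennreal_leI) (simp only: mult.assoc mult_exp_exp add.assoc)
        then show "ennreal (exp C0) * (ennreal (exp (W k)) * dd k) \<le> ennreal (exp C0 * exp (2 * w (CX * phi r))) * ennreal (exp (- 1 * W k))"
          unfolding dd_def t_def[symmetric] by (simp only: ennreal_mult' exp_ge_zero mult_nonneg_nonneg)
      qed
      also have "\<dots> = ennreal (exp C0 * exp (2 * w (CX * phi r))) * ennreal (G 1)"
        using G[of 1] by (subst nn_integral_cmult) simp_all
      also have "\<dots> = ennreal (exp C0 * G 1 * exp (2 * w (CX * phi r)))"
        using G_nonneg by (simp add: mult_ac flip: ennreal_mult)
      finally show ?thesis .
    qed
    have factor: "ennreal (exp 1) * (1 + ennreal (C * r) * csum (\<lambda>k. a k * ennreal (exp (\<beta> * W k)))) \<le>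
        ennreal (r * (exp 1 * (1 + C * (Ab * G (2 * \<delta>)))))"
    proof -
      have "ennreal (exp 1) * (1 + ennreal (C * r) * csum (\<lambda>k. a k * ennreal (exp (\<beta> * W k)))) \<le>
        ennreal (exp 1) * (1 + ennreal (C * r) * ennreal (Ab * G (2 * \<delta>)))"
        by (intro mult_left_mono add_left_mono E1) auto
      also have "\<dots> = ennreal (exp 1 * (1 + C * r * (Ab * G (2 * \<delta>))))"
        using C r Ab G_nonneg[of "2 * \<delta>"] by (simp add: ennreal_mult ennreal_plus)
      also have "\<dots> \<le> ennreal (r * (exp 1 * (1 + C * (Ab * G (2 * \<delta>)))))"
      proof (rule ennreal_leI)
        have "1 + C * r * (Ab * G (2 * \<delta>)) \<le> r * (1 + C * (Ab * G (2 * \<delta>)))" using r by (simp add: algebra_simps)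
        then have "exp 1 * (1 + C * r * (Ab * G (2 * \<delta>))) \<le> exp 1 * (r * (1 + C * (Ab * G (2 * \<delta>))))" by (rule mult_left_mono) simp
        then show "exp 1 * (1 + C * r * (Ab * G (2 * \<delta>))) \<le> r * (exp 1 * (1 + C * (Ab * G (2 * \<delta>))))" by (simp only: mult_ac)
      qed
      finally show ?thesis .
    qed
    show "\<exists>c. (\<forall>m s. \<bar>s\<bar> \<le> r \<longrightarrow> ennreal (exp (W m)) *
        cN p (conv_op (sg m) (\<lambda>x. of_real (ur x) * exp (\<i> * of_real (s * ur x)))) \<le> sconv A c m) \<and>
      csum c \<le> ennreal (B * r * exp (2 * w (CX * phi r)))"
    proof (intro exI[of _ "\<lambda>z. ennreal Kc * c z"] conjI allI impI)
      fix m s assume s: "\<bar>s\<bar> \<le> r"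
      have "0 \<le> y" "0 \<le> V1" using y V1 by auto
      interpret sp: split_fun sig S p ur R y r V1 s
        by (intro split_fun.intro decomp_fun_axioms split_fun_axioms.intro) fact+
      have eq: "sp.hb = hb" "sp.d0 = dd" by (simp_all add: fun_eq_iff sp.hb_def sp.d0_def hb_def dd_def)
      have "cN p (conv_op (sg m) (\<lambda>x. of_real (ur x) * exp (\<i> * of_real (s * ur x)))) \<le>
        ennreal Kc * sconv a (\<lambda>z. csum (\<lambda>j. ennreal (r ^ j / fact j) * iter_conv hb dd j z)) m"
        using sp.composition_estimate[of m] unfolding eq sp.K0_def Kc(1) .
      then have "ennreal (exp (W m)) * cN p (conv_op (sg m) (\<lambda>x. of_real (ur x) * exp (\<i> * of_real (s * ur x)))) \<le>
        ennreal (exp (W m)) * (ennreal Kc * sconv a (\<lambda>z. csum (\<lambda>j. ennreal (r ^ j / fact j) * iter_conv hb dd j z)) m)"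
        by (rule mult_left_mono) simp
      also have "\<dots> = ennreal Kc * (ennreal (exp (W m)) * sconv a (\<lambda>z. csum (\<lambda>j. ennreal (r ^ j / fact j) * iter_conv hb dd j z)) m)"
        by (simp only: mult_ac)
      also have "\<dots> \<le> ennreal Kc * sconv A c m" by (intro mult_left_mono c) simp
      finally show "ennreal (exp (W m)) * cN p (conv_op (sg m) (\<lambda>x. of_real (ur x) * exp (\<i> * of_real (s * ur x)))) \<le> sconv A (\<lambda>z. ennreal Kc * c z) m"
        unfolding sconv_cmult_right .
    next
      have "csum (\<lambda>z. ennreal Kc * c z) = ennreal Kc * csum c" by (rule nn_integral_cmult) simp
      also have "\<dots> \<le> ennreal Kc * (ennreal (exp C0 * G 1 * exp (2 * w (CX * phi r))) * ennreal (r * (exp 1 * (1 + C * (Ab * G (2 * \<delta>))))))"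
        by (intro mult_left_mono order_trans[OF c(2)] mult_mono theta factor) auto
      also have "\<dots> = ennreal (B * r * exp (2 * w (CX * phi r)))"
        using Kc(2) C Ab G_nonneg[of 1] G_nonneg[of "2 * \<delta>"] r
        by (subst ennreal_mult[symmetric], simp, simp, subst ennreal_mult[symmetric], simp, simp)
           (simp only: B_def mult_ac)
      finally show "csum (\<lambda>z. ennreal Kc * c z) \<le> ennreal (B * r * exp (2 * w (CX * phi r)))" .
    qed
    qed
  qed (rule par(2))
qed

end

section \<open>Integration over the parameter and against the measure\<close>

lemma exp_cancel:
  fixes z :: ennreal
  shows "ennreal (exp (- x)) * (ennreal (exp x) * z) = z" "ennreal (exp x) * (ennreal (exp (- x)) * z) = z"
    "y * z = ennreal (exp (- x)) * (y * (ennreal (exp x) * z))"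
proof -
  have e: "ennreal (exp x) * ennreal (exp (- x)) = 1" "ennreal (exp (- x)) * ennreal (exp x) = 1"
    by (simp_all add: mult_exp_exp flip: ennreal_mult)
  show 1: "ennreal (exp (- x)) * (ennreal (exp x) * z) = z" and "ennreal (exp x) * (ennreal (exp (- x)) * z) = z" for z
    by (simp_all only: mult.assoc[symmetric] e mult_1_left)
  have "y * z = ennreal (exp (- x)) * (ennreal (exp x) * (y * z))" by (rule 1[symmetric])
  then show "y * z = ennreal (exp (- x)) * (y * (ennreal (exp x) * z))" by (simp only: mult.left_commute)
qed

text \<open>On the set |\<xi>| \<ge> 3 the argument of w may be replaced by phi (max 3 |\<xi>|),
  which is continuous in \<xi> and at least 1, and on [1, \<infinity>) the weight is
  continuous.\<close>

lemma (in reg_weight) exp_weight_measurable: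
  "(\<lambda>\<xi>. ennreal (exp (l * w (phi \<bar>\<xi>\<bar>)) * indicator {\<xi>. 3 \<le> \<bar>\<xi>\<bar>} \<xi>)) \<in> borel_measurable borel"
proof -
  have "w \<circ> (\<lambda>\<xi>. phi (max 3 \<bar>\<xi>\<bar>)) \<in> borel_measurable borel"
  proof (rule borel_measurable_continuous_onI, rule continuous_on_compose)
    show "continuous_on UNIV (\<lambda>\<xi>::real. phi (max 3 \<bar>\<xi>\<bar>))"
      by (intro continuous_intros) (auto simp: max_def)
    have "1 \<le> phi (max 3 \<bar>\<xi>\<bar>)" for \<xi>::real using phi_ge[of "max 3 \<bar>\<xi>\<bar>"] by linarith
    moreover have "continuous_on {1..} w" by (intro continuous_at_imp_continuous_on ballI DERIV_isCont[OF w_deriv]) auto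
    ultimately show "continuous_on (range (\<lambda>\<xi>. phi (max 3 \<bar>\<xi>\<bar>))) w"
      by (auto elim!: continuous_on_subset)
  qed
  then have [measurable]: "(\<lambda>\<xi>. w (phi (max 3 \<bar>\<xi>\<bar>))) \<in> borel_measurable borel" by (simp only: comp_def)
  have "(\<lambda>\<xi>. ennreal (exp (l * w (phi \<bar>\<xi>\<bar>)) * indicator {\<xi>. 3 \<le> \<bar>\<xi>\<bar>} \<xi>)) =
    (\<lambda>\<xi>. ennreal (exp (l * w (phi (max 3 \<bar>\<xi>\<bar>))) * indicator {\<xi>. 3 \<le> \<bar>\<xi>\<bar>} \<xi>))"
    by (auto simp: fun_eq_iff indicator_def max_def)
  moreover have "\<dots> \<in> borel_measurable borel" by measurable
  ultimately show ?thesis by simp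
qed

lemma (in reg_weight) affine_moment_finite:
  assumes M: "finite_measure M" "sets M = sets borel"
    and H: "(\<integral>\<^sup>+\<xi>. ennreal (exp (l * w (phi \<bar>\<xi>\<bar>)) * indicator {\<xi>. 3 \<le> \<bar>\<xi>\<bar>} \<xi>) \<partial>M) < \<infinity>"
  shows "(\<integral>\<^sup>+\<xi>. ennreal K + ennreal K * ennreal (exp (l * w (phi \<bar>\<xi>\<bar>)) * indicator {\<xi>. 3 \<le> \<bar>\<xi>\<bar>} \<xi>) \<partial>M) < \<infinity>"
proof -
  interpret M: finite_measure M by fact
  define E where "E \<xi> = ennreal (exp (l * w (phi \<bar>\<xi>\<bar>)) * indicator {\<xi>. 3 \<le> \<bar>\<xi>\<bar>} \<xi>)" for \<xi>
  have [measurable]: "E \<in> borel_measurable M"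
    unfolding E_def[abs_def] measurable_cong_sets[OF M(2) refl] by (rule exp_weight_measurable)
  have "(\<integral>\<^sup>+\<xi>. ennreal K + ennreal K * E \<xi> \<partial>M) = ennreal K * emeasure M (space M) + ennreal K * (\<integral>\<^sup>+\<xi>. E \<xi> \<partial>M)"
    by (simp add: nn_integral_add nn_integral_cmult)
  also have "\<dots> < \<infinity>"
  proof -
    have "emeasure M (space M) < top" using M.emeasure_finite[of "space M"] unfolding less_top[symmetric] infinity_ennreal_def by blast
    then show ?thesis using H unfolding E_def[symmetric] by (simp add: ennreal_mult_less_top)
  qed
  finally show ?thesis unfolding E_def .
qed

context weighted_fun
begin

lemma ur_meas [measurable]: "ur \<in> borel_measurable borel"
  using measurable_compose[OF u borel_measurable_Re] by simp

text \<open>The substitution s = t \<xi> fixes the interval [0, 1] for both signs of \<xi> and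
  presents exp (i \<xi> u) - 1 as a superposition to which \<open>conv_op_param\<close>
  applies.\<close>

lemma exp_difference_estimate:
  assumes T: "\<And>s. \<bar>s\<bar> \<le> \<bar>\<xi>\<bar> \<Longrightarrow> ennreal (exp (W m)) *
      cN p (conv_op (sg m) (\<lambda>x. of_real (ur x) * exp (\<i> * of_real (s * ur x)))) \<le> T"
  shows "ennreal (exp (W m)) * cN p (conv_op (sg m) (\<lambda>x. exp (\<i> * of_real (\<xi> * ur x)) - 1)) \<le> ennreal \<bar>\<xi>\<bar> * T"
proof -
  define h where "h s x = of_real (ur x) * exp (\<i> * of_real (s * ur x))" for s :: real and x
  have hm [measurable]: "h s \<in> borel_measurable borel" for s unfolding h_def[abs_def] by measurable
  have hN: "cN p (h s) \<le> cN p (\<lambda>x. complex_of_real (ur x))" for s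
    using cN_mult_bounded[of p "\<lambda>x. complex_of_real (ur x)" "\<lambda>x. exp (\<i> * of_real (s * ur x))" 1] p
    by (simp add: h_def[abs_def])
  define k where "k t = complex_of_real (indicator {0..1::real} t) * (\<i> * of_real \<xi>)" for t
  define g where "g t x = k t * h (t * \<xi>) x" for t x
  have nk: "norm (k t) = \<bar>\<xi>\<bar> * indicator {0..1} t" for t by (simp add: k_def norm_mult indicator_def)
  have gm: "(\<lambda>(t, x). g t x) \<in> borel_measurable (lborel \<Otimes>\<^sub>M lborel)"
    unfolding g_def h_def k_def by measurable
  have eq: "exp (\<i> * of_real (\<xi> * ur x)) - 1 = (LINT t|lborel. g t x)" for x
  proof -
    let ?c = "complex_of_real (\<xi> * ur x)"
    let ?F = "\<lambda>t. exp (\<i> * (complex_of_real t * ?c))"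
    let ?f = "\<lambda>t. \<i> * ?c * ?F t"
    have "((\<lambda>z. exp (\<i> * (z * ?c))) has_field_derivative ?f t) (at (complex_of_real t))" for t
      by (rule derivative_eq_intros refl | simp)+
    from has_vector_derivative_real_field[OF this]
    have "(?F has_vector_derivative ?f t) (at t within {0..1})" for t .
    moreover have "continuous_on {0..1} ?f" by (intro continuous_intros)
    ultimately have "(LINT t|lborel. indicator {0..1} t *\<^sub>R ?f t) = ?F 1 - ?F 0"
      by (intro integral_FTC_Icc) auto
    moreover have "indicator {0..1} t *\<^sub>R ?f t = g t x" for t
      by (simp add: g_def k_def h_def scaleR_conv_of_real mult_ac)
    ultimately show ?thesis by simp
  qed
  have gN: "cN p (g t) = ennreal (\<bar>\<xi>\<bar> * indicator {0..1} t) * cN p (h (t * \<xi>))" for t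
    unfolding g_def[abs_def] using p by (subst cN_cmult) (auto simp: nk)
  have fin: "(\<integral>\<^sup>+t. cN p (g t) \<partial>lborel) < \<infinity>"
  proof -
    have "(\<integral>\<^sup>+t. cN p (g t) \<partial>lborel) \<le> (\<integral>\<^sup>+t. ennreal \<bar>\<xi>\<bar> * cN p (\<lambda>x. complex_of_real (ur x)) * indicator {0..1::real} t \<partial>lborel)"
      unfolding gN using hN by (intro nn_integral_mono) (auto simp: indicator_def intro!: mult_left_mono)
    also have "\<dots> = ennreal \<bar>\<xi>\<bar> * cN p (\<lambda>x. complex_of_real (ur x))" by (simp add: nn_integral_cmult_indicator)
    also have "\<dots> < \<infinity>" using u_fin by (simp add: ennreal_mult_less_top)
    finally show ?thesis .
  qed
  have Xm: "(\<lambda>x. exp (\<i> * of_real (\<xi> * ur x)) - 1) \<in> borel_measurable borel" by measurable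
  have bd: "cN p (conv_op (sg m) (g t)) \<le> ennreal (exp (- W m)) * (ennreal \<bar>\<xi>\<bar> * T) * indicator {0..1} t" for t
  proof (cases "t \<in> {0..1}")
    case True
    then have "\<bar>t * \<xi>\<bar> \<le> \<bar>\<xi>\<bar>" by (simp add: abs_mult mult_left_le_one_le)
    have "conv_op (sg m) (g t) = (\<lambda>y. k t * conv_op (sg m) (h (t * \<xi>)) y)"
      unfolding g_def[abs_def] by (simp add: fun_eq_iff conv_op_cmult)
    then have "cN p (conv_op (sg m) (g t)) = ennreal \<bar>\<xi>\<bar> * cN p (conv_op (sg m) (h (t * \<xi>)))"
      using p conv_op_measurable[OF wsym_sg hm] True by (simp add: cN_cmult nk)
    also have "\<dots> = ennreal (exp (- W m)) * (ennreal \<bar>\<xi>\<bar> * (ennreal (exp (W m)) * cN p (conv_op (sg m) (h (t * \<xi>)))))"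
      by (rule exp_cancel(3))
    also have "\<dots> \<le> ennreal (exp (- W m)) * (ennreal \<bar>\<xi>\<bar> * T)"
      using T[OF \<open>\<bar>t * \<xi>\<bar> \<le> \<bar>\<xi>\<bar>\<close>] unfolding h_def[abs_def] by (intro mult_left_mono) auto
    finally show ?thesis using True by simp
  next
    case False
    then have "g t = (\<lambda>x. 0)" by (simp add: g_def k_def fun_eq_iff)
    then show ?thesis using p by (simp add: conv_op_def[abs_def] cN_def lpn_def)
  qed
  have "cN p (conv_op (sg m) (\<lambda>x. exp (\<i> * of_real (\<xi> * ur x)) - 1)) \<le> (\<integral>\<^sup>+t. cN p (conv_op (sg m) (g t)) \<partial>lborel)"
    by (rule cN_conv_op_param[OF p wsym_sg lborel.sigma_finite_measure_axioms gm fin Xm]) (rule AE_I2, rule eq)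
  also have "\<dots> \<le> (\<integral>\<^sup>+t. ennreal (exp (- W m)) * (ennreal \<bar>\<xi>\<bar> * T) * indicator {0..1::real} t \<partial>lborel)"
    by (intro nn_integral_mono bd)
  also have "\<dots> = ennreal (exp (- W m)) * (ennreal \<bar>\<xi>\<bar> * T)" by (simp add: nn_integral_cmult_indicator)
  finally have "ennreal (exp (W m)) * cN p (conv_op (sg m) (\<lambda>x. exp (\<i> * of_real (\<xi> * ur x)) - 1)) \<le>
     ennreal (exp (W m)) * (ennreal (exp (- W m)) * (ennreal \<bar>\<xi>\<bar> * T))" by (rule mult_left_mono) simp
  then show ?thesis by (simp only: exp_cancel(2))
qed

lemma exp_difference_norm:
  "cN p (\<lambda>x. exp (\<i> * of_real (\<xi> * ur x)) - 1) \<le> ennreal \<bar>\<xi>\<bar> * cN p (\<lambda>x. complex_of_real (ur x))"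
proof -
  have "cN p (\<lambda>x. exp (\<i> * of_real (\<xi> * ur x)) - 1) \<le> cN p (\<lambda>x. of_real \<bar>\<xi>\<bar> * complex_of_real (ur x))"
    unfolding cN_def
  proof (rule lpn_mono)
    fix x
    have "norm (exp (\<i> * of_real (\<xi> * ur x)) - 1) \<le> \<bar>\<xi> * ur x\<bar>"
      using iexp_approx1[of "\<xi> * ur x" 0] by simp
    then show "ennreal (norm (exp (\<i> * of_real (\<xi> * ur x)) - 1)) \<le> ennreal (norm (of_real \<bar>\<xi>\<bar> * complex_of_real (ur x)))"
      by (intro ennreal_leI) (simp add: norm_mult abs_mult)
  qed (use p in simp)
  also have "\<dots> = ennreal \<bar>\<xi>\<bar> * cN p (\<lambda>x. complex_of_real (ur x))"
    using cN_cmult[of p "\<lambda>x. complex_of_real (ur x)" "of_real \<bar>\<xi>\<bar>"] p by simp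
  finally show ?thesis .
qed

text \<open>To integrate the dominating sequences over \<xi>, their choice must be measurable in
  \<xi>. Therefore |\<xi>| is rounded up to an integer, so that only countably many sequences are
  chosen.\<close>

lemma composition_sequence:
  fixes M :: "real measure"
  assumes M: "finite_measure M" "sets M = sets borel"
    and H: "\<And>l. 0 < l \<Longrightarrow> (\<integral>\<^sup>+\<xi>. ennreal (exp (l * w (phi \<bar>\<xi>\<bar>)) * indicator {\<xi>. 3 \<le> \<bar>\<xi>\<bar>} \<xi>) \<partial>M) < \<infinity>"
    and mom: "(\<integral>\<^sup>+\<xi>. ennreal \<bar>\<xi>\<bar> \<partial>M) < \<infinity>"
  obtains C where "csum C < \<infinity>"
    "\<forall>m. ennreal (exp (W m)) * cN p (conv_op (sg m) (\<lambda>x. LINT \<xi>|M. exp (\<i> * of_real (\<xi> * ur x)) - 1)) \<le> sconv A C m"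
    "(\<lambda>x. LINT \<xi>|M. exp (\<i> * of_real (\<xi> * ur x)) - 1) \<in> borel_measurable borel"
proof -
  interpret M: finite_measure M by fact
  note [measurable_cong] = M(2)
  define Q1 where "Q1 B CX r0 \<longleftrightarrow> 3 \<le> r0 \<and> 0 \<le> B \<and> 0 < CX \<and>
    (\<forall>r\<ge>r0. \<exists>c. (\<forall>m s. \<bar>s\<bar> \<le> r \<longrightarrow> ennreal (exp (W m)) *
        cN p (conv_op (sg m) (\<lambda>x. of_real (ur x) * exp (\<i> * of_real (s * ur x)))) \<le> sconv A c m) \<and>
      csum c \<le> ennreal (B * r * exp (2 * w (CX * phi r))))" for B CX r0
  have "\<exists>B CX r0. Q1 B CX r0"
    unfolding Q1_def by (rule composition_weighted) (intro exI conjI, assumption+)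
  then obtain B CX r0 where Q1: "Q1 B CX r0" by blast
  note bc = Q1[unfolded Q1_def, THEN conjunct1] Q1[unfolded Q1_def, THEN conjunct2, THEN conjunct1]
    Q1[unfolded Q1_def, THEN conjunct2, THEN conjunct2, THEN conjunct1]
    Q1[unfolded Q1_def, THEN conjunct2, THEN conjunct2, THEN conjunct2, rule_format]
  define N where "N = nat \<lceil>r0\<rceil>"
  have N: "1 \<le> N" "r0 \<le> real N" using bc(1) real_nat_ceiling_ge[of r0] unfolding N_def by linarith+
  define rr where "rr j = max (real N) (real j)" for j
  define Pr where "Pr j c \<longleftrightarrow> (\<forall>m s. \<bar>s\<bar> \<le> rr j \<longrightarrow> ennreal (exp (W m)) *
        cN p (conv_op (sg m) (\<lambda>x. of_real (ur x) * exp (\<i> * of_real (s * ur x)))) \<le> sconv A c m) \<and>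
      csum c \<le> ennreal (B * rr j * exp (2 * w (CX * phi (rr j))))" for j c
  have "\<exists>c. Pr j c" for j
    unfolding Pr_def using N by (intro bc(4)) (simp add: rr_def)
  then obtain c where "\<And>j. Pr j (c j)" by metis
  then have c: "\<And>j m s. \<bar>s\<bar> \<le> rr j \<Longrightarrow> ennreal (exp (W m)) *
        cN p (conv_op (sg m) (\<lambda>x. of_real (ur x) * exp (\<i> * of_real (s * ur x)))) \<le> sconv A (c j) m"
      "\<And>j. csum (c j) \<le> ennreal (B * rr j * exp (2 * w (CX * phi (rr j))))" by (simp_all only: Pr_def)
  define J where "J \<xi> = nat \<lceil>\<bar>\<xi>\<bar>\<rceil>" for \<xi> :: real
  have J2: "rr (J \<xi>) = max (real N) (of_int \<lceil>\<bar>\<xi>\<bar>\<rceil>)" for \<xi> by (simp add: rr_def J_def)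
  have J1: "\<bar>\<xi>\<bar> \<le> rr (J \<xi>)" for \<xi>
    unfolding J2 by (rule order_trans[OF le_of_int_ceiling max.cobounded2])
  have Jm [measurable]: "J \<in> measurable borel (count_space UNIV)" unfolding J_def[abs_def] by measurable
  have cm [measurable]: "(\<lambda>\<xi>. c (J \<xi>) z) \<in> borel_measurable borel" for z
    by (rule measurable_compose[OF Jm]) simp
  have cm' [measurable]: "(\<lambda>\<xi>. csum (c (J \<xi>))) \<in> borel_measurable borel"
    by (rule measurable_compose[OF Jm]) simp
  define Q2 where "Q2 l K \<longleftrightarrow> 0 < l \<and> 0 \<le> K \<and>
    (\<forall>x r. r = max (real N) (of_int \<lceil>\<bar>x\<bar>\<rceil>) \<longrightarrow> \<bar>x\<bar> * (B * r * exp (2 * w (CX * phi r))) \<le>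
      K + K * (exp (l * w (phi \<bar>x\<bar>)) * indicator {x. 3 \<le> \<bar>x\<bar>} x))" for l K
  have "\<exists>l K. Q2 l K"
    unfolding Q2_def by (rule exp_moment_pointwise[OF bc(2,3) N(1)]) (intro exI conjI, assumption+)
  then obtain l K where Q2: "Q2 l K" by blast
  note lK = Q2[unfolded Q2_def, THEN conjunct1] Q2[unfolded Q2_def, THEN conjunct2, THEN conjunct1]
    Q2[unfolded Q2_def, THEN conjunct2, THEN conjunct2, rule_format]
  \<comment> \<open>The superposition is dominated by the integral of the chosen sequences;
    Tonelli's theorem exchanges it with the convolution with \<open>A\<close>.\<close>
  define C where "C z = (\<integral>\<^sup>+\<xi>. ennreal \<bar>\<xi>\<bar> * c (J \<xi>) z \<partial>M)" for z
  define E where "E \<xi> = ennreal (exp (l * w (phi \<bar>\<xi>\<bar>)) * indicator {\<xi>. 3 \<le> \<bar>\<xi>\<bar>} \<xi>)" for \<xi>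
  have "csum C = (\<integral>\<^sup>+\<xi>. csum (\<lambda>z. ennreal \<bar>\<xi>\<bar> * c (J \<xi>) z) \<partial>M)"
    unfolding C_def by (rule nn_integral_count_space_nn_integral[symmetric]) auto
  also have "\<dots> = (\<integral>\<^sup>+\<xi>. ennreal \<bar>\<xi>\<bar> * csum (c (J \<xi>)) \<partial>M)" by (simp add: nn_integral_cmult)
  also have "\<dots> \<le> (\<integral>\<^sup>+\<xi>. ennreal K + ennreal K * E \<xi> \<partial>M)"
  proof (rule nn_integral_mono)
    fix \<xi>
    have "ennreal \<bar>\<xi>\<bar> * csum (c (J \<xi>)) \<le> ennreal \<bar>\<xi>\<bar> * ennreal (B * rr (J \<xi>) * exp (2 * w (CX * phi (rr (J \<xi>)))))"
      by (intro mult_left_mono c) simp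
    also have "\<dots> = ennreal (\<bar>\<xi>\<bar> * (B * rr (J \<xi>) * exp (2 * w (CX * phi (rr (J \<xi>))))))"
      by (rule ennreal_mult'[symmetric]) simp
    also have "\<dots> \<le> ennreal (K + K * (exp (l * w (phi \<bar>\<xi>\<bar>)) * indicator {x. 3 \<le> \<bar>x\<bar>} \<xi>))"
      by (rule ennreal_leI[OF lK(3)[OF J2]])
    also have "\<dots> = ennreal K + ennreal K * E \<xi>" using lK by (simp add: E_def ennreal_mult)
    finally show "ennreal \<bar>\<xi>\<bar> * csum (c (J \<xi>)) \<le> ennreal K + ennreal K * E \<xi>" .
  qed
  also have "\<dots> < \<infinity>" unfolding E_def by (rule affine_moment_finite[OF M H[OF lK(1)]])
  finally have fin: "csum C < \<infinity>" .
  define g where "g \<xi> x = exp (\<i> * of_real (\<xi> * ur x)) - 1" for \<xi> x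
  have "(\<lambda>(\<xi>, x). g \<xi> x) \<in> borel_measurable (borel \<Otimes>\<^sub>M lborel)" unfolding g_def by measurable
  then have gm: "(\<lambda>(\<xi>, x). g \<xi> x) \<in> borel_measurable (M \<Otimes>\<^sub>M lborel)"
    by (subst measurable_cong_sets[OF sets_pair_measure_cong[OF M(2) refl] refl])
  have "(\<lambda>(x, \<xi>). g \<xi> x) \<in> borel_measurable (lborel \<Otimes>\<^sub>M M)" using measurable_pair_swap[OF gm] by simp
  then have Xm: "(\<lambda>x. LINT \<xi>|M. g \<xi> x) \<in> borel_measurable borel"
    using M.borel_measurable_lebesgue_integral[of "\<lambda>x \<xi>. g \<xi> x" lborel] by simp
  have gfin: "(\<integral>\<^sup>+\<xi>. cN p (g \<xi>) \<partial>M) < \<infinity>"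
  proof -
    have "(\<integral>\<^sup>+\<xi>. cN p (g \<xi>) \<partial>M) \<le> (\<integral>\<^sup>+\<xi>. ennreal \<bar>\<xi>\<bar> * cN p (\<lambda>x. complex_of_real (ur x)) \<partial>M)"
      unfolding g_def by (intro nn_integral_mono exp_difference_norm)
    also have "\<dots> = (\<integral>\<^sup>+\<xi>. ennreal \<bar>\<xi>\<bar> \<partial>M) * cN p (\<lambda>x. complex_of_real (ur x))" by (rule nn_integral_multc) measurable
    also have "\<dots> < \<infinity>" using mom u_fin by (simp add: ennreal_mult_less_top)
    finally show ?thesis .
  qed
  show ?thesis
  proof (rule that[OF fin])
    show "(\<lambda>x. LINT \<xi>|M. exp (\<i> * of_real (\<xi> * ur x)) - 1) \<in> borel_measurable borel" using Xm by (simp add: g_def)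
    show "\<forall>m. ennreal (exp (W m)) * cN p (conv_op (sg m) (\<lambda>x. LINT \<xi>|M. exp (\<i> * of_real (\<xi> * ur x)) - 1)) \<le> sconv A C m"
    proof
    fix m
    have bd: "cN p (conv_op (sg m) (g \<xi>)) \<le> ennreal (exp (- W m)) * (ennreal \<bar>\<xi>\<bar> * sconv A (c (J \<xi>)) m)" for \<xi>
    proof -
      have "ennreal (exp (W m)) * cN p (conv_op (sg m) (g \<xi>)) \<le> ennreal \<bar>\<xi>\<bar> * sconv A (c (J \<xi>)) m"
        unfolding g_def[abs_def] by (rule exp_difference_estimate[OF c(1)[OF order_trans[OF _ J1]]])
      then have "ennreal (exp (- W m)) * (ennreal (exp (W m)) * cN p (conv_op (sg m) (g \<xi>))) \<le>
          ennreal (exp (- W m)) * (ennreal \<bar>\<xi>\<bar> * sconv A (c (J \<xi>)) m)" by (rule mult_left_mono) simp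
      then show ?thesis by (simp only: exp_cancel(1))
    qed
    have "cN p (conv_op (sg m) (\<lambda>x. LINT \<xi>|M. g \<xi> x)) \<le> (\<integral>\<^sup>+\<xi>. cN p (conv_op (sg m) (g \<xi>)) \<partial>M)"
      by (rule cN_conv_op_param[OF p wsym_sg M.sigma_finite_measure_axioms gm gfin Xm]) (rule AE_I2, rule refl)
    also have "\<dots> \<le> (\<integral>\<^sup>+\<xi>. csum (\<lambda>k. ennreal (exp (- W m)) * A k * (ennreal \<bar>\<xi>\<bar> * c (J \<xi>) (m - k))) \<partial>M)"
    proof (rule nn_integral_mono)
      fix \<xi>
      have "ennreal (exp (- W m)) * (ennreal \<bar>\<xi>\<bar> * sconv A (c (J \<xi>)) m) = csum (\<lambda>k. ennreal (exp (- W m)) * (ennreal \<bar>\<xi>\<bar> * (A k * c (J \<xi>) (m - k))))"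
        by (simp add: sconv_def nn_integral_cmult)
      then show "cN p (conv_op (sg m) (g \<xi>)) \<le> csum (\<lambda>k. ennreal (exp (- W m)) * A k * (ennreal \<bar>\<xi>\<bar> * c (J \<xi>) (m - k)))"
        using bd[of \<xi>] by (simp only: mult_ac)
    qed
    also have "\<dots> = csum (\<lambda>k. \<integral>\<^sup>+\<xi>. ennreal (exp (- W m)) * A k * (ennreal \<bar>\<xi>\<bar> * c (J \<xi>) (m - k)) \<partial>M)"
      by (rule nn_integral_count_space_nn_integral) auto
    also have "\<dots> = csum (\<lambda>k. ennreal (exp (- W m)) * A k * C (m - k))"
      by (intro nn_integral_cong) (simp add: C_def nn_integral_cmult)
    also have "\<dots> = ennreal (exp (- W m)) * sconv A C m"
      by (simp add: sconv_def nn_integral_cmult[symmetric] mult.assoc)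
    finally have "ennreal (exp (W m)) * cN p (conv_op (sg m) (\<lambda>x. LINT \<xi>|M. g \<xi> x)) \<le> ennreal (exp (W m)) * (ennreal (exp (- W m)) * sconv A C m)"
      by (rule mult_left_mono) simp
    then show "ennreal (exp (W m)) * cN p (conv_op (sg m) (\<lambda>x. LINT \<xi>|M. exp (\<i> * of_real (\<xi> * ur x)) - 1)) \<le> sconv A C m"
      by (simp only: g_def exp_cancel(2))
    qed
  qed
qed

end

section \<open>Sequence norms\<close>

lemma infsum_eq_csum:
  fixes f :: "'k::countable \<Rightarrow> ennreal"
  shows "(\<Sum>\<^sub>\<infinity>k\<in>UNIV. f k) = csum f"
proof (rule antisym)
  have eq: "(\<Sum>\<^sub>\<infinity>k\<in>UNIV. f k) = (SUP F\<in>{F. finite F \<and> F \<subseteq> UNIV}. sum f F)"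
    by (rule nonneg_infsum_complete) simp
  show "(\<Sum>\<^sub>\<infinity>k\<in>UNIV. f k) \<le> csum f"
    unfolding eq by (intro SUP_least sum_le_csum) auto
  define F where "F n = {k::'k. to_nat k < n}" for n
  have finF: "finite (F n)" for n
    unfolding F_def using finite_vimageI[OF finite_lessThan[of n] inj_to_nat] by (simp add: vimage_def)
  have "csum f = csum (\<lambda>k. SUP n. f k * indicator (F n) k)"
  proof (rule nn_integral_cong)
    fix k
    have "f k = f k * indicator (F (Suc (to_nat k))) k" by (simp add: F_def)
    also have "\<dots> \<le> (SUP n. f k * indicator (F n) k)" by (rule SUP_upper) simp
    finally have "f k \<le> (SUP n. f k * indicator (F n) k)" .
    moreover have "(SUP n. f k * indicator (F n) k) \<le> f k" by (rule SUP_least) (simp add: indicator_def)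
    ultimately show "f k = (SUP n. f k * indicator (F n) k)" by (rule antisym)
  qed
  also have "\<dots> = (SUP n. csum (\<lambda>k. f k * indicator (F n) k))"
    by (rule nn_integral_monotone_convergence_SUP)
       (auto simp: incseq_def le_fun_def F_def indicator_def intro!: mult_left_mono)
  also have "\<dots> \<le> (\<Sum>\<^sub>\<infinity>k\<in>UNIV. f k)"
  proof (rule SUP_least)
    fix n
    have "csum (\<lambda>k. f k * indicator (F n) k) = sum f (F n)"
      using finF[of n] by (simp add: nn_integral_count_space_indicator[symmetric] nn_integral_count_space_finite)
    also have "\<dots> \<le> (\<Sum>\<^sub>\<infinity>k\<in>UNIV. f k)" unfolding eq using finF by (intro SUP_upper) auto
    finally show "csum (\<lambda>k. f k * indicator (F n) k) \<le> (\<Sum>\<^sub>\<infinity>k\<in>UNIV. f k)" .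
  qed
  finally show "csum f \<le> (\<Sum>\<^sub>\<infinity>k\<in>UNIV. f k)" .
qed

definition lqn :: "ennreal \<Rightarrow> ('k \<Rightarrow> ennreal) \<Rightarrow> ennreal" where
  "lqn q h = (if q = \<infinity> then (SUP k. h k) else lpn (count_space UNIV) (enn2real q) h)"

lemma enn2real_ge_1: "1 \<le> q \<Longrightarrow> q \<noteq> \<infinity> \<Longrightarrow> 1 \<le> enn2real q"
  by (cases q) auto

lemma lqn_mono: "1 \<le> q \<Longrightarrow> (\<And>k. f k \<le> g k) \<Longrightarrow> lqn q f \<le> lqn q g"
  using enn2real_ge_1[of q] unfolding lqn_def by (auto intro!: SUP_mono' lpn_mono)

lemma lqn_cmult: "1 \<le> q \<Longrightarrow> lqn q (\<lambda>k. c * f k) = c * lqn q f"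
  using enn2real_ge_1[of q] unfolding lqn_def by (auto simp: SUP_mult_left_ennreal lpn_cmult)

lemma lqn_ge_point:
  fixes f :: "'k \<Rightarrow> ennreal"
  assumes "1 \<le> q"
  shows "f k \<le> lqn q f"
proof (cases "q = \<infinity>")
  case False
  then have Q: "1 \<le> enn2real q" using assms by (rule enn2real_ge_1[rotated])
  have "ennpowr (f k) (enn2real q) \<le> ennpowr (lpn (count_space UNIV) (enn2real q) f) (enn2real q)"
    using Q by (subst lpn_powr) (auto intro: nn_integral_ge_point)
  then have "ennpowr (ennpowr (f k) (enn2real q)) (1 / enn2real q) \<le>
      ennpowr (ennpowr (lpn (count_space UNIV) (enn2real q) f) (enn2real q)) (1 / enn2real q)"
    by (rule ennpowr_mono[rotated]) (use Q in simp)
  then show ?thesis using Q False by (simp add: ennpowr_ennpowr lqn_def)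
qed (simp add: lqn_def SUP_upper)

text \<open>The convolution is a superposition of translates of f with weights g, and the norm is
  invariant under translation.\<close>

lemma lqn_sconv:
  fixes f g :: "'g::{ab_group_add,countable} \<Rightarrow> ennreal"
  assumes "1 \<le> q"
  shows "lqn q (sconv f g) \<le> csum g * lqn q f"
proof -
  have eq: "sconv f g = (\<lambda>m. csum (\<lambda>k. g k * f (m - k)))"
    by (simp add: sconv_commute[of f g] sconv_def fun_eq_iff)
  show ?thesis
  proof (cases "q = \<infinity>")
    case True
    have "csum (\<lambda>k. g k * f (m - k)) \<le> csum g * (SUP k. f k)" for m
    proof -
      have "csum (\<lambda>k. g k * f (m - k)) \<le> csum (\<lambda>k. g k * (SUP k. f k))"
        by (intro nn_integral_mono mult_left_mono SUP_upper) auto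
      then show ?thesis by (simp add: nn_integral_multc)
    qed
    then show ?thesis using True by (simp add: lqn_def eq SUP_least)
  next
    case False
    let ?Q = "enn2real q"
    have Q: "1 \<le> ?Q" using enn2real_ge_1[OF assms False] .
    have shift: "lpn (count_space UNIV) ?Q (\<lambda>m. f (m - k)) = lpn (count_space UNIV) ?Q f" for k
      unfolding lpn_def using csum_reindex[OF bij_diff(2)[of k], of "\<lambda>m. ennpowr (f m) ?Q"] by simp
    have "lpn (count_space UNIV) ?Q (sconv f g) \<le> csum (\<lambda>k. lpn (count_space UNIV) ?Q (\<lambda>m. g k * f (m - k)))"
      unfolding eq using Q
      by (intro lpn_minkowski sigma_finite_measure_count_space_countable measurable_pair_measure_countable1) auto
    also have "\<dots> = csum g * lpn (count_space UNIV) ?Q f"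
      using Q by (simp add: lpn_cmult shift nn_integral_multc)
    finally show ?thesis using False by (simp add: lqn_def)
  qed
qed

text \<open>The weight is moved inside the power, which reduces the modulation norm to an unweighted
  sequence norm.\<close>

lemma modulation_norm_eq_lqn:
  assumes "1 \<le> q"
  shows "modulation_norm \<rho> w p q f = lqn q (\<lambda>k. ennreal (exp (w (norm (real_vec k)))) * dist_Lp_norm p (box_op \<rho> k f))"
proof (cases "q = \<infinity>")
  case False
  let ?Q = "enn2real q"
  have Q: "1 \<le> ?Q" using enn2real_ge_1[OF assms False] .
  have "ennpowr (ennreal (exp t) * d) ?Q = ennreal (exp (?Q * t)) * ennpowr d ?Q" for t d
    using Q by (simp add: ennpowr_mult powr_def)
  then show ?thesis using False by (simp add: modulation_norm_def lqn_def lpn_def infsum_eq_csum)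
qed (simp add: modulation_norm_def lqn_def)

section \<open>Composition operators on modulation spaces\<close>

text \<open>The exponent 1/\<alpha> in \<open>phi\<close> is undone by the index: phi z powr
  \<alpha> = z powr \<alpha> ln z, so w (phi z) is the exponent in \<open>L_2\<close>. In the
  bounded case the factor wt is absorbed into the parameter of \<open>L_1\<close>.\<close>

lemma (in reg_weight) moment_hypothesis:
  assumes wt: "\<forall>x>0. w x = x powr \<alpha> * wt x"
    and H: "(bounded (wt ` {1..}) \<and> (\<forall>l>0. L_1 \<alpha> \<mu> l < \<infinity>)) \<or>
         (filterlim wt at_top at_top \<and> (\<forall>l>0. L_2 \<alpha> wt \<mu> l < \<infinity>))"
    and l: "0 < l"
  shows "(\<integral>\<^sup>+\<xi>. ennreal (exp (l * w (phi \<bar>\<xi>\<bar>)) * indicator {\<xi>. 3 \<le> \<bar>\<xi>\<bar>} \<xi>) \<partial>total_variation \<mu>) < \<infinity>"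
proof -
  have wphi: "w (phi z) = z powr \<alpha> * ln z * wt (phi z)" if z: "3 \<le> z" for z
  proof -
    have "0 < phi z" using phi_ge[OF z] z by linarith
    then have "w (phi z) = phi z powr \<alpha> * wt (phi z)" using wt by blast
    also have "phi z powr \<alpha> = z powr \<alpha> * (ln z powr (1 / \<alpha>)) powr \<alpha>" using z by (subst powr_mult) auto
    also have "(ln z powr (1 / \<alpha>)) powr \<alpha> = ln z" using alpha ln_ge_1[OF z] by (simp add: powr_powr)
    finally show ?thesis .
  qed
  from H show ?thesis
  proof
    assume a: "bounded (wt ` {1..}) \<and> (\<forall>l>0. L_1 \<alpha> \<mu> l < \<infinity>)"
    then obtain b where b: "\<And>x. 1 \<le> x \<Longrightarrow> \<bar>wt x\<bar> \<le> b" unfolding bounded_iff by auto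
    define B where "B = max b 1"
    have B: "0 < B" "\<And>x. 1 \<le> x \<Longrightarrow> wt x \<le> B" using b by (auto simp: B_def intro: order_trans[OF abs_ge_self] max.coboundedI1)
    have "(\<integral>\<^sup>+\<xi>. ennreal (exp (l * w (phi \<bar>\<xi>\<bar>)) * indicator {\<xi>. 3 \<le> \<bar>\<xi>\<bar>} \<xi>) \<partial>total_variation \<mu>) \<le> L_1 \<alpha> \<mu> (l * B)"
      unfolding L_1_def
    proof (rule nn_integral_mono)
      fix \<xi> :: real
      show "ennreal (exp (l * w (phi \<bar>\<xi>\<bar>)) * indicator {\<xi>. 3 \<le> \<bar>\<xi>\<bar>} \<xi>) \<le> ennreal (exp (l * B * \<bar>\<xi>\<bar> powr \<alpha> * ln \<bar>\<xi>\<bar>))"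
      proof (cases "3 \<le> \<bar>\<xi>\<bar>")
        case True
        have "wt (phi \<bar>\<xi>\<bar>) \<le> B" using phi_ge[OF True] True by (intro B) linarith
        then have "w (phi \<bar>\<xi>\<bar>) \<le> \<bar>\<xi>\<bar> powr \<alpha> * ln \<bar>\<xi>\<bar> * B"
          unfolding wphi[OF True] using ln_ge_1[OF True] by (intro mult_left_mono mult_nonneg_nonneg) auto
        then have "l * w (phi \<bar>\<xi>\<bar>) \<le> l * (\<bar>\<xi>\<bar> powr \<alpha> * ln \<bar>\<xi>\<bar> * B)" using l by (simp only: mult_le_cancel_left_pos)
        then have "l * w (phi \<bar>\<xi>\<bar>) \<le> l * B * \<bar>\<xi>\<bar> powr \<alpha> * ln \<bar>\<xi>\<bar>" by (simp only: mult_ac)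
        then show ?thesis using True by (simp add: ennreal_leI)
      qed simp
    qed
    also have "\<dots> < \<infinity>" using a l B by simp
    finally show ?thesis .
  next
    assume b: "filterlim wt at_top at_top \<and> (\<forall>l>0. L_2 \<alpha> wt \<mu> l < \<infinity>)"
    have "(\<integral>\<^sup>+\<xi>. ennreal (exp (l * w (phi \<bar>\<xi>\<bar>)) * indicator {\<xi>. 3 \<le> \<bar>\<xi>\<bar>} \<xi>) \<partial>total_variation \<mu>) \<le> L_2 \<alpha> wt \<mu> l"
      unfolding L_2_def
    proof (rule nn_integral_mono)
      fix \<xi> :: real
      show "ennreal (exp (l * w (phi \<bar>\<xi>\<bar>)) * indicator {\<xi>. 3 \<le> \<bar>\<xi>\<bar>} \<xi>) \<le>
        ennreal (exp (l * \<bar>\<xi>\<bar> powr \<alpha> * ln \<bar>\<xi>\<bar> * wt (phi \<bar>\<xi>\<bar>))) * indicator {\<xi>. 1 < \<bar>\<xi>\<bar>} \<xi>"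
      proof (cases "3 \<le> \<bar>\<xi>\<bar>")
        case True
        then show ?thesis by (simp add: wphi[OF True] mult.assoc)
      qed simp
    qed
    also have "\<dots> < \<infinity>" using b l by simp
    finally show ?thesis .
  qed
qed

lemma (in reg_weight) power_moment_finite:
  assumes M: "finite_measure M" "sets M = sets borel"
    and H: "\<And>l. 0 < l \<Longrightarrow> (\<integral>\<^sup>+\<xi>. ennreal (exp (l * w (phi \<bar>\<xi>\<bar>)) * indicator {\<xi>. 3 \<le> \<bar>\<xi>\<bar>} \<xi>) \<partial>M) < \<infinity>"
  shows "(\<integral>\<^sup>+\<xi>. ennreal (\<bar>\<xi>\<bar> ^ n) \<partial>M) < \<infinity>"
proof -
  obtain l K where lK: "0 < l" "0 \<le> K"
    "\<And>x. \<bar>x\<bar> ^ n \<le> K + K * (exp (l * w (phi \<bar>x\<bar>)) * indicator {x. 3 \<le> \<bar>x\<bar>} (x::real))"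
    using power_moment_pointwise[of n] by blast
  have "(\<integral>\<^sup>+\<xi>. ennreal (\<bar>\<xi>\<bar> ^ n) \<partial>M) \<le>
    (\<integral>\<^sup>+\<xi>. ennreal K + ennreal K * ennreal (exp (l * w (phi \<bar>\<xi>\<bar>)) * indicator {\<xi>. 3 \<le> \<bar>\<xi>\<bar>} \<xi>) \<partial>M)"
  proof (rule nn_integral_mono)
    fix \<xi>
    have "ennreal (\<bar>\<xi>\<bar> ^ n) \<le> ennreal (K + K * (exp (l * w (phi \<bar>\<xi>\<bar>)) * indicator {x. 3 \<le> \<bar>x\<bar>} \<xi>))"
      by (rule ennreal_leI[OF lK(3)])
    also have "\<dots> = ennreal K + ennreal K * ennreal (exp (l * w (phi \<bar>\<xi>\<bar>)) * indicator {\<xi>. 3 \<le> \<bar>\<xi>\<bar>} \<xi>)"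
      using lK(2) by (simp add: ennreal_mult)
    finally show "ennreal (\<bar>\<xi>\<bar> ^ n) \<le> ennreal K + ennreal K * ennreal (exp (l * w (phi \<bar>\<xi>\<bar>)) * indicator {\<xi>. 3 \<le> \<bar>\<xi>\<bar>} \<xi>)" .
  qed
  also have "\<dots> < \<infinity>" by (rule affine_moment_finite[OF M H[OF lK(1)]])
  finally show ?thesis .
qed

lemma ennreal_sum_finite:
  assumes "finite I" "\<And>i. i \<in> I \<Longrightarrow> f i < (\<infinity> :: ennreal)"
  shows "sum f I < \<infinity>"
  using assms by (induction rule: finite_induct) auto

lemma sconv_sum_right:
  "finite I \<Longrightarrow> sconv f (\<lambda>z. \<Sum>i\<in>I. c i * g i z) m = (\<Sum>i\<in>I. c i * sconv f (g i) m)"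
proof (induction rule: finite_induct)
  case empty
  show ?case by (simp add: sconv_def)
next
  case (insert i I)
  have "(\<lambda>z. \<Sum>i\<in>insert i I. c i * g i z) = (\<lambda>z. c i * g i z + (\<Sum>i\<in>I. c i * g i z))"
    using insert by (simp add: fun_eq_iff)
  then show ?case by (simp only: sconv_add_right sconv_cmult_right sum.insert[OF insert.hyps] insert.IH)
qed

text \<open>The masses of the four parts, with their signs, add up to \<mu> UNIV = 0, so 1 may be
  subtracted inside every integral. Each part alone then vanishes at t = 0 and is controlled by
  |\<xi> t|.\<close>

lemma inv_fourier_measure_difference:
  assumes mu: "complex_measure \<mu>" "\<mu> UNIV = 0"
  shows "inv_fourier_measure \<mu> t =
    (\<Sum>i<4. (of_real (1 / sqrt (2 * pi)) * part_sign i) * (LINT \<xi>|variation_parts \<mu> i. exp (\<i> * of_real (\<xi> * t)) - 1))"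
proof -
  have "(LINT \<xi>|variation_parts \<mu> i. exp (\<i> * of_real (\<xi> * t)) - 1) =
     (LINT \<xi>|variation_parts \<mu> i. exp (\<i> * of_real (t * \<xi>))) - of_real (measure (variation_parts \<mu> i) UNIV)" if i: "i < 4" for i
  proof -
    let ?M = "variation_parts \<mu> i"
    interpret M: finite_measure ?M by (rule variation_parts_facts(1)[OF mu(1) i])
    have s: "sets ?M = sets borel" by (rule variation_parts_facts(2)[OF mu(1) i])
    have m: "(\<lambda>\<xi>. exp (\<i> * complex_of_real (t * \<xi>))) \<in> borel_measurable ?M"
      unfolding measurable_cong_sets[OF s refl] by (intro borel_measurable_continuous_onI continuous_intros)
    have "integrable ?M (\<lambda>\<xi>. exp (\<i> * complex_of_real (t * \<xi>)))"
      by (rule M.integrable_const_bound[of _ 1, OF _ m]) (auto simp: norm_exp_i_times)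
    then have "(LINT \<xi>|?M. exp (\<i> * complex_of_real (t * \<xi>)) - 1) =
        (LINT \<xi>|?M. exp (\<i> * complex_of_real (t * \<xi>))) - (LINT \<xi>|?M. (1::complex))"
      by (rule Bochner_Integration.integral_diff) simp
    also have "(LINT \<xi>|?M. (1::complex)) = of_real (measure ?M UNIV)"
      using sets_eq_imp_space_eq[OF s] by (simp add: scaleR_conv_of_real)
    finally show ?thesis by (simp only: mult.commute[of t])
  qed
  then have "(\<Sum>i<4. (of_real (1 / sqrt (2 * pi)) * part_sign i) * (LINT \<xi>|variation_parts \<mu> i. exp (\<i> * of_real (\<xi> * t)) - 1)) =
    (\<Sum>i<4. of_real (1 / sqrt (2 * pi)) * (part_sign i * (LINT \<xi>|variation_parts \<mu> i. exp (\<i> * of_real (t * \<xi>)))) -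
       of_real (1 / sqrt (2 * pi)) * (part_sign i * of_real (measure (variation_parts \<mu> i) UNIV)))"
    by (intro sum.cong refl) (simp only: lessThan_iff right_diff_distrib mult.assoc)
  also have "\<dots> = of_real (1 / sqrt (2 * pi)) * (\<Sum>i<4. part_sign i * (LINT \<xi>|variation_parts \<mu> i. exp (\<i> * of_real (t * \<xi>)))) -
      of_real (1 / sqrt (2 * pi)) * (\<Sum>i<4. part_sign i * of_real (measure (variation_parts \<mu> i) UNIV))"
    by (simp only: sum_subtractf sum_distrib_left)
  also have "\<dots> = inv_fourier_measure \<mu> t"
    by (simp only: variation_parts_total[OF mu(1)] mu(2) inv_fourier_measure_def complex_measure_integral_parts mult_zero_right diff_zero)
  finally show ?thesis ..
qed

lemma composition_in_modulation_space:
  fixes \<rho> :: "real^'n \<Rightarrow> real" and u :: "real^'n \<Rightarrow> real"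
  assumes P: "1 < P" and q: "1 \<le> q" and rho: "decomposition_function \<rho>" and rw: "reg_weight w \<alpha>"
    and mu: "complex_measure \<mu>" "\<mu> UNIV = 0"
    and H: "\<And>i l. i < 4 \<Longrightarrow> 0 < l \<Longrightarrow> (\<integral>\<^sup>+\<xi>. ennreal (exp (l * w (\<bar>\<xi>\<bar> * ln \<bar>\<xi>\<bar> powr (1 / \<alpha>))) * indicator {\<xi>. 3 \<le> \<bar>\<xi>\<bar>} \<xi>) \<partial>variation_parts \<mu> i) < \<infinity>"
    and cont: "continuous_on UNIV (inv_fourier_measure \<mu>)"
    and u: "(\<lambda>x. complex_of_real (u x)) \<in> modulation_space \<rho> w (ennreal P) q"
  shows "inv_fourier_measure \<mu> \<circ> u \<in> modulation_space \<rho> w (ennreal P) q"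
proof -
  interpret reg_weight w \<alpha> by fact
  interpret U: uniform_decomp "sigma0 \<rho>" "real CARD('n)" by (rule sigma0_uniform_decomp[OF rho])
  have P0: "0 < P" using P by simp
  let ?U = "\<lambda>x. complex_of_real (u x)"
  have um: "?U \<in> borel_measurable lebesgue" and uLp: "Lp_norm (ennreal P) ?U < \<infinity>"
    and uN: "modulation_norm \<rho> w (ennreal P) q ?U < \<infinity>"
    using u by (simp_all add: modulation_space_def Lp_space_def)
  have um': "u \<in> borel_measurable lebesgue" using measurable_compose[OF um borel_measurable_Re] by simp
  from completion_ex_borel_measurable_real[OF um'] obtain ur
    where ur: "ur \<in> borel_measurable lborel" "AE x in lborel. u x = ur x" by auto
  have urm [measurable]: "ur \<in> borel_measurable borel" using ur(1) by simp
  let ?R = "\<lambda>x. complex_of_real (ur x)"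
  have Rm: "?R \<in> borel_measurable borel" by measurable
  have ae: "AE x in lborel. ?U x = ?R x" using ur(2) by eventually_elim simp
  have Rfin: "cN P ?R < \<infinity>" using uLp Lp_norm_eq_cN[OF P0 Rm ae] by simp
  define Rp where "Rp cc \<longleftrightarrow> 0 < cc \<and> (\<forall>k f f'. f \<in> borel_measurable lebesgue \<longrightarrow> f' \<in> borel_measurable borel \<longrightarrow>
      (AE x in lborel. f x = f' x) \<longrightarrow> cN P f' < \<infinity> \<longrightarrow>
      dist_Lp_norm (ennreal P) (box_op \<rho> k f) = ennreal cc * cN P (conv_op (U.sg k) f'))" for cc
  have "\<exists>cc. Rp cc"
    unfolding Rp_def
    by (rule exI, rule conjI, rule c2_pos, (rule rho, rule P)?, intro allI impI, rule antisym,
      rule dist_norm_box_le[OF rho P], assumption+, rule dist_norm_box_ge[OF rho P], assumption+)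
  then obtain cc where Rp: "Rp cc" by blast
  note cc = Rp[unfolded Rp_def, THEN conjunct1] Rp[unfolded Rp_def, THEN conjunct2, rule_format]
  define H1 where "H1 k = ennreal (exp (w (norm (real_vec k)))) * dist_Lp_norm (ennreal P) (box_op \<rho> k ?U)" for k :: "int^'n"
  have H1: "lqn q H1 < \<infinity>" using uN unfolding modulation_norm_eq_lqn[OF q] H1_def .
  \<comment> \<open>Conversion factor between the pieces, normalised by \<open>kap\<close>, and the
    operators \<open>box_op\<close>, normalised by cc.\<close>
  define kk where "kk = norm (inverse U.kap) / cc"
  have kk: "0 \<le> kk" using cc by (simp add: kk_def)
  have pc: "cN P (U.piece ?R k) * ennreal (exp (w (norm (real_vec k)))) = ennreal kk * H1 k" for k
  proof -
    have "U.piece ?R k = (\<lambda>y. inverse U.kap * conv_op (U.sg k) ?R y)"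
      by (simp add: fun_eq_iff U.piece_def divide_inverse mult.commute)
    then have "cN P (U.piece ?R k) = ennreal (norm (inverse U.kap)) * cN P (conv_op (U.sg k) ?R)"
      using cN_cmult[OF P0 conv_op_measurable[OF U.wsym_sg Rm], of "inverse U.kap" k] by (simp only:)
    also have "norm (inverse U.kap) = kk * cc" using cc by (simp add: kk_def)
    also have "ennreal (kk * cc) * cN P (conv_op (U.sg k) ?R) = ennreal kk * dist_Lp_norm (ennreal P) (box_op \<rho> k ?U)"
      unfolding cc(2)[OF um Rm ae Rfin] using kk cc(1) by (simp add: ennreal_mult mult.assoc)
    finally show ?thesis by (simp only: H1_def mult_ac)
  qed
  have AA: "lqn q (\<lambda>k. ennreal kk * H1 k) < \<infinity>" using H1 by (simp add: lqn_cmult[OF q] ennreal_mult_less_top)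
  define Ab where "Ab = enn2real (lqn q (\<lambda>k. ennreal kk * H1 k))"
  have Ab: "lqn q (\<lambda>k. ennreal kk * H1 k) = ennreal Ab" "0 \<le> Ab"
    using AA by (simp_all add: Ab_def ennreal_enn2real_if)
  have A_le: "cN P (U.piece ?R k) * ennreal (exp (w (norm (real_vec k)))) \<le> ennreal Ab" for k
    unfolding pc Ab(1)[symmetric] by (rule lqn_ge_point[OF q])
  \<comment> \<open>Bounded weighted norms together with the summability of exp (- w) give summable
    pieces, whatever q is.\<close>
  have a_fin: "csum (\<lambda>k. cN P (U.piece ?R k)) < \<infinity>"
  proof -
    have "csum (\<lambda>k. cN P (U.piece ?R k)) \<le> csum (\<lambda>k::int^'n. ennreal Ab * ennreal (exp (- 1 * w (norm (real_vec k)))))"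
    proof (rule nn_integral_mono)
      fix k :: "int^'n"
      let ?t = "w (norm (real_vec k))"
      have "cN P (U.piece ?R k) = ennreal (exp (- ?t)) * (ennreal (exp ?t) * cN P (U.piece ?R k))" by (rule exp_cancel(1)[symmetric])
      also have "\<dots> \<le> ennreal (exp (- ?t)) * ennreal Ab" using A_le[of k] by (intro mult_left_mono) (simp_all add: mult.commute)
      finally show "cN P (U.piece ?R k) \<le> ennreal Ab * ennreal (exp (- 1 * ?t))" by (simp add: mult.commute)
    qed
    also have "\<dots> = ennreal Ab * csum (\<lambda>k::int^'n. ennreal (exp (- 1 * w (norm (real_vec k)))))" by (rule nn_integral_cmult) simp
    also have "\<dots> < \<infinity>" using w_summable[of 1, where 'n='n] by (simp add: ennreal_mult_less_top)
    finally show ?thesis .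
  qed
  have df: "decomp_fun (sigma0 \<rho>) (real CARD('n)) P ?R"
    by (intro decomp_fun.intro decomp_fun_axioms.intro U.uniform_decomp_axioms P Rm Rfin a_fin)
  interpret df: decomp_fun "sigma0 \<rho>" "real CARD('n)" P ?R by (rule df)
  have "df.a k * ennreal (exp (w (norm (real_vec k)))) \<le> ennreal Ab" for k unfolding df.a_def by (rule A_le)
  then have "weighted_fun (sigma0 \<rho>) (real CARD('n)) P ur w \<alpha> Ab"
    by (intro weighted_fun.intro weighted_fun_axioms.intro df rw Ab(2))
  then interpret wf: weighted_fun "sigma0 \<rho>" "real CARD('n)" P ur w \<alpha> Ab .
  have wA: "wf.A = (\<lambda>k. ennreal kk * H1 k)" by (rule ext) (simp only: wf.A_def df.a_def pc)
  define F where "F i x = (LINT \<xi>|variation_parts \<mu> i. exp (\<i> * of_real (\<xi> * ur x)) - 1)" for i x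
  define mo where "mo i = (\<integral>\<^sup>+\<xi>. ennreal \<bar>\<xi>\<bar> \<partial>variation_parts \<mu> i)" for i
  have mo: "mo i < \<infinity>" if i: "i < 4" for i
    using power_moment_finite[OF variation_parts_facts(1,2)[OF mu(1) i] H[OF i], of 1] by (simp add: mo_def)
  define Pr where "Pr i C \<longleftrightarrow> csum C < \<infinity> \<and>
    (\<forall>m. ennreal (exp (w (norm (real_vec m)))) * cN P (conv_op (U.sg m) (F i)) \<le> sconv wf.A C m) \<and> F i \<in> borel_measurable borel" for i C
  have "\<exists>C. Pr i C" if i: "i < 4" for i
  proof -
    show ?thesis
      unfolding Pr_def F_def[abs_def]
      by (rule wf.composition_sequence[OF variation_parts_facts(1,2)[OF mu(1) i] H[OF i] mo[OF i, unfolded mo_def]])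
        (assumption, intro exI conjI, assumption+)
  qed
  then obtain C where "\<And>i. i < 4 \<Longrightarrow> Pr i (C i)" by metis
  then have C: "csum (C i) < \<infinity>" "ennreal (exp (w (norm (real_vec m)))) * cN P (conv_op (U.sg m) (F i)) \<le> sconv wf.A (C i) m"
    "F i \<in> borel_measurable borel" if "i < 4" for i m using that by (simp_all only: Pr_def)
  define ko where "ko i = of_real (1 / sqrt (2 * pi)) * part_sign i" for i
  define X where "X x = (\<Sum>i<4. ko i * F i x)" for x
  have eqX: "inv_fourier_measure \<mu> (ur x) = X x" for x
    unfolding inv_fourier_measure_difference[OF mu] X_def ko_def F_def ..
  have Xm: "X \<in> borel_measurable borel"
    unfolding X_def[abs_def] using C(3) by (intro borel_measurable_sum borel_measurable_times) auto
  \<comment> \<open>The inequality |exp (i t) - 1| \<le> |t| and the finite first moment give a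
    pointwise bound by |ur|, hence membership in L^p.\<close>
  have Fpt: "ennreal (norm (F i x)) \<le> mo i * ennreal (norm (?R x))" if i: "i < 4" for i x
  proof -
    have "ennreal (norm (F i x)) \<le> (\<integral>\<^sup>+\<xi>. ennreal (norm (exp (\<i> * of_real (\<xi> * ur x)) - 1)) \<partial>variation_parts \<mu> i)"
      unfolding F_def by (rule norm_lint_le_nn)
    also have "\<dots> \<le> (\<integral>\<^sup>+\<xi>. ennreal \<bar>\<xi>\<bar> * ennreal (norm (?R x)) \<partial>variation_parts \<mu> i)"
    proof (rule nn_integral_mono)
      fix \<xi>
      have "norm (exp (\<i> * of_real (\<xi> * ur x)) - 1) \<le> \<bar>\<xi> * ur x\<bar>" using iexp_approx1[of "\<xi> * ur x" 0] by simp
      then have "norm (exp (\<i> * of_real (\<xi> * ur x)) - 1) \<le> \<bar>\<xi>\<bar> * norm (?R x)" by (simp only: abs_mult norm_of_real)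
      then have "ennreal (norm (exp (\<i> * of_real (\<xi> * ur x)) - 1)) \<le> ennreal (\<bar>\<xi>\<bar> * norm (?R x))" by (rule ennreal_leI)
      then show "ennreal (norm (exp (\<i> * of_real (\<xi> * ur x)) - 1)) \<le> ennreal \<bar>\<xi>\<bar> * ennreal (norm (?R x))"
        by (simp only: ennreal_mult abs_ge_zero norm_ge_zero)
    qed
    also have "\<dots> = mo i * ennreal (norm (?R x))"
      unfolding mo_def
      by (rule nn_integral_multc) (subst measurable_cong_sets[OF variation_parts_facts(2)[OF mu(1) i] refl], measurable)
    finally show ?thesis .
  qed
  have Ffin: "cN P (F i) < \<infinity>" if i: "i < 4" for i
  proof -
    have "cN P (F i) \<le> lpn lborel P (\<lambda>x. mo i * ennreal (norm (?R x)))"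
      unfolding cN_def by (rule lpn_mono[OF P0 Fpt[OF i]])
    also have "\<dots> = mo i * cN P ?R" unfolding cN_def by (rule lpn_cmult[OF P0]) measurable
    also have "\<dots> < \<infinity>" using mo[OF i] Rfin by (simp add: ennreal_mult_less_top)
    finally show ?thesis .
  qed
  have Xfin: "cN P X < \<infinity>"
  proof -
    have "cN P X \<le> lpn lborel P (\<lambda>x. (\<Sum>i<4. ennreal (norm (ko i)) * mo i) * ennreal (norm (?R x)))"
      unfolding cN_def
    proof (rule lpn_mono[OF P0])
      fix x
      have "ennreal (norm (X x)) \<le> ennreal (\<Sum>i<4. norm (ko i * F i x))"
        unfolding X_def by (intro ennreal_leI norm_sum)
      also have "\<dots> = (\<Sum>i<4. ennreal (norm (ko i)) * ennreal (norm (F i x)))"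
        by (subst sum_ennreal[symmetric]) (simp_all add: norm_mult ennreal_mult)
      also have "\<dots> \<le> (\<Sum>i<4. ennreal (norm (ko i)) * (mo i * ennreal (norm (?R x))))"
        by (intro sum_mono mult_left_mono Fpt) auto
      also have "\<dots> = (\<Sum>i<4. ennreal (norm (ko i)) * mo i) * ennreal (norm (?R x))"
        by (simp only: sum_distrib_right mult.assoc)
      finally show "ennreal (norm (X x)) \<le> (\<Sum>i<4. ennreal (norm (ko i)) * mo i) * ennreal (norm (?R x))" .
    qed
    also have "\<dots> = (\<Sum>i<4. ennreal (norm (ko i)) * mo i) * cN P ?R" unfolding cN_def by (rule lpn_cmult[OF P0]) measurable
    also have "\<dots> < \<infinity>"
    proof -
      have "(\<Sum>i<4. ennreal (norm (ko i)) * mo i) < \<infinity>"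
      proof (rule ennreal_sum_finite)
        show "ennreal (norm (ko i)) * mo i < \<infinity>" if "i \<in> {..<4}" for i
          using mo[of i] that by (simp add: ennreal_mult_less_top)
      qed simp
      then show ?thesis using Rfin by (simp add: ennreal_mult_less_top)
    qed
    finally show ?thesis .
  qed
  let ?f = "inv_fourier_measure \<mu> \<circ> u"
  have fm: "?f \<in> borel_measurable lebesgue"
    by (rule measurable_comp[OF um' borel_measurable_continuous_onI[OF cont]])
  have aef: "AE x in lborel. ?f x = X x"
    using ur(2) by eventually_elim (simp add: eqX)
  have fLp: "?f \<in> Lp_space (ennreal P)"
    unfolding Lp_space_def mem_Collect_eq Lp_norm_eq_cN[OF P0 Xm aef] using fm Xfin by (intro conjI)
  define D where "D z = (\<Sum>i<4. ennreal (cc * norm (ko i)) * C i z)" for z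
  have Dfin: "csum D < \<infinity>"
  proof -
    have "csum D = (\<Sum>i<4. ennreal (cc * norm (ko i)) * csum (C i))"
      unfolding D_def by (simp add: nn_integral_sum nn_integral_cmult)
    also have "\<dots> < \<infinity>"
    proof (rule ennreal_sum_finite)
      show "ennreal (cc * norm (ko i)) * csum (C i) < \<infinity>" if "i \<in> {..<4}" for i
        using C(1)[of i] that by (simp add: ennreal_mult_less_top)
    qed simp
    finally show ?thesis .
  qed
  have bd: "ennreal (exp (w (norm (real_vec m)))) * dist_Lp_norm (ennreal P) (box_op \<rho> m ?f) \<le> sconv wf.A D m" for m
  proof -
    let ?e = "ennreal (exp (w (norm (real_vec m))))"
    have kF: "(\<lambda>x. ko i * F i x) \<in> borel_measurable borel" if "i \<in> {..<4}" for i using C(3)[of i] that by simp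
    have "cN P (conv_op (U.sg m) X) \<le> (\<integral>\<^sup>+i. cN P (conv_op (U.sg m) (\<lambda>x. ko i * F i x)) \<partial>count_space {..<4})"
    proof (rule cN_conv_op_countable[OF P U.wsym_sg _ kF _ Xm])
      show "(\<integral>\<^sup>+i. cN P (\<lambda>x. ko i * F i x) \<partial>count_space {..<4}) < \<infinity>"
        unfolding nn_integral_count_space_finite[OF finite_lessThan]
      proof (rule ennreal_sum_finite)
        show "cN P (\<lambda>x. ko i * F i x) < \<infinity>" if "i \<in> {..<4}" for i
          using Ffin[of i] C(3)[of i] P0 that by (simp add: cN_cmult ennreal_mult_less_top)
      qed simp
      show "AE x in lborel. X x = (LINT i|count_space {..<4}. ko i * F i x)"
        by (rule AE_I2) (simp add: X_def lebesgue_integral_count_space_finite)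
    qed auto
    also have "\<dots> = (\<Sum>i<4. cN P (conv_op (U.sg m) (\<lambda>x. ko i * F i x)))" by (simp add: nn_integral_count_space_finite)
    also have "\<dots> = (\<Sum>i<4. ennreal (norm (ko i)) * cN P (conv_op (U.sg m) (F i)))"
    proof (intro sum.cong refl)
      fix i :: nat assume "i \<in> {..<4}"
      then have "F i \<in> borel_measurable borel" using C(3) by simp
      have "conv_op (U.sg m) (\<lambda>x. ko i * F i x) = (\<lambda>y. ko i * conv_op (U.sg m) (F i) y)"
        by (rule ext) (rule conv_op_cmult)
      then show "cN P (conv_op (U.sg m) (\<lambda>x. ko i * F i x)) = ennreal (norm (ko i)) * cN P (conv_op (U.sg m) (F i))"
        using cN_cmult[OF P0 conv_op_measurable[OF U.wsym_sg \<open>F i \<in> borel_measurable borel\<close>]] by (simp only:)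
    qed
    finally have "?e * (ennreal cc * cN P (conv_op (U.sg m) X)) \<le>
        ?e * (ennreal cc * (\<Sum>i<4. ennreal (norm (ko i)) * cN P (conv_op (U.sg m) (F i))))"
      by (intro mult_left_mono) auto
    also have "\<dots> = (\<Sum>i<4. ennreal (cc * norm (ko i)) * (?e * cN P (conv_op (U.sg m) (F i))))"
      using cc(1) by (simp only: sum_distrib_left ennreal_mult less_imp_le norm_ge_zero mult_ac)
    also have "\<dots> \<le> (\<Sum>i<4. ennreal (cc * norm (ko i)) * sconv wf.A (C i) m)"
      by (intro sum_mono mult_left_mono C(2)) auto
    also have "\<dots> = sconv wf.A D m" unfolding D_def by (rule sconv_sum_right[symmetric]) simp
    finally show ?thesis unfolding cc(2)[OF fm Xm aef Xfin] .
  qed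
  have "modulation_norm \<rho> w (ennreal P) q ?f \<le> lqn q (sconv wf.A D)"
    unfolding modulation_norm_eq_lqn[OF q] by (rule lqn_mono[OF q bd])
  also have "\<dots> \<le> csum D * lqn q wf.A" by (rule lqn_sconv[OF q])
  also have "\<dots> < \<infinity>" using Dfin AA unfolding wA by (simp add: ennreal_mult_less_top)
  finally show ?thesis using fLp by (simp add: modulation_space_def)
qed

theorem theorem5p5:
  fixes p q :: ennreal
    and \<alpha> :: real
    and w wt :: "real \<Rightarrow> real"
    and \<rho> :: "real^'n \<Rightarrow> real"
    and \<mu> :: "real set \<Rightarrow> complex"
  assumes "1 < p" "p < \<infinity>" "1 \<le> q"
    and "decomposition_function \<rho>"
    and "w \<in> weight_class_1" "0 < \<alpha>" "\<alpha> < 1" "regularly_varying \<alpha> w"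
    and "\<forall>x>0. w x = x powr \<alpha> * wt x" "slowly_varying wt"
    and "complex_measure \<mu>" "\<mu> UNIV = 0"
    and "(bounded (wt ` {1..}) \<and> (\<forall>l>0. L_1 \<alpha> \<mu> l < \<infinity>)) \<or>
         (filterlim wt at_top at_top \<and> (\<forall>l>0. L_2 \<alpha> wt \<mu> l < \<infinity>))"
  shows "smooth_on UNIV (inv_fourier_measure \<mu>) \<and>
    (\<forall>u :: real^'n \<Rightarrow> real.
       (\<lambda>x. complex_of_real (u x)) \<in> modulation_space \<rho> w p q \<longrightarrow>
       inv_fourier_measure \<mu> \<circ> u \<in> modulation_space \<rho> w p q)"
proof -
  obtain P where p: "p = ennreal P" and P: "1 < P"
    using assms(1,2) by (cases p) (auto simp: ennreal_1[symmetric] ennreal_less_iff simp del: ennreal_1)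
  have rw: "reg_weight w \<alpha>" using assms(5-8) by (intro reg_weight.intro) (auto simp: weight_class_1_def)
  then interpret reg_weight w \<alpha> .
  have H: "(\<integral>\<^sup>+\<xi>. ennreal (exp (l * w (phi \<bar>\<xi>\<bar>)) * indicator {\<xi>. 3 \<le> \<bar>\<xi>\<bar>} \<xi>) \<partial>variation_parts \<mu> i) < \<infinity>"
    if "i < 4" "0 < l" for i l
    by (rule order.strict_trans1[OF variation_parts_facts(3)[OF assms(11) that(1)] moment_hypothesis[OF assms(9) assms(13) that(2)]])
  have smooth: "smooth_on UNIV (inv_fourier_measure \<mu>)"
  proof (rule smooth_inv_fourier_measure[OF assms(11)])
    fix i n :: nat assume i: "i < 4"
    note facts = variation_parts_facts(1,2)[OF assms(11) i]
    have m: "(\<lambda>\<xi>::real. \<bar>\<xi>\<bar> ^ n) \<in> borel_measurable (variation_parts \<mu> i)"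
      unfolding measurable_cong_sets[OF facts(2) refl] by measurable
    show "integrable (variation_parts \<mu> i) (\<lambda>\<xi>. \<bar>\<xi>\<bar> ^ n)"
      using power_moment_finite[OF facts H[OF i], of n] m by (intro integrableI_bounded) (auto simp: power_abs)
  qed
  then have "continuous_on UNIV (inv_fourier_measure \<mu>)"
    unfolding smooth_on_def
    by (intro differentiable_imp_continuous_on) (force simp: differentiable_on_def dest: spec[of _ "[]"])
  then show ?thesis
    using smooth composition_in_modulation_space[OF P assms(3,4) rw assms(11,12) H] unfolding p by blast
qed

end
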